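(* Let $d\ge 1$, $q\in(0,1]$, $n=[dq^{-1}]+1$, $m\in\{0,1,2,\dots\}$, and let $t_0,\delta_0>0$. There is a constant $C_{q,m}=C_{q,m}(t_0,\delta_0)$ (depending only on $d,q,m,t_0,\delta_0$) such that the following holds. Let $\mathbf T=(t_{jk})_{j,k=1,2}\in GL(2,\mathbb R)$ satisfy $t_{11}+t_{12}=1$, $\max_{j,k}|t_{jk}|\le t_0$ and $|\det\mathbf T|\ge\delta_0$. Let $h_1,h_2\in \mathsf l^{\infty}(\mathsf L^2)(\mathbb R^d)$, and let $p=p(\mathbf w,\mathbf z,\boldsymbol\xi)$ be an amplitude on $\mathbb R^{3d}$ with $P_{n,m}(\cdot;p)\in \mathsf l^{q}(\mathsf L^1)(\mathbb R^{3d})$. Then $h_1\,\mathrm{Op}^{\rm a}_1(p_{\mathbf T})\,h_2\in\mathfrak S_q$ and $$\|h_1\,\mathrm{Op}^{\rm a}_1(p_{\mathbf T})\,h_2\|_{\mathfrak S_q}\le C_{q,m}\,|\!|\!|h_1|\!|\!|_{2,\infty}\,|\!|\!|h_2|\!|\!|_{2,\infty}\,|\!|\!|P_{n,m}(p)|\!|\!|_{1,q}.$$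
   Context: $[\,\cdot\,]$ is the integer part. For $0<q<\infty$, $\mathfrak S_q$ is the set of compact operators $A$ on a Hilbert space (here $L^2(\mathbb R^d)$) with singular values $s_k(A)$ such that $\|A\|_{\mathfrak S_q}=(\sum_k s_k(A)^q)^{1/q}<\infty$. Lattice quasi-norms: let $\mathcal C_{\mathbf u}\subset\mathbb R^N$ be the (axis-parallel) unit cube centred at $\mathbf u\in\mathbb R^N$. For $h\in L^r_{\rm loc}(\mathbb R^N)$, $0<r<\infty$, put $|\!|\!|h|\!|\!|_{r,\delta}=\big[\sum_{\mathbf n\in\mathbb Z^N}\big(\int_{\mathcal C_{\mathbf n}}|h|^r\big)^{\delta/r}\big]^{1/\delta}$ for $0<\delta<\infty$, and $|\!|\!|h|\!|\!|_{r,\infty}=\sup_{\mathbf u\in\mathbb R^N}\big(\int_{\mathcal C_{\mathbf u}}|h|^r\big)^{1/r}$. Write $h\in\mathsf l^\delta(\mathsf L^r)(\mathbb R^N)$ if $|\!|\!|h|\!|\!|_{r,\delta}<\infty$. Operators: for an amplitude $b(\mathbf x,\mathbf y,\boldsymbol\xi)$ and $\alpha>0$, $(\mathrm{Op}^{\rm a}_\alpha(b)u)(\mathbf x)=\big(\frac{\alpha}{2\pi}\big)^d\iint e^{i\alpha(\mathbf x-\mathbf y)\cdot\boldsymbol\xi}b(\mathbf x,\mathbf y,\boldsymbol\xi)u(\mathbf y)\,d\mathbf y\,d\boldsymbol\xi$ for Schwartz functions $u$. For a $2\times2$ real matrix $\mathbf T=(t_{jk})$, $p_{\mathbf T}(\mathbf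 x,\mathbf y,\boldsymbol\xi)=p(\mathbf w,\mathbf z,\boldsymbol\xi)$ with $\mathbf w=t_{11}\mathbf x+t_{12}\mathbf y$, $\mathbf z=t_{21}\mathbf x+t_{22}\mathbf y$. Functions $h_1,h_2$ act by multiplication; $h_1\mathrm{Op}^{\rm a}_1(p_{\mathbf T})h_2$ is the operator with kernel $h_1(\mathbf x)k(\mathbf x,\mathbf y)h_2(\mathbf y)$, $k$ being the kernel of $\mathrm{Op}^{\rm a}_1(p_{\mathbf T})$. Put $\tau=t_{21}+t_{22}$ and $$P_{n,m}(\mathbf w,\mathbf z,\boldsymbol\xi;p)=\frac{1}{1+|\mathbf z-\tau\mathbf w|^m}\sum_{n_1,n_2=0}^{n}\sum_{l=0}^m|\nabla_{\mathbf w}^{n_1}\nabla_{\mathbf z}^{n_2}\nabla_{\boldsymbol\xi}^l p(\mathbf w,\mathbf z,\boldsymbol\xi)|,$$ where $\nabla^k$ denotes the tensor of all partial derivatives of order $k$. Amplitudes are complex-valued and smooth, in the sense that all derivatives that appear exist and are continuous. *)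

theory Defs
  imports "HOL-Analysis.Analysis"
begin
definition square_integrable :: "('a::euclidean_space \<Rightarrow> complex) \<Rightarrow> bool" where
  "square_integrable f \<longleftrightarrow>
     f \<in> borel_measurable lebesgue \<and> integrable lebesgue (\<lambda>x. (cmod (f x))\<^sup>2)"

definition L2_eq :: "('a::euclidean_space \<Rightarrow> complex) \<Rightarrow> ('a \<Rightarrow> complex) \<Rightarrow> bool" where
  "L2_eq f g \<longleftrightarrow> square_integrable f \<and> square_integrable g \<and> (AE x in lebesgue. f x = g x)"

lemma square_integrable_zero: "square_integrable (\<lambda>_. 0)"
  by (simp add: square_integrable_def)

lemma square_integrable_add:
  assumes "square_integrable f" "square_integrable g"
  shows "square_integrable (\<lambda>x. f x + g x)"
proof -
  have [measurable]: "f \<in> borel_measurable lebesgue" "g \<in> borel_measurable lebesgue"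
    using assms by (auto simp: square_integrable_def)
  have "integrable lebesgue (\<lambda>x. 2 * (cmod (f x))\<^sup>2 + 2 * (cmod (g x))\<^sup>2)"
    using assms by (auto simp: square_integrable_def)
  then have "integrable lebesgue (\<lambda>x. (cmod (f x + g x))\<^sup>2)"
  proof (rule Bochner_Integration.integrable_bound)
    show "AE x in lebesgue. norm ((cmod (f x + g x))\<^sup>2)
        \<le> norm (2 * (cmod (f x))\<^sup>2 + 2 * (cmod (g x))\<^sup>2)"
    proof (rule AE_I2)
      fix x
      have "(cmod (f x + g x))\<^sup>2 \<le> (cmod (f x) + cmod (g x))\<^sup>2"
        by (intro power_mono norm_triangle_ineq) auto
      also have "\<dots> \<le> 2 * (cmod (f x))\<^sup>2 + 2 * (cmod (g x))\<^sup>2"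
        using zero_le_power2[of "cmod (f x) - cmod (g x)"]
        by (simp add: power2_eq_square algebra_simps)
      finally show "norm ((cmod (f x + g x))\<^sup>2)
          \<le> norm (2 * (cmod (f x))\<^sup>2 + 2 * (cmod (g x))\<^sup>2)" by simp
    qed
  qed measurable
  then show ?thesis by (simp add: square_integrable_def)
qed

lemma square_integrable_mult:
  assumes "square_integrable f"
  shows "square_integrable (\<lambda>x. c * f x)"
  using assms by (auto simp: square_integrable_def norm_mult power_mult_distrib)

lemma square_integrable_uminus:
  "square_integrable f \<Longrightarrow> square_integrable (\<lambda>x. - f x)"
  by (auto simp: square_integrable_def)

lemma square_integrable_diff:
  "square_integrable f \<Longrightarrow> square_integrable g \<Longrightarrow> square_integrable (\<lambda>x. f x - g x)"
  using square_integrable_add[OF _ square_integrable_uminus, of f g] by simp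

lemmas square_integrable_intros = square_integrable_zero square_integrable_add
  square_integrable_mult square_integrable_uminus square_integrable_diff

lemma integrable_mult_cnj:
  assumes "square_integrable f" "square_integrable g"
  shows "integrable lebesgue (\<lambda>x. f x * cnj (g x))"
proof -
  have [measurable]: "f \<in> borel_measurable lebesgue" "g \<in> borel_measurable lebesgue"
    using assms by (auto simp: square_integrable_def)
  have [measurable]: "cnj \<in> borel_measurable borel"
    by (intro borel_measurable_continuous_onI continuous_intros)
  have "integrable lebesgue (\<lambda>x. (cmod (f x))\<^sup>2 + (cmod (g x))\<^sup>2)"
    using assms by (auto simp: square_integrable_def)
  then show ?thesis
  proof (rule Bochner_Integration.integrable_bound)
    show "AE x in lebesgue. norm (f x * cnj (g x)) \<le> norm ((cmod (f x))\<^sup>2 + (cmod (g x))\<^sup>2)"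
    proof (rule AE_I2)
      fix x
      have "2 * (cmod (f x) * cmod (g x)) \<le> (cmod (f x))\<^sup>2 + (cmod (g x))\<^sup>2"
        using zero_le_power2[of "cmod (f x) - cmod (g x)"]
        by (simp add: power2_eq_square algebra_simps)
      moreover have "0 \<le> cmod (f x) * cmod (g x)" by simp
      ultimately show "norm (f x * cnj (g x)) \<le> norm ((cmod (f x))\<^sup>2 + (cmod (g x))\<^sup>2)"
        unfolding norm_mult complex_mod_cnj real_norm_def by linarith
    qed
  qed measurable
qed

quotient_type (overloaded) 'a L2 = "'a::euclidean_space \<Rightarrow> complex" / partial: L2_eq
proof (rule part_equivpI)
  show "\<exists>f :: 'a \<Rightarrow> complex. L2_eq f f"
    using square_integrable_zero by (auto simp: L2_eq_def intro!: exI[of _ "\<lambda>_. 0"])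
  show "symp (L2_eq :: ('a \<Rightarrow> complex) \<Rightarrow> _)"
    by (auto simp: symp_def L2_eq_def eq_commute)
  show "transp (L2_eq :: ('a \<Rightarrow> complex) \<Rightarrow> _)"
    unfolding transp_def L2_eq_def
  proof (intro allI impI conjI; (elim conjE)?)
    fix f g h :: "'a \<Rightarrow> complex"
    assume "AE x in lebesgue. f x = g x" "AE x in lebesgue. g x = h x"
    then show "AE x in lebesgue. f x = h x" by eventually_elim simp
  qed auto
qed

lemma L2_eqD: "L2_eq f f \<Longrightarrow> square_integrable f"
  by (simp add: L2_eq_def)

lemma L2_eqI: "square_integrable f \<Longrightarrow> (\<And>x. f x = g x) \<Longrightarrow> L2_eq f g"
proof -
  assume "square_integrable f" "\<And>x. f x = g x"
  moreover from this have "f = g" by blast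
  ultimately show "L2_eq f g" by (simp add: L2_eq_def)
qed

instantiation L2 :: (euclidean_space) real_vector
begin

lift_definition zero_L2 :: "'a L2" is "\<lambda>_. 0"
  by (simp add: L2_eq_def square_integrable_zero)

lift_definition plus_L2 :: "'a L2 \<Rightarrow> 'a L2 \<Rightarrow> 'a L2" is "\<lambda>f g x. f x + g x"
  unfolding L2_eq_def by (auto intro: square_integrable_add)

lift_definition uminus_L2 :: "'a L2 \<Rightarrow> 'a L2" is "\<lambda>f x. - f x"
  unfolding L2_eq_def by (auto intro: square_integrable_uminus)

lift_definition minus_L2 :: "'a L2 \<Rightarrow> 'a L2 \<Rightarrow> 'a L2" is "\<lambda>f g x. f x - g x"
  unfolding L2_eq_def by (auto intro: square_integrable_diff)

lift_definition scaleR_L2 :: "real \<Rightarrow> 'a L2 \<Rightarrow> 'a L2" is "\<lambda>r f x. complex_of_real r * f x"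
  unfolding L2_eq_def by (auto intro: square_integrable_mult)

instance
proof
  fix f g h :: "'a L2" and r s :: real
  show "f + g + h = f + (g + h)"
    by (transfer, rule L2_eqI) (auto intro!: square_integrable_intros dest!: L2_eqD)
  show "f + g = g + f"
    by (transfer, rule L2_eqI) (auto intro!: square_integrable_intros dest!: L2_eqD)
  show "0 + f = f"
    by (transfer, rule L2_eqI) (auto intro!: square_integrable_intros dest!: L2_eqD)
  show "- f + f = 0"
    by (transfer, rule L2_eqI) (auto intro!: square_integrable_intros dest!: L2_eqD)
  show "f - g = f + - g"
    by (transfer, rule L2_eqI) (auto intro!: square_integrable_intros dest!: L2_eqD)
  show "r *\<^sub>R (f + g) = r *\<^sub>R f + r *\<^sub>R g"
    by (transfer, rule L2_eqI) (auto intro!: square_integrable_intros dest!: L2_eqD simp: distrib_left)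
  show "(r + s) *\<^sub>R f = r *\<^sub>R f + s *\<^sub>R f"
    by (transfer, rule L2_eqI) (auto intro!: square_integrable_intros dest!: L2_eqD simp: distrib_right)
  show "r *\<^sub>R s *\<^sub>R f = (r * s) *\<^sub>R f"
    by (transfer, rule L2_eqI) (auto intro!: square_integrable_intros dest!: L2_eqD)
  show "1 *\<^sub>R f = f"
    by (transfer, rule L2_eqI) (auto intro!: square_integrable_intros dest!: L2_eqD)
qed

end

lift_definition scaleC_L2 :: "complex \<Rightarrow> 'a::euclidean_space L2 \<Rightarrow> 'a L2" is "\<lambda>c f x. c * f x"
  unfolding L2_eq_def by (auto intro: square_integrable_mult)

interpretation L2_complex: vector_space scaleC_L2
proof
  fix f g :: "'a L2" and r s :: complex
  show "scaleC_L2 r (f + g) = scaleC_L2 r f + scaleC_L2 r g"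
    by (transfer, rule L2_eqI) (auto intro!: square_integrable_intros dest!: L2_eqD simp: distrib_left)
  show "scaleC_L2 (r + s) f = scaleC_L2 r f + scaleC_L2 s f"
    by (transfer, rule L2_eqI) (auto intro!: square_integrable_intros dest!: L2_eqD simp: distrib_right)
  show "scaleC_L2 r (scaleC_L2 s f) = scaleC_L2 (r * s) f"
    by (transfer, rule L2_eqI) (auto intro!: square_integrable_intros dest!: L2_eqD)
  show "scaleC_L2 1 f = f"
    by (transfer, rule L2_eqI) (auto intro!: square_integrable_intros dest!: L2_eqD)
qed

lift_definition cinner_L2 :: "'a::euclidean_space L2 \<Rightarrow> 'a L2 \<Rightarrow> complex"
  is "\<lambda>f g. LINT x|lebesgue. f x * cnj (g x)"
proof -
  fix f f' g g' :: "'a \<Rightarrow> complex"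
  assume *: "L2_eq f f'" "L2_eq g g'"
  then have "integrable lebesgue (\<lambda>x. f x * cnj (g x))"
    "integrable lebesgue (\<lambda>x. f' x * cnj (g' x))"
    by (auto simp: L2_eq_def intro: integrable_mult_cnj)
  moreover from * have "AE x in lebesgue. f x = f' x" "AE x in lebesgue. g x = g' x"
    by (auto simp: L2_eq_def)
  then have "AE x in lebesgue. f x * cnj (g x) = f' x * cnj (g' x)"
    by eventually_elim simp
  ultimately show "(LINT x|lebesgue. f x * cnj (g x)) = (LINT x|lebesgue. f' x * cnj (g' x))"
    by (intro integral_cong_AE borel_measurable_integrable)
qed

text \<open>The real inner product is the real part of the complex one. It has the same norm, and a
  complex-linear operator has the same adjoint with respect to either of them.\<close>

instantiation L2 :: (euclidean_space) real_inner
begin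

definition inner_L2 :: "'a L2 \<Rightarrow> 'a L2 \<Rightarrow> real" where
  "inner_L2 f g = Re (cinner_L2 f g)"

definition norm_L2 :: "'a L2 \<Rightarrow> real" where
  "norm_L2 f = sqrt (inner f f)"

definition dist_L2 :: "'a L2 \<Rightarrow> 'a L2 \<Rightarrow> real" where
  "dist_L2 f g = norm (f - g)"

definition sgn_L2 :: "'a L2 \<Rightarrow> 'a L2" where
  "sgn_L2 f = f /\<^sub>R norm f"

definition uniformity_L2 :: "('a L2 \<times> 'a L2) filter" where
  "uniformity_L2 = (INF e\<in>{0 <..}. principal {(f, g). dist f g < e})"

definition open_L2 :: "'a L2 set \<Rightarrow> bool" where
  "open_L2 U \<longleftrightarrow> (\<forall>x\<in>U. eventually (\<lambda>(x', y). x' = x \<longrightarrow> y \<in> U) uniformity)"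

instance
proof
  fix f g h :: "'a L2" and r :: real and U :: "'a L2 set"
  have 1: "Re (cinner_L2 f g) = Re (cinner_L2 g f)"
  proof transfer
    fix f g :: "'a \<Rightarrow> complex"
    assume "L2_eq f f" "L2_eq g g"
    have "(LINT x|lebesgue. g x * cnj (f x)) = (LINT x|lebesgue. cnj (f x * cnj (g x)))"
      by (simp add: mult.commute)
    also have "\<dots> = cnj (LINT x|lebesgue. f x * cnj (g x))" by (rule Bochner_Integration.integral_cnj)
    finally show "Re (LINT x|lebesgue. f x * cnj (g x)) = Re (LINT x|lebesgue. g x * cnj (f x))"
      by simp
  qed
  show "inner f g = inner g f" using 1 by (simp add: inner_L2_def)
  have "cinner_L2 (f + g) h = cinner_L2 f h + cinner_L2 g h"
    by transfer (auto simp: L2_eq_def distrib_right integrable_mult_cnj)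
  then show "inner (f + g) h = inner f h + inner g h" by (simp add: inner_L2_def)
  have "cinner_L2 (r *\<^sub>R f) g = of_real r * cinner_L2 f g"
    by transfer (auto simp: mult.assoc)
  then show "inner (r *\<^sub>R f) g = r * inner f g" by (simp add: inner_L2_def)
  have "0 \<le> Re (cinner_L2 f f) \<and> (Re (cinner_L2 f f) = 0 \<longleftrightarrow> f = 0)"
  proof transfer
    fix f :: "'a \<Rightarrow> complex"
    assume "L2_eq f f"
    then have f: "square_integrable f" and i: "integrable lebesgue (\<lambda>x. (cmod (f x))\<^sup>2)"
      by (auto simp: L2_eq_def square_integrable_def)
    have "(\<lambda>x. f x * cnj (f x)) = (\<lambda>x. complex_of_real ((cmod (f x))\<^sup>2))"
      by (simp only: complex_norm_square)
    then have "(LINT x|lebesgue. f x * cnj (f x)) = of_real (LINT x|lebesgue. (cmod (f x))\<^sup>2)"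
      by (simp only: integral_complex_of_real)
    then have eq: "Re (LINT x|lebesgue. f x * cnj (f x)) = (LINT x|lebesgue. (cmod (f x))\<^sup>2)"
      by simp
    show "0 \<le> Re (LINT x|lebesgue. f x * cnj (f x)) \<and>
        (Re (LINT x|lebesgue. f x * cnj (f x)) = 0 \<longleftrightarrow> L2_eq f (\<lambda>_. 0))"
      unfolding eq using f integral_nonneg_eq_0_iff_AE[OF i]
      by (auto simp: L2_eq_def square_integrable_zero)
  qed
  then show "0 \<le> inner f f" "inner f f = 0 \<longleftrightarrow> f = 0" by (auto simp: inner_L2_def)
  show "norm f = sqrt (inner f f)" by (rule norm_L2_def)
  show "dist f g = norm (f - g)" by (rule dist_L2_def)
  show "sgn f = f /\<^sub>R norm f" by (rule sgn_L2_def)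
  show "uniformity = (INF e\<in>{0 <..}. principal {(f :: 'a L2, g). dist f g < e})"
    by (rule uniformity_L2_def)
  show "open U \<longleftrightarrow> (\<forall>x\<in>U. eventually (\<lambda>(x', y). x' = x \<longrightarrow> y \<in> U) uniformity)"
    by (rule open_L2_def)
qed

end

definition compact_operator :: "('a::euclidean_space L2 \<Rightarrow> 'a L2) \<Rightarrow> bool" where
  "compact_operator A \<longleftrightarrow>
     Vector_Spaces.linear scaleC_L2 scaleC_L2 A \<and> compact (closure (A ` cball 0 1))"

text \<open>The singular values of a compact operator \<open>A\<close> are the square roots of the eigenvalues of
  \<open>A\<^sup>*A\<close>, in nonincreasing order and repeated according to their (complex) multiplicity, extended by
  zeros if there are only finitely many nonzero ones. As a nonincreasing null sequence they are
  determined by the multiplicities of the positive values. They are numbered from 0.\<close>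

definition sv_eigenspace :: "('a::euclidean_space L2 \<Rightarrow> 'a L2) \<Rightarrow> real \<Rightarrow> 'a L2 set" where
  "sv_eigenspace A s = {f. adjoint A (A f) = s\<^sup>2 *\<^sub>R f}"

definition is_singular_values :: "('a::euclidean_space L2 \<Rightarrow> 'a L2) \<Rightarrow> (nat \<Rightarrow> real) \<Rightarrow> bool" where
  "is_singular_values A s \<longleftrightarrow>
     decseq s \<and> (\<forall>k. 0 \<le> s k) \<and> s \<longlonglongrightarrow> 0 \<and>
     (\<forall>t>0. card {k. s k = t} = vector_space.dim scaleC_L2 (sv_eigenspace A t))"

definition singular_value :: "('a::euclidean_space L2 \<Rightarrow> 'a L2) \<Rightarrow> nat \<Rightarrow> real" where
  "singular_value A = (THE s. is_singular_values A s)"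

definition schatten_class :: "real \<Rightarrow> ('a::euclidean_space L2 \<Rightarrow> 'a L2) set" where
  "schatten_class q = {A. compact_operator A \<and> summable (\<lambda>k. singular_value A k powr q)}"

definition schatten_norm :: "real \<Rightarrow> ('a::euclidean_space L2 \<Rightarrow> 'a L2) \<Rightarrow> real" where
  "schatten_norm q A = (\<Sum>k. singular_value A k powr q) powr (1 / q)"

definition unit_cube :: "'a::euclidean_space \<Rightarrow> 'a set" where
  "unit_cube u = cbox (u - (1/2) *\<^sub>R One) (u + (1/2) *\<^sub>R One)"

definition int_lattice :: "'a::euclidean_space set" where
  "int_lattice = {u. \<forall>b\<in>Basis. u \<bullet> b \<in> \<int>}"

definition locally_Lr :: "real \<Rightarrow> ('a::euclidean_space \<Rightarrow> 'b::euclidean_space) \<Rightarrow> bool" where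
  "locally_Lr r h \<longleftrightarrow> h \<in> borel_measurable lebesgue \<and>
     (\<forall>K. compact K \<longrightarrow> set_integrable lebesgue K (\<lambda>x. norm (h x) powr r))"

definition cube_integral ::
    "real \<Rightarrow> ('a::euclidean_space \<Rightarrow> 'b::euclidean_space) \<Rightarrow> 'a \<Rightarrow> real" where
  "cube_integral r h u = (LINT x:unit_cube u|lebesgue. norm (h x) powr r)"

definition lattice_space ::
    "real \<Rightarrow> real \<Rightarrow> ('a::euclidean_space \<Rightarrow> 'b::euclidean_space) set" where
  "lattice_space r \<delta> =
     {h. locally_Lr r h \<and> (\<lambda>u. cube_integral r h u powr (\<delta> / r)) summable_on int_lattice}"

definition lattice_norm ::
    "real \<Rightarrow> real \<Rightarrow> ('a::euclidean_space \<Rightarrow> 'b::euclidean_space) \<Rightarrow> real" where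
  "lattice_norm r \<delta> h =
     (\<Sum>\<^sub>\<infinity>u\<in>int_lattice. cube_integral r h u powr (\<delta> / r)) powr (1 / \<delta>)"

definition lattice_space_inf ::
    "real \<Rightarrow> ('a::euclidean_space \<Rightarrow> 'b::euclidean_space) set" where
  "lattice_space_inf r =
     {h. locally_Lr r h \<and> bdd_above (range (\<lambda>u. cube_integral r h u powr (1 / r)))}"

definition lattice_norm_inf ::
    "real \<Rightarrow> ('a::euclidean_space \<Rightarrow> 'b::euclidean_space) \<Rightarrow> real" where
  "lattice_norm_inf r h = (SUP u. cube_integral r h u powr (1 / r))"

definition pderiv_dir :: "'a::euclidean_space \<Rightarrow> ('a \<Rightarrow> complex) \<Rightarrow> 'a \<Rightarrow> complex" where
  "pderiv_dir b f x = vector_derivative (\<lambda>t. f (x + t *\<^sub>R b)) (at 0)"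

text \<open>The last direction in the list is differentiated first, so \<open>pderivs (bs @ cs) f\<close> reads like
  the product of differential operators \<open>\<partial>\<^sub>b\<^sub>s \<partial>\<^sub>c\<^sub>s f\<close>.\<close>

definition pderivs :: "'a::euclidean_space list \<Rightarrow> ('a \<Rightarrow> complex) \<Rightarrow> 'a \<Rightarrow> complex" where
  "pderivs bs f = foldr pderiv_dir bs f"

text \<open>Only the outermost differentiation is asked to exist here; the definition is always used for
  all suffixes of a list at once.\<close>

definition has_cont_pderivs :: "'a::euclidean_space list \<Rightarrow> ('a \<Rightarrow> complex) \<Rightarrow> bool" where
  "has_cont_pderivs bs f \<longleftrightarrow>
     (\<forall>b cs. bs = b # cs \<longrightarrow> (\<forall>x. (\<lambda>t. pderivs cs f (x + t *\<^sub>R b)) differentiable (at 0))) \<and>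
     continuous_on UNIV (pderivs bs f)"

definition schwartz :: "('a::euclidean_space \<Rightarrow> complex) \<Rightarrow> bool" where
  "schwartz u \<longleftrightarrow> (\<forall>bs. set bs \<subseteq> Basis \<longrightarrow>
     has_cont_pderivs bs u \<and> (\<forall>k::nat. bounded (range (\<lambda>x. norm x ^ k *\<^sub>R pderivs bs u x))))"

text \<open>An amplitude \<open>p(w, z, \<xi>)\<close> is a function on the product of three copies of the space. The index
  lists below label the entries of the tensors of derivatives of a given order in each variable.\<close>

definition dirs_w :: "nat \<Rightarrow> ('a::euclidean_space \<times> 'a \<times> 'a) list set" where
  "dirs_w k = {bs. length bs = k \<and> set bs \<subseteq> (\<lambda>b. (b, 0, 0)) ` Basis}"

definition dirs_z :: "nat \<Rightarrow> ('a::euclidean_space \<times> 'a \<times> 'a) list set" where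
  "dirs_z k = {bs. length bs = k \<and> set bs \<subseteq> (\<lambda>b. (0, b, 0)) ` Basis}"

definition dirs_xi :: "nat \<Rightarrow> ('a::euclidean_space \<times> 'a \<times> 'a) list set" where
  "dirs_xi k = {bs. length bs = k \<and> set bs \<subseteq> (\<lambda>b. (0, 0, b)) ` Basis}"

definition smooth_amplitude ::
    "nat \<Rightarrow> nat \<Rightarrow> ('a::euclidean_space \<times> 'a \<times> 'a \<Rightarrow> complex) \<Rightarrow> bool" where
  "smooth_amplitude n m p \<longleftrightarrow>
     (\<forall>n1\<le>n. \<forall>n2\<le>n. \<forall>l\<le>m. \<forall>ws\<in>dirs_w n1. \<forall>zs\<in>dirs_z n2. \<forall>xs\<in>dirs_xi l.
        has_cont_pderivs (ws @ zs @ xs) p)"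

definition grad_norm ::
    "nat \<Rightarrow> nat \<Rightarrow> nat \<Rightarrow> ('a::euclidean_space \<times> 'a \<times> 'a \<Rightarrow> complex) \<Rightarrow> 'a \<times> 'a \<times> 'a \<Rightarrow> real" where
  "grad_norm n1 n2 l p x =
     sqrt (\<Sum>ws\<in>dirs_w n1. \<Sum>zs\<in>dirs_z n2. \<Sum>xs\<in>dirs_xi l. (cmod (pderivs (ws @ zs @ xs) p x))\<^sup>2)"

definition amp_majorant ::
    "nat \<Rightarrow> nat \<Rightarrow> real \<Rightarrow> ('a::euclidean_space \<times> 'a \<times> 'a \<Rightarrow> complex) \<Rightarrow> 'a \<times> 'a \<times> 'a \<Rightarrow> real" where
  "amp_majorant n m \<tau> p = (\<lambda>(w, z, \<xi>).
     1 / (1 + norm (z - \<tau> *\<^sub>R w) ^ m) *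
     (\<Sum>n1\<le>n. \<Sum>n2\<le>n. \<Sum>l\<le>m. grad_norm n1 n2 l p (w, z, \<xi>)))"

definition amp_subst ::
    "real^2^2 \<Rightarrow> ('a::euclidean_space \<times> 'a \<times> 'a \<Rightarrow> complex) \<Rightarrow> 'a \<times> 'a \<times> 'a \<Rightarrow> complex" where
  "amp_subst T p = (\<lambda>(x, y, \<xi>).
     p (T$1$1 *\<^sub>R x + T$1$2 *\<^sub>R y, T$2$1 *\<^sub>R x + T$2$2 *\<^sub>R y, \<xi>))"

definition Op_integrand ::
    "real \<Rightarrow> ('a::euclidean_space \<times> 'a \<times> 'a \<Rightarrow> complex) \<Rightarrow> ('a \<Rightarrow> complex) \<Rightarrow> 'a \<Rightarrow> 'a \<times> 'a \<Rightarrow> complex"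
  where
  "Op_integrand \<alpha> b u x = (\<lambda>(y, \<xi>).
     exp (\<i> * complex_of_real (\<alpha> * ((x - y) \<bullet> \<xi>))) * b (x, y, \<xi>) * u y)"

definition Op_amp ::
    "real \<Rightarrow> ('a::euclidean_space \<times> 'a \<times> 'a \<Rightarrow> complex) \<Rightarrow> ('a \<Rightarrow> complex) \<Rightarrow> 'a \<Rightarrow> complex" where
  "Op_amp \<alpha> b u x =
     complex_of_real ((\<alpha> / (2 * pi)) ^ DIM('a)) * (LINT v|lebesgue. Op_integrand \<alpha> b u x v)"

text \<open>\<open>k\<close> is the integral kernel of \<open>Op_amp \<alpha> b\<close>. The double integral defining the operator is
  required to converge, so that default values of divergent integrals play no role.
  Testing against all Schwartz functions determines \<open>k\<close> almost everywhere; by Fubini's theorem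
  it is \<open>(\<alpha>/2\<pi>)\<^sup>d \<integral> e\<^sup>i\<^sup>\<alpha>\<^sup>(\<^sup>x\<^sup>-\<^sup>y\<^sup>)\<^sup>\<xi> b(x, y, \<xi>) d\<xi>\<close> whenever this makes sense.\<close>

definition is_Op_kernel ::
    "real \<Rightarrow> ('a::euclidean_space \<times> 'a \<times> 'a \<Rightarrow> complex) \<Rightarrow> ('a \<Rightarrow> 'a \<Rightarrow> complex) \<Rightarrow> bool" where
  "is_Op_kernel \<alpha> b k \<longleftrightarrow>
     (\<lambda>(x, y). k x y) \<in> borel_measurable lebesgue \<and>
     (\<forall>u. schwartz u \<longrightarrow> (AE x in lebesgue.
        integrable lebesgue (Op_integrand \<alpha> b u x) \<and>
        integrable lebesgue (\<lambda>y. k x y * u y) \<and>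
        Op_amp \<alpha> b u x = (LINT y|lebesgue. k x y * u y)))"

definition has_kernel ::
    "('a::euclidean_space L2 \<Rightarrow> 'a L2) \<Rightarrow> ('a \<Rightarrow> 'a \<Rightarrow> complex) \<Rightarrow> bool" where
  "has_kernel A K \<longleftrightarrow> (\<forall>f. AE x in lebesgue.
     integrable lebesgue (\<lambda>y. K x y * rep_L2 f y) \<and>
     rep_L2 (A f) x = (LINT y|lebesgue. K x y * rep_L2 f y))"

text \<open>\<open>A\<close> is the operator \<open>h\<^sub>1 Op(b) h\<^sub>2\<close>. Since kernels are determined almost everywhere, there
  is at most one such \<open>A\<close>.\<close>

definition is_weighted_Op ::
    "('a::euclidean_space \<Rightarrow> complex) \<Rightarrow> real \<Rightarrow> ('a \<times> 'a \<times> 'a \<Rightarrow> complex) \<Rightarrow> ('a \<Rightarrow> complex) \<Rightarrow>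
     ('a L2 \<Rightarrow> 'a L2) \<Rightarrow> bool" where
  "is_weighted_Op h1 \<alpha> b h2 A \<longleftrightarrow>
     (\<exists>k. is_Op_kernel \<alpha> b k \<and> has_kernel A (\<lambda>x y. h1 x * k x y * h2 y))"

end

theory Submission
  imports Defs
begin

text \<open>The operator is written as an explicit series of rank-one operators whose \<open>q\<close>-th powers of
  norms are summable; the Schatten quasi-norm of a sum of such a series is at most the \<open>q\<close>-quasi-norm
  of the sequence of norms.

  The second point is \<open>nuclear_op_schatten\<close>. For \<open>A u = (\<Sum>j. \<langle>u, g j\<rangle> f j)\<close> put
  \<open>\<mu> j = norm (f j) * norm (g j)\<close>. For every \<open>a > 0\<close> the singular values satisfy
  \<open>(\<Sum>k. min (s k) a) \<le> (\<Sum>j. min (\<mu> j) a)\<close>: the finitely many terms with \<open>\<mu> j > a\<close> act on a space whose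
  dimension is at most their number, and on its orthogonal complement the trace is bounded by the
  remaining \<open>\<mu> j\<close> (\<open>eigenvalue_min_sum_le\<close>). Since $t^q$ is an average of the functions \<open>min t a\<close>, the
  inequality passes to $q$-th powers.

  For the first point, the kernel is \<open>(1 / (2 * pi)) ^ d\<close> times the integral over \<open>\<xi>\<close> of
  \<open>cis ((x - y) \<bullet> \<xi>) * p (w, z, \<xi>)\<close>, where \<open>w\<close> and \<open>z\<close> are the linear combinations of \<open>x\<close> and \<open>y\<close> given
  by the matrix. Divide the three variables \<open>x\<close>, \<open>y\<close>, \<open>\<xi>\<close> into unit cells with centres \<open>j\<close>, \<open>k\<close>, \<open>\<nu>\<close>. For
  \<open>\<xi>\<close> in the cell of \<open>\<nu>\<close> the phase \<open>(x - y) \<bullet> (\<xi> - \<nu>)\<close> is linear in \<open>(w, z)\<close> with bounded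
  coefficients, because the determinant is bounded below. Hence the contribution of one block, times
  a cutoff, is a function of \<open>(w, z)\<close> on a box of fixed size, and it is expanded into a Fourier series
  there (\<open>localized_expansion\<close>). An exponential of a linear function of \<open>(w, z)\<close> is a
  function of \<open>x\<close> times a function of \<open>y\<close>, so each term is of rank one. Integrating by parts \<open>n\<close> times
  in \<open>w\<close> and \<open>n\<close> times in \<open>z\<close>, each time in the largest coordinate of the frequency, bounds the
  coefficients by a product weight of exponent \<open>n / d\<close> times the integral over the box of the
  derivatives of \<open>p\<close>. The weight is \<open>q\<close>-summable precisely since \<open>n * q > d\<close>.

  The denominator of the majorant is accounted for by integration by parts in \<open>\<xi>\<close>: the normalisation
  of the first row of the matrix gives \<open>z - \<tau> w = \<Delta> (y - x)\<close>, so on a block the denominator is at most a constant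
  times \<open>(1 + norm (j - k)) ^ m\<close>, and \<open>m\<close> integrations by parts gain this factor. To preserve
  the rank-one structure they are made against the constant \<open>j - k\<close> in place of \<open>x - y\<close>, which leaves
  only powers of the bounded quantities \<open>x - j\<close> and \<open>y - k\<close> (\<open>freq_integral_0_expansion\<close>).

  Finally, the boxes of the blocks meet every unit cube boundedly often (\<open>offset_cube_fibre\<close>), so
  the sum of the \<open>q\<close>-th powers is bounded by the lattice quasi-norm of the majorant, and each rank-one
  term, being supported in a product of two cells, absorbs the weights \<open>h1\<close> and \<open>h2\<close> at the cost of
  their norms (\<open>localised_weight\<close>). All constants are explicit in the dimension, \<open>q\<close>, \<open>m\<close>, the bounds on
  the matrix and a fixed cutoff function.\<close>

section \<open>Square-integrable functions as a complex Hilbert space\<close>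

lemma L2_eq_rep: "L2_eq (rep_L2 f) (rep_L2 f)"
  by (rule Quotient3_rep_reflp[OF Quotient3_L2])

lemma square_integrable_rep: "square_integrable (rep_L2 f)"
  using L2_eq_rep by (rule L2_eqD)

lemma abs_rep_L2: "abs_L2 (rep_L2 f) = f"
  by (rule Quotient3_abs_rep[OF Quotient3_L2])

lemma rep_abs_L2:
  assumes "square_integrable f"
  shows "AE x in lebesgue. rep_L2 (abs_L2 f) x = f x"
proof -
  have "L2_eq f f" using assms by (simp add: L2_eq_def)
  then have "L2_eq (rep_L2 (abs_L2 f)) f" by (rule Quotient3_rep_abs[OF Quotient3_L2])
  then show ?thesis by (simp add: L2_eq_def)
qed

lemma measurable_rep_L2 [measurable]: "rep_L2 f \<in> borel_measurable lebesgue"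
  using square_integrable_rep[of f] by (simp add: square_integrable_def)

lemma abs_L2_eqI:
  assumes "square_integrable f" "square_integrable g" "AE x in lebesgue. f x = g x"
  shows "abs_L2 f = abs_L2 g"
  using assms by (intro Quotient3_rel_abs[OF Quotient3_L2]) (simp add: L2_eq_def)

lemma cinner_abs_L2:
  assumes "square_integrable f" "square_integrable g"
  shows "cinner_L2 (abs_L2 f) (abs_L2 g) = (LINT x|lebesgue. f x * cnj (g x))"
  using assms by (intro cinner_L2.abs_eq) (simp_all add: L2_eq_def)

lemma plus_abs_L2:
  "square_integrable f \<Longrightarrow> square_integrable g \<Longrightarrow> abs_L2 f + abs_L2 g = abs_L2 (\<lambda>x. f x + g x)"
  by (intro plus_L2.abs_eq) (simp_all add: L2_eq_def)

lemma minus_abs_L2: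
  "square_integrable f \<Longrightarrow> square_integrable g \<Longrightarrow> abs_L2 f - abs_L2 g = abs_L2 (\<lambda>x. f x - g x)"
  by (intro minus_L2.abs_eq) (simp_all add: L2_eq_def)

lemma scaleC_abs_L2:
  "square_integrable f \<Longrightarrow> scaleC_L2 c (abs_L2 f) = abs_L2 (\<lambda>x. c * f x)"
  by (intro scaleC_L2.abs_eq) (simp_all add: L2_eq_def)

lemma square_integrable_sum:
  "(\<And>i. i \<in> I \<Longrightarrow> square_integrable (f i)) \<Longrightarrow> square_integrable (\<lambda>x. \<Sum>i\<in>I. f i x)"
  by (induction I rule: infinite_finite_induct)
    (auto intro: square_integrable_zero square_integrable_add)

lemma sum_abs_L2:
  "(\<And>i. i \<in> I \<Longrightarrow> square_integrable (f i)) \<Longrightarrow>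
    (\<Sum>i\<in>I. abs_L2 (f i)) = abs_L2 (\<lambda>x. \<Sum>i\<in>I. f i x)"
proof (induction I rule: infinite_finite_induct)
  case (insert i I)
  then show ?case by (simp add: plus_abs_L2 square_integrable_sum)
qed (simp_all add: zero_L2_def)

lemma power2_norm_abs_L2:
  assumes "square_integrable f"
  shows "(norm (abs_L2 f))\<^sup>2 = (LINT x|lebesgue. (cmod (f x))\<^sup>2)"
proof -
  have "(\<lambda>x. f x * cnj (f x)) = (\<lambda>x. complex_of_real ((cmod (f x))\<^sup>2))"
    by (simp only: complex_norm_square)
  then have "cinner_L2 (abs_L2 f) (abs_L2 f) = of_real (LINT x|lebesgue. (cmod (f x))\<^sup>2)"
    using assms by (simp only: cinner_abs_L2 integral_complex_of_real)
  then show ?thesis by (simp add: power2_norm_eq_inner inner_L2_def)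
qed

lemma norm_abs_L2:
  "square_integrable f \<Longrightarrow> norm (abs_L2 f) = sqrt (LINT x|lebesgue. (cmod (f x))\<^sup>2)"
  using power2_norm_abs_L2[of f] by (metis norm_ge_zero real_sqrt_unique)

lemma power2_norm_rep_L2: "(norm f)\<^sup>2 = (LINT x|lebesgue. (cmod (rep_L2 f x))\<^sup>2)"
  using power2_norm_abs_L2[OF square_integrable_rep] by (simp add: abs_rep_L2)

lemma integrable_power2_rep_L2: "integrable lebesgue (\<lambda>x. (cmod (rep_L2 f x))\<^sup>2)"
  using square_integrable_rep[of f] by (simp add: square_integrable_def)

text \<open>The Riesz--Fischer argument: Minkowski's inequality bounds the partial sums of the moduli
  in $L^2$, monotone convergence passes the bound to the full series.\<close>

lemma L2_series_pointwise:
  fixes u :: "nat \<Rightarrow> 'a::euclidean_space L2"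
  assumes sm: "summable (\<lambda>n. norm (u n))"
  shows "AE x in lebesgue. summable (\<lambda>n. cmod (rep_L2 (u n) x))"
    and "square_integrable (\<lambda>x. \<Sum>n. rep_L2 (u n) x)"
    and "norm (abs_L2 (\<lambda>x. \<Sum>n. rep_L2 (u n) x)) \<le> (\<Sum>n. norm (u n))"
proof -
  define S where "S = (\<Sum>n. norm (u n))"
  have S0: "0 \<le> S" unfolding S_def using sm by (rule suminf_nonneg) simp
  define G where "G N x = (\<Sum>n<N. cmod (rep_L2 (u n) x))" for N x
  have sq: "square_integrable (\<lambda>x. complex_of_real (cmod (rep_L2 (u n) x)))" for n
    using integrable_power2_rep_L2[of "u n"] by (simp add: square_integrable_def)
  have norm_eq: "norm (abs_L2 (\<lambda>x. complex_of_real (cmod (rep_L2 (u n) x)))) = norm (u n)" for n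
    using power2_norm_abs_L2[OF sq[of n]] power2_norm_rep_L2[of "u n"]
    by (intro power2_eq_imp_eq[of "norm (abs_L2 _)"]) simp_all
  have sqG: "square_integrable (\<lambda>x. complex_of_real (G N x))" for N
    unfolding G_def of_real_sum by (rule square_integrable_sum) (rule sq)
  have GN: "(LINT x|lebesgue. (G N x)\<^sup>2) \<le> S\<^sup>2" for N
  proof -
    have "(LINT x|lebesgue. (G N x)\<^sup>2) = (norm (abs_L2 (\<lambda>x. complex_of_real (G N x))))\<^sup>2"
      by (simp add: power2_norm_abs_L2 sqG)
    also have "abs_L2 (\<lambda>x. complex_of_real (G N x)) =
        (\<Sum>n<N. abs_L2 (\<lambda>x. complex_of_real (cmod (rep_L2 (u n) x))))"
      unfolding G_def of_real_sum by (rule sum_abs_L2[symmetric]) (rule sq)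
    also have "(norm \<dots>)\<^sup>2 \<le> S\<^sup>2"
    proof (rule power_mono)
      have "norm (\<Sum>n<N. abs_L2 (\<lambda>x. complex_of_real (cmod (rep_L2 (u n) x)))) \<le> (\<Sum>n<N. norm (u n))"
        by (rule order_trans[OF norm_sum]) (simp add: norm_eq)
      also have "\<dots> \<le> S" unfolding S_def by (rule sum_le_suminf[OF sm]) auto
      finally show "norm (\<Sum>n<N. abs_L2 (\<lambda>x. complex_of_real (cmod (rep_L2 (u n) x)))) \<le> S" .
    qed simp
    finally show ?thesis .
  qed
  have G0: "0 \<le> G N x" for N x by (simp add: G_def sum_nonneg)
  have Gmono: "G N x \<le> G M x" if "N \<le> M" for N M x
    unfolding G_def using that by (intro sum_mono2) auto
  have [measurable]: "G N \<in> borel_measurable lebesgue" for N unfolding G_def by measurable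
  have nnG: "(\<integral>\<^sup>+x. ennreal ((G N x)\<^sup>2) \<partial>lebesgue) \<le> ennreal (S\<^sup>2)" for N
  proof -
    have "integrable lebesgue (\<lambda>x. (G N x)\<^sup>2)" using sqG[of N] by (simp add: square_integrable_def)
    then have "(\<integral>\<^sup>+x. ennreal ((G N x)\<^sup>2) \<partial>lebesgue) = ennreal (LINT x|lebesgue. (G N x)\<^sup>2)"
      by (rule nn_integral_eq_integral) simp
    then show ?thesis using GN[of N] by (simp add: ennreal_leI)
  qed
  have sup: "(\<integral>\<^sup>+x. (SUP N. ennreal ((G N x)\<^sup>2)) \<partial>lebesgue) \<le> ennreal (S\<^sup>2)"
  proof -
    have "(\<integral>\<^sup>+x. (SUP N. ennreal ((G N x)\<^sup>2)) \<partial>lebesgue)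
        = (SUP N. \<integral>\<^sup>+x. ennreal ((G N x)\<^sup>2) \<partial>lebesgue)"
      by (rule nn_integral_monotone_convergence_SUP)
        (auto simp: incseq_def le_fun_def intro!: ennreal_leI power_mono Gmono G0)
    also have "\<dots> \<le> ennreal (S\<^sup>2)" by (intro SUP_least nnG)
    finally show ?thesis .
  qed
  then have "AE x in lebesgue. (SUP N. ennreal ((G N x)\<^sup>2)) \<noteq> \<infinity>"
    by (intro nn_integral_PInf_AE) (auto simp: top_unique)
  then show AE: "AE x in lebesgue. summable (\<lambda>n. cmod (rep_L2 (u n) x))"
  proof eventually_elim
    case (elim x)
    then obtain c where c: "(SUP N. ennreal ((G N x)\<^sup>2)) = ennreal c" "0 \<le> c"
      by (metis ennreal_cases infinity_ennreal_def)
    have "G N x \<le> sqrt c" for N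
    proof -
      have "ennreal ((G N x)\<^sup>2) \<le> (SUP N. ennreal ((G N x)\<^sup>2))" by (rule SUP_upper) simp
      then show ?thesis using c by (simp add: real_le_rsqrt)
    qed
    then show ?case unfolding G_def
      by (intro bounded_imp_summable[of _ "sqrt c"])
        (auto simp: lessThan_Suc_atMost[symmetric] simp del: sum.lessThan_Suc)
  qed
  define s where "s x = (\<Sum>n. rep_L2 (u n) x)" for x
  have [measurable]: "s \<in> borel_measurable lebesgue" unfolding s_def by measurable
  have le: "AE x in lebesgue. ennreal ((cmod (s x))\<^sup>2) \<le> (SUP N. ennreal ((G N x)\<^sup>2))"
    using AE
  proof eventually_elim
    case (elim x)
    have "(\<lambda>N. G N x) \<longlonglongrightarrow> (\<Sum>n. cmod (rep_L2 (u n) x))"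
      unfolding G_def using summable_LIMSEQ[OF elim] .
    then have lim: "(\<lambda>N. ennreal ((G N x)\<^sup>2)) \<longlonglongrightarrow> ennreal ((\<Sum>n. cmod (rep_L2 (u n) x))\<^sup>2)"
      by (intro tendsto_ennrealI tendsto_power)
    have "ennreal ((cmod (s x))\<^sup>2) \<le> ennreal ((\<Sum>n. cmod (rep_L2 (u n) x))\<^sup>2)"
      unfolding s_def by (intro ennreal_leI power_mono summable_norm elim) auto
    also have "\<dots> \<le> (SUP N. ennreal ((G N x)\<^sup>2))"
      by (rule LIMSEQ_le_const2[OF lim]) (auto intro!: SUP_upper)
    finally show ?case .
  qed
  have nns: "(\<integral>\<^sup>+x. ennreal ((cmod (s x))\<^sup>2) \<partial>lebesgue) \<le> ennreal (S\<^sup>2)"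
    using nn_integral_mono_AE[OF le] sup by (rule order_trans)
  have "integrable lebesgue (\<lambda>x. (cmod (s x))\<^sup>2)"
    by (rule integrableI_nonneg) (use nns in \<open>auto simp: less_top[symmetric] top_unique\<close>)
  then show sqs: "square_integrable (\<lambda>x. \<Sum>n. rep_L2 (u n) x)"
    using \<open>s \<in> borel_measurable lebesgue\<close> by (simp add: square_integrable_def s_def[abs_def])
  have "(LINT x|lebesgue. (cmod (s x))\<^sup>2) \<le> S\<^sup>2"
    by (rule integral_real_bounded) (use nns in auto)
  then have "(norm (abs_L2 s))\<^sup>2 \<le> S\<^sup>2"
    using power2_norm_abs_L2[OF sqs] by (simp add: s_def[abs_def])
  then show "norm (abs_L2 (\<lambda>x. \<Sum>n. rep_L2 (u n) x)) \<le> (\<Sum>n. norm (u n))"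
    using S0 power2_le_imp_le unfolding s_def S_def by blast
qed

lemma L2_series:
  fixes u :: "nat \<Rightarrow> 'a::euclidean_space L2"
  assumes sm: "summable (\<lambda>n. norm (u n))"
  shows "u sums abs_L2 (\<lambda>x. \<Sum>n. rep_L2 (u n) x)"
proof -
  let ?s = "\<lambda>x. \<Sum>n. rep_L2 (u n) x"
  have bd: "norm ((\<Sum>n<N. u n) - abs_L2 ?s) \<le> (\<Sum>n. norm (u (n + N)))" for N
  proof -
    have sm': "summable (\<lambda>n. norm (u (n + N)))" by (rule summable_ignore_initial_segment[OF sm])
    have "abs_L2 ?s - (\<Sum>n<N. u n) = abs_L2 (\<lambda>x. ?s x - (\<Sum>n<N. rep_L2 (u n) x))"
      using minus_abs_L2[OF L2_series_pointwise(2)[OF sm] square_integrable_sum[OF square_integrable_rep]]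
        sum_abs_L2[of "{..<N}" "\<lambda>i. rep_L2 (u i)", OF square_integrable_rep]
      by (simp add: abs_rep_L2)
    also have "\<dots> = abs_L2 (\<lambda>x. \<Sum>n. rep_L2 (u (n + N)) x)"
    proof (rule abs_L2_eqI)
      show "AE x in lebesgue. ?s x - (\<Sum>n<N. rep_L2 (u n) x) = (\<Sum>n. rep_L2 (u (n + N)) x)"
        using L2_series_pointwise(1)[OF sm]
      proof eventually_elim
        case (elim x)
        then have "summable (\<lambda>n. rep_L2 (u n) x)" by (rule summable_norm_cancel)
        from suminf_minus_initial_segment[OF this, of N] show ?case by simp
      qed
    qed (intro square_integrable_diff square_integrable_sum square_integrable_rep
        L2_series_pointwise(2) sm sm')+
    finally show ?thesis
      using L2_series_pointwise(3)[OF sm'] norm_minus_commute[of "abs_L2 ?s" "\<Sum>n<N. u n"] by simp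
  qed
  have "(\<lambda>N. \<Sum>n. norm (u (n + N))) \<longlonglongrightarrow> 0"
    by (rule suminf_exist_split2[OF sm])
  then have "(\<lambda>N. (\<Sum>n<N. u n) - abs_L2 ?s) \<longlonglongrightarrow> 0"
    by (rule Lim_null_comparison[rotated]) (auto intro!: always_eventually bd)
  then show ?thesis unfolding sums_def by (simp add: LIM_zero_iff)
qed

instance L2 :: (euclidean_space) complete_space
proof
  fix X :: "nat \<Rightarrow> 'a L2"
  assume C: "Cauchy X"
  have "\<exists>N. \<forall>m\<ge>N. \<forall>n\<ge>N. norm (X m - X n) < (1/2)^k" for k :: nat
    using CauchyD[OF C, of "(1/2)^k"] by simp
  then obtain N where N: "\<And>k m n. m \<ge> N k \<Longrightarrow> n \<ge> N k \<Longrightarrow> norm (X m - X n) < (1/2)^k" by metis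
  \<comment> \<open>The indices \<open>M k\<close> select a subsequence with geometrically small increments; its telescoping
    series converges by \<open>L2_series\<close>.\<close>
  define M where "M k = (\<Sum>i\<le>k. N i + 1)" for k
  have MN: "N k \<le> M k" for k
    unfolding M_def using member_le_sum[of k "{..k}" "\<lambda>i. N i + 1"] by simp
  have mono: "strict_mono M" by (rule strict_mono_Suc_iff[THEN iffD2]) (simp add: M_def)
  have "norm (X (M (Suc k)) - X (M k)) \<le> (1/2)^k" for k
    using N[of k "M (Suc k)" "M k"] MN[of k] strict_monoD[OF mono, of k "Suc k"] by simp
  then have "summable (\<lambda>k. norm (X (M (Suc k)) - X (M k)))"
    by (intro summable_comparison_test[OF _ summable_geometric[of "1/2::real"]]) auto
  from L2_series[OF this] have "\<exists>L. (\<lambda>k. \<Sum>i<k. X (M (Suc i)) - X (M i)) \<longlonglongrightarrow> L"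
    unfolding sums_def by blast
  moreover have "(\<Sum>i<k. X (M (Suc i)) - X (M i)) = X (M k) - X (M 0)" for k
    by (rule sum_lessThan_telescope)
  ultimately obtain L where "(\<lambda>k. X (M k) - X (M 0)) \<longlonglongrightarrow> L" by auto
  then have "(X \<circ> M) \<longlonglongrightarrow> L + X (M 0)"
    using tendsto_add[of "\<lambda>k. X (M k) - X (M 0)" L sequentially "\<lambda>_. X (M 0)"]
    by (simp add: o_def)
  then show "convergent X" using Cauchy_converges_subseq[OF C mono] by (auto simp: convergent_def)
qed

instance L2 :: (euclidean_space) banach ..

lemma cinner_add_left: "cinner_L2 (f + g) h = cinner_L2 f h + cinner_L2 g h"
  by transfer (auto simp: L2_eq_def distrib_right integrable_mult_cnj)

lemma cinner_scaleC_left: "cinner_L2 (scaleC_L2 c f) g = c * cinner_L2 f g"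
  by transfer (auto simp: mult.assoc)

lemma cinner_commute: "cinner_L2 g f = cnj (cinner_L2 f g)"
proof transfer
  fix f g :: "'a \<Rightarrow> complex"
  have "(LINT x|lebesgue. g x * cnj (f x)) = (LINT x|lebesgue. cnj (f x * cnj (g x)))"
    by (simp add: mult.commute)
  also have "\<dots> = cnj (LINT x|lebesgue. f x * cnj (g x))"
    by (rule Bochner_Integration.integral_cnj)
  finally show "(LINT x|lebesgue. g x * cnj (f x)) = cnj (LINT x|lebesgue. f x * cnj (g x))" .
qed

lemma cinner_add_right: "cinner_L2 h (f + g) = cinner_L2 h f + cinner_L2 h g"
  by (subst (1 2 3) cinner_commute) (simp add: cinner_add_left)

lemma cinner_scaleC_right: "cinner_L2 g (scaleC_L2 c f) = cnj c * cinner_L2 g f"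
  by (subst (1 2) cinner_commute) (simp add: cinner_scaleC_left)

lemma scaleC_of_real: "scaleC_L2 (of_real r) f = r *\<^sub>R f"
  by transfer (auto simp: L2_eq_def square_integrable_mult)

lemma cinner_zero [simp]: "cinner_L2 0 f = 0" "cinner_L2 f 0 = 0"
  using cinner_add_left[of 0 0 f] cinner_add_right[of f 0 0] by simp_all

lemma cinner_minus_left: "cinner_L2 (- f) g = - cinner_L2 f g"
  using cinner_add_left[of f "- f" g] by (simp add: minus_unique)

lemma cinner_minus_right: "cinner_L2 g (- f) = - cinner_L2 g f"
  using cinner_add_right[of g f "- f"] by (simp add: minus_unique)

lemma cinner_diff_left: "cinner_L2 (f - g) h = cinner_L2 f h - cinner_L2 g h"
  using cinner_add_left[of f "- g" h] by (simp add: cinner_minus_left)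

lemma cinner_diff_right: "cinner_L2 h (f - g) = cinner_L2 h f - cinner_L2 h g"
  using cinner_add_right[of h f "- g"] by (simp add: cinner_minus_right)

lemma cinner_sum_left: "cinner_L2 (\<Sum>i\<in>I. f i) h = (\<Sum>i\<in>I. cinner_L2 (f i) h)"
  by (induction I rule: infinite_finite_induct) (simp_all add: cinner_add_left)

lemma cinner_sum_right: "cinner_L2 h (\<Sum>i\<in>I. f i) = (\<Sum>i\<in>I. cinner_L2 h (f i))"
  by (induction I rule: infinite_finite_induct) (simp_all add: cinner_add_right)

lemma cinner_self: "cinner_L2 f f = of_real ((norm f)\<^sup>2)"
proof -
  have "Im (cinner_L2 f f) = 0" using cinner_commute[of f f] by (simp add: complex_eq_iff)
  then show ?thesis by (simp add: complex_eq_iff power2_norm_eq_inner inner_L2_def)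
qed

lemma norm_scaleC: "norm (scaleC_L2 c f) = cmod c * norm f"
proof (rule power2_eq_imp_eq)
  have "complex_of_real ((norm (scaleC_L2 c f))\<^sup>2) = c * cnj c * of_real ((norm f)\<^sup>2)"
    by (simp only: cinner_self[symmetric] cinner_scaleC_left cinner_scaleC_right mult_ac)
  also have "\<dots> = of_real ((cmod c * norm f)\<^sup>2)"
    by (simp add: complex_norm_square[symmetric] power_mult_distrib)
  finally show "(norm (scaleC_L2 c f))\<^sup>2 = (cmod c * norm f)\<^sup>2" by (simp only: of_real_eq_iff)
qed simp_all

lemma cinner_Cauchy_Schwarz: "cmod (cinner_L2 f g) \<le> norm f * norm g"
proof (cases "cinner_L2 f g = 0")
  case False
  define u where "u = cnj (sgn (cinner_L2 f g))"
  have u: "cmod u = 1" using False by (simp add: u_def norm_sgn)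
  have "u * cinner_L2 f g = of_real (cmod (cinner_L2 f g))"
    using False
    by (simp add: u_def sgn_eq complex_norm_square[symmetric] mult.commute power2_eq_square)
  then have "cmod (cinner_L2 f g) = inner (scaleC_L2 u f) g"
    by (simp add: inner_L2_def cinner_scaleC_left)
  also have "\<dots> \<le> norm (scaleC_L2 u f) * norm g" by (rule norm_cauchy_schwarz)
  finally show ?thesis by (simp add: norm_scaleC u)
qed simp

lemma bounded_linear_cinner_left: "bounded_linear (\<lambda>f. cinner_L2 f g)"
  by (rule bounded_linear_intro[where K="norm g"])
    (simp_all add: cinner_add_left cinner_Cauchy_Schwarz cinner_scaleC_left
      scaleC_of_real[symmetric] scaleR_conv_of_real)

lemma bounded_linear_scaleC: "bounded_linear (scaleC_L2 c)"
  by (rule bounded_linear_intro[where K="cmod c"])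
    (simp_all add: norm_scaleC L2_complex.scale_right_distrib scaleC_of_real[symmetric] mult.commute)

lemma bounded_linear_scaleC_left: "bounded_linear (\<lambda>c. scaleC_L2 c f)"
  by (rule bounded_linear_intro[where K="norm f"])
    (simp_all add: norm_scaleC L2_complex.scale_left_distrib scaleC_of_real[symmetric]
      scaleR_conv_of_real)

text \<open>Sets of vectors are treated as families indexed by themselves, with the identity as second
  argument.\<close>

definition orthonormal_family :: "'i set \<Rightarrow> ('i \<Rightarrow> 'a::euclidean_space L2) \<Rightarrow> bool" where
  "orthonormal_family I e \<longleftrightarrow> (\<forall>i\<in>I. \<forall>j\<in>I. cinner_L2 (e i) (e j) = (if i = j then 1 else 0))"

definition proj_L2 :: "'i set \<Rightarrow> ('i \<Rightarrow> 'a::euclidean_space L2) \<Rightarrow> 'a L2 \<Rightarrow> 'a L2" where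
  "proj_L2 I e f = (\<Sum>i\<in>I. scaleC_L2 (cinner_L2 f (e i)) (e i))"

lemma cinner_proj_left:
  "cinner_L2 (proj_L2 I e f) g = (\<Sum>i\<in>I. cinner_L2 f (e i) * cinner_L2 (e i) g)"
  by (simp add: proj_L2_def cinner_sum_left cinner_scaleC_left)

lemma cinner_proj_symmetric: "cinner_L2 (proj_L2 I e f) g = cinner_L2 f (proj_L2 I e g)"
proof -
  have "cinner_L2 f (proj_L2 I e g) = (\<Sum>i\<in>I. cnj (cinner_L2 g (e i)) * cinner_L2 f (e i))"
    by (simp add: proj_L2_def cinner_sum_right cinner_scaleC_right)
  also have "\<dots> = (\<Sum>i\<in>I. cinner_L2 f (e i) * cinner_L2 (e i) g)"
    by (rule sum.cong[OF refl]) (simp add: cinner_commute[of g] mult.commute)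
  finally show ?thesis by (simp add: cinner_proj_left)
qed

lemma cinner_residual:
  assumes "finite I" "orthonormal_family I e" "i \<in> I"
  shows "cinner_L2 (f - proj_L2 I e f) (e i) = 0"
proof -
  have "cinner_L2 (proj_L2 I e f) (e i) = (\<Sum>j\<in>I. cinner_L2 f (e j) * (if j = i then 1 else 0))"
    unfolding cinner_proj_left
    using assms by (intro sum.cong) (auto simp: orthonormal_family_def)
  then show ?thesis using assms by (simp add: cinner_diff_left if_distrib cong: if_cong)
qed

lemma cinner_residual_proj:
  assumes "finite I" "orthonormal_family I e"
  shows "cinner_L2 (f - proj_L2 I e f) (proj_L2 I e g) = 0"
proof -
  have "cinner_L2 (f - proj_L2 I e f) (proj_L2 I e g)
      = (\<Sum>i\<in>I. cnj (cinner_L2 g (e i)) * cinner_L2 (f - proj_L2 I e f) (e i))"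
    unfolding proj_L2_def[of I e g] by (simp add: cinner_sum_right cinner_scaleC_right)
  also have "\<dots> = 0" using cinner_residual[OF assms] by (intro sum.neutral) simp
  finally show ?thesis .
qed

lemma norm_residual:
  assumes "finite I" "orthonormal_family I e"
  shows "(norm (f - proj_L2 I e f))\<^sup>2 = (norm f)\<^sup>2 - (\<Sum>i\<in>I. (cmod (cinner_L2 f (e i)))\<^sup>2)"
proof -
  have "complex_of_real ((norm (f - proj_L2 I e f))\<^sup>2) = cinner_L2 (f - proj_L2 I e f) f"
    using cinner_residual_proj[OF assms, of f f]
    unfolding cinner_self[symmetric] by (simp add: cinner_diff_right)
  also have "\<dots> = of_real ((norm f)\<^sup>2) - (\<Sum>i\<in>I. cinner_L2 f (e i) * cinner_L2 (e i) f)"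
    by (simp add: cinner_diff_left cinner_self cinner_proj_left)
  also have "(\<Sum>i\<in>I. cinner_L2 f (e i) * cinner_L2 (e i) f)
      = (\<Sum>i\<in>I. of_real ((cmod (cinner_L2 f (e i)))\<^sup>2))"
    by (rule sum.cong[OF refl]) (metis cinner_commute complex_norm_square)
  finally have "complex_of_real ((norm (f - proj_L2 I e f))\<^sup>2)
      = of_real ((norm f)\<^sup>2 - (\<Sum>i\<in>I. (cmod (cinner_L2 f (e i)))\<^sup>2))" by simp
  then show ?thesis by (simp only: of_real_eq_iff)
qed

lemma Bessel_inequality:
  assumes "finite I" "orthonormal_family I e"
  shows "(\<Sum>i\<in>I. (cmod (cinner_L2 f (e i)))\<^sup>2) \<le> (norm f)\<^sup>2"
  using norm_residual[OF assms, of f] zero_le_power2[of "norm (f - proj_L2 I e f)"] by linarith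

lemma orthonormal_family_extend:
  assumes Q: "finite Q" "orthonormal_family Q (\<lambda>e. e)" and ne: "proj_L2 Q (\<lambda>e. e) g \<noteq> g"
  defines "r \<equiv> g - proj_L2 Q (\<lambda>e. e) g"
  defines "e \<equiv> r /\<^sub>R norm r"
  shows "e \<notin> Q" "orthonormal_family (insert e Q) (\<lambda>e. e)" "\<And>q. q \<in> Q \<Longrightarrow> cinner_L2 q e = 0"
    "proj_L2 (insert e Q) (\<lambda>e. e) g = g"
proof -
  have r0: "r \<noteq> 0" using ne by (simp add: r_def)
  have e: "e = scaleC_L2 (of_real (inverse (norm r))) r" by (simp only: scaleC_of_real e_def)
  have eq: "cinner_L2 e q = 0" if "q \<in> Q" for q
    using cinner_residual[OF Q that, of g] by (simp add: e cinner_scaleC_left r_def)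
  then show qe: "cinner_L2 q e = 0" if "q \<in> Q" for q
    using that by (subst cinner_commute) simp
  have ee: "cinner_L2 e e = 1" using r0 by (simp add: cinner_self e_def)
  then show eQ: "e \<notin> Q" using eq[of e] by auto
  show "orthonormal_family (insert e Q) (\<lambda>e. e)"
    using Q(2) eQ eq qe ee by (auto simp: orthonormal_family_def)
  have "cinner_L2 r (proj_L2 Q (\<lambda>e. e) g) = 0"
    unfolding r_def by (rule cinner_residual_proj[OF Q])
  then have "cinner_L2 (proj_L2 Q (\<lambda>e. e) g) r = 0" by (subst cinner_commute) simp
  then have "cinner_L2 g r = of_real ((norm r)\<^sup>2)"
    using cinner_self[of r] unfolding r_def by (simp add: cinner_diff_left)
  then have "cinner_L2 g e = of_real (norm r)"
    using r0 by (simp add: e cinner_scaleC_right power2_eq_square)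
  then have "scaleC_L2 (cinner_L2 g e) e = r"
    using r0 by (simp add: scaleC_of_real e_def)
  then show "proj_L2 (insert e Q) (\<lambda>e. e) g = g"
    using Q(1) eQ by (simp add: proj_L2_def r_def)
qed

text \<open>Instead of spans, the result is stated as invariance under the projection, which is how it is
  used: the complementary projection annihilates \<open>G\<close>.\<close>

lemma Gram_Schmidt:
  assumes "finite G"
  shows "\<exists>Q. finite Q \<and> card Q \<le> card G \<and> orthonormal_family Q (\<lambda>e. e) \<and>
    (\<forall>g\<in>G. proj_L2 Q (\<lambda>e. e) g = g)"
  using assms
proof (induction G rule: finite_induct)
  case empty
  show ?case by (rule exI[of _ "{}"]) (simp add: orthonormal_family_def)
next
  case (insert g G)
  then obtain Q where Q: "finite Q" "card Q \<le> card G" "orthonormal_family Q (\<lambda>e. e)"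
    "\<And>h. h \<in> G \<Longrightarrow> proj_L2 Q (\<lambda>e. e) h = h" by blast
  show ?case
  proof (cases "proj_L2 Q (\<lambda>e. e) g = g")
    case True
    then show ?thesis using Q insert.hyps by (intro exI[of _ Q]) auto
  next
    case False
    let ?r = "g - proj_L2 Q (\<lambda>e. e) g"
    let ?e = "?r /\<^sub>R norm ?r"
    note ext = orthonormal_family_extend[OF Q(1,3) False]
    have "proj_L2 (insert ?e Q) (\<lambda>e. e) h = h" if "h \<in> G" for h
    proof -
      have "cinner_L2 h ?e = cinner_L2 (proj_L2 Q (\<lambda>e. e) h) ?e" by (simp only: Q(4)[OF that])
      also have "\<dots> = 0"
        unfolding cinner_proj_left using ext(3) by (intro sum.neutral) simp
      finally have "proj_L2 (insert ?e Q) (\<lambda>e. e) h = proj_L2 Q (\<lambda>e. e) h"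
        using Q(1) ext(1) by (simp add: proj_L2_def)
      then show ?thesis using Q(4)[OF that] by simp
    qed
    then show ?thesis using Q insert.hyps ext by (intro exI[of _ "insert ?e Q"]) auto
  qed
qed

section \<open>Nuclear operators\<close>

definition nuclear_op ::
    "(nat \<Rightarrow> 'a::euclidean_space L2) \<Rightarrow> (nat \<Rightarrow> 'a L2) \<Rightarrow> 'a L2 \<Rightarrow> 'a L2" where
  "nuclear_op f g u = (\<Sum>j. scaleC_L2 (cinner_L2 u (g j)) (f j))"

lemma norm_nuclear_term:
  "norm (scaleC_L2 (cinner_L2 u (g j)) (f j)) \<le> norm u * (norm (f j) * norm (g j))"
  using mult_right_mono[OF cinner_Cauchy_Schwarz[of u "g j"], of "norm (f j)"]
  by (simp add: norm_scaleC mult_ac)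

lemma summable_norm_nuclear:
  assumes "summable (\<lambda>j. norm (f j) * norm (g j))"
  shows "summable (\<lambda>j. norm (scaleC_L2 (cinner_L2 u (g j)) (f j)))"
  by (rule summable_comparison_test[OF _ summable_mult[OF assms, of "norm u"]])
    (use norm_nuclear_term[of u g _ f] in auto)

lemma summable_nuclear:
  assumes "summable (\<lambda>j. norm (f j) * norm (g j))"
  shows "summable (\<lambda>j. scaleC_L2 (cinner_L2 u (g j)) (f j))"
  by (rule summable_norm_cancel[OF summable_norm_nuclear[OF assms]])

lemma nuclear_op_linear:
  fixes f g :: "nat \<Rightarrow> 'a::euclidean_space L2"
  assumes sm: "summable (\<lambda>j. norm (f j) * norm (g j))"
  shows "Vector_Spaces.linear scaleC_L2 scaleC_L2 (nuclear_op f g)"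
proof -
  have "nuclear_op f g (u + v) = nuclear_op f g u + nuclear_op f g v" for u v
    unfolding nuclear_op_def cinner_add_left L2_complex.scale_left_distrib
    by (rule suminf_add[symmetric]) (rule summable_nuclear[OF sm])+
  moreover have "nuclear_op f g (scaleC_L2 c u) = scaleC_L2 c (nuclear_op f g u)" for c u
    unfolding nuclear_op_def cinner_scaleC_left L2_complex.scale_scale[symmetric]
    by (rule bounded_linear.suminf[OF bounded_linear_scaleC, symmetric]) (rule summable_nuclear[OF sm])
  ultimately show ?thesis
    by (simp add: Vector_Spaces.linear_def module_hom_def module_hom_axioms_def
        L2_complex.vector_space_axioms L2_complex.module_axioms)
qed

lemma nuclear_op_scaleR:
  fixes f g :: "nat \<Rightarrow> 'a::euclidean_space L2"
  assumes sm: "summable (\<lambda>j. norm (f j) * norm (g j))"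
  shows "nuclear_op f g (r *\<^sub>R u) = r *\<^sub>R nuclear_op f g u"
  unfolding scaleC_of_real[symmetric] nuclear_op_def cinner_scaleC_left L2_complex.scale_scale[symmetric]
    by (rule bounded_linear.suminf[OF bounded_linear_scaleC, symmetric]) (rule summable_nuclear[OF sm])

lemma cinner_nuclear_op:
  assumes sm: "summable (\<lambda>j. norm (f j) * norm (g j))"
  shows "(\<lambda>j. cinner_L2 u (g j) * cinner_L2 (f j) v) sums cinner_L2 (nuclear_op f g u) v"
  using bounded_linear.sums[OF bounded_linear_cinner_left summable_sums[OF summable_nuclear[OF sm]]]
  by (simp add: nuclear_op_def cinner_scaleC_left)

lemma cinner_nuclear_adjoint:
  assumes sm: "summable (\<lambda>j. norm (f j) * norm (g j))"
  shows "cinner_L2 (nuclear_op f g u) v = cinner_L2 u (nuclear_op g f v)"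
proof -
  have sm': "summable (\<lambda>j. norm (g j) * norm (f j))" using sm by (simp add: mult.commute)
  have "(\<lambda>j. cnj (cinner_L2 v (f j) * cinner_L2 (g j) u)) sums cnj (cinner_L2 (nuclear_op g f v) u)"
    unfolding sums_cnj by (rule cinner_nuclear_op[OF sm'])
  moreover have "cnj (cinner_L2 v (f j) * cinner_L2 (g j) u) = cinner_L2 u (g j) * cinner_L2 (f j) v" for j
    by (simp add: cinner_commute[of "f j" v] cinner_commute[of u "g j"])
  ultimately have "(\<lambda>j. cinner_L2 u (g j) * cinner_L2 (f j) v) sums cinner_L2 u (nuclear_op g f v)"
    by (simp add: cinner_commute[of u "nuclear_op g f v"])
  then show ?thesis using cinner_nuclear_op[OF sm] sums_unique2 by blast
qed

lemma adjoint_nuclear_op: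
  assumes "summable (\<lambda>j. norm (f j) * norm (g j))"
  shows "adjoint (nuclear_op f g) = nuclear_op g f"
  by (rule adjoint_unique) (simp add: inner_L2_def cinner_nuclear_adjoint[OF assms])

lemma compact_finite_rank_image:
  fixes f :: "nat \<Rightarrow> 'a::euclidean_space L2"
  shows "compact {\<Sum>j<N. scaleC_L2 (c j) (f j) | c. \<forall>j<N. cmod (c j) \<le> M j}"
proof (induction N)
  case (Suc N)
  let ?S = "{\<Sum>j<N. scaleC_L2 (c j) (f j) | c. \<forall>j<N. cmod (c j) \<le> M j}"
  let ?T = "(\<lambda>c. scaleC_L2 c (f N)) ` cball 0 (M N)"
  have "compact ?T"
    by (rule compact_continuous_image)
      (auto intro!: linear_continuous_on bounded_linear_scaleC_left)
  then have "compact {x + y | x y. x \<in> ?S \<and> y \<in> ?T}" using Suc.IH by (rule compact_sums[rotated])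
  also have "{x + y | x y. x \<in> ?S \<and> y \<in> ?T}
      = {\<Sum>j<Suc N. scaleC_L2 (c j) (f j) | c. \<forall>j<Suc N. cmod (c j) \<le> M j}" (is "?L = ?R")
  proof (rule equalityI; rule subsetI)
    fix z assume "z \<in> ?L"
    then obtain c d where cd: "z = (\<Sum>j<N. scaleC_L2 (c j) (f j)) + scaleC_L2 d (f N)"
      "\<forall>j<N. cmod (c j) \<le> M j" "cmod d \<le> M N" by auto
    have "z = (\<Sum>j<Suc N. scaleC_L2 ((c(N := d)) j) (f j))" by (simp add: cd(1))
    moreover have "\<forall>j<Suc N. cmod ((c(N := d)) j) \<le> M j" using cd by (auto simp: less_Suc_eq)
    ultimately show "z \<in> ?R" by blast
  next
    fix z assume "z \<in> ?R"
    then obtain c where "z = (\<Sum>j<N. scaleC_L2 (c j) (f j)) + scaleC_L2 (c N) (f N)"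
      "\<forall>j<Suc N. cmod (c j) \<le> M j" by auto
    moreover from this have "(\<Sum>j<N. scaleC_L2 (c j) (f j)) \<in> ?S" "scaleC_L2 (c N) (f N) \<in> ?T"
      by auto
    ultimately show "z \<in> ?L" by blast
  qed
  finally show ?case .
qed simp

text \<open>The image of the unit ball is within \<open>\<epsilon>\<close> of a compact set, for every \<open>\<epsilon>\<close>: cut the series.\<close>

lemma nuclear_op_compact:
  fixes f g :: "nat \<Rightarrow> 'a::euclidean_space L2"
  assumes sm: "summable (\<lambda>j. norm (f j) * norm (g j))"
  shows "compact (closure (nuclear_op f g ` cball 0 1))"
  unfolding compact_eq_totally_bounded
proof (intro conjI allI impI)
  show "complete (closure (nuclear_op f g ` cball 0 1))"
    by (simp add: complete_eq_closed)
next
  fix \<epsilon> :: real assume "0 < \<epsilon>"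
  have "(\<lambda>N. \<Sum>j. norm (f (j + N)) * norm (g (j + N))) \<longlonglongrightarrow> 0"
    by (rule suminf_exist_split2[OF sm])
  then have "\<forall>\<^sub>F N in sequentially. (\<Sum>j. norm (f (j + N)) * norm (g (j + N))) < \<epsilon>/3"
    by (rule order_tendstoD) (use \<open>0 < \<epsilon>\<close> in simp)
  then obtain N where N: "(\<Sum>j. norm (f (j + N)) * norm (g (j + N))) < \<epsilon>/3"
    by (auto simp: eventually_sequentially)
  let ?K = "{\<Sum>j<N. scaleC_L2 (c j) (f j) | c. \<forall>j<N. cmod (c j) \<le> norm (g j)}"
  have "\<exists>k. finite k \<and> ?K \<subseteq> (\<Union>x\<in>k. ball x (\<epsilon>/3))"
    using compact_finite_rank_image[where N=N and f=f and M="\<lambda>j. norm (g j)"] \<open>0 < \<epsilon>\<close>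
    unfolding compact_eq_totally_bounded by simp
  then obtain k where k: "finite k" "?K \<subseteq> (\<Union>x\<in>k. ball x (\<epsilon>/3))" by blast
  have img: "nuclear_op f g ` cball 0 1 \<subseteq> (\<Union>x\<in>k. cball x (2 * \<epsilon>/3))"
  proof (rule image_subsetI)
    fix u :: "'a L2" assume "u \<in> cball 0 1"
    then have u: "norm u \<le> 1" by simp
    let ?t = "\<lambda>j. scaleC_L2 (cinner_L2 u (g j)) (f j)"
    have "cmod (cinner_L2 u (g j)) \<le> norm (g j)" for j
      using order_trans[OF cinner_Cauchy_Schwarz mult_right_mono[OF u]] by simp
    then have "(\<Sum>j<N. ?t j) \<in> ?K" by (intro CollectI exI[of _ "\<lambda>j. cinner_L2 u (g j)"]) simp
    then obtain x where x: "x \<in> k" "dist x (\<Sum>j<N. ?t j) < \<epsilon>/3" using k(2) by auto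
    have "nuclear_op f g u - (\<Sum>j<N. ?t j) = (\<Sum>j. ?t (j + N))"
      using suminf_minus_initial_segment[OF summable_nuclear[OF sm], of u N]
      by (simp add: nuclear_op_def)
    also have "norm \<dots> \<le> (\<Sum>j. norm (?t (j + N)))"
      by (rule summable_norm) (rule summable_ignore_initial_segment[OF summable_norm_nuclear[OF sm]])
    also have "\<dots> \<le> (\<Sum>j. norm (f (j + N)) * norm (g (j + N)))"
    proof (rule suminf_le)
      show "norm (?t (j + N)) \<le> norm (f (j + N)) * norm (g (j + N))" for j
        using order_trans[OF norm_nuclear_term mult_right_mono[OF u]] by simp
    qed (intro summable_ignore_initial_segment[OF summable_norm_nuclear[OF sm]]
        summable_ignore_initial_segment[OF sm])+
    finally have "dist (nuclear_op f g u) (\<Sum>j<N. ?t j) < \<epsilon>/3" using N by (simp add: dist_norm)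
    then have "dist x (nuclear_op f g u) \<le> 2 * \<epsilon>/3"
      using x(2) dist_triangle[of x "nuclear_op f g u" "\<Sum>j<N. ?t j"] by (simp add: dist_commute)
    then show "nuclear_op f g u \<in> (\<Union>x\<in>k. cball x (2 * \<epsilon>/3))" using x(1) by auto
  qed
  have "closed (\<Union>x\<in>k. cball x (2 * \<epsilon>/3))" using k(1) by (intro closed_UN) auto
  from closure_minimal[OF img this]
  have "closure (nuclear_op f g ` cball 0 1) \<subseteq> (\<Union>x\<in>k. cball x (2 * \<epsilon>/3))" .
  also have "\<dots> \<subseteq> (\<Union>x\<in>k. ball x \<epsilon>)"
    using \<open>0 < \<epsilon>\<close> by (intro UN_mono) auto
  finally have "closure (nuclear_op f g ` cball 0 1) \<subseteq> (\<Union>x\<in>k. ball x \<epsilon>)" .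
  then show "\<exists>k. finite k \<and> closure (nuclear_op f g ` cball 0 1) \<subseteq> (\<Union>x\<in>k. ball x \<epsilon>)"
    using k(1) by blast
qed

text \<open>A trace estimate for \<open>A\<close> on the orthogonal complement of \<open>Q\<close>: terms with \<open>j \<in> J\<close> vanish there,
  and Bessel's inequality for \<open>S\<close> and for the corresponding system of left singular vectors bounds
  each of the others.\<close>

lemma eigenvalue_sum_le:
  fixes f g :: "nat \<Rightarrow> 'a::euclidean_space L2"
  assumes sm: "summable (\<lambda>j. norm (f j) * norm (g j))"
    and S: "finite S" "orthonormal_family S (\<lambda>e. e)"
    and ev: "\<And>e. e \<in> S \<Longrightarrow> nuclear_op g f (nuclear_op f g e) = (\<sigma> e)\<^sup>2 *\<^sub>R e"
    and pos: "\<And>e. e \<in> S \<Longrightarrow> 0 < \<sigma> e"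
    and Q: "finite Q" "orthonormal_family Q (\<lambda>e. e)"
    and QJ: "\<And>j. j \<in> J \<Longrightarrow> proj_L2 Q (\<lambda>e. e) (g j) = g j"
  shows "(\<Sum>e\<in>S. \<sigma> e * (norm (e - proj_L2 Q (\<lambda>e. e) e))\<^sup>2)
    \<le> (\<Sum>j. if j \<in> J then 0 else norm (f j) * norm (g j))"
proof -
  let ?A = "nuclear_op f g"
  define P where "P u = u - proj_L2 Q (\<lambda>e. e) u" for u
  \<comment> \<open>\<open>S\<close> and \<open>v\<close> are the two orthonormal systems of a singular value decomposition of \<open>A\<close>, restricted
    to finitely many singular values.\<close>
  define v where "v e = ?A e /\<^sub>R \<sigma> e" for e
  have sm': "summable (\<lambda>j. norm (g j) * norm (f j))" using sm by (simp add: mult.commute)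
  have v: "orthonormal_family S v"
    unfolding orthonormal_family_def
  proof (intro ballI)
    fix e e' assume e: "e \<in> S" "e' \<in> S"
    have "cinner_L2 (v e) (v e') = (inverse (\<sigma> e) * inverse (\<sigma> e')) * cinner_L2 (?A e) (?A e')"
      unfolding v_def scaleC_of_real[symmetric] cinner_scaleC_left cinner_scaleC_right by simp
    also have "cinner_L2 (?A e) (?A e') = cinner_L2 (nuclear_op g f (?A e)) e'"
      by (simp add: cinner_nuclear_adjoint[OF sm'])
    also have "\<dots> = (\<sigma> e)\<^sup>2 * cinner_L2 e e'"
      by (simp only: ev[OF e(1)] scaleC_of_real[symmetric] cinner_scaleC_left)
    finally show "cinner_L2 (v e) (v e') = (if e = e' then 1 else 0)"
      using S(2) e pos[OF e(1)] by (auto simp: orthonormal_family_def power2_eq_square field_simps)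
  qed
  \<comment> \<open>The diagonal entry of \<open>A P\<close> between \<open>e\<close> and \<open>v e\<close>, computed from the singular value
    decomposition on one side and from the series on the other.\<close>
  have trace: "(\<lambda>j. cinner_L2 (P e) (g j) * cinner_L2 (f j) (v e)) sums
      of_real (\<sigma> e * (norm (P e))\<^sup>2)" if e: "e \<in> S" for e
  proof -
    have "cinner_L2 (?A (P e)) (v e) = cinner_L2 (P e) (nuclear_op g f (v e))"
      by (rule cinner_nuclear_adjoint[OF sm])
    also have "nuclear_op g f (v e) = \<sigma> e *\<^sub>R e"
      unfolding v_def nuclear_op_scaleR[OF sm'] ev[OF e]
      using pos[OF e] by (simp add: power2_eq_square)
    also have "cinner_L2 (P e) \<dots> = \<sigma> e * cinner_L2 (P e) e"
      by (simp add: scaleC_of_real[symmetric] cinner_scaleC_right)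
    also have "cinner_L2 (P e) e = cinner_L2 (P e) (P e)"
      using cinner_residual_proj[OF Q, of e e] by (simp add: P_def cinner_diff_right)
    finally show ?thesis using cinner_nuclear_op[OF sm, of "P e" "v e"] by (simp add: cinner_self)
  qed
  have move: "cinner_L2 (P e) h = cinner_L2 e (P h)" for e h
    by (simp add: P_def cinner_diff_left cinner_diff_right cinner_proj_symmetric)
  have bound: "(\<Sum>e\<in>S. cmod (cinner_L2 (P e) (g j) * cinner_L2 (f j) (v e)))
      \<le> (if j \<in> J then 0 else norm (f j) * norm (g j))" for j
  proof (cases "j \<in> J")
    case True
    then have "P (g j) = 0" by (simp add: P_def QJ)
    then show ?thesis using True by (simp add: move)
  next
    case False
    have "(\<Sum>e\<in>S. cmod (cinner_L2 e (P (g j))) * cmod (cinner_L2 (f j) (v e)))\<^sup>2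
        \<le> (\<Sum>e\<in>S. (cmod (cinner_L2 e (P (g j))))\<^sup>2) * (\<Sum>e\<in>S. (cmod (cinner_L2 (f j) (v e)))\<^sup>2)"
      by (rule Cauchy_Schwarz_ineq_sum)
    also have "(\<Sum>e\<in>S. (cmod (cinner_L2 e (P (g j))))\<^sup>2) = (\<Sum>e\<in>S. (cmod (cinner_L2 (P (g j)) e))\<^sup>2)"
      by (subst cinner_commute) simp
    also have "\<dots> * (\<Sum>e\<in>S. (cmod (cinner_L2 (f j) (v e)))\<^sup>2) \<le> (norm (g j))\<^sup>2 * (norm (f j))\<^sup>2"
    proof (rule mult_mono)
      have "(norm (P (g j)))\<^sup>2 \<le> (norm (g j))\<^sup>2"
        unfolding P_def norm_residual[OF Q] by (simp add: sum_nonneg)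
      then show "(\<Sum>e\<in>S. (cmod (cinner_L2 (P (g j)) e))\<^sup>2) \<le> (norm (g j))\<^sup>2"
        by (rule order_trans[OF Bessel_inequality[OF S]])
      show "(\<Sum>e\<in>S. (cmod (cinner_L2 (f j) (v e)))\<^sup>2) \<le> (norm (f j))\<^sup>2"
        by (rule Bessel_inequality[OF S(1) v])
    qed (simp_all add: sum_nonneg)
    also have "\<dots> = (norm (f j) * norm (g j))\<^sup>2" by (simp add: power_mult_distrib)
    finally have "(\<Sum>e\<in>S. cmod (cinner_L2 e (P (g j))) * cmod (cinner_L2 (f j) (v e)))
        \<le> norm (f j) * norm (g j)" by (rule power2_le_imp_le) simp
    then show ?thesis using False by (simp add: move norm_mult)
  qed
  have sumJ: "summable (\<lambda>j. if j \<in> J then 0 else norm (f j) * norm (g j))"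
    by (rule summable_comparison_test[OF _ sm]) auto
  have "(\<lambda>j. \<Sum>e\<in>S. cinner_L2 (P e) (g j) * cinner_L2 (f j) (v e)) sums
      (\<Sum>e\<in>S. of_real (\<sigma> e * (norm (P e))\<^sup>2))"
    by (rule sums_sum) (rule trace)
  then have eq: "(\<Sum>j. \<Sum>e\<in>S. cinner_L2 (P e) (g j) * cinner_L2 (f j) (v e))
      = complex_of_real (\<Sum>e\<in>S. \<sigma> e * (norm (P e))\<^sup>2)"
    by (simp add: sums_unique[symmetric])
  have ln: "norm (\<Sum>e\<in>S. cinner_L2 (P e) (g j) * cinner_L2 (f j) (v e))
      \<le> (if j \<in> J then 0 else norm (f j) * norm (g j))" for j
    by (rule order_trans[OF norm_sum bound])
  have "(\<Sum>e\<in>S. \<sigma> e * (norm (P e))\<^sup>2) \<le> cmod (complex_of_real (\<Sum>e\<in>S. \<sigma> e * (norm (P e))\<^sup>2))"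
    unfolding norm_of_real by (rule abs_ge_self)
  also have "\<dots> \<le> (\<Sum>j. if j \<in> J then 0 else norm (f j) * norm (g j))"
    unfolding eq[symmetric] by (rule norm_suminf_le[OF ln sumJ])
  finally show ?thesis by (simp add: P_def)
qed

text \<open>Take for \<open>Q\<close> an orthonormal basis of the span of the \<open>g j\<close> with \<open>norm (f j) * norm (g j) > a\<close>.
  A unit vector \<open>e\<close> has a part of squared length \<open>P e\<close> orthogonal to \<open>Q\<close>, where the trace estimate
  applies, and a part of squared length \<open>1 - P e\<close> in the span, where \<open>a\<close> is used as the bound. The latter
  parts add up to at most the dimension of the span.\<close>

lemma eigenvalue_min_sum_le:
  fixes f g :: "nat \<Rightarrow> 'a::euclidean_space L2"
  assumes sm: "summable (\<lambda>j. norm (f j) * norm (g j))"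
    and S: "finite S" "orthonormal_family S (\<lambda>e. e)"
    and ev: "\<And>e. e \<in> S \<Longrightarrow> nuclear_op g f (nuclear_op f g e) = (\<sigma> e)\<^sup>2 *\<^sub>R e"
    and pos: "\<And>e. e \<in> S \<Longrightarrow> 0 < \<sigma> e"
    and a: "0 < a"
  shows "(\<Sum>e\<in>S. min (\<sigma> e) a) \<le> (\<Sum>j. min (norm (f j) * norm (g j)) a)"
proof -
  define \<mu> where "\<mu> j = norm (f j) * norm (g j)" for j
  define J where "J = {j. a < \<mu> j}"
  have "\<mu> \<longlonglongrightarrow> 0" using summable_LIMSEQ_zero[OF sm] by (simp add: \<mu>_def[abs_def])
  then have "\<forall>\<^sub>F j in sequentially. \<mu> j < a" using a by (rule order_tendstoD)
  then obtain N where "\<And>j. j \<ge> N \<Longrightarrow> \<mu> j < a" by (auto simp: eventually_sequentially)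
  then have "J \<subseteq> {..<N}" by (force simp: J_def not_less[symmetric])
  then have finJ: "finite J" by (rule finite_subset) simp
  obtain Q where Q: "finite Q" "card Q \<le> card (g ` J)" "orthonormal_family Q (\<lambda>e. e)"
    "\<And>h. h \<in> g ` J \<Longrightarrow> proj_L2 Q (\<lambda>e. e) h = h"
    using Gram_Schmidt[of "g ` J"] finJ by blast
  have cardQ: "card Q \<le> card J" using Q(2) card_image_le[OF finJ, of g] by linarith
  define P where "P e = (norm (e - proj_L2 Q (\<lambda>e. e) e))\<^sup>2" for e :: "'a L2"
  have P: "1 - P e = (\<Sum>q\<in>Q. (cmod (cinner_L2 e q))\<^sup>2)" if "e \<in> S" for e
  proof -
    have "cinner_L2 e e = 1" using S(2) that by (simp add: orthonormal_family_def)
    then have "(norm e)\<^sup>2 = 1" by (simp only: cinner_self of_real_eq_1_iff)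
    then show ?thesis unfolding P_def norm_residual[OF Q(1,3)] by simp
  qed
  have sm_min: "summable (\<lambda>j. if j \<in> J then 0 else \<mu> j)"
    by (rule summable_comparison_test[OF _ sm]) (auto simp: \<mu>_def)
  have "(\<Sum>e\<in>S. 1 - P e) = (\<Sum>q\<in>Q. \<Sum>e\<in>S. (cmod (cinner_L2 e q))\<^sup>2)"
    by (subst sum.swap) (simp add: P)
  also have "\<dots> = (\<Sum>q\<in>Q. \<Sum>e\<in>S. (cmod (cinner_L2 q e))\<^sup>2)"
    by (subst cinner_commute) simp
  also have "\<dots> \<le> (\<Sum>q\<in>Q. (norm q)\<^sup>2)" by (intro sum_mono Bessel_inequality S)
  also have "\<dots> = (\<Sum>q\<in>Q. 1)"
  proof (rule sum.cong[OF refl])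
    fix q assume "q \<in> Q"
    then have "cinner_L2 q q = 1" using Q(3) by (simp add: orthonormal_family_def)
    then show "(norm q)\<^sup>2 = 1" by (simp only: cinner_self of_real_eq_1_iff)
  qed
  also have "\<dots> \<le> card J" using cardQ by simp
  finally have defect: "(\<Sum>e\<in>S. 1 - P e) \<le> card J" .
  \<comment> \<open>A minimum is below any convex combination.\<close>
  have "(\<Sum>e\<in>S. min (\<sigma> e) a) \<le> (\<Sum>e\<in>S. \<sigma> e * P e + a * (1 - P e))"
  proof (rule sum_mono)
    fix e assume e: "e \<in> S"
    have "0 \<le> P e" by (simp add: P_def)
    moreover have "0 \<le> 1 - P e" by (simp add: P[OF e] sum_nonneg)
    ultimately have "min (\<sigma> e) a * P e + min (\<sigma> e) a * (1 - P e) \<le> \<sigma> e * P e + a * (1 - P e)"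
      by (intro add_mono mult_right_mono) auto
    then show "min (\<sigma> e) a \<le> \<sigma> e * P e + a * (1 - P e)" by (simp add: algebra_simps)
  qed
  also have "\<dots> = (\<Sum>e\<in>S. \<sigma> e * P e) + a * (\<Sum>e\<in>S. 1 - P e)"
    by (simp add: sum.distrib sum_distrib_left)
  also have "\<dots> \<le> (\<Sum>j. if j \<in> J then 0 else \<mu> j) + a * card J"
  proof (intro add_mono mult_left_mono defect)
    show "(\<Sum>e\<in>S. \<sigma> e * P e) \<le> (\<Sum>j. if j \<in> J then 0 else \<mu> j)"
      unfolding P_def \<mu>_def by (rule eigenvalue_sum_le[OF sm S ev pos Q(1,3)]) (auto intro: Q(4))
  qed (use a in simp)
  also have "a * card J = (\<Sum>j. if j \<in> J then a else 0)"
    using suminf_finite[OF finJ, of "\<lambda>j. if j \<in> J then a else 0"] by simp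
  also have "(\<Sum>j. if j \<in> J then 0 else \<mu> j) + \<dots> = (\<Sum>j. min (\<mu> j) a)"
    by (subst suminf_add[OF sm_min summable_finite[OF finJ]])
      (auto simp: J_def intro!: suminf_cong)
  finally show ?thesis by (simp add: \<mu>_def)
qed

section \<open>Schatten quasi-norms of nuclear operators\<close>

text \<open>The function $t^q$ is, up to a constant, a superposition of the functions \<open>min t x\<close>.
  This turns inequalities for truncated sums into inequalities for $q$-th powers.\<close>

lemma nn_integral_min_powr:
  fixes q t :: real
  assumes "0 < q" "q < 1" "0 \<le> t"
  shows "(\<integral>\<^sup>+x. ennreal (indicator {0<..} x * (min t x * x powr (q - 2))) \<partial>lborel)
    = ennreal ((1 / q + 1 / (1 - q)) * t powr q)"
proof (cases "t = 0")
  case True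
  have "(\<lambda>x. ennreal (indicator {0<..} x * (min 0 x * x powr (q - 2)))) = (\<lambda>x. 0)"
    by (rule ext) (auto simp: indicator_def)
  then show ?thesis by (simp only: True) simp
next
  case False
  with assms have t: "0 < t" by simp
  have 1: "((\<lambda>x. x powr (q - 1)) has_integral t powr q / q) {0..t}"
    using has_integral_powr_from_0[of "q - 1" t] assms by simp
  have 2: "((\<lambda>x. t * x powr (q - 2)) has_integral t powr q / (1 - q)) {t..}"
  proof -
    have "((\<lambda>x. t * x powr (q - 2)) has_integral t * (- (t powr (q - 1)) / (q - 1))) {t..}"
      using has_integral_powr_to_inf[of "q - 2" t] assms t by (intro has_integral_mult_right) simp
    moreover have "t * (- (t powr (q - 1)) / (q - 1)) = t powr q / (1 - q)"
      using t assms by (simp add: powr_diff field_simps)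
    ultimately show ?thesis by simp
  qed
  have "((\<lambda>x. min t x * x powr (q - 2)) has_integral t powr q / q) {0..t}"
  proof (rule has_integral_eq[OF _ 1])
    fix x assume "x \<in> {0..t}"
    then show "x powr (q - 1) = min t x * x powr (q - 2)"
      by (cases "x = 0") (auto simp: powr_diff power2_eq_square min_def powr_numeral field_simps)
  qed
  moreover have "((\<lambda>x. min t x * x powr (q - 2)) has_integral t powr q / (1 - q)) {t..}"
    by (rule has_integral_eq[OF _ 2]) simp
  ultimately have "((\<lambda>x. min t x * x powr (q - 2)) has_integral (t powr q / q + t powr q / (1 - q)))
      ({0..t} \<union> {t..})"
    by (rule has_integral_Un) (use t in \<open>simp add: Int_atLeastAtMost\<close>)
  moreover have "{0..t} \<union> {t..} = {0..}" using t by auto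
  ultimately have I: "((\<lambda>x. min t x * x powr (q - 2)) has_integral
      (1 / q + 1 / (1 - q)) * t powr q) {0..}"
    by (simp add: algebra_simps)
  have "(\<integral>\<^sup>+x. ennreal (indicator {0<..} x * (min t x * x powr (q - 2))) \<partial>lborel)
      = (\<integral>\<^sup>+x. ennreal (indicator {0..} x * (min t x * x powr (q - 2))) \<partial>lborel)"
    by (rule nn_integral_cong) (auto simp: indicator_def)
  also have "\<dots> = ennreal ((1 / q + 1 / (1 - q)) * t powr q)"
    by (rule nn_integral_has_integral_lebesgue[OF _ I]) (use t in auto)
  finally show ?thesis .
qed

lemma summable_powr_imp_summable:
  fixes \<mu> :: "nat \<Rightarrow> real"
  assumes "summable (\<lambda>j. \<mu> j powr q)" "0 < q" "q \<le> 1" "\<And>j. 0 \<le> \<mu> j"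
  shows "summable \<mu>"
proof (rule summable_comparison_test_ev[OF _ assms(1)])
  have "\<forall>\<^sub>F j in sequentially. \<mu> j powr q < 1"
    using summable_LIMSEQ_zero[OF assms(1)] by (rule order_tendstoD) simp
  then show "\<forall>\<^sub>F j in sequentially. norm (\<mu> j) \<le> \<mu> j powr q"
  proof eventually_elim
    case (elim j)
    then have "\<mu> j \<le> 1"
      using assms(2) ge_one_powr_ge_zero[of "\<mu> j" q] by (meson less_imp_le linorder_not_le)
    then have "\<mu> j powr 1 \<le> \<mu> j powr q" using assms by (intro powr_mono') auto
    then show ?case using assms(4)[of j] by simp
  qed
qed

lemma eigenvalue_powr_sum_le:
  fixes f g :: "nat \<Rightarrow> 'a::euclidean_space L2"
  assumes q: "0 < q" "q \<le> 1" and sq: "summable (\<lambda>j. (norm (f j) * norm (g j)) powr q)"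
    and S: "finite S" "orthonormal_family S (\<lambda>e. e)"
    and ev: "\<And>e. e \<in> S \<Longrightarrow> nuclear_op g f (nuclear_op f g e) = (\<sigma> e)\<^sup>2 *\<^sub>R e"
    and pos: "\<And>e. e \<in> S \<Longrightarrow> 0 < \<sigma> e"
  shows "(\<Sum>e\<in>S. \<sigma> e powr q) \<le> (\<Sum>j. (norm (f j) * norm (g j)) powr q)"
proof -
  define \<mu> where "\<mu> j = norm (f j) * norm (g j)" for j
  have \<mu>0: "0 \<le> \<mu> j" for j by (simp add: \<mu>_def)
  have sq': "summable (\<lambda>j. \<mu> j powr q)" using sq by (simp add: \<mu>_def)
  have sm: "summable \<mu>" by (rule summable_powr_imp_summable[OF sq' q \<mu>0])
  have le: "(\<Sum>e\<in>S. min (\<sigma> e) a) \<le> (\<Sum>j. min (\<mu> j) a)" if "0 < a" for a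
    using eigenvalue_min_sum_le[OF sm[unfolded \<mu>_def] S ev pos that] by (simp add: \<mu>_def)
  have sm_min: "summable (\<lambda>j. min (\<mu> j) a)" if "0 < a" for a
    by (rule summable_comparison_test[OF _ sm]) (use that \<mu>0 in auto)
  have "(\<Sum>e\<in>S. \<sigma> e powr q) \<le> (\<Sum>j. \<mu> j powr q)"
  proof (cases "q = 1")
    case True
    \<comment> \<open>For \<open>q = 1\<close> the weight \<open>x powr (q - 2)\<close> is not admissible; a truncation level above all
      \<open>\<sigma> e\<close> suffices.\<close>
    define a where "a = Max (insert 1 (\<sigma> ` S))"
    have a: "0 < a" "\<And>e. e \<in> S \<Longrightarrow> \<sigma> e \<le> a"
      unfolding a_def using S(1) by (auto intro!: Max_ge simp: Max_gr_iff)
    have "(\<Sum>e\<in>S. \<sigma> e) = (\<Sum>e\<in>S. min (\<sigma> e) a)"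
      by (rule sum.cong) (use a in auto)
    also have "\<dots> \<le> (\<Sum>j. min (\<mu> j) a)" by (rule le[OF a(1)])
    also have "\<dots> \<le> (\<Sum>j. \<mu> j)" by (rule suminf_le[OF _ sm_min[OF a(1)] sm]) simp
    finally show ?thesis using True \<mu>0 less_imp_le[OF pos] by simp
  next
    case False
    with q have q1: "q < 1" by simp
    define c where "c = 1 / q + 1 / (1 - q)"
    have c: "0 < c" using q q1 by (simp add: c_def add_pos_pos)
    let ?w = "\<lambda>t x. indicator {0<..} x * (min t x * x powr (q - 2)) :: real"
    have [measurable]: "(\<lambda>x. ennreal (?w t x)) \<in> borel_measurable lborel" for t
      by measurable
    have int: "(\<integral>\<^sup>+x. ennreal (?w t x) \<partial>lborel) = ennreal (c * t powr q)" if "0 \<le> t" for t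
      unfolding c_def by (rule nn_integral_min_powr[OF q(1) q1 that])
    have w0: "0 \<le> ?w t x" if "0 \<le> t" for t x using that by (auto simp: indicator_def)
    have "ennreal (c * (\<Sum>e\<in>S. \<sigma> e powr q)) = (\<Sum>e\<in>S. ennreal (c * \<sigma> e powr q))"
      using c by (simp add: sum_distrib_left sum_ennreal)
    also have "\<dots> = (\<Sum>e\<in>S. \<integral>\<^sup>+x. ennreal (?w (\<sigma> e) x) \<partial>lborel)"
      by (rule sum.cong[OF refl]) (use int less_imp_le[OF pos] in simp)
    also have "\<dots> = (\<integral>\<^sup>+x. (\<Sum>e\<in>S. ennreal (?w (\<sigma> e) x)) \<partial>lborel)"
      by (rule nn_integral_sum[symmetric]) measurable
    also have "\<dots> \<le> (\<integral>\<^sup>+x. (\<Sum>j. ennreal (?w (\<mu> j) x)) \<partial>lborel)"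
    proof (rule nn_integral_mono)
      fix x :: real
      show "(\<Sum>e\<in>S. ennreal (?w (\<sigma> e) x)) \<le> (\<Sum>j. ennreal (?w (\<mu> j) x))"
      proof (cases "0 < x")
        case True
        have "(\<Sum>e\<in>S. ennreal (?w (\<sigma> e) x)) = ennreal (\<Sum>e\<in>S. min (\<sigma> e) x * x powr (q - 2))"
          using True less_imp_le[OF pos] by (simp add: sum_ennreal)
        also have "\<dots> \<le> ennreal (\<Sum>j. min (\<mu> j) x * x powr (q - 2))"
          using mult_right_mono[OF le[OF True], of "x powr (q - 2)"] suminf_mult2[OF sm_min[OF True], of "x powr (q - 2)"]
          by (intro ennreal_leI) (simp add: sum_distrib_right)
        also have "\<dots> = (\<Sum>j. ennreal (min (\<mu> j) x * x powr (q - 2)))"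
          using True \<mu>0 sm_min[OF True] by (intro suminf_ennreal2[symmetric] summable_mult2) auto
        finally show ?thesis using True by simp
      qed simp
    qed
    also have "\<dots> = (\<Sum>j. \<integral>\<^sup>+x. ennreal (?w (\<mu> j) x) \<partial>lborel)"
      by (rule nn_integral_suminf) measurable
    also have "\<dots> = (\<Sum>j. ennreal (c * \<mu> j powr q))" by (simp add: int \<mu>0)
    also have "\<dots> = ennreal (\<Sum>j. c * \<mu> j powr q)"
      using c by (intro suminf_ennreal2 summable_mult sq') auto
    also have "\<dots> = ennreal (c * (\<Sum>j. \<mu> j powr q))" by (simp add: suminf_mult[OF sq'])
    finally have "c * (\<Sum>e\<in>S. \<sigma> e powr q) \<le> c * (\<Sum>j. \<mu> j powr q)"
      using c by (subst (asm) ennreal_le_iff) (auto intro!: mult_nonneg_nonneg suminf_nonneg sq')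
    then show ?thesis using c by simp
  qed
  then show ?thesis by (simp add: \<mu>_def)
qed

lemma decseq_level_set:
  fixes s :: "nat \<Rightarrow> real"
  assumes "decseq s" "s \<longlonglongrightarrow> 0" "0 < t"
  shows "finite {k. t \<le> s k}" "{k. t \<le> s k} = {..<card {k. t \<le> s k}}"
proof -
  obtain N where N: "\<And>k. N \<le> k \<Longrightarrow> s k < t"
    using order_tendstoD(2)[OF assms(2,3)] by (auto simp: eventually_sequentially)
  then have "{k. t \<le> s k} \<subseteq> {..<N}" by (force simp: not_less[symmetric])
  then show fin: "finite {k. t \<le> s k}" by (rule finite_subset) simp
  define m where "m = (LEAST k. s k < t)"
  have m: "s m < t" unfolding m_def by (rule LeastI[of _ N]) (rule N, simp)
  have "t \<le> s k \<longleftrightarrow> k < m" for k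
  proof
    assume "t \<le> s k"
    show "k < m"
    proof (rule ccontr)
      assume "\<not> k < m"
      then have "s k \<le> s m" using assms(1) by (simp add: decseqD)
      then show False using m \<open>t \<le> s k\<close> by simp
    qed
  next
    assume "k < m"
    then show "t \<le> s k" using not_less_Least[of k "\<lambda>k. s k < t"] by (simp add: m_def)
  qed
  then have "{k. t \<le> s k} = {..<m}" by auto
  then show "{k. t \<le> s k} = {..<card {k. t \<le> s k}}" by simp
qed

text \<open>The superlevel sets of a nonincreasing sequence are initial segments, so their cardinalities
  determine it, and these are sums of the given multiplicities. This makes the singular
  values unique.\<close>

lemma decseq_eq_if_card_fibres_eq:
  fixes s s' :: "nat \<Rightarrow> real"
  assumes s: "decseq s" "\<And>k. 0 \<le> s k" "s \<longlonglongrightarrow> 0"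
    and s': "decseq s'" "\<And>k. 0 \<le> s' k" "s' \<longlonglongrightarrow> 0"
    and eq: "\<And>t. 0 < t \<Longrightarrow> card {k. s k = t} = card {k. s' k = t}"
  shows "s = s'"
proof -
  have fib: "finite {k. r k = v}" if "decseq r" "r \<longlonglongrightarrow> 0" "0 < v" for r :: "nat \<Rightarrow> real" and v
    by (rule finite_subset[OF _ decseq_level_set(1)[OF that]]) auto
  have values_eq: "s ` {k. t \<le> s k} = s' ` {k. t \<le> s' k}" if "0 < t" for t
  proof -
    have "v \<in> s ` {k. t \<le> s k} \<longleftrightarrow> v \<in> s' ` {k. t \<le> s' k}" for v
    proof (cases "t \<le> v")
      case True
      then have v: "0 < v" using that by simp
      have "v \<in> s ` {k. t \<le> s k} \<longleftrightarrow> card {k. s k = v} \<noteq> 0"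
        using True fib[OF s(1,3) v] by (auto simp: card_eq_0_iff)
      moreover have "v \<in> s' ` {k. t \<le> s' k} \<longleftrightarrow> card {k. s' k = v} \<noteq> 0"
        using True fib[OF s'(1,3) v] by (auto simp: card_eq_0_iff)
      ultimately show ?thesis using eq[OF v] by simp
    qed auto
    then show ?thesis by blast
  qed
  have count: "card {k. t \<le> r k} = (\<Sum>v\<in>r ` {k. t \<le> r k}. card {k. r k = v})"
    if "decseq r" "r \<longlonglongrightarrow> 0" "0 < t" for r :: "nat \<Rightarrow> real" and t
  proof -
    have "{k. t \<le> r k} = (\<Union>v\<in>r ` {k. t \<le> r k}. {k. r k = v})" by auto
    also have "card \<dots> = (\<Sum>v\<in>r ` {k. t \<le> r k}. card {k. r k = v})"
      using decseq_level_set(1)[OF that] fib[OF that(1,2)] that(3)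
      by (intro card_UN_disjoint) auto
    finally show ?thesis .
  qed
  have "card {k. t \<le> s k} = card {k. t \<le> s' k}" if "0 < t" for t
    unfolding count[OF s(1,3) that] count[OF s'(1,3) that] values_eq[OF that]
    using that by (intro sum.cong refl eq) auto
  moreover have "t \<le> r k \<longleftrightarrow> k < card {k. t \<le> r k}"
    if "decseq r" "r \<longlonglongrightarrow> 0" "0 < t" for r :: "nat \<Rightarrow> real" and t k
    using decseq_level_set(2)[OF that] by (metis lessThan_iff mem_Collect_eq)
  ultimately have lev: "t \<le> s k \<longleftrightarrow> t \<le> s' k" if "0 < t" for t k
    using s s' that by metis
  show ?thesis
  proof
    fix k
    show "s k = s' k"
    proof (rule antisym)
      show "s k \<le> s' k" using lev[of "s k" k] s(2)[of k] s'(2)[of k] by (cases "s k = 0") auto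
      show "s' k \<le> s k" using lev[of "s' k" k] s(2)[of k] s'(2)[of k] by (cases "s' k = 0") auto
    qed
  qed
qed

text \<open>The decreasing rearrangement, which provides the existence of singular values: \<open>s k\<close> is the
  largest level that is reached by more than \<open>k\<close> elements.\<close>

lemma decreasing_rearrangement_exists:
  fixes E :: "real \<Rightarrow> 'b set"
  assumes fin: "\<And>t. 0 < t \<Longrightarrow> finite (\<Union>v\<in>{t..}. E v)"
    and disj: "\<And>v w. 0 < v \<Longrightarrow> v \<noteq> w \<Longrightarrow> E v \<inter> E w = {}"
  shows "\<exists>s::nat \<Rightarrow> real. decseq s \<and> (\<forall>k. 0 \<le> s k) \<and> s \<longlonglongrightarrow> 0 \<and>
    (\<forall>t>0. card {k. s k = t} = card (E t))"
proof -
  define N where "N t = card (\<Union>v\<in>{t..}. E v)" for t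
  have N_anti: "N t' \<le> N t" if "0 < t" "t \<le> t'" for t t'
    unfolding N_def using that by (intro card_mono fin) force+
  have level_fin: "finite {v. t \<le> v \<and> E v \<noteq> {}}" if "0 < t" for t
  proof -
    have "\<exists>v. t \<le> v \<and> x \<in> E v" if "x \<in> (\<Union>v\<in>{t..}. E v)" for x using that by auto
    then obtain h where h: "\<And>x. x \<in> (\<Union>v\<in>{t..}. E v) \<Longrightarrow> t \<le> h x \<and> x \<in> E (h x)" by metis
    have "{v. t \<le> v \<and> E v \<noteq> {}} \<subseteq> h ` (\<Union>v\<in>{t..}. E v)"
    proof
      fix v assume "v \<in> {v. t \<le> v \<and> E v \<noteq> {}}"
      then obtain x where x: "x \<in> E v" "t \<le> v" by auto
      then have "x \<in> (\<Union>v\<in>{t..}. E v)" by auto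
      moreover from h[OF this] have "h x = v" using x disj[of v "h x"] \<open>0 < t\<close> by fastforce
      ultimately show "v \<in> h ` (\<Union>v\<in>{t..}. E v)" by blast
    qed
    then show ?thesis using fin[OF that] by (rule finite_subset[OF _ finite_imageI])
  qed
  define T where "T k = {t. 0 < t \<and> k < N t}" for k
  define s where "s k = Sup (insert 0 (T k))" for k
  obtain b where b: "0 < b" "\<And>v. E v \<noteq> {} \<Longrightarrow> v \<le> b"
  proof -
    define b where "b = Max (insert 1 {v. 1 \<le> v \<and> E v \<noteq> {}})"
    have b1: "1 \<le> b" unfolding b_def using level_fin[of 1] by simp
    have "v \<le> b" if "E v \<noteq> {}" for v
    proof (cases "1 \<le> v")
      case True
      then show ?thesis unfolding b_def using that level_fin[of 1] by (intro Max_ge) auto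
    next
      case False
      then show ?thesis using b1 by simp
    qed
    then show ?thesis using that[of b] b1 by simp
  qed
  have Tb: "t \<le> b" if "t \<in> T k" for t k
  proof (rule ccontr)
    assume "\<not> t \<le> b"
    then have "E v = {}" if "t \<le> v" for v using that b(2)[of v] by force
    then have "N t = 0" by (simp add: N_def)
    then show False using that by (simp add: T_def)
  qed
  have bdd: "bdd_above (insert 0 (T k))" for k
    using Tb b(1) by (intro bdd_aboveI[of _ b]) auto
  have s0: "0 \<le> s k" for k unfolding s_def by (rule cSup_upper[OF _ bdd]) simp
  \<comment> \<open>The supremum is attained.\<close>
  have key: "t \<le> s k \<longleftrightarrow> k < N t" if "0 < t" for t k
  proof
    assume "k < N t"
    then show "t \<le> s k" unfolding s_def using that by (intro cSup_upper[OF _ bdd]) (simp add: T_def)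
  next
    assume ts: "t \<le> s k"
    show "k < N t"
    proof (rule ccontr)
      assume not: "\<not> k < N t"
      \<comment> \<open>Only finitely many levels are at least \<open>t/2\<close>, so none lies just below \<open>t\<close>.\<close>
      define d where "d = Max (insert (t/2) {v. t/2 \<le> v \<and> E v \<noteq> {} \<and> v < t})"
      have fin_d: "finite (insert (t/2) {v. t/2 \<le> v \<and> E v \<noteq> {} \<and> v < t})"
        using level_fin[of "t/2"] that by (auto elim: finite_subset[rotated])
      have "t/2 \<le> d" unfolding d_def using fin_d by (rule Max_ge) simp
      moreover have "d < t" unfolding d_def using fin_d that by (subst Max_less_iff) auto
      ultimately have d: "t/2 \<le> d" "d < t" .
      have gap: "E v = {}" if "d < v" "v < t" for v
      proof (rule ccontr)
        assume "E v \<noteq> {}"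
        then have "v \<le> d" unfolding d_def using fin_d that d by (intro Max_ge) auto
        then show False using that by simp
      qed
      have "t' \<le> d" if t': "t' \<in> insert 0 (T k)" for t'
      proof (rule ccontr)
        assume "\<not> t' \<le> d"
        then have t'd: "d < t'" by simp
        with d that have "t' \<noteq> 0" using \<open>0 < t\<close> by auto
        then have t'T: "0 < t'" "k < N t'" using t' by (auto simp: T_def)
        have "(\<Union>v\<in>{t'..}. E v) \<subseteq> (\<Union>v\<in>{t..}. E v)"
        proof (rule UN_least)
          fix v assume v: "v \<in> {t'..}"
          show "E v \<subseteq> (\<Union>v\<in>{t..}. E v)"
          proof (cases "t \<le> v")
            case False
            then have "E v = {}" using v t'd by (intro gap) auto
            then show ?thesis by simp
          qed auto
        qed
        then have "N t' \<le> N t" unfolding N_def using fin[OF \<open>0 < t\<close>] by (rule card_mono[rotated])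
        then show False using t'T not by simp
      qed
      then have "s k \<le> d" unfolding s_def by (intro cSup_least) auto
      then show False using ts d by simp
    qed
  qed
  have dec: "decseq s"
    unfolding decseq_def
  proof (intro allI impI)
    fix k l :: nat assume "k \<le> l"
    show "s l \<le> s k"
    proof (cases "s l = 0")
      case False
      then have "0 < s l" using s0[of l] by simp
      then have "l < N (s l)" using key[of "s l" l] by simp
      then show ?thesis using key[of "s l" k] \<open>k \<le> l\<close> \<open>0 < s l\<close> by simp
    qed (simp add: s0)
  qed
  have null: "s \<longlonglongrightarrow> 0"
  proof (rule LIMSEQ_I)
    fix r :: real assume "0 < r"
    have "norm (s n - 0) < r" if "N r \<le> n" for n
      using key[OF \<open>0 < r\<close>, of n] s0[of n] that by auto
    then have "\<forall>n\<ge>N r. norm (s n - 0) < r" by blast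
    then show "\<exists>n0. \<forall>n\<ge>n0. norm (s n - 0) < r" by blast
  qed
  have union_eq: "(\<Union>v\<in>X. E v) = (\<Union>v\<in>Y. E v)"
    if "Y \<subseteq> X" "\<And>v. v \<in> X \<Longrightarrow> v \<notin> Y \<Longrightarrow> E v = {}" for X Y
    using that by blast
  have "card {k. s k = t} = card (E t)" if t: "0 < t" for t
  proof -
    \<comment> \<open>The next occupied level above \<open>t\<close>; the number \<open>t + 1\<close> serves if there is none.\<close>
    define u where "u = Min (insert (t + 1) {v. t < v \<and> E v \<noteq> {}})"
    have fin_u: "finite (insert (t + 1) {v. t < v \<and> E v \<noteq> {}})"
      using level_fin[OF t] by (auto elim: finite_subset[rotated])
    have u: "t < u" unfolding u_def using fin_u by (subst Min_gr_iff) auto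
    have gap: "E v = {}" if "t < v" "v < u" for v
    proof (rule ccontr)
      assume "E v \<noteq> {}"
      then have "u \<le> v" unfolding u_def using fin_u that by (intro Min_le) auto
      then show False using that by simp
    qed
    have Nu: "N t' = N u" if "t < t'" "t' \<le> u" for t'
    proof -
      have "E v = {}" if "v \<in> {t'..}" "v \<notin> {u..}" for v using that \<open>t < t'\<close> by (intro gap) auto
      then have "(\<Union>v\<in>{t'..}. E v) = (\<Union>v\<in>{u..}. E v)"
        using that by (intro union_eq) auto
      then show ?thesis by (simp add: N_def)
    qed
    have "{k. s k = t} = {..<N t} - {..<N u}"
    proof (rule set_eqI)
      fix k
      have "t < s k \<longleftrightarrow> k < N u"
      proof
        assume "t < s k"
        then have "min (s k) u \<le> s k" "t < min (s k) u" using u by auto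
        then show "k < N u" using key[of "min (s k) u" k] Nu[of "min (s k) u"] t by simp
      next
        assume "k < N u"
        then show "t < s k" using key[of u k] u t by simp
      qed
      then show "k \<in> {k. s k = t} \<longleftrightarrow> k \<in> {..<N t} - {..<N u}" using key[OF t, of k] by auto
    qed
    then have "card {k. s k = t} = N t - N u"
      by (simp add: card_Diff_subset N_anti[of t u] t u less_imp_le)
    moreover have "N t = card (E t) + N u"
    proof -
      have "(\<Union>v\<in>{t..}. E v) = (\<Union>v\<in>insert t {u..}. E v)"
        using gap u by (intro union_eq) auto
      then have "(\<Union>v\<in>{t..}. E v) = E t \<union> (\<Union>v\<in>{u..}. E v)" by simp
      moreover have "E t \<inter> E v = {}" if "v \<in> {u..}" for v using disj[OF t, of v] u that by auto
      then have "E t \<inter> (\<Union>v\<in>{u..}. E v) = {}" by blast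
      moreover have "finite (E t)" by (rule finite_subset[OF _ fin[OF t]]) auto
      moreover have "finite (\<Union>v\<in>{u..}. E v)" using t u by (intro fin) simp
      ultimately show ?thesis by (simp add: N_def card_Un_disjoint)
    qed
    ultimately show ?thesis by simp
  qed
  then show ?thesis using dec s0 null by blast
qed

lemma orthonormal_imp_independent:
  assumes "orthonormal_family B (\<lambda>e. e)"
  shows "\<not> L2_complex.dependent B"
proof
  assume "L2_complex.dependent B"
  then obtain S u where S: "finite S" "S \<subseteq> B" "(\<Sum>v\<in>S. scaleC_L2 (u v) v) = 0"
    and "\<exists>v\<in>S. u v \<noteq> 0"
    unfolding L2_complex.dependent_explicit by blast
  then obtain v where v: "v \<in> S" "u v \<noteq> 0" by blast
  have "(\<Sum>w\<in>S. u w * cinner_L2 w v) = 0"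
    using arg_cong[OF S(3), of "\<lambda>f. cinner_L2 f v"] by (simp add: cinner_sum_left cinner_scaleC_left)
  moreover have "(\<Sum>w\<in>S. u w * cinner_L2 w v) = (\<Sum>w\<in>S. if w = v then u w else 0)"
  proof (intro sum.cong refl)
    fix w assume "w \<in> S"
    then have "w \<in> B" "v \<in> B" using S(2) v(1) by auto
    then show "u w * cinner_L2 w v = (if w = v then u w else 0)"
      using assms by (simp add: orthonormal_family_def)
  qed
  ultimately show False using S(1) v by simp
qed

text \<open>The bound \<open>C\<close> holds for all finite orthonormal systems of
  eigenvectors of $A^*A$. It limits the size of such systems in each eigenspace, so a
  maximal one is a basis, and it limits the number of eigenvectors above a given level, so the
  multiplicities have a decreasing rearrangement, which is the sequence of singular values.\<close>

theorem nuclear_op_schatten: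
  fixes f g :: "nat \<Rightarrow> 'a::euclidean_space L2"
  assumes q: "0 < q" "q \<le> 1" and sq: "summable (\<lambda>j. (norm (f j) * norm (g j)) powr q)"
  shows "nuclear_op f g \<in> schatten_class q"
    and "schatten_norm q (nuclear_op f g) \<le> (\<Sum>j. (norm (f j) * norm (g j)) powr q) powr (1 / q)"
proof -
  let ?A = "nuclear_op f g"
  let ?E = "sv_eigenspace ?A"
  define C where "C = (\<Sum>j. (norm (f j) * norm (g j)) powr q)"
  have C0: "0 \<le> C" unfolding C_def by (rule suminf_nonneg[OF sq]) simp
  have sm: "summable (\<lambda>j. norm (f j) * norm (g j))"
    by (rule summable_powr_imp_summable[OF sq q]) simp
  have sm': "summable (\<lambda>j. norm (g j) * norm (f j))" using sm by (simp add: mult.commute)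
  have compact: "compact_operator ?A"
    unfolding compact_operator_def using nuclear_op_linear[OF sm] nuclear_op_compact[OF sm] by blast
  have E: "u \<in> ?E t \<longleftrightarrow> nuclear_op g f (?A u) = t\<^sup>2 *\<^sub>R u" for u t
    by (simp add: sv_eigenspace_def adjoint_nuclear_op[OF sm])
  have bound: "(\<Sum>e\<in>S. \<sigma> e powr q) \<le> C"
    if "finite S" "orthonormal_family S (\<lambda>e. e)" "\<And>e. e \<in> S \<Longrightarrow> e \<in> ?E (\<sigma> e)" "\<And>e. e \<in> S \<Longrightarrow> 0 < \<sigma> e"
    for S \<sigma>
    unfolding C_def by (rule eigenvalue_powr_sum_le[OF q sq that(1,2)]) (use that(3,4) E in auto)
  have orth: "cinner_L2 u v = 0" if uv: "u \<in> ?E t" "v \<in> ?E t'" "0 < t" "0 < t'" "t \<noteq> t'" for u v t t'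
  proof -
    have "(t\<^sup>2) * cinner_L2 u v = cinner_L2 (nuclear_op g f (?A u)) v"
      using uv(1) unfolding E by (simp add: scaleC_of_real[symmetric] cinner_scaleC_left)
    also have "\<dots> = cinner_L2 u (nuclear_op g f (?A v))"
      by (simp add: cinner_nuclear_adjoint[OF sm] cinner_nuclear_adjoint[OF sm'])
    also have "\<dots> = (t'\<^sup>2) * cinner_L2 u v"
      using uv(2) unfolding E by (simp add: scaleC_of_real[symmetric] cinner_scaleC_right)
    finally have "complex_of_real (t\<^sup>2 - t'\<^sup>2) * cinner_L2 u v = 0" by (simp add: algebra_simps)
    moreover have "t\<^sup>2 - t'\<^sup>2 \<noteq> 0" using uv(3-5) by simp
    ultimately show ?thesis by (metis mult_eq_0_iff of_real_eq_0_iff)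
  qed
  have basis: "\<exists>B. finite B \<and> orthonormal_family B (\<lambda>e. e) \<and> B \<subseteq> ?E t \<and>
      card B = vector_space.dim scaleC_L2 (?E t)" if t: "0 < t" for t
  proof -
    let ?ok = "\<lambda>B. finite B \<and> orthonormal_family B (\<lambda>e. e) \<and> B \<subseteq> ?E t"
    have sub: "L2_complex.subspace (?E t)"
    proof (rule L2_complex.subspaceI)
      have lin: "Vector_Spaces.linear scaleC_L2 scaleC_L2 (nuclear_op f g)"
        "Vector_Spaces.linear scaleC_L2 scaleC_L2 (nuclear_op g f)"
        by (rule nuclear_op_linear[OF sm] nuclear_op_linear[OF sm'])+
      note hom = lin[unfolded Vector_Spaces.linear_def module_hom_def module_hom_axioms_def]
      show "0 \<in> ?E t"
        using nuclear_op_scaleR[OF sm, of 0 0] nuclear_op_scaleR[OF sm', of 0 0] by (simp add: E)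
      show "x + y \<in> ?E t" if "x \<in> ?E t" "y \<in> ?E t" for x y
        using that hom by (simp add: E scaleR_right_distrib)
      show "scaleC_L2 c x \<in> ?E t" if "x \<in> ?E t" for c x
        using that hom
        by (simp add: E scaleC_of_real[symmetric] L2_complex.scale_left_commute)
    qed
    have card_le: "card B \<le> C / t powr q" if "?ok B" for B
    proof -
      have "(\<Sum>e\<in>B. t powr q) \<le> C" using that t by (intro bound[where \<sigma>="\<lambda>_. t"]) auto
      then show ?thesis using t by (simp add: field_simps)
    qed
    have ok0: "?ok {}" by (simp add: orthonormal_family_def)
    have "\<forall>B. ?ok B \<longrightarrow> card B \<le> nat \<lceil>C / t powr q\<rceil>"
      using order_trans[OF card_le real_nat_ceiling_ge[of "C / t powr q"]] of_nat_le_iff by blast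
    then have "\<forall>B. ?ok B \<longrightarrow> card B < Suc (nat \<lceil>C / t powr q\<rceil>)" by (simp add: less_Suc_eq_le)
    with ok0 have "\<exists>B. ?ok B \<and> (\<forall>B'. ?ok B' \<longrightarrow> card B' \<le> card B)" by (rule ex_has_greatest_nat)
    then obtain B where B: "?ok B" "\<And>B'. ?ok B' \<Longrightarrow> card B' \<le> card B" by blast
    have "proj_L2 B (\<lambda>e. e) h = h" if h: "h \<in> ?E t" for h
    proof (rule ccontr)
      assume ne: "proj_L2 B (\<lambda>e. e) h \<noteq> h"
      let ?r = "h - proj_L2 B (\<lambda>e. e) h"
      let ?e = "?r /\<^sub>R norm ?r"
      note ext = orthonormal_family_extend[of B h, OF _ _ ne]
      have "proj_L2 B (\<lambda>e. e) h \<in> ?E t"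
        unfolding proj_L2_def using B(1)
        by (intro L2_complex.subspace_sum[OF sub] L2_complex.subspace_scale[OF sub]) auto
      then have "?e \<in> ?E t"
        unfolding scaleC_of_real[symmetric]
        by (intro L2_complex.subspace_scale[OF sub] L2_complex.subspace_diff[OF sub] h)
      then have "?ok (insert ?e B)" using B(1) ext by auto
      from B(2)[OF this] show False using ext(1) B(1) by simp
    qed
    then have "h \<in> L2_complex.span B" if "h \<in> ?E t" for h
      using that unfolding proj_L2_def
      by (metis (no_types, lifting) L2_complex.span_base L2_complex.span_scale L2_complex.span_sum)
    then have "L2_complex.span B = L2_complex.span (?E t)"
      using B(1) by (intro L2_complex.span_eq[THEN iffD2]) (auto intro: L2_complex.span_base)
    then have "L2_complex.dim (?E t) = card B"
      using B(1) orthonormal_imp_independent by (intro L2_complex.dim_eq_card) auto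
    then show ?thesis using B(1) by metis
  qed
  define B where "B t = (if 0 < t then (SOME B. finite B \<and> orthonormal_family B (\<lambda>e. e) \<and> B \<subseteq> ?E t \<and>
      card B = vector_space.dim scaleC_L2 (?E t)) else {})" for t
  have B: "finite (B t)" "orthonormal_family (B t) (\<lambda>e. e)" "B t \<subseteq> ?E t"
    "card (B t) = vector_space.dim scaleC_L2 (?E t)" if "0 < t" for t
    using someI_ex[OF basis[OF that]] that by (simp_all add: B_def)
  have nz: "cinner_L2 e e = 1" if "e \<in> B t" for e t
  proof -
    have "0 < t" using that by (auto simp: B_def split: if_splits)
    then show ?thesis using that B(2)[of t] by (simp add: orthonormal_family_def)
  qed
  have Bpos: "0 < t" if "e \<in> B t" for e t using that by (auto simp: B_def split: if_splits)
  have disj: "B v \<inter> B w = {}" if "v \<noteq> w" for v w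
  proof (rule ccontr)
    assume "B v \<inter> B w \<noteq> {}"
    then obtain e where e: "e \<in> B v" "e \<in> B w" by blast
    then have "cinner_L2 e e = 0" using B(3) Bpos that by (intro orth[of e v e w]) blast+
    then show False using nz[OF e(1)] by simp
  qed
  define \<sigma> where "\<sigma> e = (THE t. e \<in> B t)" for e
  have \<sigma>: "\<sigma> e = t" if "e \<in> B t" for e t
    unfolding \<sigma>_def using that disj by (intro the_equality) auto
  have on: "orthonormal_family S (\<lambda>e. e)" if S: "S \<subseteq> (\<Union>t. B t)" for S
    unfolding orthonormal_family_def
  proof (intro ballI)
    fix e e' assume "e \<in> S" "e' \<in> S"
    then obtain t t' where tt: "e \<in> B t" "e' \<in> B t'" using S by blast
    show "cinner_L2 e e' = (if e = e' then 1 else 0)"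
    proof (cases "t = t'")
      case True
      then show ?thesis using B(2)[OF Bpos[OF tt(1)]] tt by (simp add: orthonormal_family_def)
    next
      case False
      then show ?thesis using orth[of e t e' t'] tt B(3) Bpos disj[OF False] by auto
    qed
  qed
  have boundB: "(\<Sum>e\<in>S. \<sigma> e powr q) \<le> C" if "finite S" "S \<subseteq> (\<Union>t. B t)" for S
    using that on[OF that(2)] Bpos B(3) \<sigma> by (intro bound) blast+
  have finU: "finite (\<Union>v\<in>{t..}. B v)" if t: "0 < t" for t
  proof (rule ccontr)
    assume "infinite (\<Union>v\<in>{t..}. B v)"
    then obtain S where S: "S \<subseteq> (\<Union>v\<in>{t..}. B v)" "finite S" "card S = nat \<lceil>C / t powr q\<rceil> + 1"
      using infinite_arbitrarily_large by blast
    have "card S * t powr q = (\<Sum>e\<in>S. t powr q)" by simp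
    also have "\<dots> \<le> (\<Sum>e\<in>S. \<sigma> e powr q)"
      using S(1) t q \<sigma> by (intro sum_mono powr_mono2) auto
    also have "\<dots> \<le> C" using S by (intro boundB) auto
    finally have "card S \<le> C / t powr q" using t by (simp add: field_simps)
    then show False using S(3) by linarith
  qed
  obtain s where s: "is_singular_values ?A s"
    using decreasing_rearrangement_exists[of B, OF finU disj] B(4)
    unfolding is_singular_values_def by auto
  have "singular_value ?A = s"
    unfolding singular_value_def
  proof (rule the_equality)
    show "is_singular_values ?A s" by (rule s)
  next
    fix r assume "is_singular_values ?A r"
    then show "r = s"
      using s unfolding is_singular_values_def by (intro decseq_eq_if_card_fibres_eq) auto
  qed
  have s0: "0 \<le> s k" for k using s by (simp add: is_singular_values_def)
  have part: "(\<Sum>k<K. s k powr q) \<le> C" for K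
  proof -
    define I where "I = {k. k < K \<and> 0 < s k}"
    have "\<exists>h. bij_betw h {k. s k = t} (B t)" if t: "0 < t" for t
    proof (rule finite_same_card_bij)
      show "finite {k. s k = t}"
        by (rule finite_subset[OF _ decseq_level_set(1)[of s t]])
          (use s t in \<open>auto simp: is_singular_values_def\<close>)
    qed (use B[OF t] s t in \<open>auto simp: is_singular_values_def\<close>)
    then obtain h where h: "\<And>t. 0 < t \<Longrightarrow> bij_betw (h t) {k. s k = t} (B t)" by metis
    \<comment> \<open>An injective choice of an eigenvector for each index \<open>k\<close> with \<open>s k > 0\<close>.\<close>
    define \<phi> where "\<phi> k = h (s k) k" for k
    have \<phi>: "\<phi> k \<in> B (s k)" if "k \<in> I" for k
      using h[of "s k"] that bij_betwE[of "h (s k)"] by (auto simp: I_def \<phi>_def)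
    have inj: "inj_on \<phi> I"
    proof (rule inj_onI)
      fix k l assume kl: "k \<in> I" "l \<in> I" "\<phi> k = \<phi> l"
      then have "s k = s l" using \<phi>[of k] \<phi>[of l] \<sigma> by metis
      then show "k = l"
        using h[of "s k"] kl unfolding bij_betw_def inj_on_def \<phi>_def I_def by auto
    qed
    have "(\<Sum>k<K. s k powr q) = (\<Sum>k\<in>I. s k powr q)"
      using s0 by (intro sum.mono_neutral_right) (auto simp: I_def less_le)
    also have "\<dots> = (\<Sum>k\<in>I. \<sigma> (\<phi> k) powr q)" by (intro sum.cong refl) (simp add: \<sigma>[OF \<phi>])
    also have "\<dots> = (\<Sum>e\<in>\<phi> ` I. \<sigma> e powr q)" by (simp add: sum.reindex[OF inj])
    also have "\<dots> \<le> C" using \<phi> by (intro boundB) (auto simp: I_def)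
    finally show ?thesis .
  qed
  have sums: "summable (\<lambda>k. s k powr q)"
    by (rule bounded_imp_summable[of _ C])
      (use part in \<open>auto simp: lessThan_Suc_atMost[symmetric] simp del: sum.lessThan_Suc\<close>)
  then show "?A \<in> schatten_class q"
    using compact \<open>singular_value ?A = s\<close> by (simp add: schatten_class_def)
  have "(\<Sum>k. s k powr q) \<le> C" by (rule suminf_le_const[OF sums part])
  then show "schatten_norm q ?A \<le> (\<Sum>j. (norm (f j) * norm (g j)) powr q) powr (1 / q)"
    unfolding schatten_norm_def \<open>singular_value ?A = s\<close> C_def[symmetric]
    using q by (intro powr_mono2 suminf_nonneg sums) auto
qed

section \<open>Integration by parts along a direction\<close>

lemma lborel_integral_translate:
  fixes f :: "'a::euclidean_space \<Rightarrow> 'b::{banach, second_countable_topology}"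
  assumes "f \<in> borel_measurable borel"
  shows "(\<integral>x. f (c + x) \<partial>lborel) = (\<integral>x. f x \<partial>lborel)"
  using integral_distr[of "(+) c" lborel borel f] assms by (simp add: lborel_distr_plus)

lemma lborel_integrable_translate:
  fixes f :: "'a::euclidean_space \<Rightarrow> 'b::{banach, second_countable_topology}"
  assumes "integrable lborel f"
  shows "integrable lborel (\<lambda>x. f (c + x))"
  using integrable_distr[of "(+) c" lborel borel f] assms by (simp add: lborel_distr_plus)

text \<open>By translation invariance the difference \<open>F (x + b) - F x\<close> has integral zero; it is
  also the average of \<open>F'\<close> over the translates \<open>x + s b\<close>, \<open>0 \<le> s \<le> 1\<close>.\<close>

lemma integral_directional_derivative_eq_0:
  fixes F F' :: "'a::euclidean_space \<Rightarrow> complex"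
  assumes F: "integrable lborel F" and F': "integrable lborel F'"
    and der: "\<And>x t. ((\<lambda>t. F (x + t *\<^sub>R b)) has_vector_derivative F' (x + t *\<^sub>R b)) (at t)"
    and cont: "\<And>x. continuous_on UNIV (\<lambda>t. F' (x + t *\<^sub>R b))"
  shows "(\<integral>x. F' x \<partial>lborel) = 0"
proof -
  have [measurable]: "F \<in> borel_measurable borel" "F' \<in> borel_measurable borel"
    using F F' by auto
  let ?f = "\<lambda>(s::real, x). indicator {0..1} s *\<^sub>R F' (x + s *\<^sub>R b)"
  have trans: "(\<integral>x. norm (F' (x + s *\<^sub>R b)) \<partial>lborel) = (\<integral>x. norm (F' x) \<partial>lborel)" for s
    using lborel_integral_translate[of "\<lambda>x. norm (F' x)" "s *\<^sub>R b"] by (simp add: add.commute)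
  have int: "integrable (lborel \<Otimes>\<^sub>M lborel) ?f"
  proof (rule lborel_pair.Fubini_integrable)
    show "integrable lborel (\<lambda>s. LINT x|lborel. norm (?f (s, x)))"
    proof -
      have "(\<lambda>s. LINT x|lborel. norm (?f (s, x)))
          = (\<lambda>s. indicator {0..1} s *\<^sub>R (\<integral>x. norm (F' x) \<partial>lborel))"
        by (rule ext) (simp add: trans)
      then show ?thesis by (simp add: integrable_indicator_iff)
    qed
    show "AE s in lborel. integrable lborel (\<lambda>x. ?f (s, x))"
    proof (rule AE_I2)
      fix s :: real
      have "integrable lborel (\<lambda>x. F' (x + s *\<^sub>R b))"
        using lborel_integrable_translate[OF F', of "s *\<^sub>R b"] by (simp add: add.commute)
      then show "integrable lborel (\<lambda>x. ?f (s, x))" by simp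
    qed
  qed measurable
  have inner: "(LINT s|lborel. ?f (s, x)) = F (x + b) - F x" for x
  proof -
    have "((\<lambda>s. F' (x + s *\<^sub>R b)) has_integral F (x + 1 *\<^sub>R b) - F (x + 0 *\<^sub>R b)) {0..1}"
      by (rule fundamental_theorem_of_calculus) (auto intro: has_vector_derivative_at_within der)
    then have hi: "integral {0..1} (\<lambda>s. F' (x + s *\<^sub>R b)) = F (x + b) - F x"
      by (simp add: integral_unique)
    have "set_integrable lborel {0..1} (\<lambda>s. F' (x + s *\<^sub>R b))"
      unfolding set_integrable_def
      by (rule borel_integrable_compact) (auto intro: continuous_on_subset[OF cont])
    then have "(LINT s:{0..1}|lborel. F' (x + s *\<^sub>R b)) = F (x + b) - F x"
      using hi by (simp only: set_borel_integral_eq_integral(2))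
    then show ?thesis by (simp add: set_lebesgue_integral_def)
  qed
  have "(LINT x|lborel. F (x + b) - F x) = (LINT x|lborel. LINT s|lborel. ?f (s, x))"
    by (simp only: inner)
  also have "\<dots> = (LINT s|lborel. LINT x|lborel. ?f (s, x))"
    using lborel_pair.Fubini_integral[of "\<lambda>s x. ?f (s, x)"] int by simp
  also have "(\<lambda>s. LINT x|lborel. ?f (s, x)) = (\<lambda>s. indicator {0..1} s *\<^sub>R (\<integral>x. F' x \<partial>lborel))"
  proof
    fix s :: real
    have "(\<integral>x. F' (x + s *\<^sub>R b) \<partial>lborel) = (\<integral>x. F' x \<partial>lborel)"
      using lborel_integral_translate[of F' "s *\<^sub>R b"] by (simp add: add.commute)
    then show "(LINT x|lborel. ?f (s, x)) = indicator {0..1} s *\<^sub>R (\<integral>x. F' x \<partial>lborel)" by simp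
  qed
  also have "(LINT s::real|lborel. indicator {0..1} s *\<^sub>R (\<integral>x. F' x \<partial>lborel)) = (\<integral>x. F' x \<partial>lborel)"
    by (subst Bochner_Integration.integral_scaleR_left) (auto simp: integrable_indicator_iff content_real)
  finally have "(\<integral>x. F' x \<partial>lborel) = (LINT x|lborel. F (x + b) - F x)" by simp
  also have "\<dots> = 0"
    using lborel_integral_translate[of F b] lborel_integrable_translate[OF F, of b] F
    by (simp add: add.commute)
  finally show ?thesis .
qed

lemma integrable_bounded_support_mult:
  fixes W D :: "'a::euclidean_space \<Rightarrow> complex"
  assumes W [measurable]: "W \<in> borel_measurable borel" and bd: "\<And>x. cmod (W x) \<le> K"
    and supp: "\<And>x. x \<notin> S \<Longrightarrow> W x = 0" and S: "compact S" and D: "continuous_on UNIV D"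
  shows "integrable lborel (\<lambda>x. W x * D x)"
proof -
  have [measurable]: "D \<in> borel_measurable borel" using D by (rule borel_measurable_continuous_onI)
  have "compact (D ` S)" using S continuous_on_subset[OF D] by (intro compact_continuous_image) auto
  then obtain L where L: "\<And>x. x \<in> S \<Longrightarrow> cmod (D x) \<le> L"
    using compact_imp_bounded[of "D ` S"] by (auto simp: bounded_iff)
  have "integrable lborel (indicator S :: 'a \<Rightarrow> real)"
    using S emeasure_bounded_finite[OF compact_imp_bounded[OF S]]
    by (simp add: integrable_indicator_iff borel_compact)
  then have "integrable lborel (\<lambda>x. (K * L) * indicator S x)" by simp
  then show ?thesis
  proof (rule Bochner_Integration.integrable_bound)
    show "AE x in lborel. norm (W x * D x) \<le> norm ((K * L) * indicator S x)"
    proof (rule AE_I2)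
      fix x
      show "norm (W x * D x) \<le> norm ((K * L) * indicator S x)"
      proof (cases "x \<in> S")
        case True
        have "cmod (W x) * cmod (D x) \<le> K * L"
          using bd[of x] L[OF True] order_trans[OF norm_ge_zero bd] by (intro mult_mono) auto
        then show ?thesis using True by (simp add: norm_mult)
      qed (simp add: supp)
    qed
  qed measurable
qed

lemma integration_by_parts:
  fixes W W' D D' :: "'a::euclidean_space \<Rightarrow> complex"
  assumes [measurable]: "W \<in> borel_measurable borel" "W' \<in> borel_measurable borel"
    and bd: "\<And>x. cmod (W x) \<le> K" "\<And>x. cmod (W' x) \<le> K'"
    and supp: "\<And>x. x \<notin> S \<Longrightarrow> W x = 0" "\<And>x. x \<notin> S \<Longrightarrow> W' x = 0" and S: "compact S"
    and D: "continuous_on UNIV D" "continuous_on UNIV D'"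
    and derW: "\<And>x t. ((\<lambda>t. W (x + t *\<^sub>R b)) has_vector_derivative W' (x + t *\<^sub>R b)) (at t)"
    and contW: "\<And>x. continuous_on UNIV (\<lambda>t. W' (x + t *\<^sub>R b))"
    and derD: "\<And>x t. ((\<lambda>t. D (x + t *\<^sub>R b)) has_vector_derivative D' (x + t *\<^sub>R b)) (at t)"
  shows "(\<integral>x. W x * D' x \<partial>lborel) + (\<integral>x. W' x * D x \<partial>lborel) = 0"
proof -
  note int = integrable_bounded_support_mult[OF _ _ _ S]
  have i: "integrable lborel (\<lambda>x. W x * D x)" "integrable lborel (\<lambda>x. W x * D' x)"
    "integrable lborel (\<lambda>x. W' x * D x)"
    by (rule int; use bd supp D in auto)+
  have contWline: "continuous_on UNIV (\<lambda>t. W (x + t *\<^sub>R b))" for x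
    using derW by (auto intro!: continuous_at_imp_continuous_on has_vector_derivative_continuous)
  have line: "continuous_on UNIV (\<lambda>t. h (x + t *\<^sub>R b))" if "continuous_on UNIV h" for h :: "'a \<Rightarrow> complex" and x
    by (rule continuous_on_compose2[OF that]) (auto intro!: continuous_intros)
  have "(\<integral>x. W x * D' x + W' x * D x \<partial>lborel) = 0"
  proof (rule integral_directional_derivative_eq_0[OF i(1)])
    show "integrable lborel (\<lambda>x. W x * D' x + W' x * D x)" using i by simp
    show "((\<lambda>t. W (x + t *\<^sub>R b) * D (x + t *\<^sub>R b)) has_vector_derivative
      W (x + t *\<^sub>R b) * D' (x + t *\<^sub>R b) + W' (x + t *\<^sub>R b) * D (x + t *\<^sub>R b)) (at t)" for x t
      by (rule has_vector_derivative_mult[OF derW derD])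
    show "continuous_on UNIV (\<lambda>t. W (x + t *\<^sub>R b) * D' (x + t *\<^sub>R b) + W' (x + t *\<^sub>R b) * D (x + t *\<^sub>R b))" for x
      by (intro continuous_intros contWline contW line D)
  qed
  then show ?thesis using i by simp
qed

text \<open>The derivative of an amplitude weight is of the form \<open>\<alpha> W1 + \<beta> W2 - \<gamma> W\<close>, where \<open>\<gamma> W\<close> comes from the
  frequency of the Fourier coefficient; the identity is solved for the term with \<open>\<gamma>\<close>.\<close>

lemma integration_by_parts_split:
  fixes W W1 W2 D D' :: "'a::euclidean_space \<Rightarrow> complex"
  assumes meas: "W \<in> borel_measurable borel" "W1 \<in> borel_measurable borel" "W2 \<in> borel_measurable borel"
    and bd: "\<And>x. cmod (W x) \<le> K" "\<And>x. cmod (W1 x) \<le> K" "\<And>x. cmod (W2 x) \<le> K"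
    and supp: "\<And>x. x \<notin> S \<Longrightarrow> W x = 0" "\<And>x. x \<notin> S \<Longrightarrow> W1 x = 0" "\<And>x. x \<notin> S \<Longrightarrow> W2 x = 0"
    and S: "compact S" and D: "continuous_on UNIV D" "continuous_on UNIV D'"
    and derW: "\<And>x t. ((\<lambda>t. W (x + t *\<^sub>R b)) has_vector_derivative
      \<alpha> * W1 (x + t *\<^sub>R b) + \<beta> * W2 (x + t *\<^sub>R b) - \<gamma> * W (x + t *\<^sub>R b)) (at t)"
    and contW: "\<And>x. continuous_on UNIV (\<lambda>t. W1 (x + t *\<^sub>R b))"
      "\<And>x. continuous_on UNIV (\<lambda>t. W2 (x + t *\<^sub>R b))"
    and derD: "\<And>x t. ((\<lambda>t. D (x + t *\<^sub>R b)) has_vector_derivative D' (x + t *\<^sub>R b)) (at t)"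
  shows "\<gamma> * (\<integral>x. W x * D x \<partial>lborel)
    = (\<integral>x. W x * D' x \<partial>lborel) + \<alpha> * (\<integral>x. W1 x * D x \<partial>lborel) + \<beta> * (\<integral>x. W2 x * D x \<partial>lborel)"
proof -
  let ?W' = "\<lambda>x. \<alpha> * W1 x + \<beta> * W2 x - \<gamma> * W x"
  have contWline: "continuous_on UNIV (\<lambda>t. W (x + t *\<^sub>R b))" for x
    using derW by (auto intro!: continuous_at_imp_continuous_on has_vector_derivative_continuous)
  have bd': "cmod (?W' x) \<le> cmod \<alpha> * K + cmod \<beta> * K + cmod \<gamma> * K" for x
    by (intro order_trans[OF norm_triangle_ineq4] order_trans[OF norm_triangle_ineq] add_mono)
      (simp_all add: norm_mult mult_left_mono bd)
  have int: "integrable lborel (\<lambda>x. W x * D x)" "integrable lborel (\<lambda>x. W1 x * D x)"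
    "integrable lborel (\<lambda>x. W2 x * D x)"
    using integrable_bounded_support_mult[OF _ _ _ S D(1)] meas bd supp by blast+
  have "(\<integral>x. W x * D' x \<partial>lborel) + (\<integral>x. ?W' x * D x \<partial>lborel) = 0"
  proof (rule integration_by_parts[OF _ _ bd(1) bd' _ _ S D derW _ derD])
    show "continuous_on UNIV (\<lambda>t. ?W' (x + t *\<^sub>R b))" for x
      by (intro continuous_intros contW contWline)
  qed (use meas supp in auto)
  moreover have "(\<integral>x. ?W' x * D x \<partial>lborel)
      = \<alpha> * (\<integral>x. W1 x * D x \<partial>lborel) + \<beta> * (\<integral>x. W2 x * D x \<partial>lborel) - \<gamma> * (\<integral>x. W x * D x \<partial>lborel)"
    using int by (simp add: algebra_simps)
  ultimately have "(\<integral>x. W x * D' x \<partial>lborel) + (\<alpha> * (\<integral>x. W1 x * D x \<partial>lborel)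
      + \<beta> * (\<integral>x. W2 x * D x \<partial>lborel) - \<gamma> * (\<integral>x. W x * D x \<partial>lborel)) = 0"
    by (simp only:)
  moreover have "z = a + x + y" if "a + (x + y - z) = 0" for a x y z :: complex
    using that by (simp add: algebra_simps)
  ultimately show ?thesis by blast
qed

text \<open>The three indices count derivatives of the cutoff, derivatives of the amplitude, and factors
  coming from the phase. Each integration by parts gains a factor \<open>\<eta>\<close> and replaces an integral by three,
  one for each index. For \<open>\<eta> = 0\<close> there is nothing to gain and the bound is used as it stands.\<close>

lemma repeated_parts_bound:
  fixes X :: "nat \<Rightarrow> nat \<Rightarrow> nat \<Rightarrow> complex" and \<alpha> \<eta> B :: real
  assumes rec: "\<And>k a c. k + a + c < n \<Longrightarrow>
      \<i> * of_real \<eta> * X k a c = X k (Suc a) c + of_real \<alpha> * X (Suc k) a c + \<i> * X k a (Suc c)"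
    and bd: "\<And>k a c. k + a + c \<le> n \<Longrightarrow> cmod (X k a c) \<le> B"
  shows "(if \<eta> = 0 then 1 else \<bar>\<eta>\<bar> ^ n) * cmod (X 0 0 0) \<le> (2 + \<bar>\<alpha>\<bar>) ^ n * B"
proof -
  have B0: "0 \<le> B" using order_trans[OF norm_ge_zero bd[of 0 0 0]] by simp
  have step: "\<bar>\<eta>\<bar> ^ j * cmod (X k a c) \<le> (2 + \<bar>\<alpha>\<bar>) ^ j * B" if "k + a + c + j \<le> n" for j k a c
    using that
  proof (induction j arbitrary: k a c)
    case 0
    then show ?case using bd by simp
  next
    case (Suc j)
    have "\<bar>\<eta>\<bar> * cmod (X k a c) = cmod (\<i> * of_real \<eta> * X k a c)" by (simp add: norm_mult)
    also have "\<dots> = cmod (X k (Suc a) c + of_real \<alpha> * X (Suc k) a c + \<i> * X k a (Suc c))"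
      using Suc.prems by (subst rec) auto
    also have "\<dots> \<le> cmod (X k (Suc a) c) + \<bar>\<alpha>\<bar> * cmod (X (Suc k) a c) + cmod (X k a (Suc c))"
      by (intro order_trans[OF norm_triangle_ineq] add_mono) (simp_all add: norm_mult)
    finally have le: "\<bar>\<eta>\<bar> * cmod (X k a c)
        \<le> cmod (X k (Suc a) c) + \<bar>\<alpha>\<bar> * cmod (X (Suc k) a c) + cmod (X k a (Suc c))" .
    have "\<bar>\<eta>\<bar> ^ Suc j * cmod (X k a c)
        \<le> \<bar>\<eta>\<bar> ^ j * (cmod (X k (Suc a) c) + \<bar>\<alpha>\<bar> * cmod (X (Suc k) a c) + cmod (X k a (Suc c)))"
      using mult_left_mono[OF le, of "\<bar>\<eta>\<bar> ^ j"] by (simp add: mult_ac)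
    also have "\<dots> = \<bar>\<eta>\<bar> ^ j * cmod (X k (Suc a) c) + \<bar>\<alpha>\<bar> * (\<bar>\<eta>\<bar> ^ j * cmod (X (Suc k) a c))
        + \<bar>\<eta>\<bar> ^ j * cmod (X k a (Suc c))" by (simp add: algebra_simps)
    also have "\<dots> \<le> (2 + \<bar>\<alpha>\<bar>) ^ j * B + \<bar>\<alpha>\<bar> * ((2 + \<bar>\<alpha>\<bar>) ^ j * B) + (2 + \<bar>\<alpha>\<bar>) ^ j * B"
      using Suc.prems by (intro add_mono mult_left_mono Suc.IH) auto
    also have "\<dots> = (2 + \<bar>\<alpha>\<bar>) ^ Suc j * B" by (simp add: algebra_simps)
    finally show ?case .
  qed
  show ?thesis
  proof (cases "\<eta> = 0")
    case True
    have "1 * B \<le> (2 + \<bar>\<alpha>\<bar>) ^ n * B" using B0 by (intro mult_right_mono one_le_power) auto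
    then show ?thesis using True bd[of 0 0 0] by simp
  next
    case False
    then show ?thesis using step[of 0 0 0 n] by simp
  qed
qed

section \<open>Cutoff functions\<close>

lemma antiderivative_exists:
  fixes f :: "real \<Rightarrow> real"
  assumes "continuous_on UNIV f"
  shows "\<exists>G. \<forall>x. (G has_real_derivative f x) (at x)"
proof (intro exI allI)
  fix x :: real
  let ?a = "min (x - 1) (-1)" and ?b = "max (x + 1) 1"
  have "((\<lambda>u. LBINT y=ereal 0..ereal u. f y) has_vector_derivative f x) (at x within {?a..?b})"
    by (rule interval_integral_FTC2) (auto intro: continuous_on_subset[OF assms])
  moreover have "at x within {?a..?b} = at x"
    by (rule at_within_interior) (auto simp: interior_atLeastAtMost_real)
  ultimately show "((\<lambda>u. LBINT y=ereal 0..ereal u. f y) has_real_derivative f x) (at x)"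
    by (simp add: has_real_derivative_iff_has_vector_derivative)
qed

text \<open>Induction on the number of derivatives, starting from a piecewise linear cutoff: averaging over intervals of length \<open>2 h\<close> raises the order of differentiability
  by one, the derivative of the average being a difference quotient. It enlarges the support and shrinks
  the plateau by \<open>h\<close>, hence the choice \<open>h = (b - a) / 3\<close>.\<close>

lemma smooth_cutoff_exists:
  fixes a b :: real
  assumes "0 < a" "a < b"
  shows "\<exists>\<phi> :: nat \<Rightarrow> real \<Rightarrow> real. (\<forall>k<n. \<forall>t. (\<phi> k has_real_derivative \<phi> (Suc k) t) (at t)) \<and>
    (\<forall>k\<le>n. continuous_on UNIV (\<phi> k) \<and> (\<forall>t. b \<le> \<bar>t\<bar> \<longrightarrow> \<phi> k t = 0)) \<and>
    (\<forall>t. \<bar>t\<bar> \<le> a \<longrightarrow> \<phi> 0 t = 1)"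
  using assms
proof (induction n arbitrary: a b)
  case 0
  let ?f = "\<lambda>t. max 0 (min 1 ((b - \<bar>t\<bar>) / (b - a)))"
  have "continuous_on UNIV ?f" using 0 by (intro continuous_intros) auto
  moreover have "?f t = 0" if "b \<le> \<bar>t\<bar>" for t
    using divide_nonpos_pos[of "b - \<bar>t\<bar>" "b - a"] that 0 by (simp add: max_def min_def)
  moreover have "?f t = 1" if "\<bar>t\<bar> \<le> a" for t
    using that 0 by (simp add: max_def min_def field_simps)
  ultimately show ?case by (intro exI[of _ "\<lambda>_. ?f"]) auto
next
  case (Suc n)
  define h where "h = (b - a) / 3"
  have h: "0 < h" "0 < a + h" "a + h < b - h" using Suc.prems by (auto simp: h_def field_simps)
  obtain \<psi> :: "nat \<Rightarrow> real \<Rightarrow> real" where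
    P: "\<forall>k<n. \<forall>t. (\<psi> k has_real_derivative \<psi> (Suc k) t) (at t)"
      "\<forall>k\<le>n. continuous_on UNIV (\<psi> k) \<and> (\<forall>t. b - h \<le> \<bar>t\<bar> \<longrightarrow> \<psi> k t = 0)"
      "\<forall>t. \<bar>t\<bar> \<le> a + h \<longrightarrow> \<psi> 0 t = 1"
    using Suc.IH[OF h(2,3)] by (elim exE conjE)
  have \<psi>: "(\<psi> k has_real_derivative \<psi> (Suc k) t) (at t)" if "k < n" for k t using P(1) that by simp
  have \<psi>_cont: "continuous_on UNIV (\<psi> k)" if "k \<le> n" for k using P(2) that by simp
  have \<psi>_zero: "\<psi> k t = 0" if "k \<le> n" "b - h \<le> \<bar>t\<bar>" for k t using P(2) that by simp
  have \<psi>_one: "\<psi> 0 t = 1" if "\<bar>t\<bar> \<le> a + h" for t using P(3) that by simp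
  obtain G where G: "\<And>x. (G has_real_derivative \<psi> 0 x) (at x)"
    using antiderivative_exists[OF \<psi>_cont[of 0]] by auto
  define \<phi> where "\<phi> k t = (case k of 0 \<Rightarrow> (G (t + h) - G (t - h)) / (2 * h)
      | Suc k \<Rightarrow> (\<psi> k (t + h) - \<psi> k (t - h)) / (2 * h))" for k t
  have mv: "\<exists>z. t - h < z \<and> z < t + h \<and> G (t + h) - G (t - h) = 2 * h * \<psi> 0 z" for t
  proof -
    have "\<exists>z>t - h. z < t + h \<and> G (t + h) - G (t - h) = (t + h - (t - h)) * \<psi> 0 z"
      by (rule MVT2) (use h G in auto)
    then show ?thesis by auto
  qed
  have der: "(\<phi> k has_real_derivative \<phi> (Suc k) t) (at t)" if "k < Suc n" for k t
  proof -
    have shift: "((\<lambda>t. (F (t + h) - F (t - h)) / (2 * h)) has_real_derivative (F' (t + h) - F' (t - h)) / (2 * h)) (at t)"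
      if F: "\<And>x. (F has_real_derivative F' x) (at x)" for F F' :: "real \<Rightarrow> real"
    proof -
      have "((\<lambda>t. F (t + h)) has_real_derivative F' (t + h)) (at t)"
        using DERIV_shift[of F "F' (t + h)" t h] F by simp
      moreover have "((\<lambda>t. F (t - h)) has_real_derivative F' (t - h)) (at t)"
        using DERIV_shift[of F "F' (t - h)" t "-h"] F by simp
      ultimately show ?thesis by (intro DERIV_cdivide DERIV_diff)
    qed
    show ?thesis
    proof (cases k)
      case 0
      show ?thesis unfolding 0 \<phi>_def[abs_def] using shift[of G "\<psi> 0", OF G] by simp
    next
      case (Suc l)
      then have "l < n" using that by simp
      from shift[of "\<psi> l" "\<psi> (Suc l)", OF \<psi>[OF this]] show ?thesis
        unfolding Suc \<phi>_def[abs_def] by simp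
    qed
  qed
  have cont: "continuous_on UNIV (\<phi> k)" if "k \<le> Suc n" for k
  proof (cases k)
    case 0
    then show ?thesis
      using der[of 0] by (auto intro!: continuous_at_imp_continuous_on DERIV_isCont)
  next
    case (Suc l)
    then have "continuous_on UNIV (\<psi> l)" using \<psi>_cont that by simp
    then have "continuous_on UNIV (\<lambda>t. \<psi> l (t + c))" for c
      by (rule continuous_on_compose2) (auto intro!: continuous_intros)
    from this[of h] this[of "-h"] show ?thesis
      unfolding Suc \<phi>_def[abs_def] using h by (simp add: continuous_on_diff continuous_on_divide)
  qed
  have zero: "\<phi> k t = 0" if "k \<le> Suc n" "b \<le> \<bar>t\<bar>" for k t
  proof (cases k)
    case 0
    obtain z where z: "t - h < z" "z < t + h" "G (t + h) - G (t - h) = 2 * h * \<psi> 0 z" using mv by blast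
    have "b - h \<le> \<bar>z\<bar>" using z that(2) by auto
    then show ?thesis using \<psi>_zero[of 0 z] z(3) 0 by (simp add: \<phi>_def)
  next
    case (Suc l)
    have "b - h \<le> \<bar>t + h\<bar>" "b - h \<le> \<bar>t - h\<bar>" using that(2) h by auto
    then show ?thesis using \<psi>_zero[of l] that(1) Suc by (simp add: \<phi>_def)
  qed
  have one: "\<phi> 0 t = 1" if "\<bar>t\<bar> \<le> a" for t
  proof -
    obtain z where z: "t - h < z" "z < t + h" "G (t + h) - G (t - h) = 2 * h * \<psi> 0 z" using mv by blast
    have "\<bar>z\<bar> \<le> a + h" using z that by auto
    then show ?thesis using \<psi>_one[of z] z(3) h by (simp add: \<phi>_def)
  qed
  show ?case by (intro exI[of _ \<phi>] conjI allI impI) (use der cont zero one in auto)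
qed

lemma cutoff_bounded:
  fixes \<phi> :: "nat \<Rightarrow> real \<Rightarrow> real"
  assumes "\<And>k. k \<le> n \<Longrightarrow> continuous_on UNIV (\<phi> k)" "\<And>k t. k \<le> n \<Longrightarrow> b \<le> \<bar>t\<bar> \<Longrightarrow> \<phi> k t = 0"
  shows "\<exists>B\<ge>1. \<forall>k\<le>n. \<forall>t. \<bar>\<phi> k t\<bar> \<le> B"
proof -
  have "\<exists>B. \<forall>t. \<bar>\<phi> k t\<bar> \<le> B" if k: "k \<le> n" for k
  proof -
    have "compact (\<phi> k ` {-b..b})"
      by (rule compact_continuous_image) (auto intro: continuous_on_subset[OF assms(1)[OF k]])
    then have "\<exists>B. \<forall>t\<in>{-b..b}. \<bar>\<phi> k t\<bar> \<le> B"
      using compact_imp_bounded[of "\<phi> k ` {-b..b}"] by (simp add: bounded_iff)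
    then obtain B where B: "\<And>t. t \<in> {-b..b} \<Longrightarrow> \<bar>\<phi> k t\<bar> \<le> B" by blast
    have "\<bar>\<phi> k t\<bar> \<le> max 0 B" for t
    proof (cases "b \<le> \<bar>t\<bar>")
      case False
      then have "t \<in> {-b..b}" by auto
      from B[OF this] show ?thesis by simp
    qed (simp add: assms(2)[OF k])
    then show ?thesis by blast
  qed
  then obtain B where B: "\<And>k t. k \<le> n \<Longrightarrow> \<bar>\<phi> k t\<bar> \<le> B k" by metis
  have "\<bar>\<phi> k t\<bar> \<le> (\<Sum>k\<le>n. \<bar>B k\<bar>) + 1" if "k \<le> n" for k t
    using order_trans[OF B[OF that, of t] abs_ge_self] member_le_sum[of k "{..n}" "\<lambda>k. \<bar>B k\<bar>"] that
    by (simp add: add_increasing2)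
  moreover have "1 \<le> (\<Sum>k\<le>n. \<bar>B k\<bar>) + 1" by (simp add: sum_nonneg)
  ultimately show ?thesis by blast
qed

section \<open>Multiple Fourier series of compactly supported functions\<close>

text \<open>The Fejer kernel. Its Fourier coefficients increase to 1 and its integral against a continuous
  function converges to the value at 0, which gives the inversion formula for functions that are merely
  continuous with summable coefficients.\<close>

definition fejer :: "nat \<Rightarrow> real \<Rightarrow> real" where
  "fejer M t = (cmod (\<Sum>j\<le>M. cis (real j * t)))\<^sup>2 / real (M + 1)"

lemma fejer_nonneg: "0 \<le> fejer M t"
  by (simp add: fejer_def)

lemma continuous_fejer: "continuous_on UNIV (fejer M)"
  unfolding fejer_def[abs_def] cis_conv_exp by (intro continuous_intros) auto

lemma measurable_cis [measurable]: "cis \<in> borel_measurable borel"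
  by (intro borel_measurable_continuous_onI) (simp add: cis_conv_exp[abs_def] continuous_intros)

lemma fejer_expansion:
  "complex_of_real (fejer M t) =
    (\<Sum>k\<in>{-int M..int M}. of_real (1 - \<bar>real_of_int k\<bar> / real (M + 1)) * cis (real_of_int k * t))"
proof -
  let ?D = "\<lambda>M. \<Sum>j\<le>M. cis (real j * t)"
  have "?D M * cnj (?D M) =
    (\<Sum>k\<in>{-int M..int M}. of_real (real M + 1 - \<bar>real_of_int k\<bar>) * cis (real_of_int k * t))"
  proof (induction M)
    case 0
    show ?case by simp
  next
    case (Suc M)
    define c where "c = cis (real (Suc M) * t)"
    let ?L = "{- int (Suc M)..-1}" and ?R = "{1..int (Suc M)}"
    have split: "{- int (Suc M)..int (Suc M)} = insert 0 (?L \<union> ?R)" by auto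
    have sum_split: "(\<Sum>k\<in>{- int (Suc M)..int (Suc M)}. h k) = h 0 + (\<Sum>k\<in>?L. h k) + (\<Sum>k\<in>?R. h k)"
      for h :: "int \<Rightarrow> complex"
      unfolding split by (subst sum.insert) (auto simp: sum.union_disjoint add.assoc)
    have cc: "c * cnj c = 1" by (simp add: c_def cis_cnj cis_mult)
    have L: "?D M * cnj c = (\<Sum>k\<in>?L. cis (real_of_int k * t))"
      unfolding sum_distrib_right
      by (rule sum.reindex_bij_witness[of _ "\<lambda>k. nat (k + int (Suc M))" "\<lambda>j. int j - int (Suc M)"])
        (auto simp: c_def cis_cnj cis_mult algebra_simps)
    have R: "c * cnj (?D M) = (\<Sum>k\<in>?R. cis (real_of_int k * t))"
      unfolding cnj_sum sum_distrib_left
      by (rule sum.reindex_bij_witness[of _ "\<lambda>k. nat (int (Suc M) - k)" "\<lambda>j. int (Suc M) - int j"])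
        (auto simp: c_def cis_cnj cis_mult algebra_simps)
    have "?D (Suc M) * cnj (?D (Suc M)) = ?D M * cnj (?D M) + (?D M * cnj c + c * cnj (?D M) + c * cnj c)"
      by (simp add: c_def algebra_simps)
    also have "?D M * cnj c + c * cnj (?D M) + c * cnj c
        = (\<Sum>k\<in>{- int (Suc M)..int (Suc M)}. cis (real_of_int k * t))"
      unfolding sum_split L R cc by simp
    also have "?D M * cnj (?D M) = (\<Sum>k\<in>{- int (Suc M)..int (Suc M)}.
        of_real (real M + 1 - \<bar>real_of_int k\<bar>) * cis (real_of_int k * t))"
      unfolding Suc.IH
    proof (rule sum.mono_neutral_left)
      show "\<forall>k\<in>{- int (Suc M)..int (Suc M)} - {- int M..int M}.
          of_real (real M + 1 - \<bar>real_of_int k\<bar>) * cis (real_of_int k * t) = 0"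
      proof
        fix k assume "k \<in> {- int (Suc M)..int (Suc M)} - {- int M..int M}"
        then have "\<bar>k\<bar> = int M + 1" by auto
        then have "\<bar>real_of_int k\<bar> = real M + 1" by linarith
        then show "of_real (real M + 1 - \<bar>real_of_int k\<bar>) * cis (real_of_int k * t) = 0" by simp
      qed
    qed auto
    finally show ?case by (simp add: sum.distrib[symmetric] algebra_simps)
  qed
  then have "complex_of_real ((cmod (?D M))\<^sup>2) =
    (\<Sum>k\<in>{-int M..int M}. of_real (real M + 1 - \<bar>real_of_int k\<bar>) * cis (real_of_int k * t))"
    by (simp only: complex_norm_square)
  then have "complex_of_real (fejer M t) =
    (\<Sum>k\<in>{-int M..int M}. of_real (real M + 1 - \<bar>real_of_int k\<bar>) * cis (real_of_int k * t)) / of_real (real (M + 1))"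
    unfolding fejer_def by (simp only: of_real_divide)
  also have "\<dots> = (\<Sum>k\<in>{-int M..int M}. of_real (1 - \<bar>real_of_int k\<bar> / real (M + 1)) * cis (real_of_int k * t))"
    unfolding sum_divide_distrib by (intro sum.cong refl) (simp add: divide_simps)
  finally show ?thesis .
qed

lemma fejer_tail:
  assumes "0 < \<delta>" "\<delta> \<le> \<bar>t\<bar>" "\<bar>t\<bar> \<le> pi"
  shows "fejer M t \<le> 2 / (real (M + 1) * (1 - cos \<delta>))"
proof -
  let ?D = "\<Sum>j\<le>M. cis (real j * t)"
  have "cos \<bar>t\<bar> \<le> cos \<delta>" by (rule cos_monotone_0_pi_le) (use assms in auto)
  then have c: "cos t \<le> cos \<delta>" by simp
  have "cos \<delta> < cos 0" by (rule cos_monotone_0_pi) (use assms in auto)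
  then have \<delta>: "0 < 1 - cos \<delta>" by simp
  have sq: "(cmod (1 - cis t))\<^sup>2 = 2 - 2 * cos t"
    unfolding cmod_power2 using sin_cos_squared_add[of t] by (simp add: power2_eq_square algebra_simps)
  have "(1 - cis t) * ?D = 1 - cis t ^ Suc M"
  proof -
    have "?D = (\<Sum>j\<le>M. cis t ^ j)" by (intro sum.cong refl) (rule Complex.DeMoivre[symmetric])
    then show ?thesis using sum_gp_basic[of "cis t" M] by simp
  qed
  then have "cmod (1 - cis t) * cmod ?D = cmod (1 - cis t ^ Suc M)" by (simp only: norm_mult[symmetric])
  also have "\<dots> \<le> 2"
    using norm_triangle_ineq4[of 1 "cis t ^ Suc M"] by (simp add: norm_power norm_mult)
  finally have "(cmod (1 - cis t) * cmod ?D)\<^sup>2 \<le> 2\<^sup>2" by (intro power_mono) auto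
  then have "(2 - 2 * cos t) * (cmod ?D)\<^sup>2 \<le> 4" by (simp add: power_mult_distrib sq)
  moreover have "(2 - 2 * cos \<delta>) * (cmod ?D)\<^sup>2 \<le> (2 - 2 * cos t) * (cmod ?D)\<^sup>2"
    using c by (intro mult_right_mono) auto
  ultimately have "(cmod ?D)\<^sup>2 \<le> 2 / (1 - cos \<delta>)" using \<delta> by (simp add: field_simps)
  then have "fejer M t \<le> 2 / (1 - cos \<delta>) / real (M + 1)"
    unfolding fejer_def by (intro divide_right_mono) auto
  then show ?thesis by (simp add: mult.commute)
qed

lemma has_integral_cis:
  fixes r :: real and k :: int
  assumes r: "0 < r"
  shows "((\<lambda>t. cis (real_of_int k * (t / r))) has_integral (if k = 0 then of_real (2 * pi * r) else 0))
    {-(pi * r)..pi * r}"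
proof (cases "k = 0")
  case True
  have "((\<lambda>t. 1::complex) has_integral (pi * r - -(pi * r)) *\<^sub>R 1) {-(pi * r)..pi * r}"
    using r by (intro has_integral_const_real[THEN has_integral_eq_rhs]) simp
  then show ?thesis using True by (simp add: scaleR_conv_of_real mult_ac)
next
  case False
  let ?F = "\<lambda>t. cis (real_of_int k * (t / r)) * (of_real r / (\<i> * of_int k))"
  have "((\<lambda>t. cis (real_of_int k * (t / r))) has_integral ?F (pi * r) - ?F (-(pi * r))) {-(pi * r)..pi * r}"
  proof (rule fundamental_theorem_of_calculus)
    show "(?F has_vector_derivative cis (real_of_int k * (t / r))) (at t within {-(pi * r)..pi * r})" for t
      unfolding cis_conv_exp using r False
      by (auto intro!: derivative_eq_intros has_vector_derivative_real_field simp: field_simps)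
  qed (use r in simp)
  moreover have "cis (real_of_int k * (pi * r / r)) = cis (real_of_int k * (-(pi * r) / r))"
    using r sin_npi_int[of k] by (simp add: complex_eq_iff mult.commute)
  ultimately show ?thesis using False by simp
qed

lemma has_integral_fejer:
  fixes r :: real
  assumes r: "0 < r"
  shows "((\<lambda>t. fejer M (t / r) / (2 * pi * r)) has_integral 1) {-(pi * r)..pi * r}"
proof -
  let ?a = "\<lambda>k. complex_of_real (1 - \<bar>real_of_int k\<bar> / real (M + 1))"
  have "((\<lambda>t. \<Sum>k\<in>{-int M..int M}. ?a k * cis (real_of_int k * (t / r))) has_integral
      (\<Sum>k\<in>{-int M..int M}. ?a k * (if k = 0 then of_real (2 * pi * r) else 0))) {-(pi * r)..pi * r}"
    by (intro has_integral_sum has_integral_mult_right has_integral_cis r) auto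
  also have "(\<Sum>k\<in>{-int M..int M}. ?a k * (if k = 0 then of_real (2 * pi * r) else 0)) = complex_of_real (2 * pi * r)"
    by (simp add: if_distrib cong: if_cong)
  finally have "((\<lambda>t. complex_of_real (fejer M (t / r))) has_integral complex_of_real (2 * pi * r)) {-(pi * r)..pi * r}"
    by (simp only: fejer_expansion)
  from has_integral_linear[OF this bounded_linear_Re]
  have "((\<lambda>t. fejer M (t / r)) has_integral (2 * pi * r)) {-(pi * r)..pi * r}" by (simp add: o_def)
  from has_integral_divide[OF this, of "2 * pi * r"] show ?thesis using r by simp
qed

text \<open>One period of the kernel, rescaled to period \<open>2 * pi * r\<close> and normalised to integral 1.\<close>

definition fejer_density :: "nat \<Rightarrow> real \<Rightarrow> real \<Rightarrow> real" where
  "fejer_density M r t = indicator {-(pi * r)..pi * r} t * (fejer M (t / r) / (2 * pi * r))"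

lemma fejer_density_nonneg: "0 < r \<Longrightarrow> 0 \<le> fejer_density M r t"
  by (simp add: fejer_density_def fejer_nonneg)

lemma measurable_fejer [measurable]: "fejer M \<in> borel_measurable borel"
  by (rule borel_measurable_continuous_onI) (rule continuous_fejer)

lemma measurable_fejer_density [measurable]: "fejer_density M r \<in> borel_measurable borel"
  unfolding fejer_density_def[abs_def] by measurable

lemma nn_integral_fejer_density:
  assumes "0 < r"
  shows "(\<integral>\<^sup>+t. ennreal (fejer_density M r t) \<partial>lborel) = 1"
  unfolding fejer_density_def
  using nn_integral_has_integral_lebesgue[OF _ has_integral_fejer[OF assms, of M]] assms
  by (simp add: fejer_nonneg)

lemma nn_integral_fejer_density_tail:
  assumes r: "0 < r" and \<delta>: "0 < \<delta>" "\<delta> \<le> pi"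
  shows "(\<integral>\<^sup>+t. ennreal (indicator {t. \<delta> * r \<le> \<bar>t\<bar>} t * fejer_density M r t) \<partial>lborel)
    \<le> ennreal (2 / (real (M + 1) * (1 - cos \<delta>)))"
proof -
  let ?c = "2 / (real (M + 1) * (1 - cos \<delta>))"
  have "cos \<delta> < cos 0" by (rule cos_monotone_0_pi) (use \<delta> in auto)
  then have c0: "0 \<le> ?c" by simp
  have "(\<integral>\<^sup>+t. ennreal (indicator {t. \<delta> * r \<le> \<bar>t\<bar>} t * fejer_density M r t) \<partial>lborel)
      \<le> (\<integral>\<^sup>+t. ennreal (?c / (2 * pi * r)) * indicator {-(pi * r)..pi * r} t \<partial>lborel)"
  proof (rule nn_integral_mono)
    fix t :: real
    show "ennreal (indicator {t. \<delta> * r \<le> \<bar>t\<bar>} t * fejer_density M r t)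
        \<le> ennreal (?c / (2 * pi * r)) * indicator {-(pi * r)..pi * r} t"
    proof (cases "t \<in> {-(pi * r)..pi * r} \<and> \<delta> * r \<le> \<bar>t\<bar>")
      case True
      then have "fejer M (t / r) \<le> ?c"
        using r by (intro fejer_tail \<delta>) (auto simp: field_simps abs_if)
      then have "fejer M (t / r) / (2 * pi * r) \<le> ?c / (2 * pi * r)"
        using r by (intro divide_right_mono) auto
      then show ?thesis using True by (simp add: fejer_density_def ennreal_leI)
    qed (auto simp: fejer_density_def)
  qed
  also have "\<dots> = ennreal (?c / (2 * pi * r)) * ennreal (2 * pi * r)"
    using r by (subst nn_integral_cmult_indicator) (auto simp: mult_ac)
  also have "\<dots> = ennreal ?c" using r c0 by (simp add: ennreal_mult[symmetric])
  finally show ?thesis .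
qed

definition fejer_density_n :: "nat \<Rightarrow> real \<Rightarrow> 'a::euclidean_space \<Rightarrow> real" where
  "fejer_density_n M r u = (\<Prod>b\<in>Basis. fejer_density M r (u \<bullet> b))"

lemma measurable_fejer_density_n [measurable]: "fejer_density_n M r \<in> borel_measurable borel"
  unfolding fejer_density_n_def[abs_def] by measurable

lemma fejer_density_n_nonneg: "0 < r \<Longrightarrow> 0 \<le> fejer_density_n M r u"
  by (simp add: fejer_density_n_def prod_nonneg fejer_density_nonneg)

lemma nn_integral_fejer_density_n:
  assumes r: "0 < r"
  shows "(\<integral>\<^sup>+u. ennreal (fejer_density_n M r (u::'a::euclidean_space)) \<partial>lborel) = 1"
  using nn_integral_lborel_prod[of "\<lambda>(b::'a) t. ennreal (fejer_density M r t)"] r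
  by (simp add: fejer_density_n_def prod_ennreal fejer_density_nonneg nn_integral_fejer_density)

lemma nn_integral_fejer_density_n_tail:
  assumes r: "0 < r" and \<delta>: "0 < \<delta>" "\<delta> \<le> pi"
  shows "(\<integral>\<^sup>+u. ennreal (fejer_density_n M r (u::'a::euclidean_space)) * indicator {u. \<exists>b\<in>Basis. \<delta> * r \<le> \<bar>u \<bullet> b\<bar>} u \<partial>lborel)
    \<le> ennreal (DIM('a) * (2 / (real (M + 1) * (1 - cos \<delta>))))"
proof -
  let ?T = "\<lambda>b. {u::'a. \<delta> * r \<le> \<bar>u \<bullet> b\<bar>}"
  let ?c = "2 / (real (M + 1) * (1 - cos \<delta>))"
  have "cos \<delta> < cos 0" by (rule cos_monotone_0_pi) (use \<delta> in auto)
  then have c0: "0 \<le> ?c" by simp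
  have one: "(\<integral>\<^sup>+u. ennreal (fejer_density_n M r u) * indicator (?T b) u \<partial>lborel) \<le> ennreal ?c"
    if b: "b \<in> Basis" for b
  proof -
    define f where "f c t = (if c = b then ennreal (indicator {t. \<delta> * r \<le> \<bar>t\<bar>} t * fejer_density M r t)
        else ennreal (fejer_density M r t))" for c :: 'a and t
    have f_meas: "f c \<in> borel_measurable borel" for c
      by (cases "c = b") (simp_all add: f_def[abs_def])
    have "ennreal (fejer_density_n M r u) * indicator (?T b) u = (\<Prod>c\<in>Basis. f c (u \<bullet> c))" for u
    proof -
      have "(\<Prod>c\<in>Basis. f c (u \<bullet> c)) = f b (u \<bullet> b) * (\<Prod>c\<in>Basis - {b}. f c (u \<bullet> c))"
        using b by (simp add: prod.remove)
      also have "(\<Prod>c\<in>Basis - {b}. f c (u \<bullet> c)) = (\<Prod>c\<in>Basis - {b}. ennreal (fejer_density M r (u \<bullet> c)))"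
        by (intro prod.cong) (auto simp: f_def)
      also have "f b (u \<bullet> b) = indicator (?T b) u * ennreal (fejer_density M r (u \<bullet> b))"
        by (auto simp: f_def indicator_def)
      also have "\<dots> * (\<Prod>c\<in>Basis - {b}. ennreal (fejer_density M r (u \<bullet> c)))
          = indicator (?T b) u * (\<Prod>c\<in>Basis. ennreal (fejer_density M r (u \<bullet> c)))"
        using b by (simp add: prod.remove[of Basis b] mult.assoc)
      finally show ?thesis
        using r by (simp add: fejer_density_n_def prod_ennreal fejer_density_nonneg mult.commute)
    qed
    then have "(\<integral>\<^sup>+u. ennreal (fejer_density_n M r u) * indicator (?T b) u \<partial>lborel)
        = (\<Prod>c\<in>Basis. \<integral>\<^sup>+t. f c t \<partial>lborel)"
      using nn_integral_lborel_prod[of f, OF f_meas] by simp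
    also have "\<dots> = (\<integral>\<^sup>+t. f b t \<partial>lborel) * (\<Prod>c\<in>Basis - {b}. \<integral>\<^sup>+t. f c t \<partial>lborel)"
      using b by (simp add: prod.remove)
    also have "(\<Prod>c\<in>Basis - {b}. \<integral>\<^sup>+t. f c t \<partial>lborel) = 1"
      by (intro prod.neutral) (auto simp: f_def nn_integral_fejer_density[OF r])
    also have "(\<integral>\<^sup>+t. f b t \<partial>lborel) \<le> ennreal ?c"
      unfolding f_def using nn_integral_fejer_density_tail[OF r \<delta>] by simp
    finally show ?thesis by simp
  qed
  have [measurable]: "?T b \<in> sets borel" for b by measurable
  have "(\<integral>\<^sup>+u. ennreal (fejer_density_n M r (u::'a)) * indicator {u. \<exists>b\<in>Basis. \<delta> * r \<le> \<bar>u \<bullet> b\<bar>} u \<partial>lborel)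
      \<le> (\<integral>\<^sup>+u. (\<Sum>b\<in>Basis. ennreal (fejer_density_n M r u) * indicator (?T b) u) \<partial>lborel)"
  proof (rule nn_integral_mono)
    fix u :: 'a
    show "ennreal (fejer_density_n M r u) * indicator {u. \<exists>b\<in>Basis. \<delta> * r \<le> \<bar>u \<bullet> b\<bar>} u
        \<le> (\<Sum>b\<in>Basis. ennreal (fejer_density_n M r u) * indicator (?T b) u)"
    proof (cases "\<exists>b\<in>Basis. \<delta> * r \<le> \<bar>u \<bullet> b\<bar>")
      case True
      then obtain b where b: "b \<in> Basis" "u \<in> ?T b" by auto
      have "ennreal (fejer_density_n M r u) * indicator (?T b) u
          \<le> (\<Sum>b\<in>Basis. ennreal (fejer_density_n M r u) * indicator (?T b) u)"
        using b(1) by (intro member_le_sum) auto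
      then show ?thesis using b(2) True by simp
    qed simp
  qed
  also have "\<dots> = (\<Sum>b\<in>Basis. \<integral>\<^sup>+u. ennreal (fejer_density_n M r u) * indicator (?T b) u \<partial>lborel)"
    by (rule nn_integral_sum) measurable
  also have "\<dots> \<le> (\<Sum>b\<in>(Basis::'a set). ennreal ?c)" by (intro sum_mono one)
  also have "\<dots> = ennreal (DIM('a) * ?c)"
    by (subst ennreal_mult[OF _ c0]) (auto simp: ennreal_of_nat_eq_real_of_nat)
  finally show ?thesis .
qed

lemma integrable_fejer_density_n:
  assumes "0 < r"
  shows "integrable lborel (fejer_density_n M r :: 'a::euclidean_space \<Rightarrow> real)"
    and "integral\<^sup>L lborel (fejer_density_n M r :: 'a \<Rightarrow> real) = 1"
proof -
  show "integrable lborel (fejer_density_n M r :: 'a \<Rightarrow> real)"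
    by (rule integrableI_nonneg)
      (use nn_integral_fejer_density_n[OF assms, of M, where 'a='a] assms in
        \<open>auto simp: fejer_density_n_nonneg\<close>)
  show "integral\<^sup>L lborel (fejer_density_n M r :: 'a \<Rightarrow> real) = 1"
    using nn_integral_fejer_density_n[OF assms, of M, where 'a='a] assms
    by (intro integral_eq_nn_integral[THEN trans]) (auto simp: fejer_density_n_nonneg)
qed

text \<open>Near 0 the function is close to \<open>h 0\<close> by continuity; away from 0 it is bounded and the kernel has
  small mass by \<open>nn_integral_fejer_density_n_tail\<close>.\<close>

lemma fejer_approximate_identity:
  fixes h :: "'a::euclidean_space \<Rightarrow> complex"
  assumes r: "0 < r" and cont: "isCont h 0" and bd: "\<And>u. cmod (h u) \<le> B"
    and [measurable]: "h \<in> borel_measurable borel"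
  shows "(\<lambda>M. \<integral>u. fejer_density_n M r u *\<^sub>R h u \<partial>lborel) \<longlonglongrightarrow> h 0"
proof (rule LIMSEQ_I)
  fix \<epsilon> :: real assume \<epsilon>: "0 < \<epsilon>"
  have B0: "0 \<le> B" using order_trans[OF norm_ge_zero bd] .
  let ?F = "\<lambda>M. fejer_density_n M r :: 'a \<Rightarrow> real"
  obtain \<eta> where \<eta>: "0 < \<eta>" "\<And>u. dist u 0 < \<eta> \<Longrightarrow> dist (h u) (h 0) < \<epsilon> / 2"
    using cont \<epsilon> unfolding continuous_at_eps_delta by (metis half_gt_zero)
  define \<delta> where "\<delta> = min 1 (\<eta> / (2 * r * DIM('a)))"
  have \<delta>: "0 < \<delta>" "\<delta> \<le> pi" using \<eta> r pi_ge_two by (auto simp: \<delta>_def)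
  have near: "dist (h u) (h 0) < \<epsilon> / 2" if "\<And>b. b \<in> Basis \<Longrightarrow> \<bar>u \<bullet> b\<bar> < \<delta> * r" for u
  proof (rule \<eta>(2))
    have "norm u \<le> (\<Sum>b\<in>Basis. \<bar>u \<bullet> b\<bar>)" by (rule norm_le_l1)
    also have "\<dots> \<le> (\<Sum>b\<in>(Basis::'a set). \<delta> * r)" using that by (intro sum_mono less_imp_le)
    also have "\<dots> = DIM('a) * (\<delta> * r)" by simp
    also have "\<dots> \<le> DIM('a) * (\<eta> / (2 * r * DIM('a)) * r)"
      using r by (intro mult_left_mono mult_right_mono) (auto simp: \<delta>_def)
    also have "\<dots> < \<eta>" using r \<eta> by (simp add: field_simps)
    finally show "dist u 0 < \<eta>" by simp
  qed
  let ?T = "{u::'a. \<exists>b\<in>Basis. \<delta> * r \<le> \<bar>u \<bullet> b\<bar>}"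
  have [measurable]: "?T \<in> sets borel" by measurable
  let ?c = "\<lambda>M. real DIM('a) * (2 / (real (M + 1) * (1 - cos \<delta>)))"
  have "cos \<delta> < cos 0" by (rule cos_monotone_0_pi) (use \<delta> in auto)
  then have c0: "0 \<le> ?c M" for M by simp
  have tail: "(\<integral>u. ?F M u * indicator ?T u \<partial>lborel) \<le> ?c M" for M
    using nn_integral_fejer_density_n_tail[OF r \<delta>, of M, where 'a='a] c0 r
    by (intro integral_real_bounded) (simp_all add: ennreal_mult' ennreal_indicator fejer_density_n_nonneg)
  have int_F: "integrable lborel (?F M)" "integral\<^sup>L lborel (?F M) = 1" for M
    by (rule integrable_fejer_density_n[OF r])+
  have int_Fh: "integrable lborel (\<lambda>u. ?F M u *\<^sub>R h u)" for M
  proof (rule Bochner_Integration.integrable_bound)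
    show "integrable lborel (\<lambda>u. ?F M u * B)" using int_F(1) by (rule integrable_mult_left)
    show "AE u in lborel. norm (?F M u *\<^sub>R h u) \<le> norm (?F M u * B)"
      using bd B0 r by (intro AE_I2) (simp add: abs_mult mult_left_mono)
  qed measurable
  have int_T: "integrable lborel (\<lambda>u. ?F M u * indicator ?T u)" for M
    by (rule Bochner_Integration.integrable_bound[OF int_F(1)[of M]]) (auto simp: indicator_def)
  have est: "norm ((\<integral>u. ?F M u *\<^sub>R h u \<partial>lborel) - h 0) \<le> \<epsilon> / 2 + 2 * B * ?c M" for M
  proof -
    have "(\<integral>u. ?F M u *\<^sub>R h u \<partial>lborel) - h 0 = (\<integral>u. ?F M u *\<^sub>R h u - ?F M u *\<^sub>R h 0 \<partial>lborel)"
      using int_Fh int_F by (subst Bochner_Integration.integral_diff) auto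
    also have "norm \<dots> \<le> (\<integral>u. ?F M u * (\<epsilon> / 2) + (2 * B) * (?F M u * indicator ?T u) \<partial>lborel)"
    proof (rule order_trans[OF integral_norm_bound], rule integral_mono)
      show "integrable lborel (\<lambda>u. norm (?F M u *\<^sub>R h u - ?F M u *\<^sub>R h 0))"
        using int_Fh int_F by auto
      show "integrable lborel (\<lambda>u. ?F M u * (\<epsilon> / 2) + (2 * B) * (?F M u * indicator ?T u))"
        using int_F int_T by auto
      fix u :: 'a
      have F0: "0 \<le> ?F M u" by (rule fejer_density_n_nonneg[OF r])
      have "norm (?F M u *\<^sub>R h u - ?F M u *\<^sub>R h 0) = ?F M u * norm (h u - h 0)"
        using F0 by (simp add: scaleR_diff_right[symmetric])
      also have "\<dots> \<le> ?F M u * (\<epsilon> / 2 + 2 * B * indicator ?T u)"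
      proof (rule mult_left_mono[OF _ F0])
        show "norm (h u - h 0) \<le> \<epsilon> / 2 + 2 * B * indicator ?T u"
        proof (cases "u \<in> ?T")
          case True
          have "norm (h u - h 0) \<le> B + B"
            using norm_triangle_ineq4[of "h u" "h 0"] bd[of u] bd[of 0] by linarith
          then show ?thesis using True \<epsilon> by simp
        next
          case False
          then show ?thesis using near[of u] by (auto simp: dist_norm not_le)
        qed
      qed
      finally show "norm (?F M u *\<^sub>R h u - ?F M u *\<^sub>R h 0)
          \<le> ?F M u * (\<epsilon> / 2) + (2 * B) * (?F M u * indicator ?T u)"
        by (simp add: algebra_simps)
    qed
    also have "\<dots> = \<epsilon> / 2 + 2 * B * (\<integral>u. ?F M u * indicator ?T u \<partial>lborel)"
      using int_F[of M] int_T[of M] by simp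
    also have "\<dots> \<le> \<epsilon> / 2 + 2 * B * ?c M"
      using tail[of M] B0 by (intro add_left_mono mult_left_mono) auto
    finally show ?thesis .
  qed
  have "(\<lambda>M. 2 * B * ?c M) \<longlonglongrightarrow> 0"
  proof -
    have "(\<lambda>M. (2 * B * real DIM('a) * 2 / (1 - cos \<delta>)) * (1 / real (M + 1))) \<longlonglongrightarrow> (2 * B * real DIM('a) * 2 / (1 - cos \<delta>)) * 0"
      by (intro tendsto_mult tendsto_const) (use LIMSEQ_inverse_real_of_nat in \<open>simp add: inverse_eq_divide\<close>)
    then show ?thesis by (simp add: field_simps)
  qed
  then have "\<forall>\<^sub>F M in sequentially. 2 * B * ?c M < \<epsilon> / 2" using \<epsilon> by (intro order_tendstoD) auto
  then obtain M0 where M0: "\<And>M. M \<ge> M0 \<Longrightarrow> 2 * B * ?c M < \<epsilon> / 2" by (auto simp: eventually_sequentially)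
  show "\<exists>M0. \<forall>M\<ge>M0. norm ((\<integral>u. ?F M u *\<^sub>R h u \<partial>lborel) - h 0) < \<epsilon>"
  proof (intro exI allI impI)
    fix M assume "M0 \<le> M"
    then show "norm ((\<integral>u. ?F M u *\<^sub>R h u \<partial>lborel) - h 0) < \<epsilon>" using est[of M] M0[of M] by linarith
  qed
qed

lemma prod_cis:
  "finite I \<Longrightarrow> (\<Prod>i\<in>I. cis (h i)) = cis (\<Sum>i\<in>I. h i)"
  by (induction I rule: finite_induct) (simp_all add: cis_mult)

lemma int_lattice_iff: "\<kappa> \<in> int_lattice \<longleftrightarrow> (\<forall>b\<in>Basis. \<exists>k::int. \<kappa> \<bullet> b = of_int k)"
  by (simp add: int_lattice_def Ints_def image_iff)

lemma tendsto_infsum_dominated: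
  fixes a :: "nat \<Rightarrow> 'i \<Rightarrow> 'b::{banach, second_countable_topology}"
  assumes lim: "\<And>i. i \<in> I \<Longrightarrow> (\<lambda>M. a M i) \<longlonglongrightarrow> b i"
    and bd: "\<And>M i. i \<in> I \<Longrightarrow> norm (a M i) \<le> w i" and w: "w summable_on I"
  shows "(\<lambda>M. infsum (a M) I) \<longlonglongrightarrow> infsum b I"
proof -
  have "(\<lambda>i. norm (w i)) summable_on I"
    using w by (subst summable_on_cong[of _ _ w]) (use order_trans[OF norm_ge_zero bd] in auto)
  then have "Infinite_Set_Sum.abs_summable_on w I" by (simp only: abs_summable_equivalent)
  then have wi: "integrable (count_space I) w" by (simp add: Infinite_Set_Sum.abs_summable_on_def)
  have ai: "integrable (count_space I) (a M)" for M
    by (rule Bochner_Integration.integrable_bound[OF wi])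
      (use bd in \<open>auto simp: AE_count_space intro: order_trans[OF _ abs_ge_self]\<close>)
  have bi: "integrable (count_space I) b"
  proof (rule Bochner_Integration.integrable_bound[OF wi])
    have "norm (b i) \<le> w i" if "i \<in> I" for i
      by (rule LIMSEQ_le_const2[OF tendsto_norm[OF lim[OF that]]]) (use bd that in auto)
    then show "AE i in count_space I. norm (b i) \<le> norm (w i)"
      by (auto simp: AE_count_space intro: order_trans[OF _ abs_ge_self])
  qed simp
  have "(\<lambda>M. integral\<^sup>L (count_space I) (a M)) \<longlonglongrightarrow> integral\<^sup>L (count_space I) b"
    by (rule integral_dominated_convergence[OF _ _ wi]) (use lim bd in \<open>auto simp: AE_count_space\<close>)
  moreover have "integral\<^sup>L (count_space I) h = infsum h I" if "integrable (count_space I) h" for h :: "'i \<Rightarrow> 'b"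
    using infsetsum_infsum[of h I] that
    by (simp add: infsetsum_def Infinite_Set_Sum.abs_summable_on_def)
  ultimately show ?thesis by (simp add: ai bi)
qed

text \<open>On the support of \<open>g (v + u)\<close> the truncated kernel agrees with the trigonometric polynomial, so
  the average is a finite combination of Fourier terms. It is written as a sum over the whole lattice, with
  weights that vanish outside a cube and tend to 1.\<close>

lemma fejer_average_eq_sum:
  fixes g :: "'a::euclidean_space \<Rightarrow> complex"
  assumes r: "0 < r" and g: "integrable lborel g"
    and supp: "\<And>u b. g u \<noteq> 0 \<Longrightarrow> b \<in> Basis \<Longrightarrow> \<bar>(u - v) \<bullet> b\<bar> \<le> pi * r"
  defines "w M \<kappa> \<equiv> \<Prod>b\<in>Basis. max 0 (1 - \<bar>\<kappa> \<bullet> b\<bar> / real (M + 1))"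
  shows "(\<integral>u. fejer_density_n M r u *\<^sub>R g (v + u) \<partial>lborel)
    = (\<Sum>\<^sub>\<infinity>\<kappa>\<in>int_lattice. of_real (w M \<kappa> / (2 * pi * r) ^ DIM('a)) *
        (cis (\<kappa> \<bullet> v / r) * (\<integral>u. cis (- (\<kappa> \<bullet> u / r)) * g u \<partial>lborel)))"
proof -
  let ?K = "PiE (Basis :: 'a set) (\<lambda>_. {- int M..int M})"
  let ?vec = "\<lambda>k. \<Sum>b\<in>Basis. real_of_int (k b) *\<^sub>R b :: 'a"
  have vec: "?vec k \<bullet> b = k b" if "b \<in> Basis" for k b
    using that by (simp add: inner_sum_left_Basis)
  have [measurable]: "g \<in> borel_measurable borel" using g by simp
  have cis_int: "integrable lborel (\<lambda>u. cis (- (\<kappa> \<bullet> u / r)) * g u)" for \<kappa>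
    by (rule Bochner_Integration.integrable_bound[OF g]) (auto simp: norm_mult)
  have expand: "fejer_density_n M r u *\<^sub>R g (v + u)
      = (\<Sum>k\<in>?K. of_real (w M (?vec k) / (2 * pi * r) ^ DIM('a)) * (cis (?vec k \<bullet> v / r) *
          (cis (- (?vec k \<bullet> (v + u) / r)) * g (v + u))))" for u
  proof (cases "g (v + u) = 0")
    case False
    have "fejer_density M r (u \<bullet> b) = fejer M (u \<bullet> b / r) / (2 * pi * r)" if "b \<in> Basis" for b
      using supp[OF False that] by (auto simp: fejer_density_def inner_simps indicator_def abs_le_iff)
    then have "complex_of_real (fejer_density_n M r u)
        = (\<Prod>b\<in>Basis. cnj (complex_of_real (fejer M (u \<bullet> b / r))) / of_real (2 * pi * r))"
      by (simp add: fejer_density_n_def)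
    also have "\<dots> = (\<Prod>b\<in>Basis. \<Sum>k\<in>{-int M..int M}.
        of_real (1 - \<bar>real_of_int k\<bar> / real (M + 1)) * cis (- (real_of_int k * (u \<bullet> b / r)))) /
        of_real (2 * pi * r) ^ DIM('a)"
      unfolding fejer_expansion by (simp add: prod_dividef cis_cnj)
    also have "(\<Prod>b\<in>(Basis::'a set). \<Sum>k\<in>{-int M..int M}.
        of_real (1 - \<bar>real_of_int k\<bar> / real (M + 1)) * cis (- (real_of_int k * (u \<bullet> b / r))))
      = (\<Sum>k\<in>?K. \<Prod>b\<in>Basis. of_real (1 - \<bar>real_of_int (k b)\<bar> / real (M + 1)) * cis (- (real_of_int (k b) * (u \<bullet> b / r))))"
      by (rule prod_sum_PiE) auto
    also have "\<dots> = (\<Sum>k\<in>?K. of_real (w M (?vec k)) * cis (- (?vec k \<bullet> u / r)))"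
    proof (rule sum.cong[OF refl])
      fix k assume k: "k \<in> ?K"
      have "max 0 (1 - \<bar>?vec k \<bullet> b\<bar> / real (M + 1)) = 1 - \<bar>real_of_int (k b)\<bar> / real (M + 1)"
        if "b \<in> Basis" for b
      proof -
        have "\<bar>k b\<bar> \<le> int M" using PiE_mem[OF k that] by auto
        then have "\<bar>real_of_int (k b)\<bar> \<le> real (M + 1)" by linarith
        then show ?thesis by (simp add: vec[OF that])
      qed
      moreover have "?vec k \<bullet> u = (\<Sum>b\<in>Basis. real_of_int (k b) * (u \<bullet> b))"
        by (simp add: inner_sum_left inner_commute[of u])
      ultimately show "(\<Prod>b\<in>Basis. of_real (1 - \<bar>real_of_int (k b)\<bar> / real (M + 1)) * cis (- (real_of_int (k b) * (u \<bullet> b / r))))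
          = of_real (w M (?vec k)) * cis (- (?vec k \<bullet> u / r))"
        by (simp add: w_def prod.distrib prod_cis sum_negf sum_divide_distrib of_real_prod)
    qed
    finally have "fejer_density_n M r u *\<^sub>R g (v + u)
      = (\<Sum>k\<in>?K. of_real (w M (?vec k)) * cis (- (?vec k \<bullet> u / r))) / of_real (2 * pi * r) ^ DIM('a) * g (v + u)"
      by (simp add: scaleR_conv_of_real)
    also have "\<dots> = (\<Sum>k\<in>?K. of_real (w M (?vec k) / (2 * pi * r) ^ DIM('a)) * (cis (?vec k \<bullet> v / r) *
          (cis (- (?vec k \<bullet> (v + u) / r)) * g (v + u))))"
      unfolding sum_divide_distrib sum_distrib_right
    proof (rule sum.cong[OF refl])
      fix k
      have "cis (- (?vec k \<bullet> u / r)) = cis (?vec k \<bullet> v / r) * cis (- (?vec k \<bullet> (v + u) / r))"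
        by (simp add: cis_mult inner_add_right add_divide_distrib)
      then show "of_real (w M (?vec k)) * cis (- (?vec k \<bullet> u / r)) / of_real (2 * pi * r) ^ DIM('a) * g (v + u)
         = of_real (w M (?vec k) / (2 * pi * r) ^ DIM('a)) * (cis (?vec k \<bullet> v / r) *
          (cis (- (?vec k \<bullet> (v + u) / r)) * g (v + u)))"
        by simp
    qed
    finally show ?thesis .
  qed simp
  let ?t = "\<lambda>\<kappa>. of_real (w M \<kappa> / (2 * pi * r) ^ DIM('a)) *
        (cis (\<kappa> \<bullet> v / r) * (\<integral>u. cis (- (\<kappa> \<bullet> u / r)) * g u \<partial>lborel))"
  have "(\<integral>u. fejer_density_n M r u *\<^sub>R g (v + u) \<partial>lborel)
      = (\<Sum>k\<in>?K. of_real (w M (?vec k) / (2 * pi * r) ^ DIM('a)) * (cis (?vec k \<bullet> v / r) *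
          (\<integral>u. cis (- (?vec k \<bullet> (v + u) / r)) * g (v + u) \<partial>lborel)))"
  proof -
    have "integrable lborel (\<lambda>u. of_real (w M (?vec k) / (2 * pi * r) ^ DIM('a)) * (cis (?vec k \<bullet> v / r) *
          (cis (- (?vec k \<bullet> (v + u) / r)) * g (v + u))))" for k
      by (intro integrable_mult_right lborel_integrable_translate[OF cis_int])
    then show ?thesis unfolding expand by (subst Bochner_Integration.integral_sum) simp_all
  qed
  also have "\<dots> = (\<Sum>k\<in>?K. ?t (?vec k))"
    by (subst lborel_integral_translate) auto
  also have "\<dots> = (\<Sum>\<kappa>\<in>?vec ` ?K. ?t \<kappa>)"
  proof (rule sum.reindex_cong[symmetric, OF _ refl refl])
    show "inj_on ?vec ?K"
    proof (rule inj_onI)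
      fix k l assume kl: "k \<in> ?K" "l \<in> ?K" "?vec k = ?vec l"
      show "k = l"
      proof (rule PiE_ext[OF kl(1,2)])
        fix b :: 'a assume "b \<in> Basis"
        then show "k b = l b" using vec[of b k] vec[of b l] kl(3) by simp
      qed
    qed
  qed
  also have "\<dots> = (\<Sum>\<^sub>\<infinity>\<kappa>\<in>?vec ` ?K. ?t \<kappa>)"
    by (subst infsum_finite) (auto intro!: finite_imageI finite_PiE)
  also have "\<dots> = (\<Sum>\<^sub>\<infinity>\<kappa>\<in>int_lattice. ?t \<kappa>)"
  proof (rule infsum_cong_neutral)
    fix \<kappa> :: 'a assume \<kappa>: "\<kappa> \<in> int_lattice - ?vec ` ?K"
    then obtain k where k: "\<And>b. b \<in> Basis \<Longrightarrow> \<kappa> \<bullet> b = real_of_int (k b)"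
      unfolding Diff_iff int_lattice_iff by metis
    have eq: "\<kappa> = ?vec (restrict k Basis)" using k by (subst euclidean_eq_iff) (simp add: vec)
    then have "restrict k Basis \<notin> ?K" using \<kappa> by blast
    then have "\<not> (\<forall>b\<in>Basis. k b \<in> {- int M..int M})" unfolding restrict_PiE_iff .
    then obtain b where b: "b \<in> Basis" "k b \<notin> {- int M..int M}" by blast
    then have "int M + 1 \<le> \<bar>k b\<bar>" by auto
    then have "real (M + 1) \<le> \<bar>\<kappa> \<bullet> b\<bar>" using k[OF b(1)] by linarith
    then have "max 0 (1 - \<bar>\<kappa> \<bullet> b\<bar> / real (M + 1)) = 0" by (simp add: field_simps)
    then have "w M \<kappa> = 0" unfolding w_def using b(1) by (intro prod_zero) auto
    then show "?t \<kappa> = 0" by simp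
  next
    fix \<kappa> assume "\<kappa> \<in> ?vec ` ?K - int_lattice"
    then show "?t \<kappa> = 0" by (auto simp: int_lattice_def vec)
  qed simp
  finally show ?thesis .
qed

text \<open>Both sides are limits of the Fejer averages of \<open>g\<close> at \<open>v\<close>. The hypothesis on the support says that
  it lies in one period around \<open>v\<close>, where \<open>g\<close> agrees with its periodisation.\<close>

theorem fourier_inversion:
  fixes g :: "'a::euclidean_space \<Rightarrow> complex"
  assumes r: "0 < r" and g: "integrable lborel g" and cont: "isCont g v" and bd: "\<And>u. cmod (g u) \<le> B"
    and supp: "\<And>u b. g u \<noteq> 0 \<Longrightarrow> b \<in> Basis \<Longrightarrow> \<bar>(u - v) \<bullet> b\<bar> \<le> pi * r"
    and sm: "(\<lambda>\<kappa>. cmod (\<integral>u. cis (- (\<kappa> \<bullet> u / r)) * g u \<partial>lborel)) summable_on int_lattice"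
  shows "g v = (\<Sum>\<^sub>\<infinity>\<kappa>\<in>int_lattice. of_real (1 / (2 * pi * r) ^ DIM('a)) *
        (cis (\<kappa> \<bullet> v / r) * (\<integral>u. cis (- (\<kappa> \<bullet> u / r)) * g u \<partial>lborel)))"
proof -
  have [measurable]: "g \<in> borel_measurable borel" using g by simp
  let ?c = "\<lambda>\<kappa>. \<integral>u. cis (- (\<kappa> \<bullet> u / r)) * g u \<partial>lborel"
  let ?w = "\<lambda>M \<kappa>. \<Prod>b\<in>Basis. max 0 (1 - \<bar>\<kappa> \<bullet> b\<bar> / real (M + 1))"
  let ?P = "(2 * pi * r) ^ DIM('a)"
  have P: "0 < ?P" using r by simp
  have "isCont (\<lambda>u. g (v + u)) 0"
    by (rule isCont_o2[of _ "\<lambda>u. v + u"]) (use cont in \<open>auto intro!: continuous_intros\<close>)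
  then have lim1: "(\<lambda>M. \<integral>u. fejer_density_n M r u *\<^sub>R g (v + u) \<partial>lborel) \<longlonglongrightarrow> g (v + 0)"
    by (rule fejer_approximate_identity[OF r]) (auto intro: bd)
  have lim2: "(\<lambda>M. \<Sum>\<^sub>\<infinity>\<kappa>\<in>int_lattice. of_real (?w M \<kappa> / ?P) * (cis (\<kappa> \<bullet> v / r) * ?c \<kappa>))
      \<longlonglongrightarrow> (\<Sum>\<^sub>\<infinity>\<kappa>\<in>int_lattice. of_real (1 / ?P) * (cis (\<kappa> \<bullet> v / r) * ?c \<kappa>))"
  proof (rule tendsto_infsum_dominated)
    fix \<kappa> :: 'a
    have "(\<lambda>M. max 0 (1 - \<bar>\<kappa> \<bullet> b\<bar> * (1 / real (M + 1)))) \<longlonglongrightarrow> max 0 (1 - \<bar>\<kappa> \<bullet> b\<bar> * 0)" for b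
      by (intro tendsto_intros) (use LIMSEQ_inverse_real_of_nat in \<open>simp add: inverse_eq_divide\<close>)
    then have "(\<lambda>M. ?w M \<kappa>) \<longlonglongrightarrow> (\<Prod>b\<in>(Basis::'a set). 1)" by (intro tendsto_prod) simp
    then show "(\<lambda>M. of_real (?w M \<kappa> / ?P) * (cis (\<kappa> \<bullet> v / r) * ?c \<kappa>))
        \<longlonglongrightarrow> of_real (1 / ?P) * (cis (\<kappa> \<bullet> v / r) * ?c \<kappa>)"
      using P r by (intro tendsto_intros) auto
    fix M
    have "\<bar>?w M \<kappa>\<bar> \<le> 1" unfolding abs_prod by (intro prod_le_1) auto
    then have "\<bar>?w M \<kappa>\<bar> / ?P \<le> 1 / ?P" using P by (intro divide_right_mono) auto
    then have "\<bar>?w M \<kappa>\<bar> / ?P * cmod (?c \<kappa>) \<le> 1 / ?P * cmod (?c \<kappa>)" by (rule mult_right_mono) simp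
    then show "cmod (of_real (?w M \<kappa> / ?P) * (cis (\<kappa> \<bullet> v / r) * ?c \<kappa>)) \<le> 1 / ?P * cmod (?c \<kappa>)"
      using P by (simp only: norm_mult norm_of_real norm_cis mult_1_left abs_divide abs_of_pos)
  qed (rule summable_on_cmult_right[OF sm])
  have "(\<lambda>M. \<integral>u. fejer_density_n M r u *\<^sub>R g (v + u) \<partial>lborel)
      \<longlonglongrightarrow> (\<Sum>\<^sub>\<infinity>\<kappa>\<in>int_lattice. of_real (1 / ?P) * (cis (\<kappa> \<bullet> v / r) * ?c \<kappa>))"
  proof -
    have "(\<integral>u. fejer_density_n M r u *\<^sub>R g (v + u) \<partial>lborel)
      = (\<Sum>\<^sub>\<infinity>\<kappa>\<in>int_lattice. of_real (?w M \<kappa> / ?P) * (cis (\<kappa> \<bullet> v / r) * ?c \<kappa>))" for M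
      by (rule fejer_average_eq_sum[OF r g]) (use supp in auto)
    then show ?thesis using lim2 by simp
  qed
  from LIMSEQ_unique[OF lim1 this] show ?thesis by simp
qed

section \<open>Decay of the Fourier coefficients of a localised amplitude\<close>

text \<open>The sequence \<open>\<phi>\<close> lists a cutoff function and its first \<open>n\<close> derivatives.\<close>

definition cutoff :: "nat \<Rightarrow> real \<Rightarrow> (nat \<Rightarrow> real \<Rightarrow> real) \<Rightarrow> bool" where
  "cutoff n B \<phi> \<longleftrightarrow> 1 \<le> B \<and> (\<forall>k<n. \<forall>t. (\<phi> k has_real_derivative \<phi> (Suc k) t) (at t)) \<and>
    (\<forall>k\<le>n. continuous_on UNIV (\<phi> k) \<and> (\<forall>t. 2 \<le> \<bar>t\<bar> \<longrightarrow> \<phi> k t = 0) \<and> (\<forall>t. \<bar>\<phi> k t\<bar> \<le> B)) \<and>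
    (\<forall>t. \<bar>t\<bar> \<le> 1 \<longrightarrow> \<phi> 0 t = 1)"

lemma cutoff_exists: "\<exists>B \<phi>. cutoff n B \<phi>"
proof -
  obtain \<phi> :: "nat \<Rightarrow> real \<Rightarrow> real" where \<phi>:
    "\<forall>k<n. \<forall>t. (\<phi> k has_real_derivative \<phi> (Suc k) t) (at t)"
    "\<forall>k\<le>n. continuous_on UNIV (\<phi> k) \<and> (\<forall>t. 2 \<le> \<bar>t\<bar> \<longrightarrow> \<phi> k t = 0)"
    "\<forall>t. \<bar>t\<bar> \<le> 1 \<longrightarrow> \<phi> 0 t = 1"
    using smooth_cutoff_exists[OF zero_less_one, of 2 n] by (auto simp del: all_simps)
  obtain B where "1 \<le> B" "\<forall>k\<le>n. \<forall>t. \<bar>\<phi> k t\<bar> \<le> B"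
    using cutoff_bounded[of n \<phi> 2] \<phi>(2) by blast
  then have "cutoff n B \<phi>" unfolding cutoff_def using \<phi> by simp
  then show ?thesis by blast
qed

text \<open>A product of cutoffs at \<open>u\<close>, with \<open>k\<close> derivatives on the factor of the coordinate \<open>i\<close>.\<close>

definition box_cutoff :: "(nat \<Rightarrow> real \<Rightarrow> real) \<Rightarrow> real \<Rightarrow> 'a::euclidean_space \<Rightarrow> 'a \<Rightarrow> nat \<Rightarrow> 'a \<Rightarrow> real" where
  "box_cutoff \<phi> \<rho> u i k w =
    \<phi> k (((w - u) \<bullet> i) / \<rho>) * (\<Prod>b\<in>Basis - {i}. \<phi> 0 (((w - u) \<bullet> b) / \<rho>))"

lemma box_cutoff_0:
  "i \<in> Basis \<Longrightarrow> box_cutoff \<phi> \<rho> u i 0 w = (\<Prod>b\<in>Basis. \<phi> 0 (((w - u) \<bullet> b) / \<rho>))"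
  by (simp add: box_cutoff_def prod.remove[of Basis i])

context
  fixes n :: nat and B \<rho> :: real and \<phi> :: "nat \<Rightarrow> real \<Rightarrow> real"
  assumes cut: "cutoff n B \<phi>" and \<rho>: "0 < \<rho>"
begin

lemma continuous_box_cutoff:
  assumes "k \<le> n"
  shows "continuous_on UNIV (box_cutoff \<phi> \<rho> u i k)"
proof -
  have "continuous_on UNIV (\<lambda>w. \<phi> l (((w - u) \<bullet> b) / \<rho>))" if "l \<le> n" for l b
    by (rule continuous_on_compose2[of UNIV "\<phi> l"])
      (use cut that \<rho> in \<open>auto simp: cutoff_def intro!: continuous_intros\<close>)
  then show ?thesis unfolding box_cutoff_def[abs_def] using assms by (intro continuous_intros) auto
qed

lemma box_cutoff_le:
  assumes "k \<le> n" "i \<in> Basis"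
  shows "\<bar>box_cutoff \<phi> \<rho> u i k (w :: 'a::euclidean_space)\<bar> \<le> B ^ DIM('a)"
proof -
  have b: "\<bar>\<phi> l t\<bar> \<le> B" if "l \<le> n" for l t using cut that by (simp add: cutoff_def)
  have B0: "0 \<le> B" using cut by (simp add: cutoff_def)
  have "\<bar>box_cutoff \<phi> \<rho> u i k w\<bar> \<le> B * (\<Prod>b\<in>Basis - {i}. B)"
    unfolding box_cutoff_def abs_mult abs_prod
    using b[OF assms(1)] b[of 0] B0 by (intro mult_mono prod_mono) (auto intro: prod_nonneg)
  also have "\<dots> = B ^ Suc (DIM('a) - 1)"
    by (simp only: prod_constant card_Diff_singleton[OF assms(2)] power_Suc)
  also have "Suc (DIM('a) - 1) = DIM('a)" using DIM_positive[where 'a='a] by linarith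
  finally show ?thesis .
qed

lemma box_cutoff_eq_0:
  assumes "k \<le> n" "i \<in> Basis" "w \<notin> cbox (u - (2 * \<rho>) *\<^sub>R One) (u + (2 * \<rho>) *\<^sub>R One)"
  shows "box_cutoff \<phi> \<rho> u i k w = 0"
proof -
  obtain b where b: "b \<in> Basis" "\<not> (\<bar>(w - u) \<bullet> b\<bar> \<le> 2 * \<rho>)"
    using assms(3) by (auto simp: mem_box inner_simps abs_le_iff algebra_simps)
  then have "2 \<le> \<bar>((w - u) \<bullet> b) / \<rho>\<bar>" using \<rho> by (simp add: field_simps)
  then have z: "\<phi> l (((w - u) \<bullet> b) / \<rho>) = 0" if "l \<le> n" for l
    using cut that by (simp add: cutoff_def)
  show ?thesis
  proof (cases "b = i")
    case True
    then show ?thesis using z[OF assms(1)] by (simp add: box_cutoff_def)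
  next
    case False
    then have "(\<Prod>b\<in>Basis - {i}. \<phi> 0 (((w - u) \<bullet> b) / \<rho>)) = 0"
      using z[of 0] b(1) by (intro prod_zero) auto
    then show ?thesis by (simp add: box_cutoff_def)
  qed
qed

lemma box_cutoff_eq_1:
  assumes "i \<in> Basis" "\<And>b. b \<in> Basis \<Longrightarrow> \<bar>(w - u) \<bullet> b\<bar> \<le> \<rho>"
  shows "box_cutoff \<phi> \<rho> u i 0 w = 1"
  unfolding box_cutoff_0[OF assms(1)]
  using cut assms(2) \<rho> by (intro prod.neutral) (auto simp: cutoff_def field_simps)

lemma box_cutoff_derivative:
  assumes "k < n" "i \<in> Basis"
  shows "((\<lambda>t. box_cutoff \<phi> \<rho> u i k (w + t *\<^sub>R i)) has_real_derivative
    box_cutoff \<phi> \<rho> u i (Suc k) (w + t *\<^sub>R i) / \<rho>) (at t)"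
proof -
  have other: "(\<Prod>b\<in>Basis - {i}. \<phi> 0 (((w + t *\<^sub>R i - u) \<bullet> b) / \<rho>))
      = (\<Prod>b\<in>Basis - {i}. \<phi> 0 (((w - u) \<bullet> b) / \<rho>))" for t
    using assms(2) by (intro prod.cong refl) (auto simp: inner_simps inner_Basis)
  have arg: "((w + t *\<^sub>R i - u) \<bullet> i) / \<rho> = ((w - u) \<bullet> i) / \<rho> + t * (1 / \<rho>)" for t
    using assms(2) by (simp add: inner_simps add_divide_distrib diff_divide_distrib)
  have "((\<lambda>t. \<phi> k (((w - u) \<bullet> i) / \<rho> + t * (1 / \<rho>))) has_real_derivative
      \<phi> (Suc k) (((w - u) \<bullet> i) / \<rho> + t * (1 / \<rho>)) * (1 / \<rho>)) (at t)"
    by (rule DERIV_chain2[of "\<phi> k"]) (use cut assms(1) \<rho> in \<open>auto simp: cutoff_def intro!: derivative_eq_intros\<close>)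
  then show ?thesis unfolding box_cutoff_def other arg
    by (auto intro!: derivative_eq_intros simp: mult_ac)
qed

end

text \<open>The weight against which the amplitude is integrated to obtain the Fourier coefficient of
  frequency \<open>(\<eta>, \<eta>')\<close> of its localisation. The phase has a part that depends on the variable \<open>\<xi>\<close>;
  differentiating it produces the powers of \<open>\<theta>\<close>. The family is indexed so as to be closed under
  differentiation in the directions \<open>i\<close> of \<open>w\<close> and \<open>i'\<close> of \<open>z\<close>.\<close>

definition amp_weight ::
  "(nat \<Rightarrow> real \<Rightarrow> real) \<Rightarrow> real \<Rightarrow> 'a::euclidean_space \<Rightarrow> 'a \<Rightarrow> ('a \<Rightarrow> 'a) \<Rightarrow> ('a \<Rightarrow> 'a) \<Rightarrow> ('a \<Rightarrow> complex) \<Rightarrow>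
    'a \<Rightarrow> 'a \<Rightarrow> 'a \<Rightarrow> nat \<Rightarrow> nat \<Rightarrow> 'a \<Rightarrow> nat \<Rightarrow> nat \<Rightarrow> 'a \<times> 'a \<times> 'a \<Rightarrow> complex" where
  "amp_weight \<phi> \<rho> w0 z0 \<theta> \<theta>' \<omega> \<eta> \<eta>' i k c i' k' c' x =
    \<omega> (snd (snd x)) * of_real ((\<theta> (snd (snd x)) \<bullet> i) ^ c * (\<theta>' (snd (snd x)) \<bullet> i') ^ c') *
    of_real (box_cutoff \<phi> \<rho> w0 i k (fst x) * box_cutoff \<phi> \<rho> z0 i' k' (fst (snd x))) *
    cis (fst x \<bullet> (\<theta> (snd (snd x)) - \<eta>) + fst (snd x) \<bullet> (\<theta>' (snd (snd x)) - \<eta>'))"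

lemma has_vector_derivative_cis_linear:
  "((\<lambda>t. cis (\<alpha> + t * \<beta>)) has_vector_derivative (\<i> * of_real \<beta>) * cis (\<alpha> + t * \<beta>)) (at t)"
  unfolding cis_conv_exp
  by (auto intro!: derivative_eq_intros has_vector_derivative_real_field simp: algebra_simps)

context
  fixes n :: nat and B \<rho> :: real and \<phi> :: "nat \<Rightarrow> real \<Rightarrow> real"
    and \<Theta> :: real and \<theta> \<theta>' :: "'a::euclidean_space \<Rightarrow> 'a" and \<omega> :: "'a \<Rightarrow> complex" and w0 z0 c1 c2 :: 'a
  assumes cut: "cutoff n B \<phi>" and \<rho>: "0 < \<rho>" and \<Theta>: "1 \<le> \<Theta>"
    and \<theta>_meas [measurable]: "\<theta> \<in> borel_measurable borel" "\<theta>' \<in> borel_measurable borel"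
    and \<omega>_meas [measurable]: "\<omega> \<in> borel_measurable borel"
    and \<theta>_le: "\<And>\<xi> b. \<xi> \<in> cbox c1 c2 \<Longrightarrow> b \<in> Basis \<Longrightarrow> \<bar>\<theta> \<xi> \<bullet> b\<bar> \<le> \<Theta>"
      "\<And>\<xi> b. \<xi> \<in> cbox c1 c2 \<Longrightarrow> b \<in> Basis \<Longrightarrow> \<bar>\<theta>' \<xi> \<bullet> b\<bar> \<le> \<Theta>"
    and \<omega>_le: "\<And>\<xi>. cmod (\<omega> \<xi>) \<le> 1" and \<omega>_supp: "\<And>\<xi>. \<xi> \<notin> cbox c1 c2 \<Longrightarrow> \<omega> \<xi> = 0"
begin

abbreviation (input) support_box :: "('a \<times> 'a \<times> 'a) set" where
  "support_box \<equiv> cbox (w0 - (2 * \<rho>) *\<^sub>R One, z0 - (2 * \<rho>) *\<^sub>R One, c1)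
    (w0 + (2 * \<rho>) *\<^sub>R One, z0 + (2 * \<rho>) *\<^sub>R One, c2)"

abbreviation (input) "W \<equiv> amp_weight \<phi> \<rho> w0 z0 \<theta> \<theta>' \<omega>"

lemma measurable_amp_weight:
  assumes "k \<le> n" "k' \<le> n"
  shows "W \<eta> \<eta>' i k c i' k' c' \<in> borel_measurable borel"
proof -
  have [measurable]: "fst \<in> borel_measurable (borel :: ('a \<times> 'a \<times> 'a) measure)"
    "snd \<in> borel_measurable (borel :: ('a \<times> 'a \<times> 'a) measure)"
    "fst \<in> borel_measurable (borel :: ('a \<times> 'a) measure)"
    "snd \<in> borel_measurable (borel :: ('a \<times> 'a) measure)"
    by (intro borel_measurable_continuous_onI continuous_intros)+
  have [measurable]: "box_cutoff \<phi> \<rho> u b l \<in> borel_measurable borel" if "l \<le> n" for u b :: 'a and l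
    by (rule borel_measurable_continuous_onI[OF continuous_box_cutoff[OF cut \<rho> that]])
  note [measurable] = this[OF assms(1)] this[OF assms(2)]
  show ?thesis unfolding amp_weight_def[abs_def] by measurable
qed

lemma amp_weight_le:
  assumes "k \<le> n" "k' \<le> n" "c \<le> n" "c' \<le> n" "i \<in> Basis" "i' \<in> Basis"
  shows "cmod (W \<eta> \<eta>' i k c i' k' c' x) \<le> \<Theta> ^ (2 * n) * B ^ (2 * DIM('a))"
proof -
  have B: "1 \<le> B" using cut by (simp add: cutoff_def)
  obtain w z \<xi> where x: "x = (w, z, \<xi>)" by (cases x) auto
  show ?thesis
  proof (cases "\<xi> \<in> cbox c1 c2")
    case True
    have pow: "\<bar>y ^ l\<bar> \<le> \<Theta> ^ n" if "\<bar>y\<bar> \<le> \<Theta>" "l \<le> n" for y l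
      using order_trans[OF power_mono[OF that(1), of l] power_increasing[OF that(2) \<Theta>]]
      by (simp add: power_abs)
    have "cmod (W \<eta> \<eta>' i k c i' k' c' x) = cmod (\<omega> \<xi>) * (\<bar>(\<theta> \<xi> \<bullet> i) ^ c\<bar> * \<bar>(\<theta>' \<xi> \<bullet> i') ^ c'\<bar>) *
        (\<bar>box_cutoff \<phi> \<rho> w0 i k w\<bar> * \<bar>box_cutoff \<phi> \<rho> z0 i' k' z\<bar>)"
      unfolding amp_weight_def x fst_conv snd_conv norm_mult norm_of_real abs_mult norm_cis by simp
    also have "\<dots> \<le> 1 * (\<Theta> ^ n * \<Theta> ^ n) * (B ^ DIM('a) * B ^ DIM('a))"
      using assms \<Theta> B
      by (intro mult_mono pow \<theta>_le True \<omega>_le box_cutoff_le[OF cut \<rho>]) auto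
    finally show ?thesis by (simp add: mult_2 power_add)
  next
    case False
    then show ?thesis using \<Theta> B by (simp add: amp_weight_def x \<omega>_supp)
  qed
qed

lemma amp_weight_eq_0:
  assumes "k \<le> n" "k' \<le> n" "i \<in> Basis" "i' \<in> Basis" "x \<notin> support_box"
  shows "W \<eta> \<eta>' i k c i' k' c' x = 0"
proof -
  obtain w z \<xi> where x: "x = (w, z, \<xi>)" by (cases x) auto
  then have "w \<notin> cbox (w0 - (2 * \<rho>) *\<^sub>R One) (w0 + (2 * \<rho>) *\<^sub>R One) \<or>
      z \<notin> cbox (z0 - (2 * \<rho>) *\<^sub>R One) (z0 + (2 * \<rho>) *\<^sub>R One) \<or> \<xi> \<notin> cbox c1 c2"
    using assms(5) by (auto simp: cbox_Pair_eq)
  then show ?thesis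
    by (elim disjE) (simp_all add: amp_weight_def x \<omega>_supp box_cutoff_eq_0[OF cut \<rho>] assms)
qed

lemma amp_weight_derivative_w:
  assumes "k < n" "i \<in> Basis" "i' \<in> Basis"
  shows "((\<lambda>t. W \<eta> \<eta>' i k c i' k' c' (x + t *\<^sub>R (i, 0, 0))) has_vector_derivative
    (of_real (1 / \<rho>) * W \<eta> \<eta>' i (Suc k) c i' k' c' (x + t *\<^sub>R (i, 0, 0))
      + \<i> * W \<eta> \<eta>' i k (Suc c) i' k' c' (x + t *\<^sub>R (i, 0, 0))
      - \<i> * of_real (\<eta> \<bullet> i) * W \<eta> \<eta>' i k c i' k' c' (x + t *\<^sub>R (i, 0, 0)))) (at t)"
proof -
  obtain w z \<xi> where x: "x = (w, z, \<xi>)" by (cases x) auto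
  let ?A = "\<omega> \<xi> * of_real ((\<theta> \<xi> \<bullet> i) ^ c * (\<theta>' \<xi> \<bullet> i') ^ c') * of_real (box_cutoff \<phi> \<rho> z0 i' k' z)"
  let ?\<alpha> = "w \<bullet> (\<theta> \<xi> - \<eta>) + z \<bullet> (\<theta>' \<xi> - \<eta>')" and ?\<beta> = "(\<theta> \<xi> - \<eta>) \<bullet> i"
  have eq: "W \<eta> \<eta>' i k c i' k' c' (x + t *\<^sub>R (i, 0, 0))
      = ?A * (of_real (box_cutoff \<phi> \<rho> w0 i k (w + t *\<^sub>R i)) * cis (?\<alpha> + t * ?\<beta>))" for k t
  proof -
    have "(w + t *\<^sub>R i) \<bullet> (\<theta> \<xi> - \<eta>) + z \<bullet> (\<theta>' \<xi> - \<eta>') = ?\<alpha> + t * ?\<beta>"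
      by (simp add: inner_add_left inner_commute[of i] inner_commute[of i'])
    then show ?thesis by (simp add: amp_weight_def x mult_ac add_ac)
  qed
  have eqS: "W \<eta> \<eta>' i k (Suc c) i' k' c' (x + t *\<^sub>R (i, 0, 0))
      = of_real (\<theta> \<xi> \<bullet> i) * W \<eta> \<eta>' i k c i' k' c' (x + t *\<^sub>R (i, 0, 0))" for t
    by (simp add: amp_weight_def x mult_ac)
  have d1: "((\<lambda>t. complex_of_real (box_cutoff \<phi> \<rho> w0 i k (w + t *\<^sub>R i))) has_vector_derivative
      of_real (box_cutoff \<phi> \<rho> w0 i (Suc k) (w + t *\<^sub>R i) / \<rho>)) (at t)"
    by (rule has_vector_derivative_of_real) (rule box_cutoff_derivative[OF cut \<rho> assms(1,2)])
  show ?thesis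
    unfolding eqS unfolding eq
    by (rule has_vector_derivative_eq_rhs[OF has_vector_derivative_mult[OF has_vector_derivative_const
          has_vector_derivative_mult[OF d1 has_vector_derivative_cis_linear]]])
      (simp add: algebra_simps inner_diff_left)
qed

lemma amp_weight_derivative_z:
  assumes "k' < n" "i \<in> Basis" "i' \<in> Basis"
  shows "((\<lambda>t. W \<eta> \<eta>' i k c i' k' c' (x + t *\<^sub>R (0, i', 0))) has_vector_derivative
    (of_real (1 / \<rho>) * W \<eta> \<eta>' i k c i' (Suc k') c' (x + t *\<^sub>R (0, i', 0))
      + \<i> * W \<eta> \<eta>' i k c i' k' (Suc c') (x + t *\<^sub>R (0, i', 0))
      - \<i> * of_real (\<eta>' \<bullet> i') * W \<eta> \<eta>' i k c i' k' c' (x + t *\<^sub>R (0, i', 0)))) (at t)"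
proof -
  obtain w z \<xi> where x: "x = (w, z, \<xi>)" by (cases x) auto
  let ?A = "\<omega> \<xi> * of_real ((\<theta> \<xi> \<bullet> i) ^ c * (\<theta>' \<xi> \<bullet> i') ^ c') * of_real (box_cutoff \<phi> \<rho> w0 i k w)"
  let ?\<alpha> = "w \<bullet> (\<theta> \<xi> - \<eta>) + z \<bullet> (\<theta>' \<xi> - \<eta>')" and ?\<beta> = "(\<theta>' \<xi> - \<eta>') \<bullet> i'"
  have eq: "W \<eta> \<eta>' i k c i' k' c' (x + t *\<^sub>R (0, i', 0))
      = ?A * (of_real (box_cutoff \<phi> \<rho> z0 i' k' (z + t *\<^sub>R i')) * cis (?\<alpha> + t * ?\<beta>))" for k' t
  proof -
    have "w \<bullet> (\<theta> \<xi> - \<eta>) + (z + t *\<^sub>R i') \<bullet> (\<theta>' \<xi> - \<eta>') = ?\<alpha> + t * ?\<beta>"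
      by (simp add: inner_add_left inner_commute[of i] inner_commute[of i'])
    then show ?thesis by (simp add: amp_weight_def x mult_ac add_ac)
  qed
  have eqS: "W \<eta> \<eta>' i k c i' k' (Suc c') (x + t *\<^sub>R (0, i', 0))
      = of_real (\<theta>' \<xi> \<bullet> i') * W \<eta> \<eta>' i k c i' k' c' (x + t *\<^sub>R (0, i', 0))" for t
    by (simp add: amp_weight_def x mult_ac)
  have d1: "((\<lambda>t. complex_of_real (box_cutoff \<phi> \<rho> z0 i' k' (z + t *\<^sub>R i'))) has_vector_derivative
      of_real (box_cutoff \<phi> \<rho> z0 i' (Suc k') (z + t *\<^sub>R i') / \<rho>)) (at t)"
    by (rule has_vector_derivative_of_real) (rule box_cutoff_derivative[OF cut \<rho> assms(1,3)])
  show ?thesis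
    unfolding eqS unfolding eq
    by (rule has_vector_derivative_eq_rhs[OF has_vector_derivative_mult[OF has_vector_derivative_const
          has_vector_derivative_mult[OF d1 has_vector_derivative_cis_linear]]])
      (simp add: algebra_simps inner_diff_left)
qed

lemma continuous_amp_weight_line:
  assumes "k \<le> n" "k' \<le> n" "snd (snd e) = 0"
  shows "continuous_on UNIV (\<lambda>t::real. W \<eta> \<eta>' i k c i' k' c' (x + t *\<^sub>R e))"
proof -
  have "continuous_on UNIV (\<lambda>t::real. box_cutoff \<phi> \<rho> u b l (v + t *\<^sub>R d))" if "l \<le> n" for u b v d :: 'a and l
    by (rule continuous_on_compose2[OF continuous_box_cutoff[OF cut \<rho> that]]) (auto intro!: continuous_intros)
  then show ?thesis
    unfolding amp_weight_def cis_conv_exp using assms by (auto intro!: continuous_intros)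
qed

lemma amp_weight_parts_w:
  assumes D: "continuous_on UNIV D" "continuous_on UNIV D'"
    and der: "\<And>x t. ((\<lambda>t. D (x + t *\<^sub>R (i, 0, 0))) has_vector_derivative D' (x + t *\<^sub>R (i, 0, 0))) (at t)"
    and i: "i \<in> Basis" "i' \<in> Basis" and k: "k < n" "c < n" "k' \<le> n" "c' \<le> n"
  shows "\<i> * of_real (\<eta> \<bullet> i) * (\<integral>x. W \<eta> \<eta>' i k c i' k' c' x * D x \<partial>lborel)
      = (\<integral>x. W \<eta> \<eta>' i k c i' k' c' x * D' x \<partial>lborel)
        + of_real (1 / \<rho>) * (\<integral>x. W \<eta> \<eta>' i (Suc k) c i' k' c' x * D x \<partial>lborel)
        + \<i> * (\<integral>x. W \<eta> \<eta>' i k (Suc c) i' k' c' x * D x \<partial>lborel)"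
  by (rule integration_by_parts_split[OF measurable_amp_weight measurable_amp_weight measurable_amp_weight
        amp_weight_le amp_weight_le amp_weight_le amp_weight_eq_0 amp_weight_eq_0 amp_weight_eq_0
        compact_cbox D amp_weight_derivative_w continuous_amp_weight_line continuous_amp_weight_line der])
    (use i k in auto)

lemma amp_weight_parts_z:
  assumes D: "continuous_on UNIV D" "continuous_on UNIV D'"
    and der: "\<And>x t. ((\<lambda>t. D (x + t *\<^sub>R (0, i', 0))) has_vector_derivative D' (x + t *\<^sub>R (0, i', 0))) (at t)"
    and i: "i \<in> Basis" "i' \<in> Basis" and k: "k' < n" "c' < n" "k \<le> n" "c \<le> n"
  shows "\<i> * of_real (\<eta>' \<bullet> i') * (\<integral>x. W \<eta> \<eta>' i k c i' k' c' x * D x \<partial>lborel)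
      = (\<integral>x. W \<eta> \<eta>' i k c i' k' c' x * D' x \<partial>lborel)
        + of_real (1 / \<rho>) * (\<integral>x. W \<eta> \<eta>' i k c i' (Suc k') c' x * D x \<partial>lborel)
        + \<i> * (\<integral>x. W \<eta> \<eta>' i k c i' k' (Suc c') x * D x \<partial>lborel)"
  by (rule integration_by_parts_split[OF measurable_amp_weight measurable_amp_weight measurable_amp_weight
        amp_weight_le amp_weight_le amp_weight_le amp_weight_eq_0 amp_weight_eq_0 amp_weight_eq_0
        compact_cbox D amp_weight_derivative_z continuous_amp_weight_line continuous_amp_weight_line der])
    (use i k in auto)

lemma integral_amp_weight_le:
  assumes "k \<le> n" "k' \<le> n" "c \<le> n" "c' \<le> n" "i \<in> Basis" "i' \<in> Basis" and D: "continuous_on UNIV D"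
    and I: "(\<integral>x. indicator support_box x * cmod (D x) \<partial>lborel) \<le> I"
  shows "cmod (\<integral>x. W \<eta> \<eta>' i k c i' k' c' x * D x \<partial>lborel) \<le> \<Theta> ^ (2 * n) * B ^ (2 * DIM('a)) * I"
proof -
  let ?K = "\<Theta> ^ (2 * n) * B ^ (2 * DIM('a))"
  have K0: "0 \<le> ?K" using cut \<Theta> by (simp add: cutoff_def)
  have "integrable lborel (\<lambda>x. W \<eta> \<eta>' i k c i' k' c' x * D x)"
    by (rule integrable_bounded_support_mult[OF measurable_amp_weight amp_weight_le amp_weight_eq_0 compact_cbox D])
      (use assms in auto)
  moreover have int: "integrable lborel (\<lambda>x. indicator support_box x *\<^sub>R cmod (D x))"
    by (rule borel_integrable_compact) (auto intro!: continuous_intros continuous_on_subset[OF D])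
  then have "integrable lborel (\<lambda>x. ?K * (indicator support_box x * cmod (D x)))" by simp
  moreover have "cmod (W \<eta> \<eta>' i k c i' k' c' x * D x) \<le> ?K * (indicator support_box x * cmod (D x))" for x
    using mult_right_mono[OF amp_weight_le[OF assms(1-6), of \<eta> \<eta>' x], of "cmod (D x)"]
      amp_weight_eq_0[OF assms(1,2,5,6), of x]
    by (cases "x \<in> support_box") (simp_all add: norm_mult mult.assoc)
  ultimately have "cmod (\<integral>x. W \<eta> \<eta>' i k c i' k' c' x * D x \<partial>lborel)
      \<le> (\<integral>x. ?K * (indicator support_box x * cmod (D x)) \<partial>lborel)"
    by (intro Bochner_Integration.integral_norm_bound_integral)
  also have "\<dots> \<le> ?K * I" using I K0 by (simp add: mult_left_mono)
  finally show ?thesis .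
qed

text \<open>The integrations by parts in \<open>z\<close> come first, so that \<open>D a b\<close> with \<open>a > 0\<close> is differentiated only
  in \<open>w\<close>: this is the order in which mixed derivatives of the amplitude are available. Accordingly
  the estimate in \<open>w\<close>, uniform in the indices of \<open>z\<close>, is the bound entering the one in \<open>z\<close>.\<close>

theorem amp_weight_integral_decay:
  assumes D: "\<And>a b. a \<le> n \<Longrightarrow> b \<le> n \<Longrightarrow> continuous_on UNIV (D a b)"
    and derw: "\<And>a b x t. a < n \<Longrightarrow> b \<le> n \<Longrightarrow>
      ((\<lambda>t. D a b (x + t *\<^sub>R (i, 0, 0))) has_vector_derivative D (Suc a) b (x + t *\<^sub>R (i, 0, 0))) (at t)"
    and derz: "\<And>b x t. b < n \<Longrightarrow>
      ((\<lambda>t. D 0 b (x + t *\<^sub>R (0, i', 0))) has_vector_derivative D 0 (Suc b) (x + t *\<^sub>R (0, i', 0))) (at t)"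
    and i: "i \<in> Basis" "i' \<in> Basis"
    and I: "\<And>a b. a \<le> n \<Longrightarrow> b \<le> n \<Longrightarrow> (\<integral>x. indicator support_box x * cmod (D a b x) \<partial>lborel) \<le> I"
  shows "(if \<eta> \<bullet> i = 0 then 1 else \<bar>\<eta> \<bullet> i\<bar> ^ n) * (if \<eta>' \<bullet> i' = 0 then 1 else \<bar>\<eta>' \<bullet> i'\<bar> ^ n) *
      cmod (\<integral>x. W \<eta> \<eta>' i 0 0 i' 0 0 x * D 0 0 x \<partial>lborel)
    \<le> (2 + 1 / \<rho>) ^ (2 * n) * (\<Theta> ^ (2 * n) * B ^ (2 * DIM('a)) * I)"
proof -
  let ?K = "\<Theta> ^ (2 * n) * B ^ (2 * DIM('a)) * I"
  let ?m = "if \<eta> \<bullet> i = 0 then 1 else \<bar>\<eta> \<bullet> i\<bar> ^ n"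
  have m0: "0 \<le> ?m" by simp
  have w: "?m * cmod (\<integral>x. W \<eta> \<eta>' i 0 0 i' k' c' x * D 0 b x \<partial>lborel) \<le> (2 + \<bar>1 / \<rho>\<bar>) ^ n * ?K"
    if "k' + b + c' \<le> n" for k' b c'
  proof (rule repeated_parts_bound[where X="\<lambda>k a c. \<integral>x. W \<eta> \<eta>' i k c i' k' c' x * D a b x \<partial>lborel"])
    fix k a c assume "k + a + c < n"
    then show "\<i> * of_real (\<eta> \<bullet> i) * (\<integral>x. W \<eta> \<eta>' i k c i' k' c' x * D a b x \<partial>lborel) =
        (\<integral>x. W \<eta> \<eta>' i k c i' k' c' x * D (Suc a) b x \<partial>lborel) +
        of_real (1 / \<rho>) * (\<integral>x. W \<eta> \<eta>' i (Suc k) c i' k' c' x * D a b x \<partial>lborel) +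
        \<i> * (\<integral>x. W \<eta> \<eta>' i k (Suc c) i' k' c' x * D a b x \<partial>lborel)"
      using that i by (intro amp_weight_parts_w D derw) auto
  next
    fix k a c assume "k + a + c \<le> n"
    then show "cmod (\<integral>x. W \<eta> \<eta>' i k c i' k' c' x * D a b x \<partial>lborel) \<le> ?K"
      using that i by (intro integral_amp_weight_le D I) auto
  qed
  have le: "(if \<eta>' \<bullet> i' = 0 then 1 else \<bar>\<eta>' \<bullet> i'\<bar> ^ n) *
      cmod (of_real ?m * (\<integral>x. W \<eta> \<eta>' i 0 0 i' 0 0 x * D 0 0 x \<partial>lborel))
    \<le> (2 + \<bar>1 / \<rho>\<bar>) ^ n * ((2 + \<bar>1 / \<rho>\<bar>) ^ n * ?K)"
  proof (rule repeated_parts_bound[where X="\<lambda>k' b c'. of_real ?m * (\<integral>x. W \<eta> \<eta>' i 0 0 i' k' c' x * D 0 b x \<partial>lborel)"])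
    fix k' b c' assume "k' + b + c' < n"
    then have "\<i> * of_real (\<eta>' \<bullet> i') * (\<integral>x. W \<eta> \<eta>' i 0 0 i' k' c' x * D 0 b x \<partial>lborel) =
        (\<integral>x. W \<eta> \<eta>' i 0 0 i' k' c' x * D 0 (Suc b) x \<partial>lborel) +
        of_real (1 / \<rho>) * (\<integral>x. W \<eta> \<eta>' i 0 0 i' (Suc k') c' x * D 0 b x \<partial>lborel) +
        \<i> * (\<integral>x. W \<eta> \<eta>' i 0 0 i' k' (Suc c') x * D 0 b x \<partial>lborel)"
      using i by (intro amp_weight_parts_z D derz) auto
    from arg_cong[OF this, of "\<lambda>y. of_real ?m * y"]
    show "\<i> * of_real (\<eta>' \<bullet> i') * (of_real ?m * (\<integral>x. W \<eta> \<eta>' i 0 0 i' k' c' x * D 0 b x \<partial>lborel)) =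
        of_real ?m * (\<integral>x. W \<eta> \<eta>' i 0 0 i' k' c' x * D 0 (Suc b) x \<partial>lborel) +
        of_real (1 / \<rho>) * (of_real ?m * (\<integral>x. W \<eta> \<eta>' i 0 0 i' (Suc k') c' x * D 0 b x \<partial>lborel)) +
        \<i> * (of_real ?m * (\<integral>x. W \<eta> \<eta>' i 0 0 i' k' (Suc c') x * D 0 b x \<partial>lborel))"
      by (simp only: distrib_left mult_ac)
  next
    fix k' b c' assume "k' + b + c' \<le> n"
    from w[OF this] m0
    show "cmod (of_real ?m * (\<integral>x. W \<eta> \<eta>' i 0 0 i' k' c' x * D 0 b x \<partial>lborel)) \<le> (2 + \<bar>1 / \<rho>\<bar>) ^ n * ?K"
      by (simp only: norm_mult norm_of_real abs_of_nonneg)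
  qed
  have "?m * (if \<eta>' \<bullet> i' = 0 then 1 else \<bar>\<eta>' \<bullet> i'\<bar> ^ n) *
      cmod (\<integral>x. W \<eta> \<eta>' i 0 0 i' 0 0 x * D 0 0 x \<partial>lborel)
    = (if \<eta>' \<bullet> i' = 0 then 1 else \<bar>\<eta>' \<bullet> i'\<bar> ^ n) *
      cmod (of_real ?m * (\<integral>x. W \<eta> \<eta>' i 0 0 i' 0 0 x * D 0 0 x \<partial>lborel))"
    by (simp only: norm_mult norm_of_real abs_of_nonneg[OF m0] mult_ac)
  also note le
  also have "(2 + \<bar>1 / \<rho>\<bar>) ^ n * ((2 + \<bar>1 / \<rho>\<bar>) ^ n * ?K) = (2 + 1 / \<rho>) ^ (2 * n) * ?K"
    using \<rho> by (simp add: mult_2 power_add mult.assoc)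
  finally show ?thesis .
qed

end

lemma pderivs_Cons: "pderivs (b # bs) f = pderiv_dir b (pderivs bs f)"
  by (simp add: pderivs_def)

lemma pderivs_has_vector_derivative:
  assumes "has_cont_pderivs (b # bs) f"
  shows "((\<lambda>t. pderivs bs f (x + t *\<^sub>R b)) has_vector_derivative pderivs (b # bs) f (x + t *\<^sub>R b)) (at t)"
proof -
  let ?g = "\<lambda>s. pderivs bs f ((x + t *\<^sub>R b) + s *\<^sub>R b)"
  have "?g differentiable at 0" using assms by (auto simp: has_cont_pderivs_def)
  then have "(?g has_vector_derivative pderivs (b # bs) f (x + t *\<^sub>R b)) (at 0)"
    unfolding pderivs_Cons pderiv_dir_def by (rule vector_derivative_works[THEN iffD1])
  moreover have "((\<lambda>s. s - t) has_vector_derivative 1) (at t)"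
    by (auto intro!: derivative_eq_intros)
  ultimately have "(?g \<circ> (\<lambda>s. s - t) has_vector_derivative 1 *\<^sub>R pderivs (b # bs) f (x + t *\<^sub>R b)) (at t)"
    by (intro vector_diff_chain_at) simp_all
  then show ?thesis by (simp add: o_def algebra_simps)
qed

lemma finite_dirs: "finite (dirs_w k)" "finite (dirs_z k)" "finite (dirs_xi k)"
  unfolding dirs_w_def dirs_z_def dirs_xi_def
  by (subst conj_commute, rule finite_lists_length_eq, simp)+

text \<open>The numerator of the majorant.\<close>

definition grad_sum :: "nat \<Rightarrow> nat \<Rightarrow> ('a::euclidean_space \<times> 'a \<times> 'a \<Rightarrow> complex) \<Rightarrow> 'a \<times> 'a \<times> 'a \<Rightarrow> real" where
  "grad_sum n m p x = (\<Sum>n1\<le>n. \<Sum>n2\<le>n. \<Sum>l\<le>m. grad_norm n1 n2 l p x)"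

lemma grad_norm_nonneg: "0 \<le> grad_norm n1 n2 l p x"
  by (simp add: grad_norm_def sum_nonneg)

lemma grad_sum_nonneg: "0 \<le> grad_sum n m p x"
  by (simp add: grad_sum_def sum_nonneg grad_norm_nonneg)

lemma continuous_grad_sum:
  assumes "smooth_amplitude n m p"
  shows "continuous_on UNIV (grad_sum n m p)"
  unfolding grad_sum_def[abs_def] grad_norm_def
  using assms unfolding smooth_amplitude_def has_cont_pderivs_def by (intro continuous_intros) auto

lemma pderivs_le_grad_sum:
  assumes "ws \<in> dirs_w a" "zs \<in> dirs_z b" "xs \<in> dirs_xi l" "a \<le> n" "b \<le> n" "l \<le> m"
  shows "cmod (pderivs (ws @ zs @ xs) p x) \<le> grad_sum n m p x"
proof -
  let ?s = "\<lambda>ws zs xs. (cmod (pderivs (ws @ zs @ xs) p x))\<^sup>2"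
  have "?s ws zs xs \<le> (\<Sum>xs\<in>dirs_xi l. ?s ws zs xs)"
    by (rule member_le_sum[OF assms(3)]) (auto simp: finite_dirs)
  also have "\<dots> \<le> (\<Sum>zs\<in>dirs_z b. \<Sum>xs\<in>dirs_xi l. ?s ws zs xs)"
    by (rule member_le_sum[OF assms(2)]) (auto simp: finite_dirs sum_nonneg)
  also have "\<dots> \<le> (\<Sum>ws\<in>dirs_w a. \<Sum>zs\<in>dirs_z b. \<Sum>xs\<in>dirs_xi l. ?s ws zs xs)"
    by (rule member_le_sum[OF assms(1)]) (auto simp: finite_dirs sum_nonneg)
  finally have "cmod (pderivs (ws @ zs @ xs) p x) \<le> grad_norm a b l p x"
    unfolding grad_norm_def by (rule real_le_rsqrt)
  also have "\<dots> \<le> (\<Sum>l\<le>m. grad_norm a b l p x)"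
    using assms by (intro member_le_sum) (auto simp: grad_norm_nonneg)
  also have "\<dots> \<le> (\<Sum>n2\<le>n. \<Sum>l\<le>m. grad_norm a n2 l p x)"
    using assms by (intro member_le_sum) (auto simp: grad_norm_nonneg sum_nonneg)
  also have "\<dots> \<le> grad_sum n m p x"
    unfolding grad_sum_def
    using assms by (intro member_le_sum) (auto simp: grad_norm_nonneg sum_nonneg)
  finally show ?thesis .
qed

lemma replicate_mem_dirs:
  assumes "i \<in> Basis"
  shows "replicate a (i, 0, 0) \<in> dirs_w a" "replicate a (0, i, 0) \<in> dirs_z a" "replicate a (0, 0, i) \<in> dirs_xi a"
  using assms by (auto simp: dirs_w_def dirs_z_def dirs_xi_def)

text \<open>A product of one-dimensional weights, hence summable for \<open>s > 1\<close>. It dominates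
  \<open>(1 + \<bar>\<kappa> \<bullet> i\<bar>) powr (- s * DIM('a))\<close> for the largest coordinate, which is what repeated integration by parts yields.\<close>

definition lattice_weight :: "real \<Rightarrow> 'a::euclidean_space \<Rightarrow> real" where
  "lattice_weight s \<kappa> = (\<Prod>b\<in>Basis. (1 + \<bar>\<kappa> \<bullet> b\<bar>) powr (- s))"

lemma lattice_weight_pos: "0 < lattice_weight s \<kappa>"
  unfolding lattice_weight_def by (intro prod_pos ballI) (simp add: add_pos_nonneg)

lemma lattice_weight_powr: "lattice_weight s \<kappa> powr q = lattice_weight (s * q) \<kappa>"
  by (simp add: lattice_weight_def prod_powr_distrib powr_powr)

lemma Basis_prod_split:
  "(\<Prod>b\<in>(Basis :: ('a::euclidean_space \<times> 'b::euclidean_space) set). f b)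
    = (\<Prod>b\<in>Basis. f (b, 0)) * (\<Prod>b\<in>Basis. f (0, b))"
  unfolding Basis_prod_def
  by (subst prod.union_disjoint) (auto simp: prod.reindex inj_on_def)

lemma lattice_weight_Pair:
  "lattice_weight s (\<kappa>, \<kappa>') = lattice_weight s \<kappa> * lattice_weight s \<kappa>'"
  by (simp add: lattice_weight_def Basis_prod_split)

lemma summable_int_powr:
  assumes "1 < s"
  shows "(\<lambda>k::int. (1 + \<bar>real_of_int k\<bar>) powr (- s)) summable_on UNIV"
proof -
  let ?h = "\<lambda>k::nat. (1 + real k) powr (- s)"
  have "summable (\<lambda>k. real (Suc k) powr (- s))"
    using summable_real_powr_iff[of "- s"] assms
    by (subst summable_Suc_iff[of "\<lambda>k. real k powr (- s)"]) simp
  then have "summable (\<lambda>k. norm (?h k))" by (simp add: add.commute)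
  then have nat: "?h summable_on UNIV" by (rule norm_summable_imp_summable_on)
  have img: "(\<lambda>k::int. (1 + \<bar>real_of_int k\<bar>) powr (- s)) summable_on (f ` UNIV)"
    if "inj f" "\<And>k. \<bar>f k\<bar> = int k" for f :: "nat \<Rightarrow> int"
  proof -
    have "\<bar>real_of_int (f k)\<bar> = real k" for k using that(2)[of k] by (simp flip: of_int_abs)
    then show ?thesis using nat by (subst summable_on_reindex[OF that(1)]) (simp add: o_def)
  qed
  have "UNIV = range int \<union> range (\<lambda>k. - int k)"
  proof -
    have "k \<in> range int \<union> range (\<lambda>k. - int k)" for k :: int
    proof (cases "0 \<le> k")
      case True
      then have "k = int (nat k)" by simp
      then show ?thesis by blast
    next
      case False
      then have "k = - int (nat (- k))" by simp
      then show ?thesis by blast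
    qed
    then show ?thesis by blast
  qed
  moreover have "(\<lambda>k::int. (1 + \<bar>real_of_int k\<bar>) powr (- s)) summable_on (range int \<union> range (\<lambda>k. - int k))"
    by (rule summable_on_union) (auto intro!: img injI)
  ultimately show ?thesis by simp
qed

lemma int_lattice_eq_image:
  "(int_lattice :: 'a::euclidean_space set)
    = (\<lambda>k. \<Sum>b\<in>Basis. real_of_int (k b) *\<^sub>R b) ` PiE Basis (\<lambda>_. UNIV)"
proof (intro equalityI subsetI)
  fix \<kappa> :: 'a assume "\<kappa> \<in> int_lattice"
  then obtain k where k: "\<And>b. b \<in> Basis \<Longrightarrow> \<kappa> \<bullet> b = real_of_int (k b)"
    unfolding int_lattice_iff by metis
  have "\<kappa> = (\<Sum>b\<in>Basis. real_of_int (restrict k Basis b) *\<^sub>R b)"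
  proof (rule euclidean_eqI)
    fix b :: 'a assume b: "b \<in> Basis"
    then show "\<kappa> \<bullet> b = (\<Sum>b\<in>Basis. real_of_int (restrict k Basis b) *\<^sub>R b) \<bullet> b"
      unfolding inner_sum_left_Basis[OF b] using k[OF b] by simp
  qed
  then show "\<kappa> \<in> (\<lambda>k. \<Sum>b\<in>Basis. real_of_int (k b) *\<^sub>R b) ` PiE Basis (\<lambda>_. UNIV)"
    by (rule image_eqI[where x="restrict k Basis"]) simp
next
  fix \<kappa> :: 'a assume "\<kappa> \<in> (\<lambda>k. \<Sum>b\<in>Basis. real_of_int (k b) *\<^sub>R b) ` PiE Basis (\<lambda>_. UNIV)"
  then obtain k where k: "\<kappa> = (\<Sum>b\<in>Basis. real_of_int (k b) *\<^sub>R b)" by (rule imageE)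
  show "\<kappa> \<in> int_lattice"
    unfolding int_lattice_def
  proof (intro CollectI ballI)
    fix b :: 'a assume b: "b \<in> Basis"
    show "\<kappa> \<bullet> b \<in> \<int>" unfolding k inner_sum_left_Basis[OF b] by simp
  qed
qed

lemma summable_lattice_weight:
  assumes "1 < s"
  shows "(lattice_weight s :: 'a::euclidean_space \<Rightarrow> real) summable_on int_lattice"
proof -
  let ?P = "PiE (Basis :: 'a set) (\<lambda>_. UNIV :: int set)"
  let ?vec = "\<lambda>k. \<Sum>b\<in>Basis. real_of_int (k b) *\<^sub>R b :: 'a"
  have "Infinite_Set_Sum.abs_summable_on (\<lambda>k. \<Prod>b\<in>(Basis :: 'a set). (1 + \<bar>real_of_int (k b)\<bar>) powr (- s)) ?P"
  proof (rule abs_summable_on_prod_PiE)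
    show "Infinite_Set_Sum.abs_summable_on (\<lambda>k::int. (1 + \<bar>real_of_int k\<bar>) powr (- s)) UNIV"
      unfolding abs_summable_equivalent[symmetric] using summable_int_powr[OF assms] by simp
  qed auto
  then have sm: "(\<lambda>k. \<Prod>b\<in>(Basis :: 'a set). (1 + \<bar>real_of_int (k b)\<bar>) powr (- s)) summable_on ?P"
    unfolding abs_summable_equivalent[symmetric] by (rule abs_summable_summable)
  have inj: "inj_on ?vec ?P"
  proof (rule inj_onI)
    fix k l assume kl: "k \<in> ?P" "l \<in> ?P" "?vec k = ?vec l"
    show "k = l"
    proof (rule PiE_ext[OF kl(1,2)])
      fix b :: 'a assume "b \<in> Basis"
      then show "k b = l b"
        using arg_cong[OF kl(3), of "\<lambda>v. v \<bullet> b"] by (simp add: inner_sum_left_Basis)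
    qed
  qed
  show ?thesis
    unfolding int_lattice_eq_image summable_on_reindex[OF inj]
    using sm by (simp add: o_def lattice_weight_def inner_sum_left_Basis)
qed

lemma lattice_weight_max_coordinate:
  fixes \<kappa> :: "'a::euclidean_space"
  obtains i where "i \<in> Basis" "1 \<le> lattice_weight (real n / real DIM('a)) \<kappa> * (1 + \<bar>\<kappa> \<bullet> i\<bar>) ^ n"
proof -
  define M where "M = Max ((\<lambda>b. \<bar>\<kappa> \<bullet> b\<bar>) ` Basis)"
  have "M \<in> (\<lambda>b. \<bar>\<kappa> \<bullet> b\<bar>) ` Basis" unfolding M_def by (rule Max_in) auto
  then obtain i where i: "i \<in> Basis" "\<bar>\<kappa> \<bullet> i\<bar> = M" by auto
  have le: "\<bar>\<kappa> \<bullet> b\<bar> \<le> \<bar>\<kappa> \<bullet> i\<bar>" if "b \<in> Basis" for b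
    unfolding i(2) M_def using that by (intro Max_ge) auto
  let ?s = "real n / real DIM('a)"
  have "(\<Prod>b\<in>(Basis :: 'a set). (1 + \<bar>\<kappa> \<bullet> i\<bar>) powr (- ?s)) \<le> lattice_weight ?s \<kappa>"
    unfolding lattice_weight_def
  proof (rule prod_mono)
    fix b :: 'a assume "b \<in> Basis"
    then show "0 \<le> (1 + \<bar>\<kappa> \<bullet> i\<bar>) powr - ?s \<and> (1 + \<bar>\<kappa> \<bullet> i\<bar>) powr - ?s \<le> (1 + \<bar>\<kappa> \<bullet> b\<bar>) powr - ?s"
      using le[of b] by (intro conjI powr_mono2') auto
  qed
  also have "(\<Prod>b\<in>(Basis :: 'a set). (1 + \<bar>\<kappa> \<bullet> i\<bar>) powr (- ?s)) = (1 + \<bar>\<kappa> \<bullet> i\<bar>) powr (- real n)"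
    by (simp add: powr_powr powr_realpow[symmetric] add_pos_nonneg)
  finally have "(1 + \<bar>\<kappa> \<bullet> i\<bar>) powr (- real n) * (1 + \<bar>\<kappa> \<bullet> i\<bar>) ^ n \<le> lattice_weight ?s \<kappa> * (1 + \<bar>\<kappa> \<bullet> i\<bar>) ^ n"
    by (intro mult_right_mono) auto
  moreover have "(1 + \<bar>\<kappa> \<bullet> i\<bar>) powr (- real n) * (1 + \<bar>\<kappa> \<bullet> i\<bar>) ^ n = 1"
    by (simp add: powr_minus powr_realpow add_pos_nonneg)
  ultimately show ?thesis using that i(1) by simp
qed

section \<open>Expansion of a localised amplitude into exponentials\<close>

text \<open>The product \<open>'a \<times> 'b \<times> 'c\<close> associates to the right, while the expansion is in the first two
  variables jointly.\<close>

lemma lborel_triple_integral: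
  fixes F :: "'a::euclidean_space \<times> 'b::euclidean_space \<times> 'c::euclidean_space \<Rightarrow> complex"
  assumes F: "integrable lborel F"
    and H: "integrable lborel (\<lambda>v. \<integral>\<xi>. F (fst v, snd v, \<xi>) \<partial>lborel)"
  shows "(\<integral>v. (\<integral>\<xi>. F (fst v, snd v, \<xi>) \<partial>lborel) \<partial>lborel) = (\<integral>x. F x \<partial>lborel)"
proof -
  have F': "integrable (lborel \<Otimes>\<^sub>M lborel) F" using F by (simp only: lborel_prod)
  have H': "integrable (lborel \<Otimes>\<^sub>M lborel) (\<lambda>v. \<integral>\<xi>. F (fst v, snd v, \<xi>) \<partial>lborel)"
    using H by (simp only: lborel_prod)
  have "(\<integral>v. (\<integral>\<xi>. F (fst v, snd v, \<xi>) \<partial>lborel) \<partial>lborel)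
      = (\<integral>w. (\<integral>z. (\<integral>\<xi>. F (w, z, \<xi>) \<partial>lborel) \<partial>lborel) \<partial>lborel)"
    using lborel_pair.integral_fst'[OF H'] by (simp add: lborel_prod)
  also have "\<dots> = (\<integral>w. (\<integral>y. F (w, y) \<partial>lborel) \<partial>lborel)"
  proof (rule integral_cong_AE)
    have "AE w in lborel. integrable lborel (\<lambda>y. F (w, y))"
      by (rule lborel_pair.AE_integrable_fst'[OF F'])
    then show "AE w in lborel. (\<integral>z. (\<integral>\<xi>. F (w, z, \<xi>) \<partial>lborel) \<partial>lborel) = (\<integral>y. F (w, y) \<partial>lborel)"
    proof eventually_elim
      case (elim w)
      then have "integrable (lborel \<Otimes>\<^sub>M lborel) (\<lambda>y. F (w, y))" by (simp only: lborel_prod)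
      from lborel_pair.integral_fst'[OF this] show ?case by (simp add: lborel_prod)
    qed
    show "(\<lambda>w. \<integral>z. (\<integral>\<xi>. F (w, z, \<xi>) \<partial>lborel) \<partial>lborel) \<in> borel_measurable lborel"
      using lborel_pair.integrable_fst'[OF H'] by simp
    show "(\<lambda>w. \<integral>y. F (w, y) \<partial>lborel) \<in> borel_measurable lborel"
      using lborel_pair.integrable_fst'[OF F'] by simp
  qed
  also have "\<dots> = (\<integral>x. F x \<partial>lborel)"
    using lborel_pair.integral_fst'[OF F'] by (simp add: lborel_prod)
  finally show ?thesis .
qed

lemma continuous_partial_integral:
  fixes F :: "'v::euclidean_space \<times> 'a::euclidean_space \<Rightarrow> complex"
  assumes F: "continuous_on UNIV F" and [measurable]: "\<omega> \<in> borel_measurable borel"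
    and bd: "\<And>\<xi>. cmod (\<omega> \<xi>) \<le> K" and supp: "\<And>\<xi>. \<xi> \<notin> S \<Longrightarrow> \<omega> \<xi> = 0" and S: "compact S"
  shows "continuous_on UNIV (\<lambda>v. \<integral>\<xi>. \<omega> \<xi> * F (v, \<xi>) \<partial>lborel)"
proof (rule continuous_at_imp_continuous_on, rule ballI)
  fix v :: 'v
  have slice: "continuous_on UNIV (\<lambda>\<xi>. F (v, \<xi>))" for v
    by (rule continuous_on_compose2[OF F]) (auto intro!: continuous_intros)
  have [measurable]: "(\<lambda>\<xi>. F (v, \<xi>)) \<in> borel_measurable borel" for v
    by (rule borel_measurable_continuous_onI[OF slice])
  show "isCont (\<lambda>v. \<integral>\<xi>. \<omega> \<xi> * F (v, \<xi>) \<partial>lborel) v"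
    unfolding continuous_at_sequentially o_def
  proof (intro allI impI)
    fix X :: "nat \<Rightarrow> 'v" assume X: "X \<longlonglongrightarrow> v"
    then obtain R where R: "\<And>k. norm (X k) \<le> R"
      using convergent_imp_bounded[of X v] by (auto simp: bounded_iff)
    have "compact (F ` (cball 0 R \<times> S))"
      by (intro compact_continuous_image compact_Times S compact_cball continuous_on_subset[OF F]) auto
    then have "\<exists>L. \<forall>y\<in>cball 0 R \<times> S. cmod (F y) \<le> L"
      using compact_imp_bounded[of "F ` (cball 0 R \<times> S)"] by (simp add: bounded_iff)
    then obtain L where "\<And>y. y \<in> cball 0 R \<times> S \<Longrightarrow> cmod (F y) \<le> L" by blast
    then have L: "cmod (F (X k, \<xi>)) \<le> L" if "\<xi> \<in> S" for k \<xi> using that R by simp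
    show "(\<lambda>k. \<integral>\<xi>. \<omega> \<xi> * F (X k, \<xi>) \<partial>lborel) \<longlonglongrightarrow> (\<integral>\<xi>. \<omega> \<xi> * F (v, \<xi>) \<partial>lborel)"
    proof (rule integral_dominated_convergence)
      have "integrable lborel (indicator S :: 'a \<Rightarrow> real)"
        using S emeasure_bounded_finite[OF compact_imp_bounded[OF S]]
        by (simp add: integrable_indicator_iff borel_compact)
      then show "integrable lborel (\<lambda>\<xi>. K * L * indicator S \<xi>)" by simp
      show "AE \<xi> in lborel. (\<lambda>k. \<omega> \<xi> * F (X k, \<xi>)) \<longlonglongrightarrow> \<omega> \<xi> * F (v, \<xi>)"
      proof (rule AE_I2)
        fix \<xi>
        have "continuous_on UNIV (\<lambda>v. F (v, \<xi>))"
          by (rule continuous_on_compose2[OF F]) (auto intro!: continuous_intros)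
        then have "isCont (\<lambda>v. F (v, \<xi>)) v" by (simp add: continuous_on_eq_continuous_at)
        then have "(\<lambda>k. F (X k, \<xi>)) \<longlonglongrightarrow> F (v, \<xi>)" using X by (rule isCont_tendsto_compose)
        then show "(\<lambda>k. \<omega> \<xi> * F (X k, \<xi>)) \<longlonglongrightarrow> \<omega> \<xi> * F (v, \<xi>)" by (intro tendsto_intros)
      qed
      show "AE \<xi> in lborel. norm (\<omega> \<xi> * F (X k, \<xi>)) \<le> K * L * indicator S \<xi>" for k
      proof (rule AE_I2)
        fix \<xi>
        show "norm (\<omega> \<xi> * F (X k, \<xi>)) \<le> K * L * indicator S \<xi>"
        proof (cases "\<xi> \<in> S")
          case True
          have "cmod (\<omega> \<xi>) * cmod (F (X k, \<xi>)) \<le> K * L"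
            using bd[of \<xi>] L[OF True, of k] order_trans[OF norm_ge_zero bd] by (intro mult_mono) auto
          then show ?thesis using True by (simp add: norm_mult)
        qed (simp add: supp)
      qed
    qed measurable
  qed
qed

text \<open>The decay estimate is applied in the directions \<open>i\<close> and \<open>i'\<close> of the largest coordinates of \<open>\<kappa>\<close>
  and \<open>\<kappa>'\<close>. Without derivatives on the cutoffs, the weight does not depend on the marked coordinate, so
  a fixed \<open>b0\<close> can be exchanged for them.\<close>

lemma amplitude_coefficient_bound:
  fixes p :: "'a::euclidean_space \<times> 'a \<times> 'a \<Rightarrow> complex"
  assumes cut: "cutoff n B \<phi>" and \<rho>: "0 < \<rho>" and \<Theta>: "1 \<le> \<Theta>"
    and meas: "\<theta> \<in> borel_measurable borel" "\<theta>' \<in> borel_measurable borel" "\<omega> \<in> borel_measurable borel"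
    and \<theta>_le: "\<And>\<xi> b. \<xi> \<in> cbox c1 c2 \<Longrightarrow> b \<in> Basis \<Longrightarrow> \<bar>\<theta> \<xi> \<bullet> b\<bar> \<le> \<Theta>"
      "\<And>\<xi> b. \<xi> \<in> cbox c1 c2 \<Longrightarrow> b \<in> Basis \<Longrightarrow> \<bar>\<theta>' \<xi> \<bullet> b\<bar> \<le> \<Theta>"
    and \<omega>_le: "\<And>\<xi>. cmod (\<omega> \<xi>) \<le> 1" and \<omega>_supp: "\<And>\<xi>. \<xi> \<notin> cbox c1 c2 \<Longrightarrow> \<omega> \<xi> = 0"
    and p: "smooth_amplitude n m p" and xs: "xs \<in> dirs_xi l" "l \<le> m"
    and r: "0 < r" and \<kappa>: "\<kappa> \<in> int_lattice" "\<kappa>' \<in> int_lattice" and b0: "b0 \<in> Basis"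
  shows "cmod (\<integral>x. amp_weight \<phi> \<rho> w0 z0 \<theta> \<theta>' \<omega> (\<kappa> /\<^sub>R r) (\<kappa>' /\<^sub>R r) b0 0 0 b0 0 0 x * pderivs xs p x \<partial>lborel)
    \<le> (1 + 2 * r) ^ (2 * n) * (2 + 1 / \<rho>) ^ (2 * n) * \<Theta> ^ (2 * n) * B ^ (2 * DIM('a)) *
      lattice_weight (real n / real DIM('a)) \<kappa> * lattice_weight (real n / real DIM('a)) \<kappa>' *
      (\<integral>x. indicator (cbox (w0 - (2 * \<rho>) *\<^sub>R One, z0 - (2 * \<rho>) *\<^sub>R One, c1)
        (w0 + (2 * \<rho>) *\<^sub>R One, z0 + (2 * \<rho>) *\<^sub>R One, c2)) x * grad_sum n m p x \<partial>lborel)"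
proof -
  let ?S = "cbox (w0 - (2 * \<rho>) *\<^sub>R One, z0 - (2 * \<rho>) *\<^sub>R One, c1) (w0 + (2 * \<rho>) *\<^sub>R One, z0 + (2 * \<rho>) *\<^sub>R One, c2)"
  let ?I = "\<integral>x. indicator ?S x * grad_sum n m p x \<partial>lborel"
  let ?W = "amp_weight \<phi> \<rho> w0 z0 \<theta> \<theta>' \<omega> (\<kappa> /\<^sub>R r) (\<kappa>' /\<^sub>R r)"
  let ?lw = "lattice_weight (real n / real DIM('a)) :: 'a \<Rightarrow> real"
  obtain i where i: "i \<in> Basis" "1 \<le> ?lw \<kappa> * (1 + \<bar>\<kappa> \<bullet> i\<bar>) ^ n" by (rule lattice_weight_max_coordinate)
  obtain i' where i': "i' \<in> Basis" "1 \<le> ?lw \<kappa>' * (1 + \<bar>\<kappa>' \<bullet> i'\<bar>) ^ n" by (rule lattice_weight_max_coordinate)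
  define D where "D a b = pderivs (replicate a (i, 0, 0) @ replicate b (0, i', 0) @ xs) p" for a b
  have hcp: "has_cont_pderivs (replicate a (i, 0, 0) @ replicate b (0, i', 0) @ xs) p" if "a \<le> n" "b \<le> n" for a b
    using p xs that replicate_mem_dirs(1)[OF i(1), of a] replicate_mem_dirs(2)[OF i'(1), of b]
    unfolding smooth_amplitude_def by blast
  have contD: "continuous_on UNIV (D a b)" if "a \<le> n" "b \<le> n" for a b
    using hcp[OF that] by (simp add: D_def has_cont_pderivs_def)
  let ?J = "\<integral>x. ?W b0 0 0 b0 0 0 x * pderivs xs p x \<partial>lborel"
  have e1: "(\<kappa> /\<^sub>R r) \<bullet> i = \<kappa> \<bullet> i / r" and e2: "(\<kappa>' /\<^sub>R r) \<bullet> i' = \<kappa>' \<bullet> i' / r"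
    by (simp_all add: divide_inverse mult.commute)
  have J: "?J = (\<integral>x. ?W i 0 0 i' 0 0 x * D 0 0 x \<partial>lborel)"
    using box_cutoff_0[OF b0] box_cutoff_0[OF i(1)] box_cutoff_0[OF i'(1)] by (simp add: amp_weight_def D_def)
  let ?m = "\<lambda>t. if t = 0 then 1 else \<bar>t\<bar> ^ n :: real"
  have decay: "?m ((\<kappa> /\<^sub>R r) \<bullet> i) * ?m ((\<kappa>' /\<^sub>R r) \<bullet> i') * cmod (\<integral>x. ?W i 0 0 i' 0 0 x * D 0 0 x \<partial>lborel)
    \<le> (2 + 1 / \<rho>) ^ (2 * n) * (\<Theta> ^ (2 * n) * B ^ (2 * DIM('a)) * ?I)"
  proof (rule amp_weight_integral_decay[where D=D, OF cut \<rho> \<Theta> meas \<theta>_le \<omega>_le \<omega>_supp contD _ _ i(1) i'(1)])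
    show "((\<lambda>t. D a b (x + t *\<^sub>R (i, 0, 0))) has_vector_derivative D (Suc a) b (x + t *\<^sub>R (i, 0, 0))) (at t)"
      if "a < n" "b \<le> n" for a b x t
      using pderivs_has_vector_derivative[of "(i, 0, 0)"] hcp[of "Suc a" b] that by (simp add: D_def)
    show "((\<lambda>t. D 0 b (x + t *\<^sub>R (0, i', 0))) has_vector_derivative D 0 (Suc b) (x + t *\<^sub>R (0, i', 0))) (at t)"
      if "b < n" for b x t
      using pderivs_has_vector_derivative[of "(0, i', 0)"] hcp[of 0 "Suc b"] that by (simp add: D_def)
    show "(\<integral>x. indicator ?S x * cmod (D a b x) \<partial>lborel) \<le> ?I" if "a \<le> n" "b \<le> n" for a b
    proof (rule integral_mono)
      have "integrable lborel (\<lambda>x. indicator ?S x *\<^sub>R cmod (D a b x))"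
        "integrable lborel (\<lambda>x. indicator ?S x *\<^sub>R grad_sum n m p x)"
        by (rule borel_integrable_compact;
          auto intro!: continuous_intros continuous_on_subset[OF contD[OF that]] continuous_on_subset[OF continuous_grad_sum[OF p]])+
      then show "integrable lborel (\<lambda>x. indicator ?S x * cmod (D a b x))"
        "integrable lborel (\<lambda>x. indicator ?S x * grad_sum n m p x)" by simp_all
      show "indicator ?S x * cmod (D a b x) \<le> indicator ?S x * grad_sum n m p x" for x
        unfolding D_def using that xs i(1) i'(1)
        by (intro mult_left_mono pderivs_le_grad_sum[where a=a and b=b and l=l] replicate_mem_dirs) auto
    qed
  qed
  \<comment> \<open>A nonzero integer coordinate has modulus at least 1, so \<open>1 + \<bar>k\<bar>\<close> is comparable with \<open>\<bar>k\<bar> / r\<close>.\<close>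
  have one: "(1 + \<bar>k\<bar>) ^ n \<le> (1 + 2 * r) ^ n * ?m (k / r)" if "k \<in> \<int>" for k :: real
  proof (cases "k = 0")
    case True
    then show ?thesis using r by (simp add: one_le_power)
  next
    case False
    with that have "1 \<le> \<bar>k\<bar>" using Ints_nonzero_abs_ge1 by blast
    moreover have "(1 + 2 * r) * (\<bar>k\<bar> / r) = \<bar>k\<bar> / r + 2 * \<bar>k\<bar>"
      using r by (simp add: field_simps)
    moreover have "0 \<le> \<bar>k\<bar> / r" using r by simp
    ultimately have "1 + \<bar>k\<bar> \<le> (1 + 2 * r) * (\<bar>k\<bar> / r)" by linarith
    then have "(1 + \<bar>k\<bar>) ^ n \<le> ((1 + 2 * r) * (\<bar>k\<bar> / r)) ^ n" by (intro power_mono) auto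
    then show ?thesis unfolding power_mult_distrib[of "1 + 2 * r"] using False r by (simp add: abs_divide)
  qed
  let ?R = "(1 + 2 * r) ^ n"
  have Z: "\<kappa> \<bullet> i \<in> \<int>" "\<kappa>' \<bullet> i' \<in> \<int>" using \<kappa> i(1) i'(1) by (auto simp: int_lattice_def)
  have lw0: "0 \<le> ?lw k" for k using lattice_weight_pos[of _ k] by (simp add: less_imp_le)
  have k1: "1 \<le> ?lw \<kappa> * (?R * ?m (\<kappa> \<bullet> i / r))"
    using i(2) mult_left_mono[OF one[OF Z(1)] lw0[of \<kappa>]] by linarith
  have k2: "1 \<le> ?lw \<kappa>' * (?R * ?m (\<kappa>' \<bullet> i' / r))"
    using i'(2) mult_left_mono[OF one[OF Z(2)] lw0[of \<kappa>']] by linarith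
  have "cmod ?J \<le> (?lw \<kappa> * (?R * ?m (\<kappa> \<bullet> i / r))) * (?lw \<kappa>' * (?R * ?m (\<kappa>' \<bullet> i' / r))) * cmod ?J"
    using mult_mono[OF k1 k2] k1 by (intro mult_le_cancel_right1[THEN iffD2]) auto
  also have "\<dots> = ?lw \<kappa> * ?lw \<kappa>' * ?R\<^sup>2 * (?m (\<kappa> \<bullet> i / r) * ?m (\<kappa>' \<bullet> i' / r) * cmod ?J)"
    by (simp only: power2_eq_square mult_ac)
  also have "?m (\<kappa> \<bullet> i / r) * ?m (\<kappa>' \<bullet> i' / r) * cmod ?J \<le> (2 + 1 / \<rho>) ^ (2 * n) * (\<Theta> ^ (2 * n) * B ^ (2 * DIM('a)) * ?I)"
    using decay unfolding J e1 e2 .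
  finally have "cmod ?J \<le> ?lw \<kappa> * ?lw \<kappa>' * ?R\<^sup>2 * ((2 + 1 / \<rho>) ^ (2 * n) * (\<Theta> ^ (2 * n) * B ^ (2 * DIM('a)) * ?I))"
    using lw0 by (simp add: mult_left_mono)
  then show ?thesis by (simp add: power_mult[symmetric] mult_ac)
qed

lemma int_lattice_Pair: "(\<kappa>, \<kappa>') \<in> int_lattice \<longleftrightarrow> \<kappa> \<in> int_lattice \<and> \<kappa>' \<in> int_lattice"
  unfolding int_lattice_def Basis_prod_def by (simp add: ball_Un)

text \<open>The Fourier coefficient, for period \<open>4 * pi * \<rho>\<close> in every coordinate, of the function
  \<open>(w, z)\<close> \<open>\<mapsto>\<close> \<open>\<integral>\<xi>. \<omega> \<xi> * cis (w \<bullet> \<theta> \<xi> + z \<bullet> \<theta>' \<xi>) * D (w, z, \<xi>)\<close> cut off to the box of radius \<open>2 * \<rho>\<close> around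
  \<open>(w0, z0)\<close>. As no cutoff is differentiated, the value is the same for
  every choice of the basis vector.\<close>

definition amp_coefficient ::
  "(nat \<Rightarrow> real \<Rightarrow> real) \<Rightarrow> real \<Rightarrow> 'a::euclidean_space \<Rightarrow> 'a \<Rightarrow> ('a \<Rightarrow> 'a) \<Rightarrow> ('a \<Rightarrow> 'a) \<Rightarrow> ('a \<Rightarrow> complex) \<Rightarrow>
    ('a \<times> 'a \<times> 'a \<Rightarrow> complex) \<Rightarrow> 'a \<times> 'a \<Rightarrow> complex" where
  "amp_coefficient \<phi> \<rho> w0 z0 \<theta> \<theta>' \<omega> D \<kappa> = (let b = SOME b. b \<in> Basis in
    of_real (1 / (2 * pi * (2 * \<rho>)) ^ (2 * DIM('a))) *
    (\<integral>x. amp_weight \<phi> \<rho> w0 z0 \<theta> \<theta>' \<omega> (fst \<kappa> /\<^sub>R (2 * \<rho>)) (snd \<kappa> /\<^sub>R (2 * \<rho>)) b 0 0 b 0 0 x * D x \<partial>lborel))"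

definition coefficient_const :: "nat \<Rightarrow> real \<Rightarrow> real \<Rightarrow> real \<Rightarrow> nat \<Rightarrow> real" where
  "coefficient_const n B \<rho> \<Theta> d = 1 / (2 * pi * (2 * \<rho>)) ^ (2 * d) *
    ((1 + 2 * (2 * \<rho>)) ^ (2 * n) * (2 + 1 / \<rho>) ^ (2 * n) * \<Theta> ^ (2 * n) * B ^ (2 * d))"

definition local_integral :: "real \<Rightarrow> 'a::euclidean_space \<Rightarrow> 'a \<Rightarrow> 'a \<Rightarrow> 'a \<Rightarrow> ('a \<times> 'a \<times> 'a \<Rightarrow> real) \<Rightarrow> real" where
  "local_integral \<rho> w0 z0 c1 c2 G = (\<integral>x. indicator (cbox (w0 - (2 * \<rho>) *\<^sub>R One, z0 - (2 * \<rho>) *\<^sub>R One, c1)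
        (w0 + (2 * \<rho>) *\<^sub>R One, z0 + (2 * \<rho>) *\<^sub>R One, c2)) x * G x \<partial>lborel)"

context
  fixes n m l :: nat and B \<rho> \<Theta> :: real and \<phi> :: "nat \<Rightarrow> real \<Rightarrow> real"
    and \<theta> \<theta>' :: "'a::euclidean_space \<Rightarrow> 'a" and w0 z0 c1 c2 :: 'a
    and p :: "'a \<times> 'a \<times> 'a \<Rightarrow> complex" and xs :: "('a \<times> 'a \<times> 'a) list"
  assumes cut: "cutoff n B \<phi>" and \<rho>: "0 < \<rho>" and \<Theta>: "1 \<le> \<Theta>"
    and \<theta>_cont: "continuous_on UNIV \<theta>" "continuous_on UNIV \<theta>'"
    and \<theta>_le: "\<And>\<xi> b. \<xi> \<in> cbox c1 c2 \<Longrightarrow> b \<in> Basis \<Longrightarrow> \<bar>\<theta> \<xi> \<bullet> b\<bar> \<le> \<Theta>"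
      "\<And>\<xi> b. \<xi> \<in> cbox c1 c2 \<Longrightarrow> b \<in> Basis \<Longrightarrow> \<bar>\<theta>' \<xi> \<bullet> b\<bar> \<le> \<Theta>"
    and p: "smooth_amplitude n m p" and xs: "xs \<in> dirs_xi l" "l \<le> m"
    and n: "DIM('a) < n"
begin

lemma amp_coefficient_le:
  assumes \<omega>: "\<omega> \<in> borel_measurable borel" "\<And>\<xi>. cmod (\<omega> \<xi>) \<le> 1" "\<And>\<xi>. \<xi> \<notin> cbox c1 c2 \<Longrightarrow> \<omega> \<xi> = 0"
    and \<kappa>: "\<kappa> \<in> int_lattice"
  shows "cmod (amp_coefficient \<phi> \<rho> w0 z0 \<theta> \<theta>' \<omega> (pderivs xs p) \<kappa>)
    \<le> coefficient_const n B \<rho> \<Theta> DIM('a) * lattice_weight (real n / real DIM('a)) \<kappa> *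
      local_integral \<rho> w0 z0 c1 c2 (grad_sum n m p)"
proof -
  obtain \<kappa>1 \<kappa>2 where k: "\<kappa> = (\<kappa>1, \<kappa>2)" by (cases \<kappa>)
  have kk: "\<kappa>1 \<in> int_lattice" "\<kappa>2 \<in> int_lattice"
    using \<kappa> unfolding k by (simp_all add: int_lattice_Pair)
  have b: "(SOME b. b \<in> Basis) \<in> (Basis :: 'a set)" using nonempty_Basis by (simp add: some_in_eq)
  note meas = borel_measurable_continuous_onI[OF \<theta>_cont(1)] borel_measurable_continuous_onI[OF \<theta>_cont(2)] \<omega>(1)
  have bound: "cmod (\<integral>x. amp_weight \<phi> \<rho> w0 z0 \<theta> \<theta>' \<omega> (\<kappa>1 /\<^sub>R (2 * \<rho>)) (\<kappa>2 /\<^sub>R (2 * \<rho>))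
      (SOME b. b \<in> Basis) 0 0 (SOME b. b \<in> Basis) 0 0 x * pderivs xs p x \<partial>lborel)
    \<le> (1 + 2 * (2 * \<rho>)) ^ (2 * n) * (2 + 1 / \<rho>) ^ (2 * n) * \<Theta> ^ (2 * n) * B ^ (2 * DIM('a)) *
      lattice_weight (real n / real DIM('a)) \<kappa>1 * lattice_weight (real n / real DIM('a)) \<kappa>2 *
      (\<integral>x. indicator (cbox (w0 - (2 * \<rho>) *\<^sub>R One, z0 - (2 * \<rho>) *\<^sub>R One, c1)
        (w0 + (2 * \<rho>) *\<^sub>R One, z0 + (2 * \<rho>) *\<^sub>R One, c2)) x * grad_sum n m p x \<partial>lborel)"
    by (rule amplitude_coefficient_bound[OF cut \<rho> \<Theta> meas]) (use \<theta>_le \<omega> p xs \<rho> kk b in auto)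
  have P: "0 \<le> 1 / (2 * pi * (2 * \<rho>)) ^ (2 * DIM('a))" using \<rho> by simp
  show ?thesis
    unfolding amp_coefficient_def Let_def norm_mult norm_of_real k fst_conv snd_conv coefficient_const_def
      local_integral_def lattice_weight_Pair abs_of_nonneg[OF P]
    using mult_left_mono[OF bound P] by (simp only: mult_ac)
qed

lemma summable_amp_coefficient:
  assumes \<omega>: "\<omega> \<in> borel_measurable borel" "\<And>\<xi>. cmod (\<omega> \<xi>) \<le> 1" "\<And>\<xi>. \<xi> \<notin> cbox c1 c2 \<Longrightarrow> \<omega> \<xi> = 0"
  shows "(\<lambda>\<kappa>. cmod (amp_coefficient \<phi> \<rho> w0 z0 \<theta> \<theta>' \<omega> (pderivs xs p) \<kappa>)) summable_on int_lattice"
proof (rule summable_on_comparison_test)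
  show "(\<lambda>\<kappa>::'a \<times> 'a. coefficient_const n B \<rho> \<Theta> DIM('a) * lattice_weight (real n / real DIM('a)) \<kappa> *
      local_integral \<rho> w0 z0 c1 c2 (grad_sum n m p)) summable_on int_lattice"
    by (intro summable_on_cmult_left summable_on_cmult_right summable_lattice_weight) (use n in auto)
qed (use amp_coefficient_le[OF assms] in auto)

text \<open>For \<open>(w, z)\<close> within \<open>\<rho>\<close> of the centre the cutoff is 1, and the support of the cut-off function
  has distance at most \<open>3 * \<rho>\<close> from \<open>(w, z)\<close> in each coordinate. As \<open>3 \<le> 2 * pi\<close>, it fits into one period
  around that point and Fourier inversion applies.\<close>

theorem localized_expansion:
  assumes \<omega>: "\<omega> \<in> borel_measurable borel" "\<And>\<xi>. cmod (\<omega> \<xi>) \<le> 1" "\<And>\<xi>. \<xi> \<notin> cbox c1 c2 \<Longrightarrow> \<omega> \<xi> = 0"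
    and wz: "\<And>b. b \<in> Basis \<Longrightarrow> \<bar>(w - w0) \<bullet> b\<bar> \<le> \<rho>" "\<And>b. b \<in> Basis \<Longrightarrow> \<bar>(z - z0) \<bullet> b\<bar> \<le> \<rho>"
  shows "((\<lambda>\<kappa>. cis (\<kappa> \<bullet> (w, z) / (2 * \<rho>)) * amp_coefficient \<phi> \<rho> w0 z0 \<theta> \<theta>' \<omega> (pderivs xs p) \<kappa>)
    has_sum (\<integral>\<xi>. \<omega> \<xi> * (cis (w \<bullet> \<theta> \<xi> + z \<bullet> \<theta>' \<xi>) * pderivs xs p (w, z, \<xi>)) \<partial>lborel)) int_lattice"
proof -
  let ?D = "pderivs xs p"
  let ?r = "2 * \<rho>"
  define b0 :: 'a where "b0 = (SOME b. b \<in> Basis)"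
  have b0: "b0 \<in> Basis" unfolding b0_def using nonempty_Basis by (simp add: some_in_eq)
  have "has_cont_pderivs ([] @ [] @ xs) p"
    using p xs replicate_mem_dirs[of b0 0] b0 unfolding smooth_amplitude_def by (metis replicate_0 le0)
  then have D: "continuous_on UNIV ?D" by (simp add: has_cont_pderivs_def)
  have B: "1 \<le> B" using cut by (simp add: cutoff_def)
  define F where "F y = cis (fst (fst y) \<bullet> \<theta> (snd y) + snd (fst y) \<bullet> \<theta>' (snd y)) * ?D (fst (fst y), snd (fst y), snd y)"
    for y :: "('a \<times> 'a) \<times> 'a"
  have F: "continuous_on UNIV F"
  proof -
    have "continuous_on UNIV (\<lambda>y::('a \<times> 'a) \<times> 'a. \<theta> (snd y))" "continuous_on UNIV (\<lambda>y::('a \<times> 'a) \<times> 'a. \<theta>' (snd y))"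
      by (rule continuous_on_compose2[OF \<theta>_cont(1)] continuous_on_compose2[OF \<theta>_cont(2)];
        auto intro!: continuous_intros)+
    moreover have "continuous_on UNIV (\<lambda>y::('a \<times> 'a) \<times> 'a. ?D (fst (fst y), snd (fst y), snd y))"
      by (rule continuous_on_compose2[OF D]) (auto intro!: continuous_intros)
    ultimately show ?thesis unfolding F_def[abs_def] cis_conv_exp by (intro continuous_intros)
  qed
  define h where "h v = (\<integral>\<xi>. \<omega> \<xi> * F (v, \<xi>) \<partial>lborel)" for v
  have h: "continuous_on UNIV h"
    unfolding h_def[abs_def] by (rule continuous_partial_integral[OF F \<omega>(1,2,3)]) auto
  define \<zeta> where "\<zeta> v = complex_of_real (box_cutoff \<phi> \<rho> w0 b0 0 (fst v) * box_cutoff \<phi> \<rho> z0 b0 0 (snd v))" for v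
  let ?S = "cbox (w0 - (2 * \<rho>) *\<^sub>R One, z0 - (2 * \<rho>) *\<^sub>R One) (w0 + (2 * \<rho>) *\<^sub>R One, z0 + (2 * \<rho>) *\<^sub>R One)"
  have \<zeta>_cont: "continuous_on UNIV \<zeta>"
  proof -
    have "continuous_on UNIV (\<lambda>v::'a \<times> 'a. box_cutoff \<phi> \<rho> w0 b0 0 (fst v))"
      "continuous_on UNIV (\<lambda>v::'a \<times> 'a. box_cutoff \<phi> \<rho> z0 b0 0 (snd v))"
      by (rule continuous_on_compose2[OF continuous_box_cutoff[OF cut \<rho>, of 0]]; auto intro!: continuous_intros)+
    then show ?thesis unfolding \<zeta>_def[abs_def] by (intro continuous_intros)
  qed
  have \<zeta>_le: "cmod (\<zeta> v) \<le> B ^ DIM('a) * B ^ DIM('a)" for v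
    unfolding \<zeta>_def norm_of_real abs_mult using B b0
    by (intro mult_mono box_cutoff_le[OF cut \<rho>]) auto
  have \<zeta>_0: "\<zeta> v = 0" if "v \<notin> ?S" for v
  proof -
    have "fst v \<notin> cbox (w0 - (2 * \<rho>) *\<^sub>R One) (w0 + (2 * \<rho>) *\<^sub>R One) \<or>
        snd v \<notin> cbox (z0 - (2 * \<rho>) *\<^sub>R One) (z0 + (2 * \<rho>) *\<^sub>R One)"
      using that by (cases v) (auto simp: cbox_Pair_eq)
    then show ?thesis unfolding \<zeta>_def using box_cutoff_eq_0[OF cut \<rho> _ b0, of 0] by auto
  qed
  define g where "g v = \<zeta> v * h v" for v
  have g_int: "integrable lborel g"
    unfolding g_def[abs_def]
    by (rule integrable_bounded_support_mult[OF borel_measurable_continuous_onI[OF \<zeta>_cont] \<zeta>_le \<zeta>_0 compact_cbox h])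
  have g_cont: "continuous_on UNIV g" unfolding g_def[abs_def] by (intro continuous_intros \<zeta>_cont h)
  have "compact (g ` ?S)" by (intro compact_continuous_image compact_cbox continuous_on_subset[OF g_cont]) auto
  then have "\<exists>L. \<forall>v\<in>?S. cmod (g v) \<le> L" using compact_imp_bounded[of "g ` ?S"] by (simp add: bounded_iff)
  then obtain L where L: "\<And>v. v \<in> ?S \<Longrightarrow> cmod (g v) \<le> L" by blast
  have g_le: "cmod (g v) \<le> max 0 L" for v
    using L[of v] \<zeta>_0[of v] by (cases "v \<in> ?S") (auto simp: g_def)
  let ?W = "\<lambda>\<kappa>. amp_weight \<phi> \<rho> w0 z0 \<theta> \<theta>' \<omega> (fst \<kappa> /\<^sub>R ?r) (snd \<kappa> /\<^sub>R ?r) b0 0 0 b0 0 0"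
  have coef: "(\<integral>u. cis (- (\<kappa> \<bullet> u / ?r)) * g u \<partial>lborel) = (\<integral>x. ?W \<kappa> x * ?D x \<partial>lborel)" for \<kappa>
  proof -
    have inner: "(\<integral>\<xi>. ?W \<kappa> (fst u, snd u, \<xi>) * ?D (fst u, snd u, \<xi>) \<partial>lborel) = cis (- (\<kappa> \<bullet> u / ?r)) * g u" for u
    proof -
      have "?W \<kappa> (fst u, snd u, \<xi>) * ?D (fst u, snd u, \<xi>) = (cis (- (\<kappa> \<bullet> u / ?r)) * \<zeta> u) * (\<omega> \<xi> * F (u, \<xi>))" for \<xi>
      proof -
        have "cis (fst u \<bullet> (\<theta> \<xi> - fst \<kappa> /\<^sub>R ?r) + snd u \<bullet> (\<theta>' \<xi> - snd \<kappa> /\<^sub>R ?r))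
            = cis (fst u \<bullet> \<theta> \<xi> + snd u \<bullet> \<theta>' \<xi>) * cis (- (\<kappa> \<bullet> u / ?r))"
          unfolding cis_mult using \<rho>
          by (intro arg_cong[of _ _ cis])
            (simp add: inner_diff_right inner_prod_def inner_commute[of "fst u" "fst \<kappa>"] inner_commute[of "snd u" "snd \<kappa>"] field_simps)
        then show ?thesis by (simp add: amp_weight_def \<zeta>_def F_def)
      qed
      then show ?thesis by (simp add: g_def h_def)
    qed
    note ctx = cut \<rho> \<Theta> borel_measurable_continuous_onI[OF \<theta>_cont(1)]
      borel_measurable_continuous_onI[OF \<theta>_cont(2)] \<omega>(1)
    have int1: "integrable lborel (\<lambda>x. ?W \<kappa> x * ?D x)"
    proof (rule integrable_bounded_support_mult[OF _ _ _ _ D])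
      show "?W \<kappa> \<in> borel_measurable borel"
        by (rule measurable_amp_weight[OF ctx]) (use \<theta>_le \<omega> in auto)
      show "cmod (?W \<kappa> x) \<le> \<Theta> ^ (2 * n) * B ^ (2 * DIM('a))" for x
        by (rule amp_weight_le[OF ctx]) (use \<theta>_le \<omega> b0 in auto)
      show "?W \<kappa> x = 0" if "x \<notin> cbox (w0 - (2 * \<rho>) *\<^sub>R One, z0 - (2 * \<rho>) *\<^sub>R One, c1)
          (w0 + (2 * \<rho>) *\<^sub>R One, z0 + (2 * \<rho>) *\<^sub>R One, c2)" for x
        by (rule amp_weight_eq_0[OF ctx]) (use \<theta>_le \<omega> b0 that in auto)
    qed (rule compact_cbox)
    have int2: "integrable lborel (\<lambda>u. cis (- (\<kappa> \<bullet> u / ?r)) * g u)"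
      by (rule Bochner_Integration.integrable_bound[OF g_int]) (use g_int in \<open>auto simp: norm_mult\<close>)
    show ?thesis
      using lborel_triple_integral[OF int1] int2 unfolding inner by simp
  qed
  have ac: "amp_coefficient \<phi> \<rho> w0 z0 \<theta> \<theta>' \<omega> ?D \<kappa> = of_real (1 / (2 * pi * ?r) ^ (2 * DIM('a))) *
      (\<integral>u. cis (- (\<kappa> \<bullet> u / ?r)) * g u \<partial>lborel)" for \<kappa>
    unfolding coef amp_coefficient_def Let_def b0_def[symmetric] by simp
  have P: "0 < (2 * pi * ?r) ^ (2 * DIM('a))" using \<rho> by simp
  have sm: "(\<lambda>\<kappa>. cmod (\<integral>u. cis (- (\<kappa> \<bullet> u / ?r)) * g u \<partial>lborel)) summable_on int_lattice"
  proof -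
    have "(\<lambda>\<kappa>. (2 * pi * ?r) ^ (2 * DIM('a)) * cmod (amp_coefficient \<phi> \<rho> w0 z0 \<theta> \<theta>' \<omega> ?D \<kappa>)) summable_on int_lattice"
      by (rule summable_on_cmult_right[OF summable_amp_coefficient[OF \<omega>]])
    moreover have "P * (\<bar>1 / P\<bar> * x) = x" if "0 < P" for P x :: real using that by simp
    ultimately show ?thesis unfolding ac norm_mult norm_of_real using P \<rho> by simp
  qed
  have supp: "\<bar>(u - (w, z)) \<bullet> b\<bar> \<le> pi * ?r" if gu: "g u \<noteq> 0" and b: "b \<in> Basis" for u b
  proof -
    have u: "u \<in> ?S" using gu \<zeta>_0[of u] by (auto simp: g_def)
    obtain u1 u2 where u12: "u = (u1, u2)" by (cases u)
    have bx: "\<bar>(u1 - w0) \<bullet> b\<bar> \<le> 2 * \<rho>" "\<bar>(u2 - z0) \<bullet> b\<bar> \<le> 2 * \<rho>" if "b \<in> Basis" for b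
      using u that unfolding u12 cbox_Pair_eq by (auto simp: mem_box inner_simps abs_le_iff algebra_simps)
    have c: "\<bar>(u1 - w) \<bullet> b\<bar> \<le> 3 * \<rho>" "\<bar>(u2 - z) \<bullet> b\<bar> \<le> 3 * \<rho>" if "b \<in> Basis" for b
      using bx[OF that] wz[OF that] by (auto simp: inner_simps abs_le_iff)
    have "3 * \<rho> \<le> pi * ?r" using pi_ge_two \<rho> mult_right_mono[of 2 pi "2 * \<rho>"] by simp
    moreover have "\<bar>(u - (w, z)) \<bullet> b\<bar> \<le> 3 * \<rho>"
      using b c unfolding u12 Basis_prod_def by auto
    ultimately show ?thesis by linarith
  qed
  have r: "0 < ?r" using \<rho> by simp
  have iso: "isCont g (w, z)" using g_cont by (simp add: continuous_on_eq_continuous_at)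
  have "g (w, z) = (\<Sum>\<^sub>\<infinity>\<kappa>\<in>int_lattice. of_real (1 / (2 * pi * ?r) ^ DIM('a \<times> 'a)) *
        (cis (\<kappa> \<bullet> (w, z) / ?r) * (\<integral>u. cis (- (\<kappa> \<bullet> u / ?r)) * g u \<partial>lborel)))"
    by (rule fourier_inversion[OF r g_int iso g_le supp sm])
  also have "\<dots> = (\<Sum>\<^sub>\<infinity>\<kappa>\<in>int_lattice. cis (\<kappa> \<bullet> (w, z) / ?r) * amp_coefficient \<phi> \<rho> w0 z0 \<theta> \<theta>' \<omega> ?D \<kappa>)"
  proof -
    have dim: "DIM('a \<times> 'a) = 2 * DIM('a)" by simp
    show ?thesis unfolding ac dim by (simp only: mult_ac)
  qed
  finally have eq: "(\<Sum>\<^sub>\<infinity>\<kappa>\<in>int_lattice. cis (\<kappa> \<bullet> (w, z) / ?r) * amp_coefficient \<phi> \<rho> w0 z0 \<theta> \<theta>' \<omega> ?D \<kappa>) = g (w, z)" by simp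
  have "\<zeta> (w, z) = 1" using box_cutoff_eq_1[OF cut \<rho> b0] wz by (simp add: \<zeta>_def)
  then have val: "g (w, z) = (\<integral>\<xi>. \<omega> \<xi> * (cis (w \<bullet> \<theta> \<xi> + z \<bullet> \<theta>' \<xi>) * ?D (w, z, \<xi>)) \<partial>lborel)"
    by (simp add: g_def h_def F_def)
  have "(\<lambda>\<kappa>. cis (\<kappa> \<bullet> (w, z) / ?r) * amp_coefficient \<phi> \<rho> w0 z0 \<theta> \<theta>' \<omega> ?D \<kappa>) summable_on int_lattice"
    by (rule abs_summable_summable) (use summable_amp_coefficient[OF \<omega>] in \<open>simp add: norm_mult\<close>)
  from has_sum_infsum[OF this] show ?thesis unfolding eq val .
qed

text \<open>Choosing \<open>\<omega>\<close> as the conjugate phase of the amplitude at a given point turns the expansion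
  into a pointwise bound.\<close>

lemma local_integral_bound:
  assumes wz: "\<And>b. b \<in> Basis \<Longrightarrow> \<bar>(w - w0) \<bullet> b\<bar> \<le> \<rho>" "\<And>b. b \<in> Basis \<Longrightarrow> \<bar>(z - z0) \<bullet> b\<bar> \<le> \<rho>"
  shows "(\<integral>\<xi>. indicator (cbox c1 c2) \<xi> * cmod (pderivs xs p (w, z, \<xi>)) \<partial>lborel)
    \<le> coefficient_const n B \<rho> \<Theta> DIM('a) * infsum (lattice_weight (real n / real DIM('a))) (int_lattice :: ('a \<times> 'a) set) *
      local_integral \<rho> w0 z0 c1 c2 (grad_sum n m p)"
proof -
  let ?D = "pderivs xs p"
  let ?e = "\<lambda>\<xi>. cis (w \<bullet> \<theta> \<xi> + z \<bullet> \<theta>' \<xi>)"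
  have "has_cont_pderivs ([] @ [] @ xs) p"
    using p xs unfolding smooth_amplitude_def dirs_w_def dirs_z_def
    by (metis (mono_tags, lifting) empty_subsetI le0 list.set(1) list.size(3) mem_Collect_eq)
  then have D: "continuous_on UNIV ?D" by (simp add: has_cont_pderivs_def)
  have [measurable]: "(\<lambda>\<xi>. ?D (w, z, \<xi>)) \<in> borel_measurable borel"
    by (intro borel_measurable_continuous_onI continuous_on_compose2[OF D]) (auto intro!: continuous_intros)
  have [measurable]: "\<theta> \<in> borel_measurable borel" "\<theta>' \<in> borel_measurable borel"
    by (intro borel_measurable_continuous_onI \<theta>_cont)+
  have [measurable]: "cnj \<in> borel_measurable borel"
    by (intro borel_measurable_continuous_onI continuous_intros)
  define \<omega> where "\<omega> \<xi> = indicator (cbox c1 c2) \<xi> * cnj (?e \<xi>) * cnj (sgn (?D (w, z, \<xi>)))" for \<xi>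
  have \<omega>: "\<omega> \<in> borel_measurable borel" "cmod (\<omega> \<xi>) \<le> 1" "\<xi> \<notin> cbox c1 c2 \<Longrightarrow> \<omega> \<xi> = 0" for \<xi>
  proof -
    show "\<omega> \<in> borel_measurable borel" unfolding \<omega>_def[abs_def] sgn_div_norm by measurable
  qed (auto simp: \<omega>_def norm_mult norm_sgn indicator_def)
  have unit: "cnj (sgn y) * y = of_real (cmod y)" for y :: complex
    by (cases "y = 0") (simp_all add: sgn_eq complex_norm_square[symmetric] mult.commute power2_eq_square)
  have "\<omega> \<xi> * (?e \<xi> * ?D (w, z, \<xi>)) = of_real (indicator (cbox c1 c2) \<xi> * cmod (?D (w, z, \<xi>)))" for \<xi>
  proof -
    have "\<omega> \<xi> * (?e \<xi> * ?D (w, z, \<xi>)) = indicator (cbox c1 c2) \<xi> * (cnj (?e \<xi>) * ?e \<xi>) * (cnj (sgn (?D (w, z, \<xi>))) * ?D (w, z, \<xi>))"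
      by (simp only: \<omega>_def mult_ac)
    also have "cnj (?e \<xi>) * ?e \<xi> = 1" by (simp add: cis_cnj cis_mult)
    finally show ?thesis unfolding unit by (simp add: indicator_def)
  qed
  then have val: "(\<integral>\<xi>. \<omega> \<xi> * (?e \<xi> * ?D (w, z, \<xi>)) \<partial>lborel)
      = of_real (\<integral>\<xi>. indicator (cbox c1 c2) \<xi> * cmod (?D (w, z, \<xi>)) \<partial>lborel)"
    by (simp only: integral_complex_of_real)
  let ?c = "amp_coefficient \<phi> \<rho> w0 z0 \<theta> \<theta>' \<omega> ?D"
  let ?C = "coefficient_const n B \<rho> \<Theta> DIM('a)" and ?I = "local_integral \<rho> w0 z0 c1 c2 (grad_sum n m p)"
  have lw: "(lattice_weight (real n / real DIM('a)) :: 'a \<times> 'a \<Rightarrow> real) summable_on int_lattice"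
    by (rule summable_lattice_weight) (use n in auto)
  have "(\<integral>\<xi>. indicator (cbox c1 c2) \<xi> * cmod (?D (w, z, \<xi>)) \<partial>lborel)
      \<le> cmod (of_real (\<integral>\<xi>. indicator (cbox c1 c2) \<xi> * cmod (?D (w, z, \<xi>)) \<partial>lborel))" by simp
  also have "\<dots> = cmod (\<Sum>\<^sub>\<infinity>\<kappa>\<in>int_lattice. cis (\<kappa> \<bullet> (w, z) / (2 * \<rho>)) * ?c \<kappa>)"
    using infsumI[OF localized_expansion[OF \<omega> wz]] val by simp
  also have "\<dots> \<le> (\<Sum>\<^sub>\<infinity>\<kappa>\<in>int_lattice. cmod (cis (\<kappa> \<bullet> (w, z) / (2 * \<rho>)) * ?c \<kappa>))"
    by (rule norm_infsum_bound) (use summable_amp_coefficient[OF \<omega>] in \<open>simp add: norm_mult\<close>)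
  also have "\<dots> = (\<Sum>\<^sub>\<infinity>\<kappa>\<in>int_lattice. cmod (?c \<kappa>))" by (simp add: norm_mult)
  also have "\<dots> \<le> (\<Sum>\<^sub>\<infinity>\<kappa>\<in>int_lattice. ?C * lattice_weight (real n / real DIM('a)) (\<kappa> :: 'a \<times> 'a) * ?I)"
    by (intro infsum_mono summable_amp_coefficient \<omega> summable_on_cmult_left summable_on_cmult_right lw amp_coefficient_le)
  also have "\<dots> = ?C * infsum (lattice_weight (real n / real DIM('a))) (int_lattice :: ('a \<times> 'a) set) * ?I"
    using lw by (simp add: infsum_cmult_left infsum_cmult_right summable_on_cmult_right)
  finally show ?thesis .
qed

end

section \<open>Integral operators with a rank-one expansion\<close>

lemma integrable_abs_mult:
  assumes "square_integrable f" "square_integrable g"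
  shows "integrable lebesgue (\<lambda>x. f x * g x)"
    and "(LINT x|lebesgue. cmod (f x * g x)) \<le> norm (abs_L2 f) * norm (abs_L2 g)"
proof -
  have [measurable]: "f \<in> borel_measurable lebesgue" "g \<in> borel_measurable lebesgue"
    "cnj \<in> borel_measurable borel"
    using assms by (auto simp: square_integrable_def intro!: borel_measurable_continuous_onI continuous_intros)
  have "square_integrable (\<lambda>x. cnj (g x))" using assms(2) by (simp add: square_integrable_def)
  from integrable_mult_cnj[OF assms(1) this] show "integrable lebesgue (\<lambda>x. f x * g x)" by simp
  let ?F = "\<lambda>x. complex_of_real (cmod (f x))" and ?G = "\<lambda>x. complex_of_real (cmod (g x))"
  have sq: "square_integrable ?F" "square_integrable ?G"
    using assms by (simp_all add: square_integrable_def)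
  have "complex_of_real (LINT x|lebesgue. cmod (f x * g x)) = cinner_L2 (abs_L2 ?F) (abs_L2 ?G)"
    unfolding cinner_abs_L2[OF sq] integral_complex_of_real[symmetric] by (simp add: norm_mult)
  also have "cmod \<dots> \<le> norm (abs_L2 ?F) * norm (abs_L2 ?G)" by (rule cinner_Cauchy_Schwarz)
  finally have "(LINT x|lebesgue. cmod (f x * g x)) \<le> norm (abs_L2 ?F) * norm (abs_L2 ?G)"
    by (simp add: abs_le_iff)
  moreover have "norm (abs_L2 ?F) = norm (abs_L2 f)" "norm (abs_L2 ?G) = norm (abs_L2 g)"
    by (rule power2_eq_imp_eq; simp add: power2_norm_abs_L2 assms sq)+
  ultimately show "(LINT x|lebesgue. cmod (f x * g x)) \<le> norm (abs_L2 f) * norm (abs_L2 g)" by simp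
qed

text \<open>For almost every point the rank-one series can be integrated termwise against an $L^2$ function,
  because the series of the functions \<open>b n * F n\<close>, where \<open>b n\<close> is the integral of the modulus of
  \<open>G n * f\<close>, converges absolutely in $L^2$ and hence almost everywhere.\<close>

theorem nuclear_op_has_kernel:
  fixes F G :: "nat \<Rightarrow> 'a::euclidean_space \<Rightarrow> complex"
  assumes F: "\<And>n. square_integrable (F n)" and G: "\<And>n. square_integrable (G n)"
    and sm: "summable (\<lambda>n. norm (abs_L2 (F n)) * norm (abs_L2 (G n)))"
    and K: "\<And>x y. (\<lambda>n. F n x * G n y) sums K x y"
    and K_abs: "\<And>x y. summable (\<lambda>n. cmod (F n x * G n y))"
  shows "has_kernel (nuclear_op (\<lambda>n. abs_L2 (F n)) (\<lambda>n. abs_L2 (\<lambda>y. cnj (G n y)))) K"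
  unfolding has_kernel_def
proof
  fix f :: "'a L2"
  let ?\<phi> = "rep_L2 f"
  define c where "c n = (LINT y|lebesgue. G n y * ?\<phi> y)" for n
  define b where "b n = (LINT y|lebesgue. cmod (G n y * ?\<phi> y))" for n
  define v where "v n = abs_L2 (\<lambda>x. complex_of_real (b n) * F n x)" for n
  note Gf = integrable_abs_mult[OF G square_integrable_rep[of f]]
  have Gc: "square_integrable (\<lambda>y. cnj (G n y))" for n
  proof -
    have [measurable]: "G n \<in> borel_measurable lebesgue" "cnj \<in> borel_measurable borel"
      using G[of n] by (auto simp: square_integrable_def intro!: borel_measurable_continuous_onI continuous_intros)
    show ?thesis using G[of n] by (simp add: square_integrable_def)
  qed
  have norm_Gc: "norm (abs_L2 (\<lambda>y. cnj (G n y))) = norm (abs_L2 (G n))" for n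
    by (rule power2_eq_imp_eq) (simp_all add: power2_norm_abs_L2 Gc G)
  have sm_c: "summable (\<lambda>n. norm (abs_L2 (F n)) * norm (abs_L2 (\<lambda>y. cnj (G n y))))"
    using sm by (simp add: norm_Gc)
  have inner: "cinner_L2 f (abs_L2 (\<lambda>y. cnj (G n y))) = c n" for n
    using cinner_abs_L2[OF square_integrable_rep Gc, of f n] by (simp add: abs_rep_L2 c_def mult.commute)
  have b0: "0 \<le> b n" for n by (simp add: b_def)
  have b_le: "b n \<le> norm (abs_L2 (G n)) * norm f" for n
    using Gf(2)[of n] by (simp add: b_def abs_rep_L2)
  have "norm (v n) = b n * norm (abs_L2 (F n))" for n
    unfolding v_def scaleC_abs_L2[OF F, symmetric] norm_scaleC using b0 by simp
  moreover have "b n * norm (abs_L2 (F n)) \<le> norm f * (norm (abs_L2 (F n)) * norm (abs_L2 (G n)))" for n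
    using mult_right_mono[OF b_le[of n], of "norm (abs_L2 (F n))"] by (simp add: mult_ac)
  ultimately have "summable (\<lambda>n. norm (v n))"
    using b0 by (intro summable_comparison_test[OF _ summable_mult[OF sm, of "norm f"]]) auto
  from L2_series_pointwise(1)[OF this]
  have 1: "AE x in lebesgue. summable (\<lambda>n. cmod (rep_L2 (v n) x))" .
  have 2: "AE x in lebesgue. \<forall>n. rep_L2 (v n) x = of_real (b n) * F n x"
    unfolding AE_all_countable v_def by (intro allI rep_abs_L2 square_integrable_mult F)
  let ?u = "\<lambda>n. scaleC_L2 (cinner_L2 f (abs_L2 (\<lambda>y. cnj (G n y)))) (abs_L2 (F n))"
  have sm_u: "summable (\<lambda>n. norm (?u n))" by (rule summable_norm_nuclear[OF sm_c])
  have "nuclear_op (\<lambda>n. abs_L2 (F n)) (\<lambda>n. abs_L2 (\<lambda>y. cnj (G n y))) f = abs_L2 (\<lambda>x. \<Sum>n. rep_L2 (?u n) x)"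
    unfolding nuclear_op_def using L2_series[OF sm_u] by (simp add: sums_iff)
  then have 3: "AE x in lebesgue. rep_L2 (nuclear_op (\<lambda>n. abs_L2 (F n)) (\<lambda>n. abs_L2 (\<lambda>y. cnj (G n y))) f) x
      = (\<Sum>n. rep_L2 (?u n) x)"
    using rep_abs_L2[OF L2_series_pointwise(2)[OF sm_u]] by simp
  have 4: "AE x in lebesgue. \<forall>n. rep_L2 (?u n) x = c n * F n x"
    unfolding AE_all_countable inner scaleC_abs_L2[OF F]
    by (intro allI rep_abs_L2 square_integrable_mult F)
  show "AE x in lebesgue. integrable lebesgue (\<lambda>y. K x y * ?\<phi> y) \<and>
      rep_L2 (nuclear_op (\<lambda>n. abs_L2 (F n)) (\<lambda>n. abs_L2 (\<lambda>y. cnj (G n y))) f) x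
      = (LINT y|lebesgue. K x y * ?\<phi> y)"
    using 1 2 3 4
  proof eventually_elim
    case (elim x)
    let ?t = "\<lambda>n y. F n x * (G n y * ?\<phi> y)"
    have "(LINT y|lebesgue. norm (?t n y)) = cmod (F n x) * b n" for n
      unfolding b_def norm_mult[of "F n x"] by (rule integral_mult_right_zero)
    moreover have "summable (\<lambda>n. cmod (F n x) * b n)"
      using elim(1) b0 unfolding elim(2)[THEN spec] by (simp add: norm_mult mult.commute)
    ultimately have sm_t: "summable (\<lambda>n. LINT y|lebesgue. norm (?t n y))" by simp
    have int_t: "integrable lebesgue (?t n)" for n using Gf(1) by simp
    have ae: "AE y in lebesgue. summable (\<lambda>n. norm (?t n y))"
    proof (rule AE_I2)
      fix y show "summable (\<lambda>n. norm (?t n y))"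
        using summable_mult2[OF K_abs[of x y], of "cmod (?\<phi> y)"] by (simp add: norm_mult mult.assoc)
    qed
    have Ky: "(\<Sum>n. ?t n y) = K x y * ?\<phi> y" for y
      using sums_mult2[OF K[of x y], of "?\<phi> y"] by (simp add: sums_iff mult.assoc)
    have "integrable lebesgue (\<lambda>y. K x y * ?\<phi> y)"
      using integrable_suminf[OF int_t ae sm_t] unfolding Ky .
    moreover have "(LINT y|lebesgue. K x y * ?\<phi> y) = (\<Sum>n. LINT y|lebesgue. ?t n y)"
      using integral_suminf[OF int_t ae sm_t] unfolding Ky .
    moreover have "(LINT y|lebesgue. ?t n y) = F n x * c n" for n
      unfolding c_def by (rule integral_mult_right_zero)
    moreover have "(\<Sum>n. F n x * c n) = (\<Sum>n. c n * F n x)" by (simp only: mult.commute)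
    ultimately show ?case using elim(3,4) by (simp only:)
  qed
qed

section \<open>Lattice cells\<close>

text \<open>The nearest lattice point, ties being rounded up in each coordinate. Unlike the closed unit
  cubes, its fibres form a partition of the space.\<close>

definition cell_of :: "'a::euclidean_space \<Rightarrow> 'a" where
  "cell_of x = (\<Sum>b\<in>Basis. real_of_int \<lfloor>x \<bullet> b + 1/2\<rfloor> *\<^sub>R b)"

lemma cell_of_inner: "b \<in> Basis \<Longrightarrow> cell_of x \<bullet> b = real_of_int \<lfloor>x \<bullet> b + 1/2\<rfloor>"
  unfolding cell_of_def by (rule inner_sum_left_Basis)

lemma cell_of_in_lattice: "cell_of x \<in> int_lattice"
  by (simp add: int_lattice_def cell_of_inner)

lemma cell_of_dist: "b \<in> Basis \<Longrightarrow> \<bar>(x - cell_of x) \<bullet> b\<bar> \<le> 1/2"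
  unfolding inner_diff_left cell_of_inner by linarith

definition cell :: "'a::euclidean_space \<Rightarrow> 'a set" where
  "cell \<nu> = {x. cell_of x = \<nu>}"

lemma cell_subset_unit_cube: "cell \<nu> \<subseteq> unit_cube \<nu>"
proof
  fix x assume "x \<in> cell \<nu>"
  then have d: "\<bar>(x - \<nu>) \<bullet> b\<bar> \<le> 1/2" if "b \<in> Basis" for b
    using cell_of_dist[OF that, of x] by (simp add: cell_def)
  have "\<nu> \<bullet> b - 1/2 \<le> x \<bullet> b \<and> x \<bullet> b \<le> \<nu> \<bullet> b + 1/2" if "b \<in> Basis" for b
    using d[OF that] unfolding inner_diff_left by linarith
  then show "x \<in> unit_cube \<nu>"
    unfolding unit_cube_def mem_box by (simp add: inner_simps)
qed

lemma measurable_cell_of [measurable]: "cell_of \<in> borel_measurable borel"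
  unfolding cell_of_def[abs_def] by measurable

lemma sets_cell [measurable]: "cell \<nu> \<in> sets borel"
proof -
  have "cell \<nu> = cell_of -` {\<nu>} \<inter> space borel" by (auto simp: cell_def)
  then show ?thesis using measurable_sets[OF measurable_cell_of, of "{\<nu>}"] by simp
qed

lemma infinite_int_lattice: "infinite (int_lattice :: 'a::euclidean_space set)"
proof -
  obtain b :: 'a where b: "b \<in> Basis" using nonempty_Basis by blast
  have "inj (\<lambda>n::nat. real n *\<^sub>R b)"
    using b by (intro injI) (metis nonzero_Basis of_nat_eq_iff scaleR_cancel_right)
  then have "infinite (range (\<lambda>n::nat. real n *\<^sub>R b))" by (simp add: finite_image_iff)
  moreover have "range (\<lambda>n::nat. real n *\<^sub>R b) \<subseteq> int_lattice"
    using b by (auto simp: int_lattice_def inner_Basis)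
  ultimately show ?thesis using finite_subset by blast
qed

lemma countable_int_lattice: "countable (int_lattice :: 'a::euclidean_space set)"
  unfolding int_lattice_eq_image by (intro countable_image countable_PiE) auto

lemma lattice_enumeration:
  "bij_betw (from_nat_into int_lattice) UNIV (int_lattice :: 'a::euclidean_space set)"
  by (rule bij_betw_from_nat_into[OF countable_int_lattice infinite_int_lattice])

lemma cells_partition:
  fixes f :: "'a::euclidean_space \<Rightarrow> 'b::{comm_monoid_add, t2_space}"
  shows "(\<lambda>n. if x \<in> cell (from_nat_into int_lattice n) then f x else 0) sums f x"
proof -
  let ?e = "from_nat_into (int_lattice :: 'a set)"
  have "range ?e = int_lattice" "inj ?e" using lattice_enumeration[where 'a='a] by (simp_all add: bij_betw_def)
  then have "cell_of x \<in> range ?e" using cell_of_in_lattice by simp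
  then obtain n0 where n0: "cell_of x = ?e n0" by (rule rangeE)
  have "x \<in> cell (?e n) \<longleftrightarrow> n = n0" for n
    unfolding cell_def mem_Collect_eq n0 using inj_eq[OF \<open>inj ?e\<close>] by auto
  then show ?thesis using sums_single[of n0 "\<lambda>_. f x"] by simp
qed

lemma nn_integral_cells:
  fixes f :: "'a::euclidean_space \<Rightarrow> ennreal"
  assumes [measurable]: "f \<in> borel_measurable borel"
  shows "(\<integral>\<^sup>+x. f x \<partial>lborel) = (\<Sum>n. \<integral>\<^sup>+x. indicator (cell (from_nat_into int_lattice n)) x * f x \<partial>lborel)"
proof -
  have "f x = (\<Sum>n. indicator (cell (from_nat_into int_lattice n)) x * f x)" for x
  proof -
    have "(\<lambda>n. indicator (cell (from_nat_into int_lattice n)) x * f x)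
        = (\<lambda>n. if x \<in> cell (from_nat_into int_lattice n) then f x else 0)" by (auto simp: indicator_def)
    then show ?thesis using cells_partition[of x f] by (simp add: sums_iff)
  qed
  then have "(\<integral>\<^sup>+x. f x \<partial>lborel) = (\<integral>\<^sup>+x. (\<Sum>n. indicator (cell (from_nat_into int_lattice n)) x * f x) \<partial>lborel)"
    by simp
  also have "\<dots> = (\<Sum>n. \<integral>\<^sup>+x. indicator (cell (from_nat_into int_lattice n)) x * f x \<partial>lborel)"
    by (rule nn_integral_suminf) measurable
  finally show ?thesis .
qed

lemma integrable_of_cells:
  fixes f :: "'a::euclidean_space \<Rightarrow> 'b::{banach, second_countable_topology}"
  assumes [measurable]: "f \<in> borel_measurable borel"
    and int: "\<And>\<nu>. \<nu> \<in> int_lattice \<Longrightarrow> integrable lborel (\<lambda>x. indicator (cell \<nu>) x * norm (f x))"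
    and le: "\<And>\<nu>. \<nu> \<in> int_lattice \<Longrightarrow> (\<integral>x. indicator (cell \<nu>) x * norm (f x) \<partial>lborel) \<le> a \<nu>"
    and a: "a summable_on int_lattice"
  shows "integrable lborel f" "(\<integral>x. norm (f x) \<partial>lborel) \<le> infsum a int_lattice"
proof -
  let ?e = "from_nat_into (int_lattice :: 'a set)"
  have e: "?e n \<in> int_lattice" for n using bij_betwE[OF lattice_enumeration[where 'a='a]] by simp
  have a0: "0 \<le> a \<nu>" if "\<nu> \<in> int_lattice" for \<nu>
    by (rule order_trans[OF _ le[OF that]]) (intro Bochner_Integration.integral_nonneg, auto)
  have "(\<lambda>n. a (?e n)) summable_on UNIV"
    using a summable_on_reindex_bij_betw[OF lattice_enumeration[where 'a='a], of a] by simp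
  from has_sum_imp_sums[OF has_sum_infsum[OF this]]
  have sm: "summable (\<lambda>n. a (?e n))" and inf: "(\<Sum>n. a (?e n)) = infsum a int_lattice"
    using infsum_reindex_bij_betw[OF lattice_enumeration[where 'a='a], of a] by (simp_all add: sums_iff)
  have "(\<integral>\<^sup>+x. ennreal (norm (f x)) \<partial>lborel)
      = (\<Sum>n. \<integral>\<^sup>+x. indicator (cell (?e n)) x * ennreal (norm (f x)) \<partial>lborel)"
    by (rule nn_integral_cells) measurable
  also have "\<dots> \<le> (\<Sum>n. ennreal (a (?e n)))"
  proof (rule suminf_le)
    fix n
    have "(\<integral>\<^sup>+x. indicator (cell (?e n)) x * ennreal (norm (f x)) \<partial>lborel)
        = (\<integral>\<^sup>+x. ennreal (indicator (cell (?e n)) x * norm (f x)) \<partial>lborel)"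
      by (rule nn_integral_cong) (simp add: indicator_def)
    also have "\<dots> = ennreal (\<integral>x. indicator (cell (?e n)) x * norm (f x) \<partial>lborel)"
      by (rule nn_integral_eq_integral[OF int[OF e]]) auto
    also have "\<dots> \<le> ennreal (a (?e n))" by (intro ennreal_leI le e)
    finally show "(\<integral>\<^sup>+x. indicator (cell (?e n)) x * ennreal (norm (f x)) \<partial>lborel) \<le> ennreal (a (?e n))" .
  qed auto
  also have "\<dots> = ennreal (infsum a int_lattice)"
    unfolding inf[symmetric] by (rule suminf_ennreal2[OF a0[OF e] sm])
  finally have nn: "(\<integral>\<^sup>+x. ennreal (norm (f x)) \<partial>lborel) \<le> ennreal (infsum a int_lattice)" .
  then show "integrable lborel f"
    by (intro integrableI_bounded) (auto simp: less_top[symmetric] top_unique)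
  show "(\<integral>x. norm (f x) \<partial>lborel) \<le> infsum a int_lattice"
    using nn infsum_nonneg[of int_lattice a] a0 by (intro integral_real_bounded) auto
qed

lemma has_sum_cells:
  fixes f :: "'a::euclidean_space \<Rightarrow> complex"
  assumes f: "integrable lborel f"
  shows "((\<lambda>\<nu>. \<integral>x. indicator (cell \<nu>) x *\<^sub>R f x \<partial>lborel) has_sum (\<integral>x. f x \<partial>lborel)) int_lattice"
proof -
  let ?e = "from_nat_into (int_lattice :: 'a set)"
  let ?t = "\<lambda>n x. indicator (cell (?e n)) x *\<^sub>R f x"
  have [measurable]: "f \<in> borel_measurable borel" using f by simp
  have int: "integrable lborel (?t n)" for n
    by (rule Bochner_Integration.integrable_bound[OF f]) (auto simp: indicator_def)
  have split: "(\<lambda>n. ?t n x) sums f x" "(\<lambda>n. norm (?t n x)) sums norm (f x)" for x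
  proof -
    have "(\<lambda>n. ?t n x) = (\<lambda>n. if x \<in> cell (?e n) then f x else 0)"
      "(\<lambda>n. norm (?t n x)) = (\<lambda>n. if x \<in> cell (?e n) then norm (f x) else 0)"
      by (auto simp: indicator_def)
    then show "(\<lambda>n. ?t n x) sums f x" "(\<lambda>n. norm (?t n x)) sums norm (f x)"
      using cells_partition[of x f] cells_partition[of x "\<lambda>x. norm (f x)"] by simp_all
  qed
  have "(\<Sum>n. ennreal (\<integral>x. norm (?t n x) \<partial>lborel)) = (\<integral>\<^sup>+x. ennreal (norm (f x)) \<partial>lborel)"
  proof -
    have "(\<Sum>n. ennreal (\<integral>x. norm (?t n x) \<partial>lborel)) = (\<Sum>n. \<integral>\<^sup>+x. ennreal (norm (?t n x)) \<partial>lborel)"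
      by (intro suminf_cong nn_integral_eq_integral[symmetric] integrable_norm int) auto
    also have "\<dots> = (\<Sum>n. \<integral>\<^sup>+x. indicator (cell (?e n)) x * ennreal (norm (f x)) \<partial>lborel)"
      by (intro suminf_cong nn_integral_cong) (simp add: indicator_def)
    also have "\<dots> = (\<integral>\<^sup>+x. ennreal (norm (f x)) \<partial>lborel)"
      by (rule nn_integral_cells[symmetric]) measurable
    finally show ?thesis .
  qed
  also have "\<dots> < \<infinity>" using f by (simp add: integrable_iff_bounded)
  finally have sm: "summable (\<lambda>n. \<integral>x. norm (?t n x) \<partial>lborel)"
    by (intro summable_suminf_not_top) auto
  have ae: "AE x in lborel. summable (\<lambda>n. norm (?t n x))"
    using split(2) by (intro AE_I2) (rule sums_summable)
  have sums: "(\<lambda>n. \<integral>x. ?t n x \<partial>lborel) sums (\<integral>x. f x \<partial>lborel)"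
    using sums_integral[OF int ae sm] split(1) by (simp add: sums_iff)
  have "summable (\<lambda>n. norm (\<integral>x. ?t n x \<partial>lborel))"
  proof (rule summable_comparison_test[OF _ sm], intro exI allI impI)
    fix n
    have "norm (\<integral>x. ?t n x \<partial>lborel) \<le> (\<integral>x. norm (?t n x) \<partial>lborel)" by (rule integral_norm_bound)
    then show "norm (norm (\<integral>x. ?t n x \<partial>lborel)) \<le> (\<integral>x. norm (?t n x) \<partial>lborel)" by simp
  qed
  then have "((\<lambda>n. \<integral>x. ?t n x \<partial>lborel) has_sum (\<integral>x. f x \<partial>lborel)) UNIV"
    using sums by (rule norm_summable_imp_has_sum)
  then show ?thesis
    using has_sum_reindex_bij_betw[OF lattice_enumeration, of "\<lambda>\<nu>. \<integral>x. indicator (cell \<nu>) x *\<^sub>R f x \<partial>lborel"] by simp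
qed

lemma finite_lattice_box: "finite {e \<in> int_lattice. \<forall>b\<in>Basis. \<bar>e \<bullet> b\<bar> \<le> R}"
proof -
  have "{e \<in> int_lattice. \<forall>b\<in>Basis. \<bar>e \<bullet> b\<bar> \<le> R}
      \<subseteq> (\<lambda>k. \<Sum>b\<in>Basis. real_of_int (k b) *\<^sub>R (b :: 'a)) ` PiE Basis (\<lambda>_. {-\<lceil>R\<rceil>..\<lceil>R\<rceil>})"
  proof
    fix \<kappa> :: 'a assume e: "\<kappa> \<in> {e \<in> int_lattice. \<forall>b\<in>Basis. \<bar>e \<bullet> b\<bar> \<le> R}"
    then obtain k where k: "\<And>b. b \<in> Basis \<Longrightarrow> \<kappa> \<bullet> b = real_of_int (k b)"
      unfolding mem_Collect_eq int_lattice_iff by metis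
    have eq: "\<kappa> = (\<Sum>b\<in>Basis. real_of_int (restrict k Basis b) *\<^sub>R b)"
    proof (rule euclidean_eqI)
      fix b :: 'a assume b: "b \<in> Basis"
      then show "\<kappa> \<bullet> b = (\<Sum>b\<in>Basis. real_of_int (restrict k Basis b) *\<^sub>R b) \<bullet> b"
        unfolding inner_sum_left_Basis[OF b] using k[OF b] by simp
    qed
    have "k b \<in> {-\<lceil>R\<rceil>..\<lceil>R\<rceil>}" if "b \<in> Basis" for b
    proof -
      have "\<bar>real_of_int (k b)\<bar> \<le> R" using e k[OF that] that by auto
      then show ?thesis by (simp add: abs_le_iff) linarith
    qed
    then show "\<kappa> \<in> (\<lambda>k. \<Sum>b\<in>Basis. real_of_int (k b) *\<^sub>R (b :: 'a)) ` PiE Basis (\<lambda>_. {-\<lceil>R\<rceil>..\<lceil>R\<rceil>})"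
      by (intro image_eqI[where x="restrict k Basis"] eq) simp
  qed
  then show ?thesis by (rule finite_subset) (intro finite_imageI finite_PiE, auto)
qed

text \<open>This is the form in which bounded overlap is used: \<open>X\<close> indexes the blocks, \<open>Y\<close> the unit cubes.\<close>

lemma summable_on_bounded_fibres:
  fixes g :: "'b \<Rightarrow> real"
  assumes g: "g summable_on Y" "\<And>y. y \<in> Y \<Longrightarrow> 0 \<le> g y" and f: "f ` X \<subseteq> Y"
    and fib: "\<And>y. y \<in> Y \<Longrightarrow> finite {x \<in> X. f x = y} \<and> card {x \<in> X. f x = y} \<le> M"
  shows "(\<lambda>x. g (f x)) summable_on X" "infsum (\<lambda>x. g (f x)) X \<le> real M * infsum g Y"
proof -
  have bound: "(\<Sum>x\<in>A. g (f x)) \<le> real M * infsum g Y" if A: "finite A" "A \<subseteq> X" for A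
  proof -
    have "(\<Sum>x\<in>A. g (f x)) = (\<Sum>y\<in>f ` A. \<Sum>x\<in>{x \<in> A. f x = y}. g (f x))"
      by (rule sum.image_gen[OF A(1)])
    also have "\<dots> = (\<Sum>y\<in>f ` A. real (card {x \<in> A. f x = y}) * g y)"
      by (intro sum.cong) auto
    also have "\<dots> \<le> (\<Sum>y\<in>f ` A. real M * g y)"
    proof (intro sum_mono mult_right_mono)
      fix y assume "y \<in> f ` A"
      then have y: "y \<in> Y" using A(2) f by auto
      then show "0 \<le> g y" by (rule g(2))
      have "card {x \<in> A. f x = y} \<le> card {x \<in> X. f x = y}" using fib[OF y] A(2) by (intro card_mono) auto
      then show "real (card {x \<in> A. f x = y}) \<le> real M" using fib[OF y] by linarith
    qed
    also have "\<dots> = real M * (\<Sum>y\<in>f ` A. g y)" by (simp add: sum_distrib_left)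
    also have "\<dots> \<le> real M * infsum g Y"
      using A f g by (intro mult_left_mono finite_sum_le_infsum) auto
    finally show ?thesis .
  qed
  show sm: "(\<lambda>x. g (f x)) summable_on X"
    using bound f g(2) by (intro nonneg_bdd_above_summable_on) (auto intro!: bdd_aboveI)
  show "infsum (\<lambda>x. g (f x)) X \<le> real M * infsum g Y"
    by (rule infsum_le_finite_sums[OF sm bound])
qed

section \<open>Bounded overlap of the localisation boxes\<close>

text \<open>Divide by \<open>x + y\<close>: on the unit interval \<open>v \<le> v powr q\<close>.\<close>

lemma powr_add_le:
  fixes x y :: real
  assumes q: "0 < q" "q \<le> 1" and "0 \<le> x" "0 \<le> y"
  shows "(x + y) powr q \<le> x powr q + y powr q"
proof (cases "x + y = 0")
  case False
  define s where "s = x + y"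
  have s: "0 < s" using False assms(3,4) by (simp add: s_def)
  have one: "v / s * s powr q \<le> v powr q" if v: "0 \<le> v" "v \<le> s" for v
  proof -
    have "(v / s) powr 1 \<le> (v / s) powr q" using v s q by (intro powr_mono') auto
    then have "v / s * s powr q \<le> (v / s) powr q * s powr q" using v s by (intro mult_right_mono) auto
    also have "\<dots> = v powr q" using v s by (simp add: powr_divide)
    finally show ?thesis .
  qed
  have "x / s + y / s = 1" using s by (simp add: s_def add_divide_distrib[symmetric])
  then have "s powr q = (x / s + y / s) * s powr q" by simp
  then have "s powr q = x / s * s powr q + y / s * s powr q" by (simp only: distrib_right)
  also have "\<dots> \<le> x powr q + y powr q" using assms by (intro add_mono one) (auto simp: s_def)
  finally show ?thesis by (simp add: s_def)
qed (use assms in simp)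

lemma powr_sum_le:
  fixes f :: "'i \<Rightarrow> real"
  assumes q: "0 < q" "q \<le> 1" and "finite A" "\<And>i. i \<in> A \<Longrightarrow> 0 \<le> f i"
  shows "(\<Sum>i\<in>A. f i) powr q \<le> (\<Sum>i\<in>A. f i powr q)"
  using assms(3,4)
proof (induction A rule: finite_induct)
  case (insert i A)
  have "(f i + (\<Sum>i\<in>A. f i)) powr q \<le> f i powr q + (\<Sum>i\<in>A. f i) powr q"
    using insert.prems by (intro powr_add_le[OF q] sum_nonneg) auto
  then show ?case using insert by simp
qed simp

lemma summable_on_of_powr:
  fixes f :: "'i \<Rightarrow> real"
  assumes q: "0 < q" "q \<le> 1" and sm: "(\<lambda>i. f i powr q) summable_on A" and f: "\<And>i. i \<in> A \<Longrightarrow> 0 \<le> f i"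
  shows "f summable_on A"
proof -
  define S where "S = (\<Sum>\<^sub>\<infinity>i\<in>A. f i powr q)"
  have "f i \<le> S powr ((1 - q) / q) * f i powr q" if i: "i \<in> A" for i
  proof (cases "f i = 0")
    case False
    then have fi: "0 < f i" using f[OF i] by simp
    have "f i powr q \<le> S"
      unfolding S_def using finite_sum_le_infsum[OF sm, of "{i}"] i by simp
    then have "(f i powr q) powr ((1 - q) / q) \<le> S powr ((1 - q) / q)"
      using q by (intro powr_mono2) auto
    then have "f i powr (1 - q) * f i powr q \<le> S powr ((1 - q) / q) * f i powr q"
      using q by (intro mult_right_mono) (simp_all add: powr_powr)
    then show ?thesis using fi by (simp add: powr_add[symmetric])
  qed simp
  then show ?thesis
    using f by (intro summable_on_comparison_test[OF summable_on_cmult_right[OF sm, of "S powr ((1 - q) / q)"]]) auto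
qed

lemma summable_on_finite_sum:
  fixes f :: "'i \<Rightarrow> 'b \<Rightarrow> 'c::real_normed_vector"
  shows "finite A \<Longrightarrow> (\<And>i. i \<in> A \<Longrightarrow> f i summable_on X) \<Longrightarrow> (\<lambda>x. \<Sum>i\<in>A. f i x) summable_on X"
  by (induction A rule: finite_induct) (auto intro: summable_on_add)

lemma infsum_finite_sum:
  fixes f :: "'i \<Rightarrow> 'b \<Rightarrow> 'c::real_normed_vector"
  shows "finite A \<Longrightarrow> (\<And>i. i \<in> A \<Longrightarrow> f i summable_on X) \<Longrightarrow>
    (\<Sum>\<^sub>\<infinity>x\<in>X. \<Sum>i\<in>A. f i x) = (\<Sum>i\<in>A. infsum (f i) X)"
  by (induction A rule: finite_induct) (auto simp: infsum_add summable_on_finite_sum)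

lemma has_sum_finite_sum:
  fixes f :: "'i \<Rightarrow> 'b \<Rightarrow> 'c::real_normed_vector"
  assumes "finite A" "\<And>i. i \<in> A \<Longrightarrow> (f i has_sum a i) S"
  shows "((\<lambda>x. \<Sum>i\<in>A. f i x) has_sum (\<Sum>i\<in>A. a i)) S"
  using assms
proof (induction A rule: finite_induct)
  case empty
  show ?case by (simp add: has_sum_0)
next
  case (insert i A)
  have "((\<lambda>x. f i x + (\<Sum>i\<in>A. f i x)) has_sum (a i + (\<Sum>i\<in>A. a i))) S"
    using insert by (intro has_sum_add) auto
  then show ?case using insert by simp
qed

lemma mem_unit_cube: "x \<in> unit_cube u \<longleftrightarrow> (\<forall>b\<in>Basis. \<bar>(x - u) \<bullet> b\<bar> \<le> 1/2)"
proof -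
  have "(\<forall>b\<in>Basis. u \<bullet> b - 1/2 \<le> x \<bullet> b \<and> x \<bullet> b \<le> u \<bullet> b + 1/2) \<longleftrightarrow> (\<forall>b\<in>Basis. \<bar>(x - u) \<bullet> b\<bar> \<le> 1/2)"
    unfolding inner_diff_left by (intro ball_cong refl) linarith
  then show ?thesis by (simp add: unit_cube_def mem_box inner_simps)
qed

lemma unit_cube_Pair: "unit_cube (u, v) = unit_cube u \<times> unit_cube v"
  by (auto simp: mem_unit_cube Basis_prod_def ball_Un)

lemma norm_le_of_coordinates:
  fixes x :: "'a::euclidean_space" and c :: real
  assumes "\<And>b. b \<in> Basis \<Longrightarrow> \<bar>x \<bullet> b\<bar> \<le> c"
  shows "norm x \<le> DIM('a) * c"
proof -
  have "norm x \<le> (\<Sum>b\<in>Basis. \<bar>x \<bullet> b\<bar>)" by (rule norm_le_l1)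
  also have "\<dots> \<le> (\<Sum>b\<in>(Basis :: 'a set). c)" using assms by (rule sum_mono)
  finally show ?thesis by simp
qed

lemma int_lattice_add: "u \<in> int_lattice \<Longrightarrow> v \<in> int_lattice \<Longrightarrow> u + v \<in> int_lattice"
  by (simp add: int_lattice_def inner_add_left)

lemma int_lattice_diff: "u \<in> int_lattice \<Longrightarrow> v \<in> int_lattice \<Longrightarrow> u - v \<in> int_lattice"
  by (simp add: int_lattice_def inner_diff_left)

definition lattice_box :: "real \<Rightarrow> 'a::euclidean_space set" where
  "lattice_box R = {e \<in> int_lattice. \<forall>b\<in>Basis. \<bar>e \<bullet> b\<bar> \<le> R}"

lemma finite_lattice_box': "finite (lattice_box R)"
  unfolding lattice_box_def by (rule finite_lattice_box)

locale substitution =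
  fixes t11 t12 t21 t22 t0 \<delta>0 :: real
  assumes row: "t11 + t12 = 1" and t0: "0 < t0" and \<delta>0: "0 < \<delta>0"
    and bounds: "\<bar>t11\<bar> \<le> t0" "\<bar>t12\<bar> \<le> t0" "\<bar>t21\<bar> \<le> t0" "\<bar>t22\<bar> \<le> t0"
    and det: "\<delta>0 \<le> \<bar>t11 * t22 - t12 * t21\<bar>"
begin

definition \<tau> :: real where "\<tau> = t21 + t22"
definition \<Delta> :: real where "\<Delta> = t11 * t22 - t12 * t21"
definition wpt :: "'a::euclidean_space \<Rightarrow> 'a \<Rightarrow> 'a" where "wpt x y = t11 *\<^sub>R x + t12 *\<^sub>R y"
definition zpt :: "'a::euclidean_space \<Rightarrow> 'a \<Rightarrow> 'a" where "zpt x y = t21 *\<^sub>R x + t22 *\<^sub>R y"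

lemma \<Delta>_nz: "\<Delta> \<noteq> 0" "\<delta>0 \<le> \<bar>\<Delta>\<bar>"
  using det \<delta>0 by (auto simp: \<Delta>_def)

lemma \<Delta>_le: "\<bar>\<Delta>\<bar> \<le> 2 * t0\<^sup>2"
proof -
  have "\<bar>t11 * t22\<bar> \<le> t0 * t0" "\<bar>t12 * t21\<bar> \<le> t0 * t0"
    unfolding abs_mult using bounds t0 by (intro mult_mono; simp)+
  then show ?thesis by (simp add: \<Delta>_def power2_eq_square)
qed

lemma \<tau>_le: "\<bar>\<tau>\<bar> \<le> 2 * t0"
  using bounds by (simp add: \<tau>_def)

text \<open>This identity is where the normalisation of the first row enters.\<close>

lemma zpt_minus: "zpt x y - \<tau> *\<^sub>R wpt x y = \<Delta> *\<^sub>R (y - x)"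
proof -
  have e1: "t21 - \<tau> * t11 = - \<Delta>" unfolding \<tau>_def \<Delta>_def using row by algebra
  have e2: "t22 - \<tau> * t12 = \<Delta>" unfolding \<tau>_def \<Delta>_def using row by algebra
  have e3: "zpt x y - \<tau> *\<^sub>R wpt x y = (t21 - \<tau> * t11) *\<^sub>R x + (t22 - \<tau> * t12) *\<^sub>R y"
    by (simp add: zpt_def wpt_def algebra_simps)
  show ?thesis unfolding e3 e1 e2 by (simp add: scaleR_diff_right)
qed

lemma wpt_zpt_inverse: "\<Delta> *\<^sub>R x = t22 *\<^sub>R wpt x y - t12 *\<^sub>R zpt x y" "\<Delta> *\<^sub>R y = t11 *\<^sub>R zpt x y - t21 *\<^sub>R wpt x y"
  by (simp_all add: \<Delta>_def wpt_def zpt_def algebra_simps)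

lemma wpt_diff: "wpt x y - wpt x' y' = wpt (x - x') (y - y')" "zpt x y - zpt x' y' = zpt (x - x') (y - y')"
  by (simp_all add: wpt_def zpt_def algebra_simps)

definition overlap_radius :: real where "overlap_radius = 2 * t0 / \<delta>0"

lemma inverse_coordinates_le:
  assumes b: "\<bar>wpt x y \<bullet> b\<bar> \<le> 1" "\<bar>zpt x y \<bullet> b\<bar> \<le> 1"
  shows "\<bar>x \<bullet> b\<bar> \<le> overlap_radius" "\<bar>y \<bullet> b\<bar> \<le> overlap_radius"
proof -
  have *: "\<bar>v\<bar> \<le> overlap_radius" if "\<Delta> * v = s * a - s' * a'" "\<bar>s\<bar> \<le> t0" "\<bar>s'\<bar> \<le> t0" "\<bar>a\<bar> \<le> 1" "\<bar>a'\<bar> \<le> 1"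
    for v s s' a a'
  proof -
    have "\<bar>s * a\<bar> \<le> t0 * 1" "\<bar>s' * a'\<bar> \<le> t0 * 1"
      unfolding abs_mult using that t0 by (intro mult_mono; simp)+
    then have "\<bar>\<Delta>\<bar> * \<bar>v\<bar> \<le> 2 * t0" unfolding abs_mult[symmetric] that(1) by simp
    moreover have "\<delta>0 * \<bar>v\<bar> \<le> \<bar>\<Delta>\<bar> * \<bar>v\<bar>" using \<Delta>_nz(2) by (rule mult_right_mono) simp
    ultimately show ?thesis using \<delta>0 by (simp add: overlap_radius_def field_simps)
  qed
  have "\<Delta> * (x \<bullet> b) = t22 * (wpt x y \<bullet> b) - t12 * (zpt x y \<bullet> b)"
    using arg_cong[OF wpt_zpt_inverse(1)[of x y], of "\<lambda>v. v \<bullet> b"] by (simp add: inner_diff_left)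
  then show "\<bar>x \<bullet> b\<bar> \<le> overlap_radius" using b bounds by (intro *)
  have "\<Delta> * (y \<bullet> b) = t11 * (zpt x y \<bullet> b) - t21 * (wpt x y \<bullet> b)"
    using arg_cong[OF wpt_zpt_inverse(2)[of y x], of "\<lambda>v. v \<bullet> b"] by (simp add: inner_diff_left)
  then show "\<bar>y \<bullet> b\<bar> \<le> overlap_radius" using b bounds by (intro *)
qed

text \<open>For a block \<open>(j, k, \<nu>)\<close> the amplitude is localised to a box around \<open>(wpt j k, zpt j k, \<nu>)\<close>. It is
  covered by the unit cubes whose offset \<open>e\<close> from the nearest lattice point lies in a finite set
  independent of the block; for fixed \<open>e\<close> the map from blocks to cubes has bounded fibres.\<close>

definition offset_cube :: "'a::euclidean_space \<times> 'a \<Rightarrow> 'a \<times> 'a \<times> 'a \<Rightarrow> 'a \<times> 'a \<times> 'a" where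
  "offset_cube e jkn = (case jkn of (j, k, \<nu>) \<Rightarrow> (cell_of (wpt j k) + fst e, cell_of (zpt j k) + snd e, \<nu>))"

definition offsets :: "('a::euclidean_space \<times> 'a) set" where
  "offsets = lattice_box (1 + 2 * t0) \<times> lattice_box (1 + 2 * t0)"

lemma finite_offsets: "finite offsets"
  unfolding offsets_def by (intro finite_cartesian_product finite_lattice_box')

lemma offset_cube_in_lattice:
  assumes "e \<in> offsets" "jkn \<in> int_lattice"
  shows "offset_cube e jkn \<in> int_lattice"
proof -
  obtain j k \<nu> where "jkn = (j, k, \<nu>)" by (cases jkn)
  then show ?thesis
    using assms by (auto simp: offset_cube_def offsets_def lattice_box_def int_lattice_Pair
        intro!: int_lattice_add cell_of_in_lattice)
qed

lemma offset_cubes_cover: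
  assumes "(w, z, \<xi>) \<in> cbox (wpt j k - (2 * t0) *\<^sub>R One, zpt j k - (2 * t0) *\<^sub>R One, \<nu> - (1/2) *\<^sub>R One)
    (wpt j k + (2 * t0) *\<^sub>R One, zpt j k + (2 * t0) *\<^sub>R One, \<nu> + (1/2) *\<^sub>R One)"
  shows "\<exists>e\<in>offsets. (w, z, \<xi>) \<in> unit_cube (offset_cube e (j, k, \<nu>))"
proof -
  have near: "cell_of x - cell_of x0 \<in> lattice_box (1 + 2 * t0)"
    if "x \<in> cbox (x0 - (2 * t0) *\<^sub>R One) (x0 + (2 * t0) *\<^sub>R One)" for x x0 :: 'a
    unfolding lattice_box_def
  proof (intro CollectI conjI ballI)
    show "cell_of x - cell_of x0 \<in> int_lattice" by (intro int_lattice_diff cell_of_in_lattice)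
    fix b :: 'a assume b: "b \<in> Basis"
    have "x0 \<bullet> b - 2 * t0 \<le> x \<bullet> b" "x \<bullet> b \<le> x0 \<bullet> b + 2 * t0"
      using that b by (auto simp: mem_box inner_simps)
    then show "\<bar>(cell_of x - cell_of x0) \<bullet> b\<bar> \<le> 1 + 2 * t0"
      using cell_of_dist[OF b, of x] cell_of_dist[OF b, of x0] unfolding inner_diff_left by linarith
  qed
  let ?e = "(cell_of w - cell_of (wpt j k), cell_of z - cell_of (zpt j k))"
  have m: "w \<in> cbox (wpt j k - (2 * t0) *\<^sub>R One) (wpt j k + (2 * t0) *\<^sub>R One)"
    "z \<in> cbox (zpt j k - (2 * t0) *\<^sub>R One) (zpt j k + (2 * t0) *\<^sub>R One)" "\<xi> \<in> unit_cube \<nu>"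
    using assms by (simp_all add: cbox_Pair_eq unit_cube_def)
  have "?e \<in> offsets" unfolding offsets_def using near[OF m(1)] near[OF m(2)] by simp
  moreover have "x \<in> unit_cube (cell_of x)" for x :: 'a
    using cell_subset_unit_cube[of "cell_of x"] by (auto simp: cell_def)
  then have "(w, z, \<xi>) \<in> unit_cube (offset_cube ?e (j, k, \<nu>))"
    using m(3) by (simp add: offset_cube_def unit_cube_Pair)
  ultimately show ?thesis by blast
qed

text \<open>Two blocks with the same cube have images under the matrix that differ by at most 1 in each
  coordinate, and the inverse matrix is bounded.\<close>

lemma offset_cube_fibre:
  fixes e :: "'a::euclidean_space \<times> 'a"
  shows "finite {jkn \<in> int_lattice. offset_cube e jkn = y} \<and>
    card {jkn \<in> int_lattice. offset_cube e jkn = y} \<le> (card (lattice_box overlap_radius :: 'a set))\<^sup>2"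
proof (cases "{jkn \<in> int_lattice. offset_cube e jkn = y} = {}")
  case False
  let ?X = "{jkn \<in> int_lattice. offset_cube e jkn = y}"
  let ?L = "lattice_box overlap_radius :: 'a set"
  obtain j0 k0 \<nu>0 where 0: "(j0, k0, \<nu>0) \<in> ?X" using False by auto
  let ?h = "\<lambda>(j, k, \<nu>). (j - j0, k - k0)"
  have third: "\<nu> = \<nu>0" if "(j, k, \<nu>) \<in> ?X" for j k \<nu>
    using that 0 by (auto simp: offset_cube_def)
  have "inj_on ?h ?X"
  proof (rule inj_onI)
    fix a b assume ab: "a \<in> ?X" "b \<in> ?X" "?h a = ?h b"
    obtain j k \<nu> j' k' \<nu>' where "a = (j, k, \<nu>)" "b = (j', k', \<nu>')" by (cases a, cases b)
    then show "a = b" using ab third[of j k \<nu>] third[of j' k' \<nu>'] by simp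
  qed
  moreover have "?h ` ?X \<subseteq> ?L \<times> ?L"
  proof
    fix v assume "v \<in> ?h ` ?X"
    then obtain j k \<nu> where v: "v = (j - j0, k - k0)" and X: "(j, k, \<nu>) \<in> ?X" by auto
    have eq: "cell_of (wpt j k) = cell_of (wpt j0 k0)" "cell_of (zpt j k) = cell_of (zpt j0 k0)"
      using X 0 by (auto simp: offset_cube_def)
    have "\<bar>wpt (j - j0) (k - k0) \<bullet> b\<bar> \<le> 1" "\<bar>zpt (j - j0) (k - k0) \<bullet> b\<bar> \<le> 1" if b: "b \<in> Basis" for b
      unfolding wpt_diff[symmetric]
      using cell_of_dist[OF b, of "wpt j k"] cell_of_dist[OF b, of "wpt j0 k0"]
        cell_of_dist[OF b, of "zpt j k"] cell_of_dist[OF b, of "zpt j0 k0"]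
      unfolding eq inner_diff_left by linarith+
    then have "\<bar>(j - j0) \<bullet> b\<bar> \<le> overlap_radius" "\<bar>(k - k0) \<bullet> b\<bar> \<le> overlap_radius" if "b \<in> Basis" for b
      using inverse_coordinates_le[of "j - j0" "k - k0" b] that by blast+
    moreover have "j - j0 \<in> int_lattice" "k - k0 \<in> int_lattice"
      using X 0 by (auto simp: int_lattice_Pair intro: int_lattice_diff)
    ultimately show "v \<in> ?L \<times> ?L" by (simp add: v lattice_box_def)
  qed
  moreover have "finite (?L \<times> ?L)" by (intro finite_cartesian_product finite_lattice_box')
  ultimately have "finite ?X" "card ?X \<le> card (?L \<times> ?L)"
    by (meson inj_on_finite, meson card_inj_on_le)
  then show ?thesis by (simp add: card_cartesian_product power2_eq_square)
next
  case True
  then show ?thesis by (simp only:) simp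
qed

definition growth_const :: "nat \<Rightarrow> nat \<Rightarrow> real" where
  "growth_const d m = 2 * (1 + 2 * t0 * d * (1 + 2 * t0) + 2 * t0\<^sup>2) ^ m"

text \<open>By \<open>zpt_minus\<close> the quantity \<open>z - \<tau> w\<close> equals \<open>\<Delta> (k - j)\<close> at the centre of the box, and it varies by a
  bounded amount on the box.\<close>

lemma majorant_weight_le:
  fixes w z j k :: "'a::euclidean_space"
  assumes "\<And>b. b \<in> Basis \<Longrightarrow> \<bar>(w - wpt j k) \<bullet> b\<bar> \<le> 2 * t0" "\<And>b. b \<in> Basis \<Longrightarrow> \<bar>(z - zpt j k) \<bullet> b\<bar> \<le> 2 * t0"
  shows "1 + norm (z - \<tau> *\<^sub>R w) ^ m \<le> growth_const DIM('a) m * (1 + norm (j - k)) ^ m"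
proof -
  let ?d = "real DIM('a)"
  let ?R = "1 + 2 * t0 * ?d * (1 + 2 * t0) + 2 * t0\<^sup>2"
  have "z - \<tau> *\<^sub>R w = (z - zpt j k) - \<tau> *\<^sub>R (w - wpt j k) + \<Delta> *\<^sub>R (k - j)"
    using zpt_minus[of j k] by (simp add: algebra_simps)
  also have "norm \<dots> \<le> norm (z - zpt j k) + \<bar>\<tau>\<bar> * norm (w - wpt j k) + \<bar>\<Delta>\<bar> * norm (j - k)"
    using norm_triangle_ineq[of "(z - zpt j k) - \<tau> *\<^sub>R (w - wpt j k)" "\<Delta> *\<^sub>R (k - j)"]
      norm_triangle_ineq4[of "z - zpt j k" "\<tau> *\<^sub>R (w - wpt j k)"]
    by (simp add: norm_minus_commute[of k j])
  also have "\<dots> \<le> ?d * (2 * t0) + (2 * t0) * (?d * (2 * t0)) + 2 * t0\<^sup>2 * norm (j - k)"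
    using t0 assms
    by (intro add_mono mult_mono mult_right_mono norm_le_of_coordinates \<tau>_le \<Delta>_le) auto
  also have "\<dots> \<le> ?R * (1 + norm (j - k))"
  proof -
    have "0 \<le> norm (j - k)" "0 \<le> 2 * t0 * ?d * (1 + 2 * t0) * norm (j - k)" "0 \<le> 2 * t0\<^sup>2"
      using t0 by auto
    then show ?thesis by (simp add: algebra_simps)
  qed
  finally have le: "norm (z - \<tau> *\<^sub>R w) ^ m \<le> (?R * (1 + norm (j - k))) ^ m" by (intro power_mono) auto
  have "1 \<le> ?R" using t0 by simp
  then have "1 * 1 \<le> ?R * (1 + norm (j - k))" by (intro mult_mono) auto
  then have "1 \<le> (?R * (1 + norm (j - k))) ^ m" by (intro one_le_power) simp
  then show ?thesis using le by (simp add: growth_const_def power_mult_distrib)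
qed

end

section \<open>Summing the localised integrals of the majorant\<close>

locale amplitude_bound = substitution t11 t12 t21 t22 t0 \<delta>0
  for t11 t12 t21 t22 t0 \<delta>0 :: real +
  fixes q :: real and n m :: nat and B :: real and \<phi> :: "nat \<Rightarrow> real \<Rightarrow> real"
    and p :: "'a::euclidean_space \<times> 'a \<times> 'a \<Rightarrow> complex"
  assumes q: "0 < q" "q \<le> 1" and nq: "DIM('a) < real n * q"
    and cut: "cutoff n B \<phi>" and p: "smooth_amplitude n m p"
    and maj: "amp_majorant n m (t21 + t22) p \<in> lattice_space 1 q"
begin

definition majorant :: "'a \<times> 'a \<times> 'a \<Rightarrow> real" where "majorant = amp_majorant n m \<tau> p"

lemma n: "DIM('a) < n"
proof -
  have "real n * q \<le> real n" using q by (simp add: mult_left_le)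
  then show ?thesis using nq by simp
qed

lemma majorant_eq: "majorant x = grad_sum n m p x / (1 + norm (fst (snd x) - \<tau> *\<^sub>R fst x) ^ m)"
  by (cases x) (simp add: majorant_def amp_majorant_def grad_sum_def)

lemma majorant_nonneg: "0 \<le> majorant x"
  by (simp add: majorant_eq grad_sum_nonneg)

lemma continuous_majorant: "continuous_on UNIV majorant"
proof -
  have "0 < 1 + norm (fst (snd x) - \<tau> *\<^sub>R fst x) ^ m" for x :: "'a \<times> 'a \<times> 'a"
    by (rule add_pos_nonneg) auto
  then have "1 + norm (fst (snd x) - \<tau> *\<^sub>R fst x) ^ m \<noteq> 0" for x :: "'a \<times> 'a \<times> 'a"
    by (simp add: less_imp_neq[symmetric])
  then show ?thesis unfolding majorant_eq[abs_def]
    by (intro continuous_intros continuous_grad_sum[OF p]) auto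
qed

definition cube_mass :: "'a \<times> 'a \<times> 'a \<Rightarrow> real" where
  "cube_mass u = (\<integral>x. indicator (unit_cube u) x * majorant x \<partial>lborel)"

lemma cube_mass_eq: "cube_mass u = cube_integral 1 majorant u"
proof -
  have [measurable]: "majorant \<in> borel_measurable borel" by (rule borel_measurable_continuous_onI[OF continuous_majorant])
  have "cube_integral 1 majorant u = (\<integral>x. indicator (unit_cube u) x * majorant x \<partial>lebesgue)"
    by (simp add: cube_integral_def set_lebesgue_integral_def majorant_nonneg)
  also have "\<dots> = cube_mass u"
    unfolding cube_mass_def unit_cube_def by (intro integral_completion) measurable
  finally show ?thesis by simp
qed

lemma cube_mass_nonneg: "0 \<le> cube_mass u"
  unfolding cube_mass_def by (intro Bochner_Integration.integral_nonneg) (simp add: majorant_nonneg)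

lemma summable_cube_mass: "(\<lambda>u. cube_mass u powr q) summable_on int_lattice"
  using maj unfolding cube_mass_eq by (simp add: lattice_space_def majorant_def \<tau>_def)

definition total_mass :: real where "total_mass = (\<Sum>\<^sub>\<infinity>u\<in>int_lattice. cube_mass u powr q)"

lemma total_mass_eq: "total_mass powr (1 / q) = lattice_norm 1 q (amp_majorant n m (t21 + t22) p)"
  by (simp add: total_mass_def cube_mass_eq lattice_norm_def majorant_def \<tau>_def)

definition block_integral :: "'a \<times> 'a \<times> 'a \<Rightarrow> real" where
  "block_integral jkn = (case jkn of (j, k, \<nu>) \<Rightarrow>
    local_integral t0 (wpt j k) (zpt j k) (\<nu> - (1/2) *\<^sub>R One) (\<nu> + (1/2) *\<^sub>R One) (grad_sum n m p))"

text \<open>The integral of the majorant over the box of a block, up to a constant factor: the denominator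
  of the majorant is replaced by its size at the centre of the block.\<close>

definition block_mass :: "'a \<times> 'a \<times> 'a \<Rightarrow> real" where
  "block_mass jkn = block_integral jkn / (1 + norm (fst jkn - fst (snd jkn))) ^ m"

lemma block_integral_nonneg: "0 \<le> block_integral jkn"
  unfolding block_integral_def local_integral_def
  by (cases jkn) (auto intro!: Bochner_Integration.integral_nonneg simp: grad_sum_nonneg)

lemma one_plus_norm_power_pos: "0 < (1 + norm v) ^ m"
  by (intro zero_less_power add_pos_nonneg) auto

lemma block_mass_nonneg: "0 \<le> block_mass jkn"
  unfolding block_mass_def by (intro divide_nonneg_nonneg block_integral_nonneg less_imp_le[OF one_plus_norm_power_pos])

text \<open>Cover the box by unit cubes and bound the denominator on it.\<close>

lemma block_mass_le:
  "block_mass jkn \<le> growth_const DIM('a) m * (\<Sum>e\<in>offsets. cube_mass (offset_cube e jkn))"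
proof -
  obtain j k \<nu> where jkn: "jkn = (j, k, \<nu>)" by (cases jkn)
  let ?S = "cbox (wpt j k - (2 * t0) *\<^sub>R One, zpt j k - (2 * t0) *\<^sub>R One, \<nu> - (1/2) *\<^sub>R One)
    (wpt j k + (2 * t0) *\<^sub>R One, zpt j k + (2 * t0) *\<^sub>R One, \<nu> + (1/2) *\<^sub>R One)"
  let ?g = "growth_const DIM('a) m * (1 + norm (j - k)) ^ m"
  have g0: "0 \<le> ?g" using t0 by (simp add: growth_const_def)
  have int: "integrable lborel (\<lambda>x. indicator (cbox a b) x * h x)" if "continuous_on UNIV h" for a b and h :: "'a \<times> 'a \<times> 'a \<Rightarrow> real"
    using borel_integrable_compact[of "cbox a b" h] continuous_on_subset[OF that] by simp
  have pt: "indicator ?S x * grad_sum n m p x \<le> (\<Sum>e\<in>offsets. ?g * (indicator (unit_cube (offset_cube e jkn)) x * majorant x))" for x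
  proof (cases "x \<in> ?S")
    case True
    obtain w z \<xi> where x: "x = (w, z, \<xi>)" by (cases x)
    obtain e where e: "e \<in> offsets" "x \<in> unit_cube (offset_cube e jkn)"
      using offset_cubes_cover[of w z \<xi> j k \<nu>] True unfolding x jkn by blast
    have "\<bar>(w - wpt j k) \<bullet> b\<bar> \<le> 2 * t0 \<and> \<bar>(z - zpt j k) \<bullet> b\<bar> \<le> 2 * t0" if "b \<in> Basis" for b
    proof -
      have "wpt j k \<bullet> b - 2 * t0 \<le> w \<bullet> b \<and> w \<bullet> b \<le> wpt j k \<bullet> b + 2 * t0 \<and>
          zpt j k \<bullet> b - 2 * t0 \<le> z \<bullet> b \<and> z \<bullet> b \<le> zpt j k \<bullet> b + 2 * t0"
        using True that unfolding x by (auto simp: cbox_Pair_eq mem_box inner_simps)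
      then show ?thesis unfolding inner_diff_left by linarith
    qed
    then have "1 + norm (z - \<tau> *\<^sub>R w) ^ m \<le> ?g" by (intro majorant_weight_le) auto
    then have "majorant x * (1 + norm (z - \<tau> *\<^sub>R w) ^ m) \<le> majorant x * ?g" by (rule mult_left_mono[OF _ majorant_nonneg])
    moreover have "0 < 1 + norm (z - \<tau> *\<^sub>R w) ^ m" by (rule add_pos_nonneg) auto
    then have "majorant x * (1 + norm (z - \<tau> *\<^sub>R w) ^ m) = grad_sum n m p x"
      by (simp add: majorant_eq x)
    ultimately have "indicator ?S x * grad_sum n m p x \<le> ?g * (indicator (unit_cube (offset_cube e jkn)) x * majorant x)"
      using True e by (simp add: mult.commute)
    also have "\<dots> \<le> (\<Sum>e\<in>offsets. ?g * (indicator (unit_cube (offset_cube e jkn)) x * majorant x))"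
      using e(1) g0 majorant_nonneg by (intro member_le_sum finite_offsets) auto
    finally show ?thesis .
  next
    case False
    have "0 \<le> (\<Sum>e\<in>offsets. ?g * (indicator (unit_cube (offset_cube e jkn)) x * majorant x))"
      by (intro sum_nonneg mult_nonneg_nonneg[OF g0] mult_nonneg_nonneg majorant_nonneg) simp
    then show ?thesis using False by simp
  qed
  have "block_integral jkn \<le> (\<integral>x. (\<Sum>e\<in>offsets. ?g * (indicator (unit_cube (offset_cube e jkn)) x * majorant x)) \<partial>lborel)"
    unfolding block_integral_def local_integral_def jkn prod.case
  proof (rule integral_mono)
    show "integrable lborel (\<lambda>x. indicator ?S x * grad_sum n m p x)"
      by (rule int[OF continuous_grad_sum[OF p]])
    show "integrable lborel (\<lambda>x. \<Sum>e\<in>offsets. ?g * (indicator (unit_cube (offset_cube e (j, k, \<nu>))) x * majorant x))"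
      unfolding unit_cube_def
      by (intro Bochner_Integration.integrable_sum Bochner_Integration.integrable_mult_right int continuous_majorant)
  qed (use pt in \<open>simp add: jkn\<close>)
  also have "\<dots> = (\<Sum>e\<in>offsets. ?g * cube_mass (offset_cube e jkn))"
    unfolding cube_mass_def unit_cube_def
    by (subst Bochner_Integration.integral_sum)
      (auto intro!: Bochner_Integration.integrable_mult_right int continuous_majorant)
  also have "\<dots> = (growth_const DIM('a) m * (\<Sum>e\<in>offsets. cube_mass (offset_cube e jkn))) * (1 + norm (j - k)) ^ m"
    by (simp add: sum_distrib_left sum_distrib_right mult_ac)
  finally show ?thesis
    unfolding block_mass_def jkn fst_conv snd_conv by (simp add: pos_divide_le_eq[OF one_plus_norm_power_pos])
qed

definition overlap_const :: real where
  "overlap_const = growth_const DIM('a) m powr q * (card (offsets :: ('a \<times> 'a) set) *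
    (real (card (lattice_box overlap_radius :: 'a set)))\<^sup>2)"

lemma summable_block_mass_powr: "(\<lambda>jkn. block_mass jkn powr q) summable_on int_lattice"
  and sum_block_mass_powr_le: "(\<Sum>\<^sub>\<infinity>jkn\<in>int_lattice. block_mass jkn powr q) \<le> overlap_const * total_mass"
proof -
  let ?M = "(card (lattice_box overlap_radius :: 'a set))\<^sup>2"
  let ?g = "growth_const DIM('a) m"
  let ?h = "\<lambda>e jkn. cube_mass (offset_cube e jkn) powr q"
  have g0: "0 \<le> ?g" using t0 by (simp add: growth_const_def)
  have one: "?h e summable_on int_lattice" "infsum (?h e) int_lattice \<le> real ?M * total_mass"
    if e: "e \<in> offsets" for e
    unfolding total_mass_def
    by (rule summable_on_bounded_fibres[OF summable_cube_mass, where f="offset_cube e" and M="?M"];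
      use offset_cube_in_lattice[OF e] offset_cube_fibre[of e] in auto)+
  have le: "block_mass jkn powr q \<le> (\<Sum>e\<in>offsets. ?g powr q * ?h e jkn)" for jkn
  proof -
    have "block_mass jkn powr q \<le> (?g * (\<Sum>e\<in>offsets. cube_mass (offset_cube e jkn))) powr q"
      using q by (intro powr_mono2 block_mass_le block_mass_nonneg) auto
    also have "\<dots> = ?g powr q * (\<Sum>e\<in>offsets. cube_mass (offset_cube e jkn)) powr q"
      using g0 by (simp add: powr_mult sum_nonneg cube_mass_nonneg)
    also have "\<dots> \<le> ?g powr q * (\<Sum>e\<in>offsets. ?h e jkn)"
      by (intro mult_left_mono powr_sum_le q finite_offsets cube_mass_nonneg) auto
    finally show ?thesis by (simp add: sum_distrib_left)
  qed
  have sm: "(\<lambda>jkn. \<Sum>e\<in>offsets. ?g powr q * ?h e jkn) summable_on int_lattice"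
    by (intro summable_on_finite_sum finite_offsets summable_on_cmult_right one)
  show sm': "(\<lambda>jkn. block_mass jkn powr q) summable_on int_lattice"
    by (rule summable_on_comparison_test[OF sm]) (use le in auto)
  have "(\<Sum>\<^sub>\<infinity>jkn\<in>int_lattice. block_mass jkn powr q) \<le> (\<Sum>\<^sub>\<infinity>jkn\<in>int_lattice. \<Sum>e\<in>offsets. ?g powr q * ?h e jkn)"
    by (rule infsum_mono[OF sm' sm le])
  also have "\<dots> = (\<Sum>e\<in>offsets. \<Sum>\<^sub>\<infinity>jkn\<in>int_lattice. ?g powr q * ?h e jkn)"
    by (rule infsum_finite_sum[OF finite_offsets]) (intro summable_on_cmult_right one)
  also have "\<dots> \<le> (\<Sum>e\<in>(offsets :: ('a \<times> 'a) set). ?g powr q * (real ?M * total_mass))"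
    by (intro sum_mono) (use one in \<open>simp add: infsum_cmult_right mult_left_mono\<close>)
  also have "\<dots> = overlap_const * total_mass" by (simp add: overlap_const_def mult_ac)
  finally show "(\<Sum>\<^sub>\<infinity>jkn\<in>int_lattice. block_mass jkn powr q) \<le> overlap_const * total_mass" .
qed

lemma summable_block_mass: "block_mass summable_on int_lattice"
  by (rule summable_on_of_powr[OF q summable_block_mass_powr block_mass_nonneg])

end

section \<open>The kernel as a series of products\<close>

context amplitude_bound
begin

text \<open>The coefficients of \<open>(x - y) \<bullet> (\<xi> - \<nu>)\<close> as a linear function of \<open>wpt x y\<close> and \<open>zpt x y\<close>, obtained by
  solving \<open>zpt_minus\<close> for \<open>x - y\<close>.\<close>

definition \<theta> :: "'a \<Rightarrow> 'a \<Rightarrow> 'a" where "\<theta> \<nu> \<xi> = (\<tau> / \<Delta>) *\<^sub>R (\<xi> - \<nu>)"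
definition \<theta>' :: "'a \<Rightarrow> 'a \<Rightarrow> 'a" where "\<theta>' \<nu> \<xi> = (- 1 / \<Delta>) *\<^sub>R (\<xi> - \<nu>)"
definition \<Theta> :: real where "\<Theta> = 1 + (1 + 2 * t0) / \<delta>0"

lemma phase_identity: "wpt x y \<bullet> \<theta> \<nu> \<xi> + zpt x y \<bullet> \<theta>' \<nu> \<xi> = (x - y) \<bullet> (\<xi> - \<nu>)"
proof -
  have "wpt x y \<bullet> \<theta> \<nu> \<xi> + zpt x y \<bullet> \<theta>' \<nu> \<xi> = - (1 / \<Delta>) * ((zpt x y - \<tau> *\<^sub>R wpt x y) \<bullet> (\<xi> - \<nu>))"
    by (simp add: \<theta>_def \<theta>'_def inner_diff_left algebra_simps diff_divide_distrib)
  then show ?thesis using \<Delta>_nz by (simp add: zpt_minus inner_diff_left algebra_simps)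
qed

lemma \<Theta>_ge_1: "1 \<le> \<Theta>"
  using t0 \<delta>0 by (simp add: \<Theta>_def)

lemma continuous_\<theta>: "continuous_on UNIV (\<theta> \<nu>)" "continuous_on UNIV (\<theta>' \<nu>)"
  unfolding \<theta>_def[abs_def] \<theta>'_def[abs_def] by (intro continuous_intros)+

lemma \<theta>_le:
  assumes "\<xi> \<in> cbox (\<nu> - (1/2) *\<^sub>R One) (\<nu> + (1/2) *\<^sub>R One)" "b \<in> Basis"
  shows "\<bar>\<theta> \<nu> \<xi> \<bullet> b\<bar> \<le> \<Theta>" "\<bar>\<theta>' \<nu> \<xi> \<bullet> b\<bar> \<le> \<Theta>"
proof -
  have half: "\<bar>(\<xi> - \<nu>) \<bullet> b\<bar> \<le> 1/2" using assms mem_unit_cube[of \<xi> \<nu>] by (simp add: unit_cube_def)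
  have *: "\<bar>(s / \<Delta>) * y\<bar> \<le> \<Theta>" if s: "\<bar>s\<bar> \<le> 1 + 2 * t0" and y: "\<bar>y\<bar> \<le> 1/2" for s y
  proof -
    have "\<bar>s\<bar> / \<bar>\<Delta>\<bar> \<le> (1 + 2 * t0) / \<delta>0"
      using s \<Delta>_nz \<delta>0 t0 by (intro frac_le) auto
    then have "\<bar>s\<bar> / \<bar>\<Delta>\<bar> * \<bar>y\<bar> \<le> (1 + 2 * t0) / \<delta>0 * 1"
      using y t0 \<delta>0 by (intro mult_mono) auto
    then show ?thesis by (simp add: \<Theta>_def abs_mult abs_divide)
  qed
  show "\<bar>\<theta> \<nu> \<xi> \<bullet> b\<bar> \<le> \<Theta>" "\<bar>\<theta>' \<nu> \<xi> \<bullet> b\<bar> \<le> \<Theta>"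
    unfolding \<theta>_def \<theta>'_def inner_scaleR_left using \<tau>_le t0 by (intro * half; simp)+
qed

definition freq_deriv :: "'a \<Rightarrow> nat \<Rightarrow> 'a \<times> 'a \<times> 'a \<Rightarrow> complex" where
  "freq_deriv i l = pderivs (replicate l (0, 0, i)) p"

lemma freq_deriv_0: "freq_deriv i 0 = p"
  by (simp add: freq_deriv_def pderivs_def)

lemma has_cont_pderivs_xi:
  assumes "i \<in> Basis" "l \<le> m"
  shows "has_cont_pderivs (replicate l (0, 0, i)) p"
proof -
  have "has_cont_pderivs (replicate 0 (i, 0, 0) @ replicate 0 (0, i, 0) @ replicate l (0, 0, i)) p"
    using p assms replicate_mem_dirs[OF assms(1)] unfolding smooth_amplitude_def by blast
  then show ?thesis by simp
qed

lemma continuous_freq_deriv: "i \<in> Basis \<Longrightarrow> l \<le> m \<Longrightarrow> continuous_on UNIV (freq_deriv i l)"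
  using has_cont_pderivs_xi by (simp add: freq_deriv_def has_cont_pderivs_def)

lemma wpt_cell_le:
  assumes "x \<in> cell j" "y \<in> cell k" "b \<in> Basis"
  shows "\<bar>(wpt x y - wpt j k) \<bullet> b\<bar> \<le> t0" "\<bar>(zpt x y - zpt j k) \<bullet> b\<bar> \<le> t0"
proof -
  have s: "\<bar>(x - j) \<bullet> b\<bar> \<le> 1/2" "\<bar>(y - k) \<bullet> b\<bar> \<le> 1/2"
    using assms cell_of_dist[OF assms(3)] by (auto simp: cell_def)
  have *: "\<bar>s * v + s' * v'\<bar> \<le> t0" if "\<bar>s\<bar> \<le> t0" "\<bar>s'\<bar> \<le> t0" "\<bar>v\<bar> \<le> 1/2" "\<bar>v'\<bar> \<le> 1/2" for s s' v v' :: real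
  proof -
    have "\<bar>s * v\<bar> \<le> t0 * (1/2)" "\<bar>s' * v'\<bar> \<le> t0 * (1/2)"
      unfolding abs_mult using that t0 by (intro mult_mono; simp)+
    then show ?thesis using abs_triangle_ineq[of "s * v" "s' * v'"] by linarith
  qed
  have "(wpt x y - wpt j k) \<bullet> b = t11 * ((x - j) \<bullet> b) + t12 * ((y - k) \<bullet> b)"
    "(zpt x y - zpt j k) \<bullet> b = t21 * ((x - j) \<bullet> b) + t22 * ((y - k) \<bullet> b)"
    unfolding wpt_diff by (simp_all add: wpt_def zpt_def inner_add_left)
  then show "\<bar>(wpt x y - wpt j k) \<bullet> b\<bar> \<le> t0" "\<bar>(zpt x y - zpt j k) \<bullet> b\<bar> \<le> t0"
    using s bounds by (auto intro!: *)
qed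

definition coefficient :: "'a \<Rightarrow> nat \<Rightarrow> 'a \<times> 'a \<times> 'a \<Rightarrow> 'a \<times> 'a \<Rightarrow> complex" where
  "coefficient i l jkn \<kappa> = (case jkn of (j, k, \<nu>) \<Rightarrow>
    amp_coefficient \<phi> t0 (wpt j k) (zpt j k) (\<theta> \<nu>) (\<theta>' \<nu>) (indicator (cell \<nu>)) (freq_deriv i l) \<kappa>)"

abbreviation (input) lw :: "'a \<times> 'a \<Rightarrow> real" where "lw \<equiv> lattice_weight (real n / real DIM('a))"

definition coeff_const :: real where "coeff_const = coefficient_const n B t0 \<Theta> DIM('a)"

definition slice_const :: real where "slice_const = coeff_const * infsum lw int_lattice"

lemma summable_lw: "lw summable_on int_lattice"
  by (rule summable_lattice_weight) (use n in auto)

lemma coeff_const_nonneg: "0 \<le> coeff_const"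
proof -
  have "1 \<le> B" using cut by (simp add: cutoff_def)
  then show ?thesis using t0 \<Theta>_ge_1 by (simp add: coeff_const_def coefficient_const_def)
qed

lemma indicator_cell_outside:
  "\<xi> \<notin> cbox (\<nu> - (1/2) *\<^sub>R One) (\<nu> + (1/2) *\<^sub>R One) \<Longrightarrow> indicator (cell \<nu>) \<xi> = (0 :: complex)"
  using cell_subset_unit_cube[of \<nu>] by (auto simp: indicator_def unit_cube_def)

lemma norm_indicator_le: "cmod (indicator A \<xi>) \<le> 1"
  by (simp add: indicator_def)

lemma coefficient_le:
  assumes i: "i \<in> Basis" "l \<le> m" and \<kappa>: "\<kappa> \<in> int_lattice"
  shows "cmod (coefficient i l jkn \<kappa>) \<le> coeff_const * lw \<kappa> * block_integral jkn"
proof -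
  obtain j k \<nu> where jkn: "jkn = (j, k, \<nu>)" by (cases jkn)
  have "cmod (amp_coefficient \<phi> t0 (wpt j k) (zpt j k) (\<theta> \<nu>) (\<theta>' \<nu>) (indicator (cell \<nu>)) (pderivs (replicate l (0, 0, i)) p) \<kappa>)
    \<le> coefficient_const n B t0 \<Theta> DIM('a) * lattice_weight (real n / real DIM('a)) \<kappa> *
      local_integral t0 (wpt j k) (zpt j k) (\<nu> - (1/2) *\<^sub>R One) (\<nu> + (1/2) *\<^sub>R One) (grad_sum n m p)"
    by (rule amp_coefficient_le[OF cut t0 \<Theta>_ge_1 continuous_\<theta>])
      (use \<theta>_le p replicate_mem_dirs(3)[OF i(1)] i n \<kappa> in \<open>auto simp: indicator_cell_outside norm_indicator_le\<close>)
  then show ?thesis by (simp add: coefficient_def jkn freq_deriv_def coeff_const_def block_integral_def)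
qed

lemma cell_expansion:
  assumes i: "i \<in> Basis" "l \<le> m" and xy: "x \<in> cell j" "y \<in> cell k"
  shows "((\<lambda>\<kappa>. cis ((x - y) \<bullet> \<nu>) * (cis (\<kappa> \<bullet> (wpt x y, zpt x y) / (2 * t0)) * coefficient i l (j, k, \<nu>) \<kappa>))
    has_sum (\<integral>\<xi>. indicator (cell \<nu>) \<xi> *\<^sub>R (cis ((x - y) \<bullet> \<xi>) * freq_deriv i l (wpt x y, zpt x y, \<xi>)) \<partial>lborel)) int_lattice"
proof -
  have "((\<lambda>\<kappa>. cis (\<kappa> \<bullet> (wpt x y, zpt x y) / (2 * t0)) *
      amp_coefficient \<phi> t0 (wpt j k) (zpt j k) (\<theta> \<nu>) (\<theta>' \<nu>) (indicator (cell \<nu>)) (pderivs (replicate l (0, 0, i)) p) \<kappa>)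
    has_sum (\<integral>\<xi>. indicator (cell \<nu>) \<xi> * (cis (wpt x y \<bullet> \<theta> \<nu> \<xi> + zpt x y \<bullet> \<theta>' \<nu> \<xi>) *
      pderivs (replicate l (0, 0, i)) p (wpt x y, zpt x y, \<xi>)) \<partial>lborel)) int_lattice"
    by (rule localized_expansion[OF cut t0 \<Theta>_ge_1 continuous_\<theta>, where ?c1.0="\<nu> - (1/2) *\<^sub>R One" and ?c2.0="\<nu> + (1/2) *\<^sub>R One"])
      (use \<theta>_le p replicate_mem_dirs(3)[OF i(1)] i n wpt_cell_le[OF xy] in \<open>auto simp: indicator_cell_outside norm_indicator_le\<close>)
  from has_sum_cmult_right[OF this, of "cis ((x - y) \<bullet> \<nu>)"]
  have "((\<lambda>\<kappa>. cis ((x - y) \<bullet> \<nu>) * (cis (\<kappa> \<bullet> (wpt x y, zpt x y) / (2 * t0)) * coefficient i l (j, k, \<nu>) \<kappa>))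
    has_sum (cis ((x - y) \<bullet> \<nu>) * (\<integral>\<xi>. indicator (cell \<nu>) \<xi> * (cis ((x - y) \<bullet> (\<xi> - \<nu>)) * freq_deriv i l (wpt x y, zpt x y, \<xi>)) \<partial>lborel))) int_lattice"
    by (simp add: coefficient_def freq_deriv_def phase_identity)
  moreover have "cis ((x - y) \<bullet> \<nu>) * (\<integral>\<xi>. indicator (cell \<nu>) \<xi> * (cis ((x - y) \<bullet> (\<xi> - \<nu>)) * freq_deriv i l (wpt x y, zpt x y, \<xi>)) \<partial>lborel)
      = (\<integral>\<xi>. indicator (cell \<nu>) \<xi> *\<^sub>R (cis ((x - y) \<bullet> \<xi>) * freq_deriv i l (wpt x y, zpt x y, \<xi>)) \<partial>lborel)"
  proof -
    have "cis ((x - y) \<bullet> \<nu>) * (indicator (cell \<nu>) \<xi> * (cis ((x - y) \<bullet> (\<xi> - \<nu>)) * d))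
        = indicator (cell \<nu>) \<xi> *\<^sub>R (cis ((x - y) \<bullet> \<xi>) * d)" for \<xi> d
    proof -
      have "cis ((x - y) \<bullet> \<nu>) * cis ((x - y) \<bullet> (\<xi> - \<nu>)) = cis ((x - y) \<bullet> \<xi>)"
        unfolding cis_mult inner_diff_right by simp
      then show ?thesis by (simp add: indicator_def)
    qed
    then show ?thesis by (simp flip: integral_mult_right_zero)
  qed
  ultimately show ?thesis by simp
qed

lemma summable_row: "(\<lambda>\<nu>. block_mass (j, k, \<nu>)) summable_on int_lattice" if "j \<in> int_lattice" "k \<in> int_lattice"
proof -
  have "block_mass summable_on Pair j ` Pair k ` int_lattice"
    by (rule summable_on_subset_banach[OF summable_block_mass]) (use that in \<open>auto simp: int_lattice_Pair\<close>)
  then have "block_mass summable_on (\<lambda>\<nu>. (j, k, \<nu>)) ` int_lattice" by (simp add: image_image)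
  then show ?thesis by (subst (asm) summable_on_reindex) (auto simp: inj_on_def o_def)
qed

definition row_mass :: "'a \<Rightarrow> 'a \<Rightarrow> real" where
  "row_mass j k = (\<Sum>\<^sub>\<infinity>\<nu>\<in>int_lattice. block_mass (j, k, \<nu>))"

lemma block_integral_eq: "block_integral (j, k, \<nu>) = (1 + norm (j - k)) ^ m * block_mass (j, k, \<nu>)"
  unfolding block_mass_def fst_conv snd_conv times_divide_eq_right
  using less_imp_neq[OF one_plus_norm_power_pos[of "j - k"], symmetric]
  by (rule nonzero_mult_div_cancel_left[symmetric])

text \<open>The integral over \<open>\<xi>\<close> is split into cells, and each part is estimated by the mass of its block.
  In particular all integrals over \<open>\<xi>\<close> converge at every point, not only almost everywhere.\<close>

lemma integrable_slice:
  assumes i: "i \<in> Basis" "l \<le> m"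
  shows "integrable lborel (\<lambda>\<xi>. freq_deriv i l (wpt x y, zpt x y, \<xi>))"
    and "(\<integral>\<xi>. cmod (freq_deriv i l (wpt x y, zpt x y, \<xi>)) \<partial>lborel)
      \<le> slice_const * ((1 + norm (cell_of x - cell_of y)) ^ m * row_mass (cell_of x) (cell_of y))"
proof -
  let ?j = "cell_of x" and ?k = "cell_of y"
  have xy: "x \<in> cell ?j" "y \<in> cell ?k" by (auto simp: cell_def)
  let ?f = "\<lambda>\<xi>. freq_deriv i l (wpt x y, zpt x y, \<xi>)"
  have cont: "continuous_on UNIV ?f"
    by (rule continuous_on_compose2[OF continuous_freq_deriv[OF i]]) (auto intro!: continuous_intros)
  have [measurable]: "?f \<in> borel_measurable borel" by (rule borel_measurable_continuous_onI[OF cont])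
  let ?c = "\<lambda>\<nu>::'a. cbox (\<nu> - (1/2) *\<^sub>R One) (\<nu> + (1/2) *\<^sub>R One)"
  have intc: "integrable lborel (\<lambda>\<xi>. indicator (?c \<nu>) \<xi> * norm (?f \<xi>))" for \<nu>
    using borel_integrable_compact[of "?c \<nu>" "\<lambda>\<xi>. norm (?f \<xi>)"] continuous_on_norm[OF continuous_on_subset[OF cont]]
    by simp
  have ind: "indicator (cell \<nu>) \<xi> * norm (?f \<xi>) \<le> indicator (?c \<nu>) \<xi> * norm (?f \<xi>)" for \<nu> \<xi>
    using cell_subset_unit_cube[of \<nu>] by (intro mult_right_mono) (auto simp: indicator_def unit_cube_def)
  have int: "integrable lborel (\<lambda>\<xi>. indicator (cell \<nu>) \<xi> * norm (?f \<xi>))" for \<nu>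
  proof (rule Bochner_Integration.integrable_bound[OF intc[of \<nu>]])
    show "AE \<xi> in lborel. norm (indicator (cell \<nu>) \<xi> * norm (?f \<xi>)) \<le> norm (indicator (?c \<nu>) \<xi> * norm (?f \<xi>))"
      using ind by (intro AE_I2) simp
  qed measurable
  have le: "(\<integral>\<xi>. indicator (cell \<nu>) \<xi> * norm (?f \<xi>) \<partial>lborel) \<le> slice_const * ((1 + norm (?j - ?k)) ^ m * block_mass (?j, ?k, \<nu>))" for \<nu>
  proof -
    have "(\<integral>\<xi>. indicator (cell \<nu>) \<xi> * norm (?f \<xi>) \<partial>lborel) \<le> (\<integral>\<xi>. indicator (?c \<nu>) \<xi> * norm (?f \<xi>) \<partial>lborel)"
      by (rule integral_mono[OF int intc ind])
    also have "\<dots> \<le> slice_const * block_integral (?j, ?k, \<nu>)"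
    proof -
      have "(\<integral>\<xi>. indicator (?c \<nu>) \<xi> * cmod (pderivs (replicate l (0, 0, i)) p (wpt x y, zpt x y, \<xi>)) \<partial>lborel)
        \<le> coefficient_const n B t0 \<Theta> DIM('a) * infsum (lattice_weight (real n / real DIM('a))) (int_lattice :: ('a \<times> 'a) set) *
          local_integral t0 (wpt ?j ?k) (zpt ?j ?k) (\<nu> - (1/2) *\<^sub>R One) (\<nu> + (1/2) *\<^sub>R One) (grad_sum n m p)"
        by (rule local_integral_bound[OF cut t0 \<Theta>_ge_1 continuous_\<theta>, where ?c1.0="\<nu> - (1/2) *\<^sub>R One" and ?c2.0="\<nu> + (1/2) *\<^sub>R One"])
          (use \<theta>_le p replicate_mem_dirs(3)[OF i(1)] i n wpt_cell_le[OF xy] in auto)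
      then show ?thesis by (simp add: freq_deriv_def coeff_const_def slice_const_def block_integral_def)
    qed
    finally show ?thesis by (simp add: block_integral_eq)
  qed
  have sm: "(\<lambda>\<nu>. slice_const * ((1 + norm (?j - ?k)) ^ m * block_mass (?j, ?k, \<nu>))) summable_on int_lattice"
    by (intro summable_on_cmult_right summable_row cell_of_in_lattice)
  show "integrable lborel ?f" by (rule integrable_of_cells(1)[OF _ int le sm]) measurable
  have "(\<integral>\<xi>. cmod (?f \<xi>) \<partial>lborel) \<le> (\<Sum>\<^sub>\<infinity>\<nu>\<in>int_lattice. slice_const * ((1 + norm (?j - ?k)) ^ m * block_mass (?j, ?k, \<nu>)))"
    by (rule integrable_of_cells(2)[OF _ int le sm]) measurable
  then show "(\<integral>\<xi>. cmod (?f \<xi>) \<partial>lborel) \<le> slice_const * ((1 + norm (?j - ?k)) ^ m * row_mass ?j ?k)"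
    by (simp add: row_mass_def infsum_cmult_right' summable_row cell_of_in_lattice)
qed

definition freq_integral :: "'a \<Rightarrow> nat \<Rightarrow> 'a \<Rightarrow> 'a \<Rightarrow> complex" where
  "freq_integral i l x y = (\<integral>\<xi>. cis ((x - y) \<bullet> \<xi>) * freq_deriv i l (wpt x y, zpt x y, \<xi>) \<partial>lborel)"

lemma integrable_freq_integral:
  assumes "i \<in> Basis" "l \<le> m"
  shows "integrable lborel (\<lambda>\<xi>. cis ((x - y) \<bullet> \<xi>) * freq_deriv i l (wpt x y, zpt x y, \<xi>))"
  using integrable_slice(1)[OF assms, of x y]
  by (rule Bochner_Integration.integrable_bound)
    (use integrable_slice(1)[OF assms, of x y] in \<open>auto simp: norm_mult\<close>)

text \<open>Integration by parts in \<open>\<xi>\<close>.\<close>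

lemma freq_integral_Suc:
  assumes i: "i \<in> Basis" "l < m"
  shows "freq_integral i (Suc l) x y = - \<i> * of_real ((x - y) \<bullet> i) * freq_integral i l x y"
proof -
  let ?v = "\<lambda>\<xi>. (wpt x y, zpt x y, \<xi>)"
  let ?F = "\<lambda>\<xi>. cis ((x - y) \<bullet> \<xi>) * freq_deriv i l (?v \<xi>)"
  let ?F' = "\<lambda>\<xi>. \<i> * of_real ((x - y) \<bullet> i) * ?F \<xi> + cis ((x - y) \<bullet> \<xi>) * freq_deriv i (Suc l) (?v \<xi>)"
  have int: "integrable lborel ?F" "integrable lborel (\<lambda>\<xi>. cis ((x - y) \<bullet> \<xi>) * freq_deriv i (Suc l) (?v \<xi>))"
    using i by (intro integrable_freq_integral; simp)+
  have cont: "continuous_on UNIV (\<lambda>t. freq_deriv i l' (?v (\<xi> + t *\<^sub>R i)))" if "l' \<le> m" for l' \<xi>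
    by (rule continuous_on_compose2[OF continuous_freq_deriv[OF i(1) that]]) (auto intro!: continuous_intros)
  have "(\<integral>\<xi>. ?F' \<xi> \<partial>lborel) = 0"
  proof (rule integral_directional_derivative_eq_0[OF int(1)])
    show "integrable lborel ?F'" using int by (intro Bochner_Integration.integrable_add integrable_mult_right)
    fix \<xi>
    show "((\<lambda>t. ?F (\<xi> + t *\<^sub>R i)) has_vector_derivative ?F' (\<xi> + t *\<^sub>R i)) (at t)" for t
    proof -
      have "has_cont_pderivs ((0, 0, i) # replicate l (0, 0, i)) p"
        using has_cont_pderivs_xi[OF i(1), of "Suc l"] i(2) by simp
      from pderivs_has_vector_derivative[OF this, of "?v \<xi>" t]
      have d: "((\<lambda>t. freq_deriv i l (?v (\<xi> + t *\<^sub>R i))) has_vector_derivative freq_deriv i (Suc l) (?v (\<xi> + t *\<^sub>R i))) (at t)"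
        by (simp add: freq_deriv_def)
      have lin: "(x - y) \<bullet> (\<xi> + t *\<^sub>R i) = (x - y) \<bullet> \<xi> + t * ((x - y) \<bullet> i)" for t
        by (simp add: inner_add_right)
      show ?thesis unfolding lin
        by (rule has_vector_derivative_eq_rhs[OF has_vector_derivative_mult[OF has_vector_derivative_cis_linear d]])
          (simp add: algebra_simps)
    qed
    show "continuous_on UNIV (\<lambda>t. ?F' (\<xi> + t *\<^sub>R i))"
      unfolding cis_conv_exp using i by (intro continuous_intros cont) auto
  qed
  then have "\<i> * of_real ((x - y) \<bullet> i) * freq_integral i l x y + freq_integral i (Suc l) x y = 0"
    using int by (simp add: freq_integral_def mult.assoc)
  from minus_unique[OF this] show ?thesis by simp
qed

lemma freq_integral_eq_power: "i \<in> Basis \<Longrightarrow> l \<le> m \<Longrightarrow> freq_integral i l x y = (- \<i> * of_real ((x - y) \<bullet> i)) ^ l * freq_integral i 0 x y"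
  by (induction l) (simp_all add: freq_integral_Suc mult.assoc)

text \<open>Expand \<open>j - k = (x - y) + (j - x) + (y - k)\<close> with the binomial theorem. Powers of \<open>x - y\<close> turn
  into derivatives of the amplitude; the other two differences are bounded on a block, and each depends on
  only one of the variables \<open>x\<close> and \<open>y\<close>. The sums run up to \<open>m\<close>, beyond the range of the binomials, to
  make the index set the same for all blocks.\<close>

lemma freq_integral_0_expansion:
  assumes i: "i \<in> Basis" and m': "m' \<le> m"
  shows "of_real ((j - k) \<bullet> i) ^ m' * freq_integral i 0 x y = (\<Sum>l\<le>m. \<Sum>r\<le>m.
    of_nat (m' choose l) * of_nat ((m' - l) choose r) * \<i> ^ l *
    of_real (((j - x) \<bullet> i) ^ (m' - l - r) * ((y - k) \<bullet> i) ^ r) * freq_integral i l x y)"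
proof -
  let ?c = "(x - y) \<bullet> i" and ?s = "(y - k) \<bullet> i" and ?t = "(j - x) \<bullet> i"
  have "(j - k) \<bullet> i = ?c + (?s + ?t)" by (simp add: inner_diff_left)
  then have "complex_of_real ((j - k) \<bullet> i) ^ m' = (of_real ?c + of_real (?s + ?t)) ^ m'" by simp
  also have "\<dots> = (\<Sum>l\<le>m'. of_nat (m' choose l) * of_real ?c ^ l * of_real (?s + ?t) ^ (m' - l))"
    by (rule binomial_ring)
  also have "\<dots> = (\<Sum>l\<le>m. of_nat (m' choose l) * of_real ?c ^ l * of_real (?s + ?t) ^ (m' - l))"
    using m' by (intro sum.mono_neutral_left) (auto simp: binomial_eq_0)
  finally have A: "complex_of_real ((j - k) \<bullet> i) ^ m' * freq_integral i 0 x y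
      = (\<Sum>l\<le>m. of_nat (m' choose l) * of_real ?c ^ l * of_real (?s + ?t) ^ (m' - l) * freq_integral i 0 x y)"
    by (simp add: sum_distrib_right)
  have B: "complex_of_real (?s + ?t) ^ e = (\<Sum>r\<le>m. of_nat (e choose r) * of_real (?t ^ (e - r) * ?s ^ r))"
    if "e \<le> m" for e
  proof -
    have "complex_of_real (?s + ?t) ^ e = (\<Sum>r\<le>e. of_nat (e choose r) * of_real ?s ^ r * of_real ?t ^ (e - r))"
      unfolding of_real_add by (rule binomial_ring)
    also have "\<dots> = (\<Sum>r\<le>m. of_nat (e choose r) * of_real ?s ^ r * of_real ?t ^ (e - r))"
      using that by (intro sum.mono_neutral_left) (auto simp: binomial_eq_0)
    finally show ?thesis by (simp add: mult_ac)
  qed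
  show ?thesis unfolding A
  proof (rule sum.cong[OF refl])
    fix l assume l: "l \<in> {..m}"
    have XL: "freq_integral i l x y = (- \<i> * of_real ?c) ^ l * freq_integral i 0 x y"
      by (rule freq_integral_eq_power[OF i]) (use l in simp)
    have "\<i> ^ l * freq_integral i l x y = (\<i> * (- \<i> * of_real ?c)) ^ l * freq_integral i 0 x y"
      unfolding power_mult_distrib[of "\<i>"] by (subst XL) (simp only: mult.assoc)
    moreover have "\<i> * (- \<i> * of_real ?c) = of_real ?c" by simp
    ultimately have eq: "\<i> ^ l * freq_integral i l x y = of_real ?c ^ l * freq_integral i 0 x y" by (simp only:)
    have "of_nat (m' choose l) * of_real ?c ^ l * of_real (?s + ?t) ^ (m' - l) * freq_integral i 0 x y
      = of_nat (m' choose l) * of_real (?s + ?t) ^ (m' - l) * (\<i> ^ l * freq_integral i l x y)"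
      by (subst eq) (simp only: mult_ac)
    also have "\<dots> = (\<Sum>r\<le>m. of_nat (m' choose l) * of_nat ((m' - l) choose r) * \<i> ^ l *
          of_real (?t ^ (m' - l - r) * ?s ^ r) * freq_integral i l x y)"
      using m' by (subst B) (simp_all only: sum_distrib_left sum_distrib_right mult_ac diff_le_self order_trans[OF diff_le_self])
    finally show "of_nat (m' choose l) * of_real ?c ^ l * of_real (?s + ?t) ^ (m' - l) * freq_integral i 0 x y
      = (\<Sum>r\<le>m. of_nat (m' choose l) * of_nat ((m' - l) choose r) * \<i> ^ l *
          of_real (?t ^ (m' - l - r) * ?s ^ r) * freq_integral i l x y)" .
  qed
qed

text \<open>The direction of integration by parts in \<open>\<xi>\<close> for two cells with distance vector \<open>v\<close>.\<close>

definition far_axis :: "'a \<Rightarrow> 'a" where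
  "far_axis v = (SOME i. i \<in> Basis \<and> (\<forall>b\<in>Basis. \<bar>v \<bullet> b\<bar> \<le> \<bar>v \<bullet> i\<bar>))"

lemma far_axis: "far_axis v \<in> Basis" "b \<in> Basis \<Longrightarrow> \<bar>v \<bullet> b\<bar> \<le> \<bar>v \<bullet> far_axis v\<bar>"
proof -
  define M where "M = Max ((\<lambda>b. \<bar>v \<bullet> b\<bar>) ` Basis)"
  have "M \<in> (\<lambda>b. \<bar>v \<bullet> b\<bar>) ` Basis" unfolding M_def by (rule Max_in) auto
  then obtain i where i: "i \<in> Basis" "M = \<bar>v \<bullet> i\<bar>" by auto
  have "\<forall>b\<in>Basis. \<bar>v \<bullet> b\<bar> \<le> \<bar>v \<bullet> i\<bar>"
    unfolding i(2)[symmetric] M_def by (intro ballI Max_ge) auto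
  then have "far_axis v \<in> Basis \<and> (\<forall>b\<in>Basis. \<bar>v \<bullet> b\<bar> \<le> \<bar>v \<bullet> far_axis v\<bar>)"
    unfolding far_axis_def using i(1) by (intro someI_ex[where P="\<lambda>i. i \<in> Basis \<and> (\<forall>b\<in>Basis. \<bar>v \<bullet> b\<bar> \<le> \<bar>v \<bullet> i\<bar>)"]) auto
  then show "far_axis v \<in> Basis" "b \<in> Basis \<Longrightarrow> \<bar>v \<bullet> b\<bar> \<le> \<bar>v \<bullet> far_axis v\<bar>" by (rule conjunct1, elim conjE bspec)
qed

text \<open>For \<open>v = 0\<close> there is no frequency to gain from; with order 0 the gain is 1 there, and it is
  nonzero for all \<open>v\<close>.\<close>

definition parts_order :: "'a \<Rightarrow> nat" where "parts_order v = (if v = 0 then 0 else m)"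

definition parts_gain :: "'a \<Rightarrow> real" where "parts_gain v = (v \<bullet> far_axis v) ^ parts_order v"

lemma parts_gain:
  assumes v: "v \<in> int_lattice"
  shows "parts_gain v \<noteq> 0" "(1 + norm v) ^ m / \<bar>parts_gain v\<bar> \<le> (1 + real DIM('a)) ^ m"
proof -
  have "parts_gain v \<noteq> 0 \<and> (1 + norm v) ^ m \<le> (1 + real DIM('a)) ^ m * \<bar>parts_gain v\<bar>"
  proof (cases "v = 0")
    case True
    then show ?thesis by (simp add: parts_gain_def parts_order_def one_le_power)
  next
    case False
    then obtain b where b: "b \<in> Basis" "v \<bullet> b \<noteq> 0" using euclidean_all_zero_iff by blast
    have "v \<bullet> far_axis v \<in> \<int>" using v far_axis(1) by (auto simp: int_lattice_def)
    moreover have "v \<bullet> far_axis v \<noteq> 0" using far_axis(2)[OF b(1), of v] b(2) by auto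
    ultimately have ge1: "1 \<le> \<bar>v \<bullet> far_axis v\<bar>" using Ints_nonzero_abs_ge1 by blast
    have "norm v \<le> DIM('a) * \<bar>v \<bullet> far_axis v\<bar>" by (rule norm_le_of_coordinates) (rule far_axis(2))
    then have "1 + norm v \<le> (1 + real DIM('a)) * \<bar>v \<bullet> far_axis v\<bar>" using ge1 by (simp add: algebra_simps)
    then have "(1 + norm v) ^ m \<le> ((1 + real DIM('a)) * \<bar>v \<bullet> far_axis v\<bar>) ^ m" by (intro power_mono) auto
    then show ?thesis using False \<open>v \<bullet> far_axis v \<noteq> 0\<close>
      by (simp add: parts_gain_def parts_order_def power_mult_distrib power_abs)
  qed
  then show "parts_gain v \<noteq> 0" "(1 + norm v) ^ m / \<bar>parts_gain v\<bar> \<le> (1 + real DIM('a)) ^ m"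
    by (auto simp: pos_divide_le_eq)
qed

text \<open>The indices are the block \<open>(j, k, \<nu>)\<close>, the pair \<open>(l, r)\<close> of the binomial expansion of
  \<open>freq_integral_0_expansion\<close>, and the frequency \<open>\<kappa>\<close> of the Fourier series on the block.\<close>

definition index_set :: "(('a \<times> 'a \<times> 'a) \<times> (nat \<times> nat) \<times> ('a \<times> 'a)) set" where
  "index_set = int_lattice \<times> ({..m} \<times> {..m}) \<times> int_lattice"

definition atom_coeff :: "('a \<times> 'a \<times> 'a) \<times> (nat \<times> nat) \<times> ('a \<times> 'a) \<Rightarrow> complex" where
  "atom_coeff = (\<lambda>((j, k, \<nu>), (l, r), \<kappa>). of_real ((1 / (2 * pi)) ^ DIM('a) / parts_gain (j - k)) *
    (of_nat (parts_order (j - k) choose l) * of_nat ((parts_order (j - k) - l) choose r) * \<i> ^ l) *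
    coefficient (far_axis (j - k)) l (j, k, \<nu>) \<kappa>)"

definition atom_left :: "('a \<times> 'a \<times> 'a) \<times> (nat \<times> nat) \<times> ('a \<times> 'a) \<Rightarrow> 'a \<Rightarrow> complex" where
  "atom_left = (\<lambda>((j, k, \<nu>), (l, r), \<kappa>) x. indicator (cell j) x *
    of_real (((j - x) \<bullet> far_axis (j - k)) ^ (parts_order (j - k) - l - r)) *
    cis (x \<bullet> \<nu> + (t11 *\<^sub>R fst \<kappa> + t21 *\<^sub>R snd \<kappa>) \<bullet> x / (2 * t0)))"

definition atom_right :: "('a \<times> 'a \<times> 'a) \<times> (nat \<times> nat) \<times> ('a \<times> 'a) \<Rightarrow> 'a \<Rightarrow> complex" where
  "atom_right = (\<lambda>((j, k, \<nu>), (l, r), \<kappa>) y. indicator (cell k) y *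
    of_real (((y - k) \<bullet> far_axis (j - k)) ^ r) *
    cis (- (y \<bullet> \<nu>) + (t12 *\<^sub>R fst \<kappa> + t22 *\<^sub>R snd \<kappa>) \<bullet> y / (2 * t0)))"

lemma norm_atom_le:
  "cmod (atom_left ((j, k, \<nu>), lr, \<kappa>) x) \<le> indicator (cell j) x"
  "cmod (atom_right ((j, k, \<nu>), lr, \<kappa>) y) \<le> indicator (cell k) y"
proof -
  have *: "\<bar>((v - u) \<bullet> far_axis w) ^ e\<bar> \<le> 1" if "cell_of u = v \<or> cell_of v = u" for u v w :: 'a and e
  proof -
    have "\<bar>(v - u) \<bullet> far_axis w\<bar> \<le> 1/2"
      using that cell_of_dist[OF far_axis(1), of u w] cell_of_dist[OF far_axis(1), of v w]
      by (auto simp: inner_diff_left abs_minus_commute)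
    then show ?thesis unfolding power_abs by (intro power_le_one) auto
  qed
  obtain l r where lr: "lr = (l, r)" by (cases lr)
  show "cmod (atom_left ((j, k, \<nu>), lr, \<kappa>) x) \<le> indicator (cell j) x"
    unfolding lr atom_left_def prod.case norm_mult norm_of_real norm_cis
    using *[of x j "j - k" "parts_order (j - k) - l - r"] by (simp add: indicator_def cell_def)
  show "cmod (atom_right ((j, k, \<nu>), lr, \<kappa>) y) \<le> indicator (cell k) y"
    unfolding lr atom_right_def prod.case norm_mult norm_of_real norm_cis
    using *[of k y "j - k" r] by (simp add: indicator_def cell_def)
qed

definition atom_const :: real where
  "atom_const = 4 ^ m * coeff_const * (1 + real DIM('a)) ^ m"

lemma atom_coeff_le:
  assumes "idx \<in> index_set"
  shows "cmod (atom_coeff idx) \<le> atom_const * (block_mass (fst idx) * lw (snd (snd idx)))"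
proof -
  obtain j k \<nu> l r \<kappa> where idx: "idx = ((j, k, \<nu>), (l, r), \<kappa>)" by (cases idx) auto
  have m: "j - k \<in> int_lattice" "l \<le> m" "\<kappa> \<in> int_lattice"
    using assms by (auto simp: idx index_set_def int_lattice_Pair intro: int_lattice_diff)
  have om: "parts_order (j - k) \<le> m" by (simp add: parts_order_def)
  have bin: "real (e choose f) \<le> 2 ^ m" if "e \<le> m" for e f
  proof -
    have "(e choose f) \<le> 2 ^ e" by (rule binomial_le_pow2)
    also have "\<dots> \<le> 2 ^ m" using that by (intro power_increasing) auto
    finally show ?thesis by (metis of_nat_le_iff of_nat_numeral of_nat_power)
  qed
  have "0 < pi" by (rule pi_gt_zero)
  then have c: "(1 / (2 * pi)) ^ DIM('a) \<le> 1" using pi_ge_two by (intro power_le_one) auto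
  have pi0: "0 \<le> (1 / (2 * pi)) ^ DIM('a)" using pi_ge_two by simp
  have g: "0 < \<bar>parts_gain (j - k)\<bar>" using parts_gain(1)[OF m(1)] by simp
  have "cmod (atom_coeff idx) = (1 / (2 * pi)) ^ DIM('a) / \<bar>parts_gain (j - k)\<bar> *
      (real (parts_order (j - k) choose l) * real ((parts_order (j - k) - l) choose r)) * cmod (coefficient (far_axis (j - k)) l (j, k, \<nu>) \<kappa>)"
    unfolding atom_coeff_def idx prod.case norm_mult norm_of_real norm_of_nat norm_power abs_divide abs_of_nonneg[OF pi0]
    by simp
  also have "\<dots> \<le> 1 / \<bar>parts_gain (j - k)\<bar> * (2 ^ m * 2 ^ m) * (coeff_const * lw \<kappa> * block_integral (j, k, \<nu>))"
    using bin om g c by (intro mult_mono divide_right_mono coefficient_le far_axis(1) m) auto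
  also have "\<dots> = 4 ^ m * coeff_const * lw \<kappa> * block_mass (j, k, \<nu>) * ((1 + norm (j - k)) ^ m / \<bar>parts_gain (j - k)\<bar>)"
    by (simp add: block_integral_eq power_mult_distrib[symmetric])
  also have "\<dots> \<le> 4 ^ m * coeff_const * lw \<kappa> * block_mass (j, k, \<nu>) * (1 + real DIM('a)) ^ m"
    using coeff_const_nonneg lattice_weight_pos[of _ \<kappa>]
    by (intro mult_left_mono parts_gain(2) m mult_nonneg_nonneg block_mass_nonneg) (auto intro: less_imp_le)
  finally show ?thesis by (simp add: idx atom_const_def mult_ac)
qed

lemma summable_on_index_set:
  fixes f :: "'a \<times> 'a \<times> 'a \<Rightarrow> real" and g :: "'a \<times> 'a \<Rightarrow> real"
  assumes f: "f summable_on int_lattice" "\<And>u. u \<in> int_lattice \<Longrightarrow> 0 \<le> f u"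
    and g: "g summable_on int_lattice" "\<And>u. u \<in> int_lattice \<Longrightarrow> 0 \<le> g u"
  shows "((\<lambda>idx. f (fst idx) * g (snd (snd idx))) has_sum
    (real (m + 1) ^ 2 * infsum g int_lattice * infsum f int_lattice)) index_set"
proof -
  let ?L = "int_lattice :: ('a \<times> 'a) set"
  let ?M = "{..m} \<times> {..m} :: (nat \<times> nat) set"
  have inner: "((\<lambda>y. g (snd y)) has_sum (real (m + 1) ^ 2 * infsum g ?L)) (?M \<times> ?L)"
  proof (rule has_sum_SigmaI)
    show "((\<lambda>\<kappa>. g (snd (lr, \<kappa>))) has_sum infsum g ?L) ?L" for lr :: "nat \<times> nat"
      using has_sum_infsum[OF g(1)] by simp
    show "((\<lambda>lr. infsum g ?L) has_sum (real (m + 1) ^ 2 * infsum g ?L)) ?M"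
      using has_sum_finite[of ?M "\<lambda>lr. infsum g ?L"] by (simp add: power2_eq_square algebra_simps)
    have "(\<lambda>y. norm (g (snd y))) summable_on (?M \<times> ?L)"
    proof (rule iffD2[OF Infinite_Sum.abs_summable_on_Sigma_iff], intro conjI ballI)
      show "(\<lambda>\<kappa>. norm (g (snd (lr, \<kappa>)))) summable_on ?L" for lr :: "nat \<times> nat"
        using g by (subst summable_on_cong[where g=g]) auto
    qed (simp add: summable_on_finite)
    then show "(\<lambda>y. g (snd y)) summable_on (?M \<times> ?L)" by (rule abs_summable_summable)
  qed
  have inner0: "0 \<le> g (snd y)" if "y \<in> ?M \<times> ?L" for y using that g(2) by auto
  show ?thesis
    unfolding index_set_def
  proof (rule has_sum_SigmaI)
    show "((\<lambda>y. f (fst (u, y)) * g (snd (snd (u, y)))) has_sum (f u * (real (m + 1) ^ 2 * infsum g ?L))) (?M \<times> ?L)"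
      for u using has_sum_cmult_right[OF inner, of "f u"] by simp
    then have val: "infsum (\<lambda>y. f u * g (snd y)) (?M \<times> ?L) = f u * (real (m + 1) ^ 2 * infsum g ?L)" for u
      by (simp add: infsumI)
    show "((\<lambda>u. f u * (real (m + 1) ^ 2 * infsum g ?L)) has_sum (real (m + 1) ^ 2 * infsum g ?L * infsum f int_lattice)) int_lattice"
      using has_sum_cmult_left[OF has_sum_infsum[OF f(1)], of "real (m + 1) ^ 2 * infsum g ?L"]
      by (simp add: mult.commute)
    have "(\<lambda>idx. norm (f (fst idx) * g (snd (snd idx)))) summable_on (int_lattice \<times> (?M \<times> ?L))"
    proof (rule iffD2[OF Infinite_Sum.abs_summable_on_Sigma_iff], intro conjI ballI)
      fix u :: "'a \<times> 'a \<times> 'a" assume u: "u \<in> int_lattice"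
      have "(\<lambda>y. f u * g (snd y)) summable_on (?M \<times> ?L)"
        by (intro summable_on_cmult_right has_sum_imp_summable[OF inner])
      then show "(\<lambda>y. norm (f (fst (u, y)) * g (snd (snd (u, y))))) summable_on (?M \<times> ?L)"
        using f(2)[OF u] inner0 by (subst summable_on_cong[where g="\<lambda>y. f u * g (snd y)"]) (auto simp: abs_mult)
    next
      have "(\<lambda>u. f u * (real (m + 1) ^ 2 * infsum g ?L)) summable_on int_lattice"
        by (intro summable_on_cmult_left f(1))
      moreover have "norm (infsum (\<lambda>y. norm (f (fst (u, y)) * g (snd (snd (u, y))))) (?M \<times> ?L))
          = f u * (real (m + 1) ^ 2 * infsum g ?L)" if u: "u \<in> int_lattice" for u
      proof -
        have "infsum (\<lambda>y. norm (f (fst (u, y)) * g (snd (snd (u, y))))) (?M \<times> ?L) = infsum (\<lambda>y. f u * g (snd y)) (?M \<times> ?L)"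
          using f(2)[OF u] inner0 by (intro infsum_cong) (auto simp: abs_mult)
        moreover have "0 \<le> f u * (real (m + 1) ^ 2 * infsum g ?L)"
          using f(2)[OF u] g(2) by (intro mult_nonneg_nonneg infsum_nonneg) auto
        ultimately show ?thesis unfolding val by simp
      qed
      ultimately show "(\<lambda>u. norm (infsum (\<lambda>y. norm (f (fst (u, y)) * g (snd (snd (u, y))))) (?M \<times> ?L))) summable_on int_lattice"
        by (subst summable_on_cong[where g="\<lambda>u. f u * (real (m + 1) ^ 2 * infsum g ?L)"]) auto
    qed
    then show "(\<lambda>idx. f (fst idx) * g (snd (snd idx))) summable_on (int_lattice \<times> (?M \<times> ?L))"
      by (rule abs_summable_summable)
  qed
qed

definition kernel :: "'a \<Rightarrow> 'a \<Rightarrow> complex" where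
  "kernel x y = of_real ((1 / (2 * pi)) ^ DIM('a)) * (\<integral>\<xi>. cis ((x - y) \<bullet> \<xi>) * p (wpt x y, zpt x y, \<xi>) \<partial>lborel)"

lemma abs_summable_atoms:
  "(\<lambda>idx. norm (atom_coeff idx * (atom_left idx x * atom_right idx y))) summable_on index_set"
proof (rule Infinite_Sum.abs_summable_on_comparison_test')
  show "(\<lambda>idx. atom_const * (block_mass (fst idx) * lw (snd (snd idx)))) summable_on index_set"
    by (intro summable_on_cmult_right has_sum_imp_summable[OF summable_on_index_set] summable_block_mass
        block_mass_nonneg summable_lw less_imp_le[OF lattice_weight_pos])
  fix idx assume idx: "idx \<in> index_set"
  obtain j k \<nu> lr \<kappa> where i: "idx = ((j, k, \<nu>), lr, \<kappa>)" by (cases idx) auto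
  have "cmod (atom_left idx x) * cmod (atom_right idx y) \<le> 1 * 1"
    unfolding i by (intro mult_mono order_trans[OF norm_atom_le(1)] order_trans[OF norm_atom_le(2)])
      (auto simp: indicator_def)
  then have "cmod (atom_coeff idx) * (cmod (atom_left idx x) * cmod (atom_right idx y)) \<le> cmod (atom_coeff idx)"
    by (simp add: mult_left_le)
  also have "\<dots> \<le> atom_const * (block_mass (fst idx) * lw (snd (snd idx)))" by (rule atom_coeff_le[OF idx])
  finally show "norm (atom_coeff idx * (atom_left idx x * atom_right idx y))
      \<le> atom_const * (block_mass (fst idx) * lw (snd (snd idx)))" by (simp add: norm_mult)
qed

text \<open>For given \<open>x\<close> and \<open>y\<close> only the blocks with \<open>x\<close> in the cell of \<open>j\<close> and \<open>y\<close> in the cell of \<open>k\<close> contribute.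
  There the sum over \<open>\<kappa>\<close> is the Fourier series, the sum over \<open>\<nu>\<close> restores the integral over all \<open>\<xi>\<close>, and
  the finite sum over \<open>(l, r)\<close> undoes the integrations by parts.\<close>

theorem kernel_expansion:
  "((\<lambda>idx. atom_coeff idx * (atom_left idx x * atom_right idx y)) has_sum kernel x y) index_set"
proof -
  let ?j = "cell_of x" and ?k = "cell_of y"
  let ?v = "?j - ?k"
  let ?i = "far_axis ?v"
  let ?M = "{..m} \<times> {..m} :: (nat \<times> nat) set"
  let ?t = "\<lambda>idx. atom_coeff idx * (atom_left idx x * atom_right idx y)"
  have xy: "x \<in> cell ?j" "y \<in> cell ?k" by (auto simp: cell_def)
  have sm: "?t summable_on index_set" by (rule abs_summable_summable[OF abs_summable_atoms])
  define pre where "pre = (1 / (2 * pi)) ^ DIM('a) / parts_gain ?v"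
  define c where "c lr = of_real pre * (of_nat (parts_order ?v choose fst lr) * of_nat ((parts_order ?v - fst lr) choose snd lr) * \<i> ^ fst lr *
      of_real (((?j - x) \<bullet> ?i) ^ (parts_order ?v - fst lr - snd lr) * ((y - ?k) \<bullet> ?i) ^ snd lr))" for lr
  define Y where "Y l \<nu> = (\<integral>\<xi>. indicator (cell \<nu>) \<xi> *\<^sub>R (cis ((x - y) \<bullet> \<xi>) * freq_deriv ?i l (wpt x y, zpt x y, \<xi>)) \<partial>lborel)" for l \<nu>
  have inner: "((\<lambda>\<kappa>. ?t ((?j, ?k, \<nu>), lr, \<kappa>)) has_sum (c lr * Y (fst lr) \<nu>)) int_lattice"
    if lr: "lr \<in> ?M" for lr \<nu>
  proof -
    obtain l r where lr': "lr = (l, r)" by (cases lr)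
    have l: "l \<le> m" using lr lr' by simp
    have "?t ((?j, ?k, \<nu>), lr, \<kappa>) = c lr *
        (cis ((x - y) \<bullet> \<nu>) * (cis (\<kappa> \<bullet> (wpt x y, zpt x y) / (2 * t0)) * coefficient ?i l (?j, ?k, \<nu>) \<kappa>))" for \<kappa>
    proof -
      obtain \<kappa>1 \<kappa>2 where \<kappa>: "\<kappa> = (\<kappa>1, \<kappa>2)" by (cases \<kappa>)
      have eq: "cis (x \<bullet> \<nu> + (t11 *\<^sub>R \<kappa>1 + t21 *\<^sub>R \<kappa>2) \<bullet> x / (2 * t0)) * cis (- (y \<bullet> \<nu>) + (t12 *\<^sub>R \<kappa>1 + t22 *\<^sub>R \<kappa>2) \<bullet> y / (2 * t0))
          = cis ((x - y) \<bullet> \<nu>) * cis (\<kappa> \<bullet> (wpt x y, zpt x y) / (2 * t0))"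
        unfolding cis_mult \<kappa>
        by (intro arg_cong[of _ _ cis]) (simp add: wpt_def zpt_def inner_simps add_divide_distrib)
      have "indicator (cell ?j) x = (1 :: complex)" "indicator (cell ?k) y = (1 :: complex)" using xy by simp_all
      then have "?t ((?j, ?k, \<nu>), lr, \<kappa>) = (c lr * coefficient ?i l (?j, ?k, \<nu>) \<kappa>) *
        (cis (x \<bullet> \<nu> + (t11 *\<^sub>R \<kappa>1 + t21 *\<^sub>R \<kappa>2) \<bullet> x / (2 * t0)) * cis (- (y \<bullet> \<nu>) + (t12 *\<^sub>R \<kappa>1 + t22 *\<^sub>R \<kappa>2) \<bullet> y / (2 * t0)))"
        unfolding lr' \<kappa> atom_coeff_def atom_left_def atom_right_def prod.case fst_conv snd_conv c_def pre_def
        by (simp only: of_real_mult mult_ac mult_1_left mult_1_right)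
      then show ?thesis unfolding eq by (simp only: mult_ac)
    qed
    then show ?thesis
      using has_sum_cmult_right[OF cell_expansion[OF far_axis(1) l xy, of \<nu> ?v], of "c lr"] by (simp add: lr' Y_def)
  qed
  have zero: "?t ((j, k, \<nu>), lr, \<kappa>) = 0" if "(j, k) \<noteq> (?j, ?k)" for j k \<nu> lr \<kappa>
  proof -
    have "atom_left ((j, k, \<nu>), lr, \<kappa>) x = 0 \<or> atom_right ((j, k, \<nu>), lr, \<kappa>) y = 0"
      using that norm_atom_le(1)[of j k \<nu> lr \<kappa> x] norm_atom_le(2)[of j k \<nu> lr \<kappa> y]
      by (auto simp: indicator_def cell_def split: if_splits)
    then show ?thesis by auto
  qed
  define S where "S jkn = (case jkn of (j, k, \<nu>) \<Rightarrow> if (j, k) = (?j, ?k) then (\<Sum>lr\<in>?M. c lr * Y (fst lr) \<nu>) else 0)" for jkn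
  have row: "((\<lambda>y. ?t (jkn, y)) has_sum S jkn) (?M \<times> int_lattice)" if jkn: "jkn \<in> int_lattice" for jkn
  proof -
    obtain j k \<nu> where e: "jkn = (j, k, \<nu>)" by (cases jkn)
    show ?thesis
    proof (cases "(j, k) = (?j, ?k)")
      case True
      have "((\<lambda>y. ?t ((?j, ?k, \<nu>), y)) has_sum (\<Sum>lr\<in>?M. c lr * Y (fst lr) \<nu>)) (?M \<times> int_lattice)"
      proof (rule has_sum_SigmaI)
        show "((\<lambda>\<kappa>. ?t ((?j, ?k, \<nu>), lr, \<kappa>)) has_sum (c lr * Y (fst lr) \<nu>)) int_lattice" if "lr \<in> ?M" for lr
          by (rule inner[OF that])
        show "((\<lambda>lr. c lr * Y (fst lr) \<nu>) has_sum (\<Sum>lr\<in>?M. c lr * Y (fst lr) \<nu>)) ?M" by (rule has_sum_finite) simp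
        have "(\<lambda>idx. ?t idx) summable_on Pair (?j, ?k, \<nu>) ` (?M \<times> int_lattice)"
          by (rule summable_on_subset_banach[OF sm]) (use jkn True e in \<open>auto simp: index_set_def\<close>)
        then show "(\<lambda>y. ?t ((?j, ?k, \<nu>), y)) summable_on (?M \<times> int_lattice)"
          by (subst (asm) summable_on_reindex) (auto simp: inj_on_def o_def)
      qed
      then show ?thesis using True by (simp add: S_def e)
    next
      case False
      have "((\<lambda>y. ?t (jkn, y)) has_sum 0) (?M \<times> int_lattice)"
      proof (rule has_sum_0)
        fix y :: "(nat \<times> nat) \<times> ('a \<times> 'a)"
        obtain lr \<kappa> where y: "y = (lr, \<kappa>)" by (cases y)
        show "?t (jkn, y) = 0" using zero[OF False, of \<nu> lr \<kappa>] by (simp only: e y)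
      qed
      then show ?thesis using False by (auto simp: S_def e)
    qed
  qed
  have "((\<lambda>\<nu>. \<Sum>lr\<in>?M. c lr * Y (fst lr) \<nu>) has_sum (\<Sum>lr\<in>?M. c lr * freq_integral ?i (fst lr) x y)) int_lattice"
    unfolding freq_integral_def Y_def
    by (intro has_sum_finite_sum has_sum_cmult_right has_sum_cells integrable_freq_integral far_axis(1)) auto
  also have "(\<Sum>lr\<in>?M. c lr * freq_integral ?i (fst lr) x y) = kernel x y"
  proof -
    have "(\<Sum>lr\<in>?M. c lr * freq_integral ?i (fst lr) x y) = (\<Sum>l\<le>m. \<Sum>r\<le>m. c (l, r) * freq_integral ?i l x y)"
      by (simp add: sum.cartesian_product case_prod_beta)
    also have "\<dots> = of_real pre * (of_real (?v \<bullet> ?i) ^ parts_order ?v * freq_integral ?i 0 x y)"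
      by (subst freq_integral_0_expansion[OF far_axis(1)]) (simp_all add: c_def parts_order_def sum_distrib_left mult.assoc)
    also have "\<dots> = of_real (pre * parts_gain ?v) * freq_integral ?i 0 x y" by (simp add: parts_gain_def)
    also have "pre * parts_gain ?v = (1 / (2 * pi)) ^ DIM('a)"
      using parts_gain(1)[OF int_lattice_diff[OF cell_of_in_lattice cell_of_in_lattice], of x y] by (simp add: pre_def)
    finally show ?thesis by (simp add: kernel_def freq_integral_def freq_deriv_0)
  qed
  finally have "((\<lambda>\<nu>. S (?j, ?k, \<nu>)) has_sum kernel x y) int_lattice" by (simp add: S_def)
  then have "(S has_sum kernel x y) ((\<lambda>\<nu>. (?j, ?k, \<nu>)) ` int_lattice)"
    by (subst has_sum_reindex) (auto simp: inj_on_def o_def)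
  then have S: "(S has_sum kernel x y) int_lattice"
    by (subst (asm) has_sum_cong_neutral[where T=int_lattice and g=S])
      (auto simp: S_def int_lattice_Pair cell_of_in_lattice image_iff)
  show ?thesis unfolding index_set_def
    by (rule has_sum_SigmaI[where g=S, OF row S sm[unfolded index_set_def]])
qed

end

section \<open>The weighted operator\<close>

lemma set_indicator_bounded_integrable:
  fixes f :: "'a::euclidean_space \<Rightarrow> real"
  assumes [measurable]: "f \<in> borel_measurable borel" and le: "\<And>x. x \<in> cell \<nu> \<Longrightarrow> \<bar>f x\<bar> \<le> c"
  shows "integrable lborel (\<lambda>x. indicator (cell \<nu>) x * \<bar>f x\<bar>)"
    and "0 \<le> c \<Longrightarrow> (\<integral>x. indicator (cell \<nu>) x * \<bar>f x\<bar> \<partial>lborel) \<le> c"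
proof -
  have em: "emeasure lborel (unit_cube \<nu>) = 1"
    unfolding unit_cube_def by (subst emeasure_lborel_cbox) (auto simp: inner_simps)
  have int1: "integrable lborel (\<lambda>x. indicator (unit_cube \<nu>) x * c)"
    unfolding unit_cube_def
    by (intro integrable_mult_left integrable_real_indicator emeasure_lborel_cbox_finite) simp
  have le': "indicator (cell \<nu>) x * \<bar>f x\<bar> \<le> indicator (unit_cube \<nu>) x * c" if "0 \<le> c" for x
    using le[of x] cell_subset_unit_cube[of \<nu>] that by (auto simp: indicator_def)
  have le2: "indicator (cell \<nu>) x * \<bar>f x\<bar> \<le> \<bar>indicator (unit_cube \<nu>) x * c\<bar>" for x
    using le[of x] cell_subset_unit_cube[of \<nu>] by (auto simp: indicator_def)
  show int: "integrable lborel (\<lambda>x. indicator (cell \<nu>) x * \<bar>f x\<bar>)"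
    by (rule Bochner_Integration.integrable_bound[OF int1]) (use le2 in auto)
  assume c: "0 \<le> c"
  have "(\<integral>x. indicator (cell \<nu>) x * \<bar>f x\<bar> \<partial>lborel) \<le> (\<integral>x. indicator (unit_cube \<nu>) x * c \<partial>lborel)"
    by (rule integral_mono[OF int int1 le'[OF c]])
  also have "\<dots> = c" using em by (simp add: measure_def unit_cube_def)
  finally show "(\<integral>x. indicator (cell \<nu>) x * \<bar>f x\<bar> \<partial>lborel) \<le> c" .
qed

lemma schwartz_weighted_bound:
  assumes "schwartz u"
  obtains C where "0 \<le> C" "\<And>y. (1 + norm y) ^ m * cmod (u y) \<le> C"
proof -
  have b: "bounded (range (\<lambda>x. norm x ^ k *\<^sub>R u x))" for k
    using assms[unfolded schwartz_def, rule_format, of "[]"] by (simp add: pderivs_def)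
  obtain a where a: "\<And>y. cmod (u y) \<le> a"
    using b[of 0] unfolding bounded_iff by auto
  obtain a' where a': "\<And>y. norm y ^ m * cmod (u y) \<le> a'"
    using b[of m] unfolding bounded_iff by auto
  have a0: "0 \<le> a" "0 \<le> a'" using order_trans[OF norm_ge_zero a] order_trans[OF _ a'[of 0]] by auto
  have "(1 + norm y) ^ m * cmod (u y) \<le> 2 ^ m * (a + a')" for y
  proof (cases "norm y \<le> 1")
    case True
    then have "(1 + norm y) ^ m \<le> 2 ^ m" by (intro power_mono) auto
    then have "(1 + norm y) ^ m * cmod (u y) \<le> 2 ^ m * (a + a')" using a[of y] a0 by (intro mult_mono) auto
    then show ?thesis .
  next
    case False
    then have "(1 + norm y) ^ m \<le> (2 * norm y) ^ m" by (intro power_mono) auto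
    then have "(1 + norm y) ^ m * cmod (u y) \<le> 2 ^ m * (norm y ^ m * cmod (u y))"
      by (simp add: power_mult_distrib mult_right_mono flip: mult.assoc)
    also have "\<dots> \<le> 2 ^ m * (a + a')" using a'[of y] a0 by (intro mult_left_mono) auto
    finally show ?thesis .
  qed
  then show ?thesis using a0 by (intro that[of "2 ^ m * (a + a')"]) auto
qed

lemma schwartz_continuous: "schwartz u \<Longrightarrow> continuous_on UNIV u"
  unfolding schwartz_def using has_cont_pderivs_def[of "[]" u] by (auto simp: pderivs_def dest: spec[of _ "[]"])

lemma one_plus_norm_cell_le: "1 + norm (cell_of y) \<le> (1 + real DIM('a)) * (1 + norm (y :: 'a::euclidean_space))"
proof -
  have "norm (y - cell_of y) \<le> DIM('a) * (1/2)" by (rule norm_le_of_coordinates) (rule cell_of_dist)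
  moreover have "norm (cell_of y) \<le> norm y + norm (y - cell_of y)"
    using norm_triangle_ineq4[of y "y - cell_of y"] by simp
  moreover have "0 \<le> real DIM('a) * norm y" by simp
  moreover have "0 \<le> real DIM('a)" by simp
  ultimately show ?thesis unfolding distrib_left distrib_right by linarith
qed

lemma localised_weight:
  fixes h :: "'a::euclidean_space \<Rightarrow> complex"
  assumes h: "h \<in> lattice_space_inf 2" and [measurable]: "a \<in> borel_measurable borel"
    and a: "\<And>x. cmod (a x) \<le> indicator (cell j) x"
  shows "square_integrable (\<lambda>x. c * (h x * a x))"
    and "norm (abs_L2 (\<lambda>x. c * (h x * a x))) \<le> cmod c * lattice_norm_inf 2 h"
proof -
  have hm [measurable]: "h \<in> borel_measurable lebesgue"
    and hi: "set_integrable lebesgue (unit_cube j) (\<lambda>x. norm (h x) powr 2)"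
    and bdd: "bdd_above (range (\<lambda>u. cube_integral 2 h u powr (1 / 2)))"
    using h by (auto simp: lattice_space_inf_def locally_Lr_def unit_cube_def)
  have am: "a \<in> borel_measurable lebesgue" by (rule measurable_completion) measurable
  have int: "integrable lebesgue (\<lambda>x. (cmod c)\<^sup>2 * (indicator (unit_cube j) x * norm (h x) powr 2))"
    using hi unfolding set_integrable_def by (intro integrable_mult_right) simp
  have pt: "(cmod (c * (h x * a x)))\<^sup>2 \<le> (cmod c)\<^sup>2 * (indicator (unit_cube j) x * norm (h x) powr 2)" for x
  proof -
    have "(cmod (a x))\<^sup>2 \<le> indicator (unit_cube j) x"
    proof (cases "x \<in> cell j")
      case True
      then have "cmod (a x) \<le> 1" using a[of x] by simp
      then have "(cmod (a x))\<^sup>2 \<le> 1" by (simp add: power_le_one)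
      then show ?thesis using True cell_subset_unit_cube[of j] by (auto simp: indicator_def)
    next
      case False
      then have "a x = 0" using a[of x] by simp
      then show ?thesis by simp
    qed
    then have "(cmod (h x))\<^sup>2 * (cmod (a x))\<^sup>2 \<le> (cmod (h x))\<^sup>2 * indicator (unit_cube j) x"
      by (intro mult_left_mono) auto
    moreover have "norm (h x) powr 2 = (cmod (h x))\<^sup>2" by simp
    ultimately have "(cmod (h x))\<^sup>2 * (cmod (a x))\<^sup>2 \<le> indicator (unit_cube j) x * norm (h x) powr 2"
      by (simp only: mult.commute)
    then show ?thesis unfolding norm_mult power_mult_distrib by (rule mult_left_mono) simp
  qed
  have meas: "(\<lambda>x. c * (h x * a x)) \<in> borel_measurable lebesgue"
    using hm am by (intro borel_measurable_times borel_measurable_const)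
  have int': "integrable lebesgue (\<lambda>x. (cmod (c * (h x * a x)))\<^sup>2)"
  proof (rule Bochner_Integration.integrable_bound[OF int])
    show "(\<lambda>x. (cmod (c * (h x * a x)))\<^sup>2) \<in> borel_measurable lebesgue" using meas by measurable
    show "AE x in lebesgue. norm ((cmod (c * (h x * a x)))\<^sup>2)
        \<le> norm ((cmod c)\<^sup>2 * (indicator (unit_cube j) x * norm (h x) powr 2))"
      using pt by (intro AE_I2) (simp add: abs_mult)
  qed
  show sq: "square_integrable (\<lambda>x. c * (h x * a x))"
    using meas int' by (simp add: square_integrable_def)
  have "(LINT x|lebesgue. (cmod (c * (h x * a x)))\<^sup>2) \<le> (LINT x|lebesgue. (cmod c)\<^sup>2 * (indicator (unit_cube j) x * norm (h x) powr 2))"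
    by (rule integral_mono[OF int' int pt])
  also have "\<dots> = (cmod c)\<^sup>2 * cube_integral 2 h j"
    by (simp add: cube_integral_def set_lebesgue_integral_def)
  finally have "norm (abs_L2 (\<lambda>x. c * (h x * a x))) \<le> sqrt ((cmod c)\<^sup>2 * cube_integral 2 h j)"
    unfolding norm_abs_L2[OF sq] by (rule real_sqrt_le_mono)
  also have "\<dots> = cmod c * cube_integral 2 h j powr (1 / 2)"
  proof -
    have "0 \<le> cube_integral 2 h j"
      unfolding cube_integral_def set_lebesgue_integral_def by (intro Bochner_Integration.integral_nonneg) simp
    then show ?thesis by (simp add: real_sqrt_mult powr_half_sqrt)
  qed
  also have "\<dots> \<le> cmod c * lattice_norm_inf 2 h"
    unfolding lattice_norm_inf_def by (intro mult_left_mono cSUP_upper bdd) auto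
  finally show "norm (abs_L2 (\<lambda>x. c * (h x * a x))) \<le> cmod c * lattice_norm_inf 2 h" .
qed

context amplitude_bound
begin

lemma row_mass_nonneg: "0 \<le> row_mass j k"
  unfolding row_mass_def by (intro infsum_nonneg block_mass_nonneg)

lemma summable_row_mass:
  assumes j: "j \<in> int_lattice"
  shows "(\<lambda>k. row_mass j k) summable_on int_lattice"
proof -
  have "block_mass summable_on Pair j ` (int_lattice \<times> int_lattice)"
    by (rule summable_on_subset_banach[OF summable_block_mass]) (use j in \<open>auto simp: int_lattice_Pair\<close>)
  then have "(\<lambda>(k, \<nu>). block_mass (j, k, \<nu>)) summable_on int_lattice \<times> int_lattice"
    by (subst (asm) summable_on_reindex) (auto simp: inj_on_def o_def case_prod_beta')
  then show ?thesis unfolding row_mass_def by (rule summable_on_Sigma_banach)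
qed

lemma slice_const_nonneg: "0 \<le> slice_const"
  unfolding slice_const_def by (intro mult_nonneg_nonneg coeff_const_nonneg infsum_nonneg less_imp_le[OF lattice_weight_pos])

lemma continuous_p: "continuous_on UNIV p"
  using continuous_freq_deriv[of _ 0] freq_deriv_0 nonempty_Basis by fastforce

lemma continuous_wpt_zpt:
  "continuous_on UNIV f \<Longrightarrow> continuous_on UNIV g \<Longrightarrow> continuous_on UNIV (\<lambda>v. wpt (f v) (g v))"
  "continuous_on UNIV f \<Longrightarrow> continuous_on UNIV g \<Longrightarrow> continuous_on UNIV (\<lambda>v. zpt (f v) (g v))"
  unfolding wpt_def zpt_def by (intro continuous_intros; assumption)+

lemma integrable_p:
  "integrable lborel (\<lambda>\<xi>. p (wpt x y, zpt x y, \<xi>))"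
  "(\<integral>\<xi>. cmod (p (wpt x y, zpt x y, \<xi>)) \<partial>lborel)
      \<le> slice_const * ((1 + norm (cell_of x - cell_of y)) ^ m * row_mass (cell_of x) (cell_of y))"
  using integrable_slice[of "far_axis 0" 0 x y] far_axis(1) by (simp_all add: freq_deriv_0)

lemma measurable_p_slice [measurable]:
  "(\<lambda>(y, \<xi>). p (wpt x y, zpt x y, \<xi>)) \<in> borel_measurable (borel \<Otimes>\<^sub>M borel)"
  unfolding borel_prod case_prod_beta
  by (intro borel_measurable_continuous_onI continuous_on_compose2[OF continuous_p] continuous_on_Pair
      continuous_wpt_zpt continuous_intros) auto

lemma measurable_kernel: "(\<lambda>(x, y). kernel x y) \<in> borel_measurable lebesgue"
proof -
  have "(\<lambda>(v, \<xi>). cis ((fst v - snd v) \<bullet> \<xi>) * p (wpt (fst v) (snd v), zpt (fst v) (snd v), \<xi>))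
      \<in> borel_measurable (borel \<Otimes>\<^sub>M borel :: (('a \<times> 'a) \<times> 'a) measure)"
    unfolding borel_prod case_prod_beta cis_conv_exp
    by (intro borel_measurable_continuous_onI continuous_on_mult continuous_on_compose2[OF continuous_p] continuous_on_Pair
        continuous_wpt_zpt continuous_intros) auto
  then have "(\<lambda>v. \<integral>\<xi>. cis ((fst v - snd v) \<bullet> \<xi>) * p (wpt (fst v) (snd v), zpt (fst v) (snd v), \<xi>) \<partial>lborel)
      \<in> borel_measurable (borel :: ('a \<times> 'a) measure)"
    by (intro lborel.borel_measurable_lebesgue_integral) (simp cong: measurable_cong_sets)
  then have "(\<lambda>v. kernel (fst v) (snd v)) \<in> borel_measurable borel"
    unfolding kernel_def by (intro borel_measurable_times borel_measurable_const)
  then show ?thesis unfolding case_prod_beta by (intro measurable_completion) simp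
qed

text \<open>By Fubini's theorem everything follows from absolute convergence of the double integral. The
  integral over \<open>\<xi>\<close> of the amplitude grows at most like \<open>(1 + norm (j - k)) ^ m\<close> times a summable factor,
  and the decay of the Schwartz function compensates this growth in \<open>y\<close>.\<close>

lemma is_Op_kernel_kernel:
  assumes T: "amp_subst T p = (\<lambda>(x, y, \<xi>). p (wpt x y, zpt x y, \<xi>))"
  shows "is_Op_kernel 1 (amp_subst T p) kernel"
  unfolding is_Op_kernel_def
proof (intro conjI allI impI AE_I2 measurable_kernel)
  fix u :: "'a \<Rightarrow> complex" and x :: 'a assume u: "schwartz u"
  let ?f = "\<lambda>(y, \<xi>). cis ((x - y) \<bullet> \<xi>) * p (wpt x y, zpt x y, \<xi>) * u y"
  let ?j = "cell_of x"
  have Op: "Op_integrand 1 (amp_subst T p) u x = ?f"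
    by (simp add: Op_integrand_def T cis_conv_exp fun_eq_iff)
  have [measurable]: "u \<in> borel_measurable borel" by (rule borel_measurable_continuous_onI[OF schwartz_continuous[OF u]])
  have fm [measurable]: "?f \<in> borel_measurable (lborel \<Otimes>\<^sub>M lborel)"
    unfolding cis_conv_exp by measurable
  obtain C where C: "0 \<le> C" "\<And>y. (1 + norm y) ^ m * cmod (u y) \<le> C"
    using schwartz_weighted_bound[OF u, of m] by blast
  define M where "M = ((1 + norm ?j) * (1 + real DIM('a))) ^ m * C"
  have M0: "0 \<le> M" using C by (simp add: M_def)
  have M: "(1 + norm (?j - cell_of y)) ^ m * cmod (u y) \<le> M" for y
  proof -
    have "1 + norm (?j - cell_of y) \<le> 1 + norm ?j + norm (cell_of y)"
      using norm_triangle_ineq4[of ?j "cell_of y"] by simp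
    also have "\<dots> \<le> (1 + norm ?j) * (1 + norm (cell_of y))" by (simp add: algebra_simps)
    also have "\<dots> \<le> (1 + norm ?j) * ((1 + real DIM('a)) * (1 + norm y))"
      by (intro mult_left_mono one_plus_norm_cell_le) auto
    finally have "(1 + norm (?j - cell_of y)) ^ m \<le> ((1 + norm ?j) * (1 + real DIM('a)) * (1 + norm y)) ^ m"
      by (intro power_mono) (auto simp: mult_ac)
    then have "(1 + norm (?j - cell_of y)) ^ m * cmod (u y) \<le> ((1 + norm ?j) * (1 + real DIM('a))) ^ m * ((1 + norm y) ^ m * cmod (u y))"
      by (simp add: power_mult_distrib mult_right_mono flip: mult.assoc)
    also have "\<dots> \<le> M" unfolding M_def using C(2) by (intro mult_left_mono) auto
    finally show ?thesis .
  qed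
  let ?g = "\<lambda>y. \<integral>\<xi>. cmod (?f (y, \<xi>)) \<partial>lborel"
  have geq: "?g y = (\<integral>\<xi>. cmod (p (wpt x y, zpt x y, \<xi>)) \<partial>lborel) * cmod (u y)" for y
    by (simp add: norm_mult)
  have g0: "0 \<le> ?g y" for y by (intro Bochner_Integration.integral_nonneg) simp
  have gm [measurable]: "?g \<in> borel_measurable borel"
  proof -
    have "(\<lambda>(y, \<xi>). cmod (?f (y, \<xi>))) \<in> borel_measurable (borel \<Otimes>\<^sub>M lborel)"
      using fm by (simp cong: measurable_cong_sets) measurable
    then show ?thesis by (rule lborel.borel_measurable_lebesgue_integral)
  qed
  have gle: "\<bar>?g y\<bar> \<le> slice_const * M * row_mass ?j k" if "y \<in> cell k" for y k
  proof -
    have "?g y \<le> (slice_const * ((1 + norm (?j - cell_of y)) ^ m * row_mass ?j (cell_of y))) * cmod (u y)"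
      unfolding geq by (intro mult_right_mono integrable_p) auto
    also have "\<dots> = (slice_const * row_mass ?j (cell_of y)) * ((1 + norm (?j - cell_of y)) ^ m * cmod (u y))" by simp
    also have "\<dots> \<le> (slice_const * row_mass ?j (cell_of y)) * M"
      by (intro mult_left_mono M mult_nonneg_nonneg slice_const_nonneg row_mass_nonneg)
    finally show ?thesis using g0 that by (simp add: cell_def mult_ac)
  qed
  have "integrable lborel ?g"
  proof (rule integrable_of_cells(1)[OF gm])
    show "(\<lambda>k. slice_const * M * row_mass ?j k) summable_on int_lattice"
      by (intro summable_on_cmult_right summable_row_mass cell_of_in_lattice)
    fix k :: 'a
    show "integrable lborel (\<lambda>y. indicator (cell k) y * norm (?g y))"
      unfolding real_norm_def by (rule set_indicator_bounded_integrable(1)[OF gm gle])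
    show "(\<integral>y. indicator (cell k) y * norm (?g y) \<partial>lborel) \<le> slice_const * M * row_mass ?j k"
      unfolding real_norm_def
      by (rule set_indicator_bounded_integrable(2)[OF gm gle], assumption)
        (intro mult_nonneg_nonneg slice_const_nonneg M0 row_mass_nonneg)
  qed
  have slice: "integrable lborel (\<lambda>\<xi>. ?f (y, \<xi>))" for y
    using integrable_freq_integral[OF far_axis(1), of 0 x y 0] by (simp add: freq_deriv_0)
  have int: "integrable (lborel \<Otimes>\<^sub>M lborel) ?f"
    by (rule lborel_pair.Fubini_integrable[OF fm \<open>integrable lborel ?g\<close>]) (intro AE_I2 slice)
  then have int': "integrable lborel ?f" by (simp add: lborel_prod)
  show "integrable lebesgue (Op_integrand 1 (amp_subst T p) u x)"
    unfolding Op using int' by (simp add: integrable_completion)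
  let ?c = "complex_of_real ((1 / (2 * pi)) ^ DIM('a))"
  have ker: "kernel x y * u y = ?c * (\<integral>\<xi>. ?f (y, \<xi>) \<partial>lborel)" for y
    by (simp add: kernel_def)
  have ki: "integrable lborel (\<lambda>y. kernel x y * u y)"
    unfolding ker by (intro integrable_mult_right lborel_pair.integrable_fst'[OF int])
  show "integrable lebesgue (\<lambda>y. kernel x y * u y)"
    using ki by (subst integrable_completion) auto
  have "(LINT y|lebesgue. kernel x y * u y) = (LINT y|lborel. kernel x y * u y)"
    using ki by (intro integral_completion) auto
  also have "\<dots> = ?c * (LINT y|lborel. (\<integral>\<xi>. ?f (y, \<xi>) \<partial>lborel))"
    unfolding ker by simp
  also have "(LINT y|lborel. (\<integral>\<xi>. ?f (y, \<xi>) \<partial>lborel)) = (LINT v|lborel. ?f v)"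
    using lborel_pair.integral_fst'[OF int] by (simp add: lborel_prod)
  also have "\<dots> = (LINT v|lebesgue. ?f v)"
    using int' by (intro integral_completion[symmetric]) auto
  finally show "Op_amp 1 (amp_subst T p) u x = (LINT y|lebesgue. kernel x y * u y)"
    unfolding Op_amp_def Op by simp
qed

lemma measurable_atoms:
  "atom_left idx \<in> borel_measurable borel" "atom_right idx \<in> borel_measurable borel"
proof -
  obtain j k \<nu> l r \<kappa> where idx: "idx = ((j, k, \<nu>), (l, r), \<kappa>)" by (cases idx) auto
  show "atom_left idx \<in> borel_measurable borel" "atom_right idx \<in> borel_measurable borel"
    unfolding idx atom_left_def atom_right_def prod.case cis_conv_exp by measurable
qed

definition schatten_const :: real where
  "schatten_const = atom_const * (real (m + 1) ^ 2 *
    infsum (lattice_weight (real n / real DIM('a) * q)) (int_lattice :: ('a \<times> 'a) set) * overlap_const) powr (1 / q)"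

text \<open>The atoms are enumerated as a sequence. Multiplied by \<open>h1\<close> and \<open>h2\<close> they have norms bounded by
  \<open>block_mass\<close> and the lattice weight, and the \<open>q\<close>-th powers of both factors are summable.\<close>

theorem weighted_Op_bound:
  assumes T: "amp_subst T p = (\<lambda>(x, y, \<xi>). p (wpt x y, zpt x y, \<xi>))"
    and h: "h1 \<in> lattice_space_inf 2" "h2 \<in> lattice_space_inf 2"
  shows "\<exists>A. is_weighted_Op h1 1 (amp_subst T p) h2 A \<and> A \<in> schatten_class q \<and>
    schatten_norm q A \<le> schatten_const * lattice_norm_inf 2 h1 * lattice_norm_inf 2 h2 *
      lattice_norm 1 q (amp_majorant n m (t21 + t22) p)"
proof -
  let ?N1 = "lattice_norm_inf 2 h1" and ?N2 = "lattice_norm_inf 2 h2"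
  let ?lq = "lattice_weight (real n / real DIM('a) * q) :: 'a \<times> 'a \<Rightarrow> real"
  let ?L = "int_lattice :: ('a \<times> 'a) set"
  define e where "e = from_nat_into index_set"
  have bij: "bij_betw e UNIV index_set"
  proof -
    have "countable index_set" unfolding index_set_def
      by (intro countable_SIGMA countable_int_lattice) auto
    moreover have "infinite index_set" unfolding index_set_def
      using infinite_int_lattice[where 'a="'a \<times> 'a \<times> 'a"] infinite_int_lattice[where 'a="'a \<times> 'a"]
      by (auto simp: finite_cartesian_product_iff)
    ultimately show ?thesis unfolding e_def by (rule bij_betw_from_nat_into)
  qed
  have e: "e i \<in> index_set" for i using bij_betwE[OF bij] by simp
  define F where "F i = (\<lambda>x. atom_coeff (e i) * (h1 x * atom_left (e i) x))" for i
  define G where "G i = (\<lambda>y. 1 * (h2 y * atom_right (e i) y))" for i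
  have F: "square_integrable (F i)" "norm (abs_L2 (F i)) \<le> cmod (atom_coeff (e i)) * ?N1"
    and G: "square_integrable (G i)" "norm (abs_L2 (G i)) \<le> ?N2" for i
  proof -
    obtain j k \<nu> lr \<kappa> where idx: "e i = ((j, k, \<nu>), lr, \<kappa>)" by (cases "e i") auto
    show "square_integrable (F i)" "norm (abs_L2 (F i)) \<le> cmod (atom_coeff (e i)) * ?N1"
      unfolding F_def by (rule localised_weight[OF h(1) measurable_atoms(1), where j=j]; simp add: idx norm_atom_le)+
    show "square_integrable (G i)" "norm (abs_L2 (G i)) \<le> ?N2"
      using localised_weight[OF h(2) measurable_atoms(2)[of "e i"], of k 1] norm_atom_le(2)[of j k \<nu> lr \<kappa>]
      by (simp_all add: idx G_def)
  qed
  define A where "A = nuclear_op (\<lambda>i. abs_L2 (F i)) (\<lambda>i. abs_L2 (\<lambda>y. cnj (G i y)))"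
  have cnj: "norm (abs_L2 (\<lambda>y. cnj (G i y))) = norm (abs_L2 (G i))" for i
  proof -
    have "square_integrable (\<lambda>y. cnj (G i y))" using G(1)[of i] by (simp add: square_integrable_def measurable_compose[OF _ borel_measurable_continuous_onI[OF continuous_on_cnj[OF continuous_on_id]]])
    then show ?thesis by (simp add: norm_abs_L2 G(1))
  qed
  have N0: "0 \<le> ?N1" "0 \<le> ?N2"
  proof -
    have "0 \<le> lattice_norm_inf 2 h" if "h \<in> lattice_space_inf 2" for h :: "'a \<Rightarrow> complex"
      unfolding lattice_norm_inf_def using that
      by (intro cSUP_upper2[of _ _ 0]) (auto simp: lattice_space_inf_def)
    then show "0 \<le> ?N1" "0 \<le> ?N2" using h by auto
  qed
  define W where "W = atom_const * ?N1 * ?N2"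
  have W0: "0 \<le> W" using N0 coeff_const_nonneg by (simp add: W_def atom_const_def)
  define a where "a idx = block_mass (fst idx) powr q * ?lq (snd (snd idx))" for idx :: "('a \<times> 'a \<times> 'a) \<times> (nat \<times> nat) \<times> ('a \<times> 'a)"
  have lq: "1 < real n / real DIM('a) * q" using nq by (simp add: pos_less_divide_eq)
  have "((\<lambda>idx. a idx) has_sum (real (m + 1) ^ 2 * infsum ?lq ?L * (\<Sum>\<^sub>\<infinity>jkn\<in>int_lattice. block_mass jkn powr q))) index_set"
    unfolding a_def
    by (rule summable_on_index_set[OF summable_block_mass_powr _ summable_lattice_weight[OF lq]])
      (auto intro: less_imp_le[OF lattice_weight_pos])
  then have a_sums: "(\<lambda>i. a (e i)) sums (real (m + 1) ^ 2 * infsum ?lq ?L * (\<Sum>\<^sub>\<infinity>jkn\<in>int_lattice. block_mass jkn powr q))"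
    by (intro has_sum_imp_sums) (simp add: has_sum_reindex_bij_betw[OF bij])
  have le: "(norm (abs_L2 (F i)) * norm (abs_L2 (\<lambda>y. cnj (G i y)))) powr q \<le> W powr q * a (e i)" for i
  proof -
    let ?b = "block_mass (fst (e i)) * lw (snd (snd (e i)))"
    have "norm (abs_L2 (F i)) * norm (abs_L2 (\<lambda>y. cnj (G i y))) \<le> (cmod (atom_coeff (e i)) * ?N1) * ?N2"
      unfolding cnj by (intro mult_mono F G mult_nonneg_nonneg N0) auto
    also have "\<dots> \<le> (atom_const * ?b * ?N1) * ?N2"
      by (intro mult_right_mono atom_coeff_le e N0)
    also have "\<dots> = W * ?b" by (simp add: W_def mult_ac)
    finally have "(norm (abs_L2 (F i)) * norm (abs_L2 (\<lambda>y. cnj (G i y)))) powr q \<le> (W * ?b) powr q"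
      using q by (intro powr_mono2) auto
    also have "\<dots> = W powr q * a (e i)"
      using W0 block_mass_nonneg less_imp_le[OF lattice_weight_pos]
      by (simp add: a_def powr_mult lattice_weight_powr)
    finally show ?thesis .
  qed
  have sq: "summable (\<lambda>i. (norm (abs_L2 (F i)) * norm (abs_L2 (\<lambda>y. cnj (G i y)))) powr q)"
    by (rule summable_comparison_test'[OF summable_mult[OF sums_summable[OF a_sums]], of 0 _ "W powr q"]) (use le in simp)
  have "has_kernel A (\<lambda>x y. h1 x * kernel x y * h2 y)"
    unfolding A_def
  proof (rule nuclear_op_has_kernel[OF F(1) G(1)])
    show "summable (\<lambda>i. norm (abs_L2 (F i)) * norm (abs_L2 (G i)))"
      using summable_powr_imp_summable[OF sq q] by (simp add: cnj)
    fix x y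
    let ?t = "\<lambda>idx. atom_coeff idx * (atom_left idx x * atom_right idx y)"
    have FG: "F i x * G i y = h1 x * h2 y * ?t (e i)" for i by (simp add: F_def G_def mult_ac)
    have "((\<lambda>i. ?t (e i)) has_sum kernel x y) UNIV"
      using kernel_expansion[of x y] has_sum_reindex_bij_betw[OF bij, of ?t] by simp
    from sums_mult[OF has_sum_imp_sums[OF this], of "h1 x * h2 y"]
    show "(\<lambda>i. F i x * G i y) sums (h1 x * kernel x y * h2 y)" unfolding FG by (simp add: mult_ac)
    have "(\<lambda>i. norm (?t (e i))) summable_on UNIV"
      using abs_summable_atoms[of x y] summable_on_reindex_bij_betw[OF bij, of "\<lambda>idx. norm (?t idx)"] by simp
    from summable_mult[OF summable_on_imp_summable[OF this], of "cmod (h1 x * h2 y)"]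
    show "summable (\<lambda>i. cmod (F i x * G i y))" unfolding FG norm_mult[of "h1 x * h2 y"] .
  qed
  then have wOp: "is_weighted_Op h1 1 (amp_subst T p) h2 A"
    unfolding is_weighted_Op_def using is_Op_kernel_kernel[OF T] by blast
  have cls: "A \<in> schatten_class q" unfolding A_def by (rule nuclear_op_schatten(1)[OF q sq])
  let ?K = "real (m + 1) ^ 2 * infsum ?lq ?L"
  have K0: "0 \<le> ?K" by (intro mult_nonneg_nonneg infsum_nonneg less_imp_le[OF lattice_weight_pos]) auto
  have O0: "0 \<le> overlap_const" by (simp add: overlap_const_def)
  have T0: "0 \<le> total_mass" unfolding total_mass_def by (intro infsum_nonneg) simp
  have "schatten_norm q A \<le> (\<Sum>i. (norm (abs_L2 (F i)) * norm (abs_L2 (\<lambda>y. cnj (G i y)))) powr q) powr (1 / q)"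
    unfolding A_def by (rule nuclear_op_schatten(2)[OF q sq])
  also have "\<dots> \<le> (W powr q * (?K * overlap_const * total_mass)) powr (1 / q)"
  proof (intro powr_mono2)
    have "(\<Sum>i. (norm (abs_L2 (F i)) * norm (abs_L2 (\<lambda>y. cnj (G i y)))) powr q) \<le> (\<Sum>i. W powr q * a (e i))"
      by (rule suminf_le[OF le sq summable_mult[OF sums_summable[OF a_sums]]])
    also have "\<dots> = W powr q * (?K * (\<Sum>\<^sub>\<infinity>jkn\<in>int_lattice. block_mass jkn powr q))"
      using sums_unique[OF sums_mult[OF a_sums, of "W powr q"]] by simp
    also have "\<dots> \<le> W powr q * (?K * (overlap_const * total_mass))"
      by (intro mult_left_mono sum_block_mass_powr_le K0) auto
    finally show "(\<Sum>i. (norm (abs_L2 (F i)) * norm (abs_L2 (\<lambda>y. cnj (G i y)))) powr q) \<le> W powr q * (?K * overlap_const * total_mass)"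
      by (simp add: mult.assoc)
    show "0 \<le> (\<Sum>i. (norm (abs_L2 (F i)) * norm (abs_L2 (\<lambda>y. cnj (G i y)))) powr q)"
      by (rule suminf_nonneg[OF sq]) simp
  qed (use q in simp)
  also have "\<dots> = W * (?K * overlap_const) powr (1 / q) * total_mass powr (1 / q)"
    using q W0 K0 O0 T0 by (simp add: powr_mult powr_powr)
  also have "\<dots> = schatten_const * ?N1 * ?N2 * lattice_norm 1 q (amp_majorant n m (t21 + t22) p)"
    unfolding total_mass_eq by (simp add: schatten_const_def W_def mult_ac)
  finally show ?thesis using wOp cls by blast
qed

end

theorem theorem2p5:
  fixes q t0 \<delta>0 :: real and n m :: nat
  assumes "0 < q" and "q \<le> 1"
    and "n = nat \<lfloor>real CARD('d::finite) / q\<rfloor> + 1"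
    and "0 < t0" and "0 < \<delta>0"
  shows "\<exists>C::real. \<forall>(T::real^2^2) (h1::real^'d \<Rightarrow> complex) (h2::real^'d \<Rightarrow> complex)
      (p::(real^'d) \<times> (real^'d) \<times> (real^'d) \<Rightarrow> complex).
    invertible T \<and> T$1$1 + T$1$2 = 1 \<and> (\<forall>j k. \<bar>T$j$k\<bar> \<le> t0) \<and> \<bar>det T\<bar> \<ge> \<delta>0 \<and>
    h1 \<in> lattice_space_inf 2 \<and> h2 \<in> lattice_space_inf 2 \<and>
    smooth_amplitude n m p \<and>
    amp_majorant n m (T$2$1 + T$2$2) p \<in> lattice_space 1 q \<longrightarrow>
    (\<exists>A. is_weighted_Op h1 1 (amp_subst T p) h2 A \<and>
         A \<in> schatten_class q \<and>
         schatten_norm q A \<le> C * lattice_norm_inf 2 h1 * lattice_norm_inf 2 h2 *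
           lattice_norm 1 q (amp_majorant n m (T$2$1 + T$2$2) p))"
proof -
  obtain B \<phi> where cut: "cutoff n B \<phi>" using cutoff_exists by blast
  have nq: "DIM(real^'d) < real n * q"
  proof -
    have "real CARD('d) / q < real n" using assms(3) by linarith
    then show ?thesis using assms(1) by (simp add: pos_divide_less_eq)
  qed
  have bound: "\<exists>A. is_weighted_Op h1 1 (amp_subst T p) h2 A \<and> A \<in> schatten_class q \<and>
         schatten_norm q A \<le> amplitude_bound.schatten_const TYPE(real^'d) t0 \<delta>0 q n m B * lattice_norm_inf 2 h1 * lattice_norm_inf 2 h2 *
           lattice_norm 1 q (amp_majorant n m (T$2$1 + T$2$2) p)"
    if T: "T$1$1 + T$1$2 = 1" "\<And>j k. \<bar>T$j$k\<bar> \<le> t0" "\<bar>det T\<bar> \<ge> \<delta>0"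
      and h: "h1 \<in> lattice_space_inf 2" "h2 \<in> lattice_space_inf 2"
      and p: "smooth_amplitude n m p" "amp_majorant n m (T$2$1 + T$2$2) p \<in> lattice_space 1 q"
    for T :: "real^2^2" and h1 h2 :: "real^'d \<Rightarrow> complex" and p :: "(real^'d) \<times> (real^'d) \<times> (real^'d) \<Rightarrow> complex"
  proof -
    interpret amplitude_bound "T$1$1" "T$1$2" "T$2$1" "T$2$2" t0 \<delta>0 q n m B \<phi> p
      by unfold_locales (use assms T p cut nq in \<open>simp_all add: det_2\<close>)
    show ?thesis
      by (rule weighted_Op_bound[OF _ h]) (simp add: amp_subst_def wpt_def zpt_def)
  qed
  show ?thesis
    by (intro exI[of _ "amplitude_bound.schatten_const TYPE(real^'d) t0 \<delta>0 q n m B"] allI impI) (use bound in blast)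
qed

end
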